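(* Let $(M,g)$ be a compact Riemannian spin manifold with spinor bundle $\mathcal{S}\to M$, and let $\sigma_0$ be a parallel spinor on $M$ of unit length. Let $\Phi$ be the map from symmetric $2$-tensors to sections of $\mathcal{S}\otimes T^*M$ given in a local orthonormal frame $\{e_i\}$ with dual frame $\{e^i\}$ by $\Phi(h)=\sum_{i,j}h_{ij}\,e_i\cdot\sigma_0\otimes e^j$, and let $\mathcal{D}$ be the Dirac operator on $\mathcal{S}\otimes T^*M$. Then for every smooth symmetric $2$-tensor $h$ on $M$, $$\mathcal{D}^*\mathcal{D}\,\Phi(h)=\Phi(\nabla^*\nabla h-2\mathring{R}h).$$
   Context: Clifford multiplication satisfies $e_ie_j+e_je_i=-2\delta_{ij}$. The twisted Dirac operator is $\mathcal{D}=\sum_k e_k\cdot\nabla_{e_k}$ acting on sections of $\mathcal{S}\otimes T^*M$ (Clifford multiplication on the $\mathcal{S}$ factor, connection induced by the Levi-Civita connection), and $\mathcal{D}^*$ is its formal adjoint. The curvature is $R_{XY}=-\nabla_X\nabla_Y+\nabla_Y\nabla_X+\nabla_{[X,Y]}$, $R(X,Y,Z,W)=\langle R_{XY}Z,W\rangle$, $R_{ijkl}=R(e_i,e_j,e_k,e_l)$ (so $R_{ijij}$ is the sectional curvature of the plane spanned by $e_i,e_j$), and $(\mathring{R}h)_{ij}=\sum_{k,l}R_{ikjl}h_{kl}$. *)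

theory Defs
  imports "HOL-Analysis.Analysis"
begin

section \<open>Smooth manifolds\<close>

primrec k_smooth_on :: "nat \<Rightarrow> 'a::real_normed_vector set \<Rightarrow> ('a \<Rightarrow> 'b::real_normed_vector) \<Rightarrow> bool" where
  "k_smooth_on 0 S f = continuous_on S f"
| "k_smooth_on (Suc k) S f =
    ((\<forall>x\<in>S. f differentiable (at x)) \<and> (\<forall>v. k_smooth_on k S (\<lambda>x. frechet_derivative f (at x) v)))"

text \<open>Only used for open \<open>S\<close>.\<close>

definition smooth_on :: "'a::real_normed_vector set \<Rightarrow> ('a \<Rightarrow> 'b::real_normed_vector) \<Rightarrow> bool" where
  "smooth_on S f \<longleftrightarrow> (\<forall>k. k_smooth_on k S f)"

text \<open>A manifold is the universe of a type \<open>'m\<close> together with an atlas; a chart is a domain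
  and a coordinate map on it. The dimension is \<open>CARD('n)\<close>.\<close>

type_synonym ('m, 'n) chart = "'m set \<times> ('m \<Rightarrow> real^'n)"

definition smooth_atlas :: "('m::topological_space, 'n::finite) chart set \<Rightarrow> bool" where
  "smooth_atlas A \<longleftrightarrow>
    (\<Union>(U, \<phi>)\<in>A. U) = UNIV \<and>
    (\<forall>(U, \<phi>)\<in>A. open U \<and> open (\<phi> ` U) \<and> homeomorphism U (\<phi> ` U) \<phi> (inv_into U \<phi>)) \<and>
    (\<forall>(U, \<phi>)\<in>A. \<forall>(V, \<psi>)\<in>A. smooth_on (\<phi> ` (U \<inter> V)) (\<psi> \<circ> inv_into U \<phi>))"

definition smooth_map ::
    "('m, 'n::finite) chart set \<Rightarrow> 'm set \<Rightarrow> ('m \<Rightarrow> 'b::real_normed_vector) \<Rightarrow> bool" where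
  "smooth_map A W f \<longleftrightarrow> (\<forall>(U, \<phi>)\<in>A. smooth_on (\<phi> ` (U \<inter> W)) (f \<circ> inv_into U \<phi>))"

text \<open>A tangent vector at \<open>p\<close> is a directional derivative operator on real functions. As the
  functions are total, its value on functions that are not smooth near \<open>p\<close> is fixed to be 0.\<close>

type_synonym 'm tvec = "('m \<Rightarrow> real) \<Rightarrow> real"

definition smooth_near ::
    "('m::topological_space, 'n::finite) chart set \<Rightarrow> 'm \<Rightarrow> ('m \<Rightarrow> 'b::real_normed_vector) \<Rightarrow> bool" where
  "smooth_near A p f \<longleftrightarrow> (\<exists>W. open W \<and> p \<in> W \<and> smooth_map A W f)"

definition coord_vector ::
    "('m::topological_space, 'n::finite) chart set \<Rightarrow> ('m, 'n) chart \<Rightarrow> 'm \<Rightarrow> real^'n \<Rightarrow> 'm tvec" where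
  "coord_vector A c p u = (\<lambda>f. if smooth_near A p f
     then frechet_derivative (f \<circ> inv_into (fst c) (snd c)) (at (snd c p)) u else 0)"

definition tangent_space :: "('m::topological_space, 'n::finite) chart set \<Rightarrow> 'm \<Rightarrow> 'm tvec set" where
  "tangent_space A p = {coord_vector A c p u | c u. c \<in> A \<and> p \<in> fst c}"

text \<open>Derivative of a vector-valued function along a tangent vector, componentwise.\<close>

definition vderiv :: "'m tvec \<Rightarrow> ('m \<Rightarrow> 'b::euclidean_space) \<Rightarrow> 'b" where
  "vderiv v F = (\<Sum>b\<in>Basis. v (\<lambda>q. F q \<bullet> b) *\<^sub>R b)"

definition linear_tangent :: "'m tvec set \<Rightarrow> ('m tvec \<Rightarrow> 'b::real_vector) \<Rightarrow> bool" where
  "linear_tangent T L \<longleftrightarrow>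
    (\<forall>v\<in>T. \<forall>w\<in>T. \<forall>a b. L (\<lambda>f. a * v f + b * w f) = a *\<^sub>R L v + b *\<^sub>R L w)"

definition smooth_field ::
    "('m::topological_space, 'n::finite) chart set \<Rightarrow> 'm set \<Rightarrow> ('m \<Rightarrow> 'm tvec) \<Rightarrow> bool" where
  "smooth_field A W X \<longleftrightarrow>
    (\<forall>p\<in>W. X p \<in> tangent_space A p) \<and>
    (\<forall>V (f :: 'm \<Rightarrow> real). open V \<and> V \<subseteq> W \<and> smooth_map A V f \<longrightarrow> smooth_map A V (\<lambda>p. X p f))"

definition lie_bracket ::
    "('m::topological_space, 'n::finite) chart set \<Rightarrow> ('m \<Rightarrow> 'm tvec) \<Rightarrow> ('m \<Rightarrow> 'm tvec) \<Rightarrow> 'm \<Rightarrow> 'm tvec" where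
  "lie_bracket A X Y p = (\<lambda>f. if smooth_near A p f
     then X p (\<lambda>q. Y q f) - Y p (\<lambda>q. X q f) else 0)"

text \<open>Some local smooth vector field with prescribed value at \<open>p\<close>. It is used only in tensorial
  expressions, where the choice is immaterial.\<close>

definition extend_vector ::
    "('m::topological_space, 'n::finite) chart set \<Rightarrow> 'm \<Rightarrow> 'm tvec \<Rightarrow> 'm \<Rightarrow> 'm tvec" where
  "extend_vector A p x = (SOME X. (\<exists>W. open W \<and> p \<in> W \<and> smooth_field A W X) \<and> X p = x)"

section \<open>Riemannian manifolds\<close>

type_synonym 'm tensor2 = "'m \<Rightarrow> 'm tvec \<Rightarrow> 'm tvec \<Rightarrow> real"
type_synonym 'm tensor3 = "'m \<Rightarrow> 'm tvec \<Rightarrow> 'm tvec \<Rightarrow> 'm tvec \<Rightarrow> real"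

text \<open>Smooth symmetric 2-tensors, and smooth sections of the tensor product of the cotangent bundle
  (first argument) with the bundle of symmetric 2-tensors.\<close>

definition sym2_tensor :: "('m::topological_space, 'n::finite) chart set \<Rightarrow> 'm tensor2 \<Rightarrow> bool" where
  "sym2_tensor A h \<longleftrightarrow>
    (\<forall>p. \<forall>x\<in>tangent_space A p. linear_tangent (tangent_space A p) (h p x) \<and>
        (\<forall>y\<in>tangent_space A p. h p x y = h p y x)) \<and>
    (\<forall>W X Y. open W \<and> smooth_field A W X \<and> smooth_field A W Y \<longrightarrow>
        smooth_map A W (\<lambda>p. h p (X p) (Y p)))"

definition cot_sym2_tensor :: "('m::topological_space, 'n::finite) chart set \<Rightarrow> 'm tensor3 \<Rightarrow> bool" where
  "cot_sym2_tensor A T \<longleftrightarrow>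
    (\<forall>p. \<forall>x\<in>tangent_space A p. \<forall>y\<in>tangent_space A p.
        linear_tangent (tangent_space A p) (\<lambda>v. T p v x y) \<and>
        linear_tangent (tangent_space A p) (T p x y) \<and>
        (\<forall>v\<in>tangent_space A p. T p v x y = T p v y x)) \<and>
    (\<forall>W V X Y. open W \<and> smooth_field A W V \<and> smooth_field A W X \<and> smooth_field A W Y \<longrightarrow>
        smooth_map A W (\<lambda>p. T p (V p) (X p) (Y p)))"

definition riemannian_metric :: "('m::topological_space, 'n::finite) chart set \<Rightarrow> 'm tensor2 \<Rightarrow> bool" where
  "riemannian_metric A g \<longleftrightarrow> sym2_tensor A g \<and>
    (\<forall>p. \<forall>x\<in>tangent_space A p. x \<noteq> (\<lambda>f. 0) \<longrightarrow> g p x x > 0)"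

text \<open>The Levi-Civita connection: \<open>D p v Y\<close> is the covariant derivative at \<open>p\<close> of the local vector
  field \<open>Y\<close> in the direction \<open>v\<close>. The last three clauses are the Leibniz rule, compatibility with
  the metric and vanishing torsion.\<close>

definition levi_civita :: "('m::topological_space, 'n::finite) chart set \<Rightarrow> 'm tensor2 \<Rightarrow>
    ('m \<Rightarrow> 'm tvec \<Rightarrow> ('m \<Rightarrow> 'm tvec) \<Rightarrow> 'm tvec) \<Rightarrow> bool" where
  "levi_civita A g D \<longleftrightarrow> (\<forall>W Y. open W \<and> smooth_field A W Y \<longrightarrow>
    (\<forall>p\<in>W. \<forall>v\<in>tangent_space A p. D p v Y \<in> tangent_space A p) \<and>
    (\<forall>p\<in>W. \<forall>Y'. (\<forall>q\<in>W. Y' q = Y q) \<longrightarrow> (\<forall>v\<in>tangent_space A p. D p v Y' = D p v Y)) \<and>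
    (\<forall>p\<in>W. \<forall>f. linear_tangent (tangent_space A p) (\<lambda>v. D p v Y f)) \<and>
    (\<forall>X. smooth_field A W X \<longrightarrow> smooth_field A W (\<lambda>p. D p (X p) Y)) \<and>
    (\<forall>X. smooth_field A W X \<longrightarrow> (\<forall>p\<in>W. \<forall>v\<in>tangent_space A p.
        D p v (\<lambda>q f. X q f + Y q f) = (\<lambda>f. D p v X f + D p v Y f))) \<and>
    (\<forall>a. smooth_map A W a \<longrightarrow> (\<forall>p\<in>W. \<forall>v\<in>tangent_space A p.
        D p v (\<lambda>q f. a q * Y q f) = (\<lambda>f. v a * Y p f + a p * D p v Y f))) \<and>
    (\<forall>X. smooth_field A W X \<longrightarrow> (\<forall>p\<in>W. \<forall>v\<in>tangent_space A p.
        v (\<lambda>q. g q (X q) (Y q)) = g p (D p v X) (Y p) + g p (X p) (D p v Y))) \<and>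
    (\<forall>X. smooth_field A W X \<longrightarrow> (\<forall>p\<in>W. \<forall>f.
        D p (X p) Y f - D p (Y p) X f = lie_bracket A X Y p f)))"

definition gram_matrix ::
    "('m::topological_space, 'n::finite) chart set \<Rightarrow> 'm tensor2 \<Rightarrow> ('m, 'n) chart \<Rightarrow> 'm \<Rightarrow> real^'n^'n" where
  "gram_matrix A g c p =
    (\<chi> a b. g p (coord_vector A c p (axis a 1)) (coord_vector A c p (axis b 1)))"

definition riemannian_volume ::
    "('m::topological_space, 'n::finite) chart set \<Rightarrow> 'm tensor2 \<Rightarrow> 'm measure \<Rightarrow> bool" where
  "riemannian_volume A g \<mu> \<longleftrightarrow> sets \<mu> = sets borel \<and>
    (\<forall>(U, \<phi>)\<in>A. \<forall>B\<in>sets borel. B \<subseteq> U \<longrightarrow>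
      emeasure \<mu> B = (\<integral>\<^sup>+x. ennreal (sqrt (det (gram_matrix A g (U, \<phi>) (inv_into U \<phi> x))))
                          * indicator (\<phi> ` B) x \<partial>lborel))"

text \<open>The record carries the Levi-Civita connection and the volume measure, both of which are
  uniquely determined by the metric.\<close>

record ('m, 'n::finite) riem_manifold =
  atlas :: "('m, 'n) chart set"
  metric :: "'m tensor2"
  lc :: "'m \<Rightarrow> 'm tvec \<Rightarrow> ('m \<Rightarrow> 'm tvec) \<Rightarrow> 'm tvec"
  vol :: "'m measure"

definition riemannian_manifold ::
    "('m::{t2_space, second_countable_topology}, 'n::finite, 'z) riem_manifold_scheme \<Rightarrow> bool" where
  "riemannian_manifold M \<longleftrightarrow> smooth_atlas (atlas M) \<and> riemannian_metric (atlas M) (metric M) \<and>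
    levi_civita (atlas M) (metric M) (lc M) \<and> riemannian_volume (atlas M) (metric M) (vol M)"

definition onb :: "('m::topological_space, 'n::finite, 'z) riem_manifold_scheme \<Rightarrow> 'm \<Rightarrow> 'n \<Rightarrow> 'm tvec" where
  "onb M p = (SOME b. (\<forall>i. b i \<in> tangent_space (atlas M) p) \<and>
     (\<forall>i j. metric M p (b i) (b j) = (if i = j then 1 else 0)))"

text \<open>Sign convention: \<open>R\<^sub>X\<^sub>Y = - \<nabla>\<^sub>X \<nabla>\<^sub>Y + \<nabla>\<^sub>Y \<nabla>\<^sub>X + \<nabla>\<^sub>[\<^sub>X\<^sub>,\<^sub>Y\<^sub>]\<close>.\<close>

definition curvature_op :: "('m::topological_space, 'n::finite, 'z) riem_manifold_scheme \<Rightarrow>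
    ('m \<Rightarrow> 'm tvec) \<Rightarrow> ('m \<Rightarrow> 'm tvec) \<Rightarrow> ('m \<Rightarrow> 'm tvec) \<Rightarrow> 'm \<Rightarrow> 'm tvec" where
  "curvature_op M X Y Z p = (\<lambda>f.
     - lc M p (X p) (\<lambda>q. lc M q (Y q) Z) f + lc M p (Y p) (\<lambda>q. lc M q (X q) Z) f
     + lc M p (lie_bracket (atlas M) X Y p) Z f)"

definition riem_curv :: "('m::topological_space, 'n::finite, 'z) riem_manifold_scheme \<Rightarrow>
    'm \<Rightarrow> 'm tvec \<Rightarrow> 'm tvec \<Rightarrow> 'm tvec \<Rightarrow> 'm tvec \<Rightarrow> real" where
  "riem_curv M p x y z w = metric M p
     (curvature_op M (extend_vector (atlas M) p x) (extend_vector (atlas M) p y) (extend_vector (atlas M) p z) p) w"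

definition curv_action ::
    "('m::topological_space, 'n::finite, 'z) riem_manifold_scheme \<Rightarrow> 'm tensor2 \<Rightarrow> 'm tensor2" where
  "curv_action M h p x y = (\<Sum>k\<in>UNIV. \<Sum>l\<in>UNIV.
     riem_curv M p x (onb M p k) y (onb M p l) * h p (onb M p k) (onb M p l))"

definition nabla ::
    "('m::topological_space, 'n::finite, 'z) riem_manifold_scheme \<Rightarrow> 'm tensor2 \<Rightarrow> 'm tensor3" where
  "nabla M h p v x y = (let X = extend_vector (atlas M) p x; Y = extend_vector (atlas M) p y in
     v (\<lambda>q. h q (X q) (Y q)) - h p (lc M p v X) y - h p x (lc M p v Y))"

definition inner_tensor2 ::
    "('m::topological_space, 'n::finite, 'z) riem_manifold_scheme \<Rightarrow> 'm tensor2 \<Rightarrow> 'm tensor2 \<Rightarrow> 'm \<Rightarrow> real" where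
  "inner_tensor2 M h k p = (\<Sum>i\<in>UNIV. \<Sum>j\<in>UNIV.
     h p (onb M p i) (onb M p j) * k p (onb M p i) (onb M p j))"

definition inner_tensor3 ::
    "('m::topological_space, 'n::finite, 'z) riem_manifold_scheme \<Rightarrow> 'm tensor3 \<Rightarrow> 'm tensor3 \<Rightarrow> 'm \<Rightarrow> real" where
  "inner_tensor3 M S T p = (\<Sum>i\<in>UNIV. \<Sum>j\<in>UNIV. \<Sum>k\<in>UNIV.
     S p (onb M p i) (onb M p j) (onb M p k) * T p (onb M p i) (onb M p j) (onb M p k))"

text \<open>Formal adjoints are characterised by integration against all smooth sections, without a
  support condition: this is the right notion on compact manifolds only.\<close>

definition nabla_adjoint ::
    "('m::topological_space, 'n::finite, 'z) riem_manifold_scheme \<Rightarrow> ('m tensor3 \<Rightarrow> 'm tensor2) \<Rightarrow> bool" where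
  "nabla_adjoint M P \<longleftrightarrow>
    (\<forall>T. cot_sym2_tensor (atlas M) T \<longrightarrow> sym2_tensor (atlas M) (P T)) \<and>
    (\<forall>h T. sym2_tensor (atlas M) h \<and> cot_sym2_tensor (atlas M) T \<longrightarrow>
      (\<integral>p. inner_tensor3 M (nabla M h) T p \<partial>vol M) = (\<integral>p. inner_tensor2 M h (P T) p \<partial>vol M))"

section \<open>Spin structures and spinors\<close>

text \<open>Matrices of the complex spin representation, in a unitary basis. The condition on the
  dimension makes the Clifford module irreducible.\<close>

definition clifford_rep :: "('n::finite \<Rightarrow> complex^'k^'k::finite) \<Rightarrow> bool" where
  "clifford_rep \<gamma> \<longleftrightarrow> CARD('k) = 2 ^ (CARD('n) div 2) \<and>
    (\<forall>i j. \<gamma> i ** \<gamma> j + \<gamma> j ** \<gamma> i = (if i = j then - 2 *\<^sub>R mat 1 else 0)) \<and>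
    (\<forall>i a b. \<gamma> i $ b $ a = - cnj (\<gamma> i $ a $ b))"

text \<open>The spin representation is faithful on the spin group, which is therefore identified with its
  image: the products of an even number of unit vectors.\<close>

definition spin_group :: "('n::finite \<Rightarrow> complex^'k^'k::finite) \<Rightarrow> (complex^'k^'k) set" where
  "spin_group \<gamma> = {foldr (\<lambda>v s. (\<Sum>i\<in>UNIV. v $ i *\<^sub>R \<gamma> i) ** s) vs (mat 1) | vs.
     even (length vs) \<and> (\<forall>v\<in>set vs. norm (v :: real^'n) = 1)}"

text \<open>A spin structure is given by a cocycle: on each patch there is a local orthonormal frame, and
  the transition functions between the frames are lifted to the spin group. The spinor bundle is the
  associated bundle, so the frames yield local trivialisations with fibre \<open>complex^'k\<close> and
  transition functions \<open>transition\<close>. Since the transitions of the frames lift to the spin group, they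
  lie in SO(n), so the frames orient the manifold.\<close>

record ('m, 'n::finite, 'i, 'k::finite) spin_manifold = "('m, 'n) riem_manifold" +
  indices :: "'i set"
  patch :: "'i \<Rightarrow> 'm set"
  frame :: "'i \<Rightarrow> 'n \<Rightarrow> 'm \<Rightarrow> 'm tvec"
  transition :: "'i \<Rightarrow> 'i \<Rightarrow> 'm \<Rightarrow> complex^'k^'k"
  gam :: "'n \<Rightarrow> complex^'k^'k"

definition spin_structure ::
    "('m::topological_space, 'n::finite, 'i, 'k::finite, 'z) spin_manifold_scheme \<Rightarrow> bool" where
  "spin_structure M \<longleftrightarrow> clifford_rep (gam M) \<and>
    (\<Union>\<alpha>\<in>indices M. patch M \<alpha>) = UNIV \<and>
    (\<forall>\<alpha>\<in>indices M. open (patch M \<alpha>) \<and>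
      (\<forall>i. smooth_field (atlas M) (patch M \<alpha>) (frame M \<alpha> i)) \<and>
      (\<forall>p\<in>patch M \<alpha>. \<forall>i j.
        metric M p (frame M \<alpha> i p) (frame M \<alpha> j p) = (if i = j then 1 else 0))) \<and>
    (\<forall>\<alpha>\<in>indices M. \<forall>\<beta>\<in>indices M.
      smooth_map (atlas M) (patch M \<alpha> \<inter> patch M \<beta>) (transition M \<alpha> \<beta>) \<and>
      (\<forall>p\<in>patch M \<alpha> \<inter> patch M \<beta>. transition M \<alpha> \<beta> p \<in> spin_group (gam M) \<and>
        (\<forall>j. transition M \<alpha> \<beta> p ** gam M j =
          (\<Sum>i\<in>UNIV. metric M p (frame M \<alpha> i p) (frame M \<beta> j p) *\<^sub>R gam M i) ** transition M \<alpha> \<beta> p))) \<and>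
    (\<forall>\<alpha>\<in>indices M. \<forall>\<beta>\<in>indices M. \<forall>\<delta>\<in>indices M. \<forall>p\<in>patch M \<alpha> \<inter> patch M \<beta> \<inter> patch M \<delta>.
      transition M \<alpha> \<beta> p ** transition M \<beta> \<delta> p = transition M \<alpha> \<delta> p)"

text \<open>Sections of the spinor bundle, and of its tensor product with the cotangent bundle (regarded as
  1-forms with values in spinors), in terms of the local trivialisations.\<close>

type_synonym ('m, 'i, 'k) spinor = "'i \<Rightarrow> 'm \<Rightarrow> complex^'k"
type_synonym ('m, 'i, 'k) tspinor = "'i \<Rightarrow> 'm \<Rightarrow> 'm tvec \<Rightarrow> complex^'k"

definition spinor_field :: "('m::topological_space, 'n::finite, 'i, 'k::finite, 'z) spin_manifold_scheme \<Rightarrow>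
    ('m, 'i, 'k) spinor \<Rightarrow> bool" where
  "spinor_field M \<psi> \<longleftrightarrow>
    (\<forall>\<alpha>\<in>indices M. smooth_map (atlas M) (patch M \<alpha>) (\<psi> \<alpha>)) \<and>
    (\<forall>\<alpha>\<in>indices M. \<forall>\<beta>\<in>indices M. \<forall>p\<in>patch M \<alpha> \<inter> patch M \<beta>. \<psi> \<alpha> p = transition M \<alpha> \<beta> p *v \<psi> \<beta> p)"

definition tspinor_field :: "('m::topological_space, 'n::finite, 'i, 'k::finite, 'z) spin_manifold_scheme \<Rightarrow>
    ('m, 'i, 'k) tspinor \<Rightarrow> bool" where
  "tspinor_field M \<Psi> \<longleftrightarrow>
    (\<forall>\<alpha>\<in>indices M. \<forall>p\<in>patch M \<alpha>. linear_tangent (tangent_space (atlas M) p) (\<Psi> \<alpha> p)) \<and>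
    (\<forall>\<alpha>\<in>indices M. \<forall>W X. open W \<and> W \<subseteq> patch M \<alpha> \<and> smooth_field (atlas M) W X \<longrightarrow>
      smooth_map (atlas M) W (\<lambda>p. \<Psi> \<alpha> p (X p))) \<and>
    (\<forall>\<alpha>\<in>indices M. \<forall>\<beta>\<in>indices M. \<forall>p\<in>patch M \<alpha> \<inter> patch M \<beta>. \<forall>w\<in>tangent_space (atlas M) p.
      \<Psi> \<alpha> p w = transition M \<alpha> \<beta> p *v \<Psi> \<beta> p w)"

definition clifford_mult :: "('m::topological_space, 'n::finite, 'i, 'k::finite, 'z) spin_manifold_scheme \<Rightarrow>
    'i \<Rightarrow> 'm \<Rightarrow> 'm tvec \<Rightarrow> complex^'k \<Rightarrow> complex^'k" where
  "clifford_mult M \<alpha> p v z = (\<Sum>i\<in>UNIV. metric M p v (frame M \<alpha> i p) *\<^sub>R (gam M i *v z))"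

text \<open>Spin connection induced by the Levi-Civita connection. The factor 1/4 with a plus sign is the
  lift of the connection matrix to the spin representation for the convention
  \<open>e\<^sub>i e\<^sub>j + e\<^sub>j e\<^sub>i = - 2 \<delta>\<^sub>i\<^sub>j\<close>.\<close>

definition spin_nabla :: "('m::topological_space, 'n::finite, 'i, 'k::finite, 'z) spin_manifold_scheme \<Rightarrow>
    'm tvec \<Rightarrow> ('m, 'i, 'k) spinor \<Rightarrow> ('m, 'i, 'k) spinor" where
  "spin_nabla M v \<psi> \<alpha> p = vderiv v (\<psi> \<alpha>) +
     (1/4) *\<^sub>R (\<Sum>i\<in>UNIV. \<Sum>j\<in>UNIV.
       metric M p (lc M p v (frame M \<alpha> i)) (frame M \<alpha> j p) *\<^sub>R (gam M i *v (gam M j *v \<psi> \<alpha> p)))"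

definition parallel_spinor :: "('m::topological_space, 'n::finite, 'i, 'k::finite, 'z) spin_manifold_scheme \<Rightarrow>
    ('m, 'i, 'k) spinor \<Rightarrow> bool" where
  "parallel_spinor M \<psi> \<longleftrightarrow> spinor_field M \<psi> \<and>
    (\<forall>\<alpha>\<in>indices M. \<forall>p\<in>patch M \<alpha>. \<forall>v\<in>tangent_space (atlas M) p. spin_nabla M v \<psi> \<alpha> p = 0)"

text \<open>Connection on the tensor product bundle, by the product rule.\<close>

definition twisted_nabla :: "('m::topological_space, 'n::finite, 'i, 'k::finite, 'z) spin_manifold_scheme \<Rightarrow>
    'm tvec \<Rightarrow> ('m, 'i, 'k) tspinor \<Rightarrow> ('m, 'i, 'k) tspinor" where
  "twisted_nabla M v \<Psi> \<alpha> p w = (let Y = extend_vector (atlas M) p w in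
     spin_nabla M v (\<lambda>\<beta> q. \<Psi> \<beta> q (Y q)) \<alpha> p - \<Psi> \<alpha> p (lc M p v Y))"

definition twisted_dirac :: "('m::topological_space, 'n::finite, 'i, 'k::finite, 'z) spin_manifold_scheme \<Rightarrow>
    ('m, 'i, 'k) tspinor \<Rightarrow> ('m, 'i, 'k) tspinor" where
  "twisted_dirac M \<Psi> \<alpha> p w = (\<Sum>k\<in>UNIV.
     clifford_mult M \<alpha> p (frame M \<alpha> k p) (twisted_nabla M (frame M \<alpha> k p) \<Psi> \<alpha> p w))"

text \<open>Hermitian product; the choice of the trivialisation is immaterial since the spin group acts
  unitarily.\<close>

definition inner_tspinor :: "('m::topological_space, 'n::finite, 'i, 'k::finite, 'z) spin_manifold_scheme \<Rightarrow>
    ('m, 'i, 'k) tspinor \<Rightarrow> ('m, 'i, 'k) tspinor \<Rightarrow> 'm \<Rightarrow> complex" where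
  "inner_tspinor M \<Psi> \<Xi> p = (let \<alpha> = (SOME \<alpha>. \<alpha> \<in> indices M \<and> p \<in> patch M \<alpha>) in
     \<Sum>i\<in>UNIV. \<Sum>a\<in>UNIV. \<Psi> \<alpha> p (onb M p i) $ a * cnj (\<Xi> \<alpha> p (onb M p i) $ a))"

definition twisted_dirac_adjoint :: "('m::topological_space, 'n::finite, 'i, 'k::finite, 'z) spin_manifold_scheme \<Rightarrow>
    (('m, 'i, 'k) tspinor \<Rightarrow> ('m, 'i, 'k) tspinor) \<Rightarrow> bool" where
  "twisted_dirac_adjoint M P \<longleftrightarrow>
    (\<forall>\<Xi>. tspinor_field M \<Xi> \<longrightarrow> tspinor_field M (P \<Xi>)) \<and>
    (\<forall>\<Psi> \<Xi>. tspinor_field M \<Psi> \<and> tspinor_field M \<Xi> \<longrightarrow>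
      (\<integral>p. inner_tspinor M (twisted_dirac M \<Psi>) \<Xi> p \<partial>vol M) =
      (\<integral>p. inner_tspinor M \<Psi> (P \<Xi>) p \<partial>vol M))"

definition Phi :: "('m::topological_space, 'n::finite, 'i, 'k::finite, 'z) spin_manifold_scheme \<Rightarrow>
    ('m, 'i, 'k) spinor \<Rightarrow> 'm tensor2 \<Rightarrow> ('m, 'i, 'k) tspinor" where
  "Phi M \<sigma> h \<alpha> p w = (\<Sum>i\<in>UNIV. \<Sum>j\<in>UNIV.
     (h p (frame M \<alpha> i p) (frame M \<alpha> j p) * metric M p (frame M \<alpha> j p) w) *\<^sub>R
       clifford_mult M \<alpha> p (frame M \<alpha> i p) (\<sigma> \<alpha> p))"

end

theory Submission
  imports Defs
begin

text \<open>The proof separates analysis from algebra. On a compact manifold integration by parts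
  determines the two formal adjoints. The adjoint of the connection on symmetric 2-tensors is
  minus the trace of the covariant derivative (\<open>nabla_adjoint_eq\<close>), and the twisted
  Dirac operator is its own adjoint (\<open>twisted_dirac_adjoint_eq\<close>): in both cases the
  pointwise difference of the two sides of the adjoint relation is a divergence, whose integral
  vanishes (\<open>divergence_theorem\<close>), and a section orthogonal to itself is zero. The
  claim is thereby reduced to a pointwise identity for the square of the Dirac operator on
  \<open>\<Phi>(h)\<close>.\<close>

text \<open>This identity is computed in a local orthonormal frame. Since Clifford multiplication
  and \<open>\<sigma>\<close> are parallel, derivatives only hit the components of
  \<open>h\<close>: the value of \<open>\<D>\<D>\<Phi>(h)\<close> on \<open>e\<^sub>j\<close> is
  the sum of \<open>(\<nabla>\<^sub>l\<nabla>\<^sub>k h)\<^sub>i\<^sub>j e\<^sub>l \<cdot>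
  e\<^sub>k \<cdot> e\<^sub>i \<cdot> \<sigma>\<close>. By the Clifford relation, the part
  symmetric in \<open>l\<close> and \<open>k\<close> contributes minus the trace of the second
  covariant derivative, that is \<open>\<Phi>(\<nabla>\<^sup>*\<nabla>h)\<close>. The
  antisymmetric part is by the Ricci identity (\<open>ricci_identity\<close>) the curvature acting
  on the two indices of \<open>h\<close>. A parallel spinor is annihilated by the curvature
  (\<open>parallel_curvature\<close>), so moving \<open>e\<^sub>i\<close> past \<open>e\<^sub>l
  \<cdot> e\<^sub>k\<close> leaves only contractions of the curvature with \<open>i\<close>. Where
  the curvature acts on the index \<open>i\<close>, this is the Ricci curvature, which annihilates
  \<open>\<sigma>\<close> by the first Bianchi identity (\<open>ricci_annihilates\<close>). Where
  it acts on the index \<open>j\<close>, it is the term with the curvature action on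
  \<open>h\<close>. This algebra is \<open>second_derivative_contract\<close>.\<close>

text \<open>Connection and curvature enter through their matrices in a frame. The covariant
  derivatives and the curvature are given by arbitrary extensions of tangent vectors to vector
  fields; the notion of a tensorial expression (\<open>tensorial_at\<close>) replaces such an
  extension by the fields of a frame. Since second derivatives are taken, the frames are not
  normalised at a point, and all identities carry the connection matrices along; in particular the
  first Bianchi identity is the Jacobi identity for the frame fields.\<close>

section \<open>Smooth functions on Euclidean spaces\<close>

lemma k_smooth_on_cong:
  assumes "open S" "\<And>x. x \<in> S \<Longrightarrow> f x = g x"
  shows "k_smooth_on k S f \<longleftrightarrow> k_smooth_on k S g"
proof -
  have *: "k_smooth_on k S g" if "\<forall>x\<in>S. f x = g x" "k_smooth_on k S f" for f g :: "'a \<Rightarrow> 'b"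
    using that
  proof (induction k arbitrary: f g)
    case 0
    show ?case unfolding k_smooth_on.simps
      by (rule continuous_on_eq[of S f]) (use 0 in simp_all)
  next
    case (Suc k)
    have d: "(g has_derivative frechet_derivative f (at x)) (at x)" if "x \<in> S" for x
      by (rule has_derivative_transform_within_open[where f=f, OF _ assms(1) that])
        (use Suc.prems that in \<open>simp_all flip: frechet_derivative_works\<close>)
    show ?case
      unfolding k_smooth_on.simps
    proof (intro conjI ballI allI)
      show "g differentiable (at x)" if "x \<in> S" for x
        using d[OF that] by (auto simp: differentiable_def)
      fix v
      have "\<forall>x\<in>S. frechet_derivative f (at x) v = frechet_derivative g (at x) v"
        using d frechet_derivative_at by metis
      then show "k_smooth_on k S (\<lambda>x. frechet_derivative g (at x) v)"
        by (rule Suc.IH) (use Suc.prems in auto)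
    qed
  qed
  show ?thesis
    by (rule iffI) (use *[of f g] *[of g f] assms in auto)
qed

lemma k_smooth_on_subset: "k_smooth_on k S f \<Longrightarrow> S' \<subseteq> S \<Longrightarrow> k_smooth_on k S' f"
  by (induction k arbitrary: f) (auto intro: continuous_on_subset)

lemma k_smooth_on_continuous: "k_smooth_on k S f \<Longrightarrow> continuous_on S f"
  by (cases k) (auto intro!: continuous_at_imp_continuous_on differentiable_imp_continuous_within)

lemma k_smooth_on_SucD: "k_smooth_on (Suc k) S f \<Longrightarrow> k_smooth_on k S f"
proof (induction k arbitrary: f)
  case 0
  then show ?case using k_smooth_on_continuous[OF 0] by simp
qed auto

text \<open>Smoothness is tested by exhibiting some derivative: the Frechet derivative chosen in the
  definition agrees with it on an open set.\<close>

lemma k_smooth_on_SucI: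
  assumes "open S" "\<And>x. x \<in> S \<Longrightarrow> (f has_derivative f' x) (at x)"
    "\<And>v. k_smooth_on k S (\<lambda>x. f' x v)"
  shows "k_smooth_on (Suc k) S f"
  unfolding k_smooth_on.simps
proof (intro conjI ballI allI)
  show "f differentiable (at x)" if "x \<in> S" for x
    using assms(2)[OF that] by (auto simp: differentiable_def)
  fix v
  have "frechet_derivative f (at x) v = f' x v" if "x \<in> S" for x
    using frechet_derivative_at[OF assms(2)[OF that]] by simp
  then show "k_smooth_on k S (\<lambda>x. frechet_derivative f (at x) v)"
    using k_smooth_on_cong[OF assms(1), of "\<lambda>x. frechet_derivative f (at x) v" "\<lambda>x. f' x v"] assms(3) by blast
qed

lemma k_smooth_on_SucE:
  assumes "k_smooth_on (Suc k) S f" "x \<in> S"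
  shows "(f has_derivative frechet_derivative f (at x)) (at x)"
  using assms by (simp flip: frechet_derivative_works)

lemma k_smooth_on_const: "open S \<Longrightarrow> k_smooth_on k S (\<lambda>x. c)"
proof (induction k arbitrary: c)
  case (Suc k)
  show ?case by (rule k_smooth_on_SucI[where f'="\<lambda>_ _. 0"]) (use Suc in auto)
qed auto

lemma k_smooth_on_bounded_linear:
  assumes "open S" "bounded_linear L"
  shows "k_smooth_on k S f \<Longrightarrow> k_smooth_on k S (\<lambda>x. L (f x))"
proof (induction k arbitrary: f)
  case 0
  then show ?case using bounded_linear.continuous_on[OF assms(2)] by simp
next
  case (Suc k)
  show ?case
  proof (rule k_smooth_on_SucI[where f'="\<lambda>x v. L (frechet_derivative f (at x) v)"])
    show "((\<lambda>x. L (f x)) has_derivative (\<lambda>v. L (frechet_derivative f (at x) v))) (at x)" if "x \<in> S" for x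
      by (rule bounded_linear.has_derivative[OF assms(2) k_smooth_on_SucE[OF Suc.prems that]])
  qed (use Suc assms(1) in simp_all)
qed

lemma k_smooth_on_add:
  assumes "open S"
  shows "k_smooth_on k S f \<Longrightarrow> k_smooth_on k S g \<Longrightarrow> k_smooth_on k S (\<lambda>x. f x + g x)"
proof (induction k arbitrary: f g)
  case 0
  then show ?case by (auto intro!: continuous_intros)
next
  case (Suc k)
  show ?case
  proof (rule k_smooth_on_SucI[where f'="\<lambda>x v. frechet_derivative f (at x) v + frechet_derivative g (at x) v"])
    show "((\<lambda>x. f x + g x) has_derivative (\<lambda>v. frechet_derivative f (at x) v + frechet_derivative g (at x) v)) (at x)"
      if "x \<in> S" for x
      by (rule has_derivative_add[OF k_smooth_on_SucE[OF Suc.prems(1) that] k_smooth_on_SucE[OF Suc.prems(2) that]])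
  qed (use Suc assms(1) in simp_all)
qed

lemma k_smooth_on_bounded_bilinear:
  assumes "open S" "bounded_bilinear B"
  shows "k_smooth_on k S f \<Longrightarrow> k_smooth_on k S g \<Longrightarrow> k_smooth_on k S (\<lambda>x. B (f x) (g x))"
proof (induction k arbitrary: f g)
  case 0
  then show ?case by (auto intro!: bounded_bilinear.continuous_on[OF assms(2)])
next
  case (Suc k)
  show ?case
  proof (rule k_smooth_on_SucI[where f'="\<lambda>x v. B (f x) (frechet_derivative g (at x) v) + B (frechet_derivative f (at x) v) (g x)"])
    show "((\<lambda>x. B (f x) (g x)) has_derivative (\<lambda>v. B (f x) (frechet_derivative g (at x) v) + B (frechet_derivative f (at x) v) (g x))) (at x)"
      if "x \<in> S" for x
      by (rule bounded_bilinear.FDERIV[OF assms(2) k_smooth_on_SucE[OF Suc.prems(1) that] k_smooth_on_SucE[OF Suc.prems(2) that]])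
    show "k_smooth_on k S (\<lambda>x. B (f x) (frechet_derivative g (at x) v) + B (frechet_derivative f (at x) v) (g x))" for v
      by (intro k_smooth_on_add assms(1) Suc.IH k_smooth_on_SucD[OF Suc.prems(1)] k_smooth_on_SucD[OF Suc.prems(2)])
        (use Suc.prems in auto)
  qed (use assms in auto)
qed

lemma k_smooth_on_sum:
  assumes "open S" "\<And>i. i \<in> I \<Longrightarrow> k_smooth_on k S (f i)"
  shows "k_smooth_on k S (\<lambda>x. \<Sum>i\<in>I. f i x)"
  using assms(2)
  by (induction I rule: infinite_finite_induct)
    (auto intro!: k_smooth_on_add k_smooth_on_const assms(1))

lemma k_smooth_on_inverse:
  fixes f :: "'a::real_normed_vector \<Rightarrow> real"
  assumes "open S" "\<And>x. x \<in> S \<Longrightarrow> f x \<noteq> 0"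
  shows "k_smooth_on k S f \<Longrightarrow> k_smooth_on k S (\<lambda>x. inverse (f x))"
proof (induction k)
  case 0
  then show ?case using assms by (auto intro!: continuous_intros)
next
  case (Suc k)
  note mult = k_smooth_on_bounded_bilinear[OF assms(1) bounded_bilinear_mult]
  show ?case
  proof (rule k_smooth_on_SucI[where f'="\<lambda>x v. (-1) * (inverse (f x) * frechet_derivative f (at x) v * inverse (f x))"])
    show "((\<lambda>x. inverse (f x)) has_derivative (\<lambda>v. (-1) * (inverse (f x) * frechet_derivative f (at x) v * inverse (f x)))) (at x)"
      if "x \<in> S" for x
      using Deriv.has_derivative_inverse[OF assms(2)[OF that] k_smooth_on_SucE[OF Suc.prems that]] by simp
    show "k_smooth_on k S (\<lambda>x. (-1) * (inverse (f x) * frechet_derivative f (at x) v * inverse (f x)))" for v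
      by (intro mult k_smooth_on_const assms(1) Suc.IH k_smooth_on_SucD[OF Suc.prems]) (use Suc.prems in auto)
  qed (use assms in auto)
qed

text \<open>By the chain rule, the derivative of the composition is a combination of partial
  derivatives of \<open>g\<close>, composed with \<open>f\<close>. These are again of the form
  considered, with one order of smoothness less, so that the induction is over all
  \<open>g\<close>.\<close>

lemma k_smooth_on_compose:
  fixes f :: "'a::real_normed_vector \<Rightarrow> 'b::euclidean_space"
  assumes "open S" "open T" "f ` S \<subseteq> T"
  shows "k_smooth_on k S f \<Longrightarrow> k_smooth_on k T g \<Longrightarrow> k_smooth_on k S (\<lambda>x. g (f x))"
proof (induction k arbitrary: g)
  case 0
  then show ?case using continuous_on_compose2[of T g S f] assms by simp
next
  case (Suc k)
  let ?f = "\<lambda>x v. frechet_derivative f (at x) v"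
  have fT: "f x \<in> T" if "x \<in> S" for x using assms that by auto
  show ?case
  proof (rule k_smooth_on_SucI[where f'="\<lambda>x v. \<Sum>b\<in>Basis. (?f x v \<bullet> b) *\<^sub>R frechet_derivative g (at (f x)) b"])
    show "((\<lambda>x. g (f x)) has_derivative (\<lambda>v. \<Sum>b\<in>Basis. (?f x v \<bullet> b) *\<^sub>R frechet_derivative g (at (f x)) b)) (at x)"
      if "x \<in> S" for x
    proof -
      have g: "(g has_derivative frechet_derivative g (at (f x))) (at (f x))"
        using k_smooth_on_SucE[OF Suc.prems(2) fT[OF that]] .
      have h1: "((\<lambda>x. g (f x)) has_derivative (\<lambda>v. frechet_derivative g (at (f x)) (?f x v))) (at x)"
        by (rule has_derivative_compose[OF k_smooth_on_SucE[OF Suc.prems(1) that] g])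
      have h2: "frechet_derivative g (at (f x)) y = (\<Sum>b\<in>Basis. (y \<bullet> b) *\<^sub>R frechet_derivative g (at (f x)) b)" for y
        using linear_sum[of "frechet_derivative g (at (f x))" "\<lambda>b. (y \<bullet> b) *\<^sub>R b" Basis]
          has_derivative_linear[OF g] by (simp add: euclidean_representation linear_cmul)
      have "(\<lambda>v. frechet_derivative g (at (f x)) (?f x v)) =
          (\<lambda>v. \<Sum>b\<in>Basis. (?f x v \<bullet> b) *\<^sub>R frechet_derivative g (at (f x)) b)"
        by (rule ext) (rule h2)
      with h1 show ?thesis by (simp only:)
    qed
    show "k_smooth_on k S (\<lambda>x. \<Sum>b\<in>Basis. (?f x v \<bullet> b) *\<^sub>R frechet_derivative g (at (f x)) b)" for v
    proof (intro k_smooth_on_sum k_smooth_on_bounded_bilinear[OF assms(1) bounded_bilinear_scaleR] assms(1))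
      show "k_smooth_on k S (\<lambda>x. ?f x v \<bullet> b)" for b
        by (rule k_smooth_on_bounded_linear[OF assms(1) bounded_linear_inner_left]) (use Suc.prems in simp)
      show "k_smooth_on k S (\<lambda>x. frechet_derivative g (at (f x)) b)" for b
        by (rule Suc.IH[OF k_smooth_on_SucD[OF Suc.prems(1)]]) (use Suc.prems in simp)
    qed
  qed (use assms in auto)
qed

lemma k_smooth_on_local:
  assumes "\<And>x. x \<in> S \<Longrightarrow> \<exists>V. open V \<and> x \<in> V \<and> k_smooth_on k V f"
  shows "k_smooth_on k S f"
  using assms
proof (induction k arbitrary: f)
  case 0
  have "continuous (at x) f" if "x \<in> S" for x
  proof -
    obtain V where "open V" "x \<in> V" "continuous_on V f" using 0[OF \<open>x \<in> S\<close>] by auto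
    then show ?thesis by (simp add: continuous_on_eq_continuous_at)
  qed
  then show ?case by (simp add: continuous_at_imp_continuous_on)
next
  case (Suc k)
  have "\<exists>V. open V \<and> x \<in> V \<and> k_smooth_on k V (\<lambda>x. frechet_derivative f (at x) v)" if "x \<in> S" for x v
    using Suc.prems[OF that] by auto
  moreover have "f differentiable (at x)" if "x \<in> S" for x
    using Suc.prems[OF that] by auto
  ultimately show ?case using Suc.IH by auto
qed

text \<open>The derivative of \<open>x\<^sup>-\<^sup>m exp (- 1 / x)\<close>, extended by zero, is a combination of functions of
  the same kind, so that all of them are smooth by induction on the order.\<close>

definition flat_fun :: "nat \<Rightarrow> real \<Rightarrow> real" where
  "flat_fun m x = (if x > 0 then inverse x ^ m * exp (- inverse x) else 0)"

lemma flat_fun_tendsto: "(flat_fun m \<longlongrightarrow> 0) (at 0)"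
proof -
  have r: "(flat_fun m \<longlongrightarrow> 0) (at_right 0)"
  proof -
    have "((\<lambda>x::real. (inverse x) ^ m / exp (inverse x)) \<longlongrightarrow> 0) (at_right 0)"
      by (rule filterlim_compose[OF tendsto_power_div_exp_0 filterlim_inverse_at_top_right])
    then show ?thesis
      by (rule Lim_transform_eventually)
        (auto simp: flat_fun_def exp_minus field_simps eventually_at_filter)
  qed
  have l: "(flat_fun m \<longlongrightarrow> 0) (at_left 0)"
    by (rule Lim_transform_eventually[OF tendsto_const])
      (auto simp: flat_fun_def eventually_at_filter)
  show ?thesis using filterlim_split_at[OF l r] .
qed

lemma flat_fun_has_derivative:
  "(flat_fun m has_derivative (\<lambda>v. v * (flat_fun (m + 2) x - real m * flat_fun (Suc m) x))) (at x)"
proof -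
  have "(flat_fun m has_real_derivative (flat_fun (m + 2) x - real m * flat_fun (Suc m) x)) (at x)"
  proof (cases "x = 0")
    case True
    have "((\<lambda>y. (flat_fun m y - flat_fun m 0) / (y - 0)) \<longlongrightarrow> 0) (at 0)"
      by (rule Lim_transform_eventually[OF flat_fun_tendsto[of "Suc m"]])
        (auto simp: flat_fun_def eventually_at_filter field_simps)
    then show ?thesis
      using True by (simp add: has_field_derivative_iff flat_fun_def)
  next
    case False
    show ?thesis
    proof (cases "x > 0")
      case True
      have "((\<lambda>x. inverse x ^ m * exp (- inverse x)) has_real_derivative
          (flat_fun (m + 2) x - real m * flat_fun (Suc m) x)) (at x)"
        using True
      proof -
        have e: "((\<lambda>x. exp (- inverse x)) has_real_derivative exp (- inverse x) * (inverse x * inverse x)) (at x)"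
          using True by (auto intro!: derivative_eq_intros simp: power2_eq_square)
        have p: "((\<lambda>x. inverse x ^ m) has_real_derivative - real m * inverse x ^ Suc m) (at x)"
          using DERIV_power[OF DERIV_inverse, of x m UNIV] True by (cases m) (simp_all add: algebra_simps)
        show ?thesis
          using DERIV_mult[OF p e] True by (simp add: flat_fun_def algebra_simps)
      qed
      then show ?thesis
        by (rule has_field_derivative_transform_within_open[where S="{0<..}"])
          (use True in \<open>auto simp: flat_fun_def\<close>)
    next
      case neg: False
      have "((\<lambda>x. 0) has_real_derivative (flat_fun (m + 2) x - real m * flat_fun (Suc m) x)) (at x)"
        using neg False by (auto simp: flat_fun_def)
      then show ?thesis
        by (rule has_field_derivative_transform_within_open[where S="{..<0}"])
          (use neg False in \<open>auto simp: flat_fun_def\<close>)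
    qed
  qed
  moreover have "(\<lambda>v. v * (flat_fun (m + 2) x - real m * flat_fun (Suc m) x)) =
      (*) (flat_fun (m + 2) x - real m * flat_fun (Suc m) x)"
    by (rule ext) (rule mult.commute)
  ultimately show ?thesis
    unfolding has_field_derivative_def by (simp only:)
qed

lemma k_smooth_on_flat_fun: "k_smooth_on k UNIV (flat_fun m)"
proof (induction k arbitrary: m)
  case 0
  have "continuous (at x) (flat_fun m)" for x
    using has_derivative_continuous[OF flat_fun_has_derivative] .
  then show ?case by (simp add: continuous_at_imp_continuous_on)
next
  case (Suc k)
  note intros = k_smooth_on_bounded_bilinear[OF open_UNIV bounded_bilinear_mult] k_smooth_on_const k_smooth_on_add
  have "k_smooth_on k UNIV (\<lambda>x. v * (flat_fun (m + 2) x + (- real m) * flat_fun (Suc m) x))" for v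
    by (intro intros Suc.IH open_UNIV)
  then show ?case
    by (intro k_smooth_on_SucI[OF _ flat_fun_has_derivative]) auto
qed

text \<open>A function of the squared distance, as the distance itself is not smooth at the
  centre.\<close>

definition bump :: "'a::euclidean_space \<Rightarrow> real \<Rightarrow> 'a \<Rightarrow> real" where
  "bump a r x = flat_fun 0 (r\<^sup>2 - (x - a) \<bullet> (x - a))"

lemma bump_nonneg: "bump a r x \<ge> 0"
  by (simp add: bump_def flat_fun_def)

lemma bump_pos_iff:
  assumes "r > 0"
  shows "bump a r x > 0 \<longleftrightarrow> x \<in> ball a r"
proof -
  have "norm (x - a) < r \<longleftrightarrow> (norm (x - a))\<^sup>2 < r\<^sup>2"
    using assms power_strict_mono[of "norm (x - a)" r 2] power2_less_imp_less[of "norm (x - a)" r] by auto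
  then have "(x - a) \<bullet> (x - a) < r\<^sup>2 \<longleftrightarrow> norm (x - a) < r"
    by (simp add: dot_square_norm)
  then show ?thesis by (auto simp: bump_def flat_fun_def dist_norm norm_minus_commute)
qed

lemma k_smooth_on_ident: "open S \<Longrightarrow> k_smooth_on k S (\<lambda>x. x)"
proof (cases k)
  case (Suc n)
  assume "open S"
  then show ?thesis unfolding Suc
    by (intro k_smooth_on_SucI[where f'="\<lambda>_ v. v"]) (auto intro: k_smooth_on_const)
qed auto

lemma smooth_on_bump: "smooth_on UNIV (bump a r)"
proof -
  have d: "k_smooth_on k UNIV (\<lambda>x. x + (- a))" for k
    by (intro k_smooth_on_add k_smooth_on_ident k_smooth_on_const) auto
  have "k_smooth_on k UNIV (\<lambda>x. r\<^sup>2 + (-1) * ((x + (- a)) \<bullet> (x + (- a))))" for k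
    by (intro k_smooth_on_add k_smooth_on_const d
        k_smooth_on_bounded_bilinear[OF open_UNIV bounded_bilinear_mult]
        k_smooth_on_bounded_bilinear[OF open_UNIV bounded_bilinear_inner]) auto
  from k_smooth_on_compose[OF open_UNIV open_UNIV _ this k_smooth_on_flat_fun]
  have "k_smooth_on k UNIV (\<lambda>x. flat_fun 0 (r\<^sup>2 + (-1) * ((x + (- a)) \<bullet> (x + (- a)))))" for k
    by simp
  then show ?thesis
    by (simp add: smooth_on_def bump_def[abs_def])
qed

section \<open>Charts, smooth maps and tangent vectors\<close>

locale smooth_manifold =
  fixes A :: "('m::t2_space, 'n::finite) chart set"
  assumes smooth_atlas: "smooth_atlas A"
begin

lemma chart_homeomorphism:
  assumes "(U, \<phi>) \<in> A"
  shows "open U" "open (\<phi> ` U)" "homeomorphism U (\<phi> ` U) \<phi> (inv_into U \<phi>)"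
  using smooth_atlas assms unfolding smooth_atlas_def by fast+

lemma chart_cover: obtains U \<phi> where "(U, \<phi>) \<in> A" "p \<in> U"
proof -
  have "p \<in> (\<Union>(U, \<phi>)\<in>A. U)" using smooth_atlas unfolding smooth_atlas_def by simp
  then show ?thesis using that by auto
qed

lemma chart_inv [simp]: "(U, \<phi>) \<in> A \<Longrightarrow> p \<in> U \<Longrightarrow> inv_into U \<phi> (\<phi> p) = p"
  using homeomorphism_apply1[OF chart_homeomorphism(3)] by blast

lemma chart_image_eq:
  assumes "(U, \<phi>) \<in> A"
  shows "\<phi> ` (U \<inter> W) = \<phi> ` U \<inter> inv_into U \<phi> -` W"
  using assms by auto

lemma chart_open_image:
  assumes "(U, \<phi>) \<in> A" "open W"
  shows "open (\<phi> ` (U \<inter> W))"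
  unfolding chart_image_eq[OF assms(1)]
  by (rule continuous_open_preimage)
    (use chart_homeomorphism[OF assms(1)] assms(2) in \<open>auto simp: homeomorphism_def\<close>)

lemma chart_preimage_open:
  assumes "(U, \<phi>) \<in> A" "open V"
  shows "open (U \<inter> \<phi> -` V)"
  by (rule continuous_open_preimage)
    (use chart_homeomorphism[OF assms(1)] assms(2) in \<open>auto simp: homeomorphism_def\<close>)

lemma smooth_mapI:
  assumes "\<And>U \<phi> k. (U, \<phi>) \<in> A \<Longrightarrow> k_smooth_on k (\<phi> ` (U \<inter> W)) (\<lambda>x. F (inv_into U \<phi> x))"
  shows "smooth_map A W F"
  using assms unfolding smooth_map_def smooth_on_def by (auto simp: o_def)

lemma smooth_mapD:
  assumes "smooth_map A W F" "(U, \<phi>) \<in> A"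
  shows "k_smooth_on k (\<phi> ` (U \<inter> W)) (\<lambda>x. F (inv_into U \<phi> x))"
  using assms unfolding smooth_map_def smooth_on_def by (auto simp: o_def)

lemma smooth_map_const: "open W \<Longrightarrow> smooth_map A W (\<lambda>q. c)"
  by (rule smooth_mapI) (rule k_smooth_on_const, rule chart_open_image)

lemma smooth_map_bounded_linear:
  "open W \<Longrightarrow> bounded_linear L \<Longrightarrow> smooth_map A W F \<Longrightarrow> smooth_map A W (\<lambda>q. L (F q))"
  by (rule smooth_mapI, rule k_smooth_on_bounded_linear)
    (auto intro: chart_open_image smooth_mapD)

lemma smooth_map_bounded_bilinear:
  "open W \<Longrightarrow> bounded_bilinear B \<Longrightarrow> smooth_map A W F \<Longrightarrow> smooth_map A W G \<Longrightarrow>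
    smooth_map A W (\<lambda>q. B (F q) (G q))"
  by (rule smooth_mapI, rule k_smooth_on_bounded_bilinear)
    (auto intro: chart_open_image smooth_mapD)

lemma smooth_map_add:
  "open W \<Longrightarrow> smooth_map A W F \<Longrightarrow> smooth_map A W G \<Longrightarrow> smooth_map A W (\<lambda>q. F q + G q)"
  by (rule smooth_mapI, rule k_smooth_on_add)
    (auto intro: chart_open_image smooth_mapD)

lemma smooth_map_sum:
  "open W \<Longrightarrow> (\<And>i. i \<in> I \<Longrightarrow> smooth_map A W (F i)) \<Longrightarrow> smooth_map A W (\<lambda>q. \<Sum>i\<in>I. F i q)"
  by (rule smooth_mapI, rule k_smooth_on_sum)
    (auto intro: chart_open_image smooth_mapD)

lemma smooth_map_inverse:
  fixes f :: "'m \<Rightarrow> real"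
  shows "open W \<Longrightarrow> (\<And>q. q \<in> W \<Longrightarrow> f q \<noteq> 0) \<Longrightarrow> smooth_map A W f \<Longrightarrow> smooth_map A W (\<lambda>q. inverse (f q))"
  by (rule smooth_mapI, rule k_smooth_on_inverse)
    (auto intro: chart_open_image smooth_mapD)

lemma smooth_map_uminus: "open W \<Longrightarrow> smooth_map A W F \<Longrightarrow> smooth_map A W (\<lambda>q. - F q)"
  using smooth_map_bounded_linear[OF _ bounded_linear_minus[OF bounded_linear_ident]] .

lemma smooth_map_diff:
  "open W \<Longrightarrow> smooth_map A W F \<Longrightarrow> smooth_map A W G \<Longrightarrow> smooth_map A W (\<lambda>q. F q - G q)"
  using smooth_map_add[of W F "\<lambda>q. - G q"] smooth_map_uminus[of W G] by simp

lemmas smooth_map_mult = smooth_map_bounded_bilinear[OF _ bounded_bilinear_mult]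
lemmas smooth_map_scaleR = smooth_map_bounded_bilinear[OF _ bounded_bilinear_scaleR]
lemmas smooth_map_inner = smooth_map_bounded_bilinear[OF _ bounded_bilinear_inner]

lemma smooth_map_subset: "smooth_map A W F \<Longrightarrow> W' \<subseteq> W \<Longrightarrow> smooth_map A W' F"
  by (rule smooth_mapI, rule k_smooth_on_subset, erule smooth_mapD) auto

lemma smooth_map_cong:
  assumes "open W" "\<And>q. q \<in> W \<Longrightarrow> F q = G q" "smooth_map A W F"
  shows "smooth_map A W G"
proof (rule smooth_mapI)
  fix U \<phi> k assume c: "(U, \<phi>) \<in> A"
  have "F (inv_into U \<phi> x) = G (inv_into U \<phi> x)" if "x \<in> \<phi> ` (U \<inter> W)" for x
    using that c assms(2) by auto
  then show "k_smooth_on k (\<phi> ` (U \<inter> W)) (\<lambda>x. G (inv_into U \<phi> x))"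
    using k_smooth_on_cong[OF chart_open_image[OF c assms(1)],
        of "\<lambda>x. F (inv_into U \<phi> x)" "\<lambda>x. G (inv_into U \<phi> x)" k] smooth_mapD[OF assms(3) c, of k]
    by blast
qed

lemma smooth_map_local:
  assumes "\<And>p. p \<in> W \<Longrightarrow> \<exists>V. open V \<and> p \<in> V \<and> smooth_map A V F"
  shows "smooth_map A W F"
proof (rule smooth_mapI, rule k_smooth_on_local)
  fix U \<phi> k x assume c: "(U, \<phi>) \<in> A" and x: "x \<in> \<phi> ` (U \<inter> W)"
  then obtain p where p: "p \<in> U" "p \<in> W" "x = \<phi> p" by auto
  obtain V where V: "open V" "p \<in> V" "smooth_map A V F" using assms[OF p(2)] by blast
  show "\<exists>Va. open Va \<and> x \<in> Va \<and> k_smooth_on k Va (\<lambda>x. F (inv_into U \<phi> x))"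
    by (rule exI[of _ "\<phi> ` (U \<inter> V)"])
      (use chart_open_image[OF c V(1)] p V smooth_mapD[OF V(3) c, of k] in blast)
qed

lemma smooth_map_continuous_on:
  assumes "open W" "smooth_map A W F"
  shows "continuous_on W F"
proof -
  have "continuous (at p) F" if "p \<in> W" for p
  proof -
    obtain U \<phi> where c: "(U, \<phi>) \<in> A" "p \<in> U" using chart_cover .
    have "continuous_on (U \<inter> W) \<phi>"
      using homeomorphism_cont1[OF chart_homeomorphism(3)[OF c(1)]] by (rule continuous_on_subset) simp
    then have "continuous_on (U \<inter> W) (\<lambda>q. F (inv_into U \<phi> (\<phi> q)))"
      using continuous_on_compose2[OF k_smooth_on_continuous[OF smooth_mapD[OF assms(2) c(1), of 0]],
          of "U \<inter> W" \<phi>] by blast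
    then have "continuous_on (U \<inter> W) F"
      by (rule continuous_on_eq) (use c in auto)
    moreover have "open (U \<inter> W)" using chart_homeomorphism(1)[OF c(1)] assms(1) by auto
    ultimately show ?thesis using c that by (simp add: continuous_on_eq_continuous_at)
  qed
  then show ?thesis by (simp add: continuous_at_imp_continuous_on)
qed

text \<open>Smoothness may be checked in a single chart, since the transition maps are
  smooth.\<close>

lemma smooth_map_chart:
  assumes c: "(U, \<phi>) \<in> A" and W: "open W" "W \<subseteq> U" and G: "\<And>k. k_smooth_on k (\<phi> ` W) G"
  shows "smooth_map A W (\<lambda>q. G (\<phi> q))"
proof (rule smooth_mapI)
  fix V \<psi> k assume d: "(V, \<psi>) \<in> A"
  have UW: "U \<inter> W = W" using W by auto
  have "smooth_on (\<psi> ` (V \<inter> U)) (\<phi> \<circ> inv_into V \<psi>)"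
    using smooth_atlas c d unfolding smooth_atlas_def by fast
  then have "k_smooth_on k (\<psi> ` (V \<inter> W)) (\<lambda>x. \<phi> (inv_into V \<psi> x))"
    unfolding smooth_on_def o_def using W k_smooth_on_subset by (metis image_mono inf_mono order_refl)
  moreover have "open (\<phi> ` W)" using chart_open_image[OF c W(1)] UW by simp
  moreover have "(\<lambda>x. \<phi> (inv_into V \<psi> x)) ` (\<psi> ` (V \<inter> W)) \<subseteq> \<phi> ` W" using d by auto
  ultimately show "k_smooth_on k (\<psi> ` (V \<inter> W)) (\<lambda>x. G (\<phi> (inv_into V \<psi> x)))"
    using k_smooth_on_compose[OF chart_open_image[OF d W(1)] _ _ _ G] by blast
qed

lemma smooth_nearI: "smooth_map A W F \<Longrightarrow> open W \<Longrightarrow> p \<in> W \<Longrightarrow> smooth_near A p F"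
  unfolding smooth_near_def by blast

lemma smooth_near_bounded_linear:
  "bounded_linear L \<Longrightarrow> smooth_near A p F \<Longrightarrow> smooth_near A p (\<lambda>q. L (F q))"
  unfolding smooth_near_def using smooth_map_bounded_linear by blast

lemma smooth_near_has_derivative:
  assumes "smooth_near A p F" "(U, \<phi>) \<in> A" "p \<in> U"
  shows "((\<lambda>x. F (inv_into U \<phi> x)) has_derivative frechet_derivative (\<lambda>x. F (inv_into U \<phi> x)) (at (\<phi> p))) (at (\<phi> p))"
proof -
  obtain W where W: "open W" "p \<in> W" "smooth_map A W F" using assms(1) unfolding smooth_near_def by blast
  show ?thesis
    by (rule k_smooth_on_SucE[OF smooth_mapD[OF W(3) assms(2), of "Suc 0"]]) (use W assms in auto)
qed

lemma coord_vector_eq: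
  "smooth_near A p f \<Longrightarrow> coord_vector A (U, \<phi>) p u f = frechet_derivative (\<lambda>x. f (inv_into U \<phi> x)) (at (\<phi> p)) u"
  by (simp add: coord_vector_def o_def)

lemma vderiv_coord_vector:
  assumes "smooth_near A p F" "(U, \<phi>) \<in> A" "p \<in> U"
  shows "vderiv (coord_vector A (U, \<phi>) p u) F = frechet_derivative (\<lambda>x. F (inv_into U \<phi> x)) (at (\<phi> p)) u"
proof -
  note d = smooth_near_has_derivative[OF assms]
  have "coord_vector A (U, \<phi>) p u (\<lambda>q. F q \<bullet> b) =
      frechet_derivative (\<lambda>x. F (inv_into U \<phi> x)) (at (\<phi> p)) u \<bullet> b" for b
  proof -
    have "coord_vector A (U, \<phi>) p u (\<lambda>q. F q \<bullet> b) =
        frechet_derivative (\<lambda>x. F (inv_into U \<phi> x) \<bullet> b) (at (\<phi> p)) u"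
      by (rule coord_vector_eq[OF smooth_near_bounded_linear[OF bounded_linear_inner_left assms(1)]])
    also have "\<dots> = frechet_derivative (\<lambda>x. F (inv_into U \<phi> x)) (at (\<phi> p)) u \<bullet> b"
      using frechet_derivative_at[OF has_derivative_inner_left[OF d, of b]] by metis
    finally show ?thesis .
  qed
  then show ?thesis unfolding vderiv_def by (simp add: euclidean_representation)
qed

lemma vderiv_real: "vderiv v f = v f" for f :: "'m \<Rightarrow> real"
  by (simp add: vderiv_def)

lemma coord_vector_tangent: "(U, \<phi>) \<in> A \<Longrightarrow> p \<in> U \<Longrightarrow> coord_vector A (U, \<phi>) p u \<in> tangent_space A p"
  unfolding tangent_space_def by (intro CollectI exI[of _ "(U, \<phi>)"] exI[of _ u]) auto

lemma tangent_cases: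
  assumes "v \<in> tangent_space A p"
  obtains U \<phi> u where "(U, \<phi>) \<in> A" "p \<in> U" "v = coord_vector A (U, \<phi>) p u"
  using assms unfolding tangent_space_def by (auto simp: split_paired_all)

text \<open>By the chain rule, tangent vectors are the coordinate vectors of any one chart.\<close>

lemma tangent_in_chart:
  assumes "v \<in> tangent_space A p" and c: "(U, \<phi>) \<in> A" "p \<in> U"
  obtains u where "v = coord_vector A (U, \<phi>) p u"
proof -
  obtain V \<psi> w where d: "(V, \<psi>) \<in> A" "p \<in> V" and v: "v = coord_vector A (V, \<psi>) p w"
    using tangent_cases[OF assms(1)] .
  have "open U" using chart_homeomorphism(1)[OF c(1)] .
  then have s: "smooth_map A U (\<lambda>q. \<phi> q)"
    by (rule smooth_map_chart[OF c(1), of U "\<lambda>x. x"])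
      (use k_smooth_on_ident chart_homeomorphism(2)[OF c(1)] in auto)
  define t where "t = (\<lambda>x. \<phi> (inv_into V \<psi> x))"
  have t: "(t has_derivative frechet_derivative t (at (\<psi> p))) (at (\<psi> p))"
    unfolding t_def
    by (rule smooth_near_has_derivative[OF smooth_nearI[OF s \<open>open U\<close> c(2)] d])
  have "v f = coord_vector A (U, \<phi>) p (frechet_derivative t (at (\<psi> p)) w) f" for f
  proof (cases "smooth_near A p f")
    case False
    then show ?thesis unfolding v by (simp add: coord_vector_def)
  next
    case True
    let ?g = "\<lambda>x. f (inv_into U \<phi> x)"
    have tp: "t (\<psi> p) = \<phi> p" unfolding t_def using d by simp
    have "((\<lambda>x. ?g (t x)) has_derivative (\<lambda>w. frechet_derivative ?g (at (\<phi> p)) (frechet_derivative t (at (\<psi> p)) w))) (at (\<psi> p))"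
      by (rule has_derivative_compose[OF t]) (use smooth_near_has_derivative[OF True c] tp in simp)
    then have "((\<lambda>x. f (inv_into V \<psi> x)) has_derivative (\<lambda>w. frechet_derivative ?g (at (\<phi> p)) (frechet_derivative t (at (\<psi> p)) w))) (at (\<psi> p))"
      by (rule has_derivative_transform_within_open[OF _ chart_open_image[OF d(1) \<open>open U\<close>]])
        (use c d in \<open>auto simp: t_def\<close>)
    from frechet_derivative_at[OF this] show ?thesis
      unfolding v coord_vector_eq[OF True] by metis
  qed
  then show ?thesis using that by blast
qed

lemma coord_vector_linear:
  assumes "(U, \<phi>) \<in> A" "p \<in> U"
  shows "coord_vector A (U, \<phi>) p (a *\<^sub>R u + b *\<^sub>R w) =
    (\<lambda>f. a * coord_vector A (U, \<phi>) p u f + b * coord_vector A (U, \<phi>) p w f)"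
proof
  fix f
  show "coord_vector A (U, \<phi>) p (a *\<^sub>R u + b *\<^sub>R w) f =
    a * coord_vector A (U, \<phi>) p u f + b * coord_vector A (U, \<phi>) p w f"
  proof (cases "smooth_near A p f")
    case True
    show ?thesis
      unfolding coord_vector_eq[OF True]
      using has_derivative_linear[OF smooth_near_has_derivative[OF True assms]]
      by (simp add: linear_add linear_cmul)
  qed (simp add: coord_vector_def)
qed

lemma tangent_comb:
  assumes "v \<in> tangent_space A p" "w \<in> tangent_space A p"
  shows "(\<lambda>f. a * v f + b * w f) \<in> tangent_space A p"
proof -
  obtain U \<phi> where c: "(U, \<phi>) \<in> A" "p \<in> U" using chart_cover .
  obtain u where u: "v = coord_vector A (U, \<phi>) p u" using tangent_in_chart[OF assms(1) c] .
  obtain u' where u': "w = coord_vector A (U, \<phi>) p u'" using tangent_in_chart[OF assms(2) c] .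
  show ?thesis
    unfolding u u' coord_vector_linear[OF c, symmetric] by (rule coord_vector_tangent[OF c])
qed

lemma tangent_zero: "(\<lambda>f. 0) \<in> tangent_space A p"
proof -
  obtain U \<phi> where c: "(U, \<phi>) \<in> A" "p \<in> U" using chart_cover .
  show ?thesis
    using tangent_comb[OF coord_vector_tangent[OF c] coord_vector_tangent[OF c], of 0 _ 0] by simp
qed

lemma tangent_scale: "v \<in> tangent_space A p \<Longrightarrow> (\<lambda>f. a * v f) \<in> tangent_space A p"
  using tangent_comb[of v p v a 0] by simp

lemma tangent_add: "v \<in> tangent_space A p \<Longrightarrow> w \<in> tangent_space A p \<Longrightarrow> (\<lambda>f. v f + w f) \<in> tangent_space A p"
  using tangent_comb[of v p w 1 1] by simp

lemma tangent_sum: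
  "(\<And>i. i \<in> I \<Longrightarrow> v i \<in> tangent_space A p) \<Longrightarrow> (\<lambda>f. \<Sum>i\<in>I. a i * v i f) \<in> tangent_space A p"
  by (induction I rule: infinite_finite_induct)
    (auto simp: tangent_zero intro!: tangent_add tangent_scale)

lemma linear_tangent_sum:
  assumes L: "linear_tangent (tangent_space A p) L" and v: "\<And>i. i \<in> I \<Longrightarrow> v i \<in> tangent_space A p"
  shows "L (\<lambda>f. \<Sum>i\<in>I. a i * v i f) = (\<Sum>i\<in>I. a i *\<^sub>R L (v i))"
proof -
  have 0: "L (\<lambda>f. 0) = 0"
    using L[unfolded linear_tangent_def, rule_format, OF tangent_zero tangent_zero, of 0 0] by simp
  show ?thesis
    using v
  proof (induction I rule: infinite_finite_induct)
    case (insert i I)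
    have "(\<lambda>f. \<Sum>i\<in>I. a i * v i f) \<in> tangent_space A p"
      using insert.prems by (intro tangent_sum) auto
    then have "L (\<lambda>f. a i * v i f + 1 * (\<Sum>i\<in>I. a i * v i f)) = a i *\<^sub>R L (v i) + 1 *\<^sub>R L (\<lambda>f. \<Sum>i\<in>I. a i * v i f)"
      by (rule L[unfolded linear_tangent_def, rule_format, OF insert.prems[of i, OF insertI1]])
    then show ?case using insert by simp
  qed (simp_all add: 0)
qed

lemma smooth_map_chart_coord:
  assumes "(U, \<phi>) \<in> A"
  shows "smooth_map A U (\<lambda>q. \<phi> q $ a)"
proof -
  have o: "open (\<phi> ` U)" using chart_homeomorphism(2)[OF assms] .
  show ?thesis
    by (rule smooth_map_chart[OF assms, of U "\<lambda>x. x $ a"])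
      (use chart_homeomorphism(1)[OF assms] k_smooth_on_bounded_linear[OF o bounded_linear_vec_nth k_smooth_on_ident[OF o]] in auto)
qed

lemma coord_vector_coord:
  assumes "(U, \<phi>) \<in> A" "p \<in> U"
  shows "coord_vector A (U, \<phi>) p u (\<lambda>q. \<phi> q $ a) = u $ a"
proof -
  have o: "open U" "open (\<phi> ` U)" using chart_homeomorphism[OF assms(1)] by auto
  have "((\<lambda>x. x $ a) has_derivative (\<lambda>x. x $ a)) (at (\<phi> p))"
    by (rule bounded_linear_imp_has_derivative[OF bounded_linear_vec_nth])
  then have "((\<lambda>x. \<phi> (inv_into U \<phi> x) $ a) has_derivative (\<lambda>x. x $ a)) (at (\<phi> p))"
    by (rule has_derivative_transform_within_open[OF _ o(2)]) (use assms in auto)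
  from frechet_derivative_at[OF this] show ?thesis
    unfolding coord_vector_eq[OF smooth_nearI[OF smooth_map_chart_coord[OF assms(1), of a] o(1) assms(2)]]
    by metis
qed

lemma coord_vector_zero: "(U, \<phi>) \<in> A \<Longrightarrow> p \<in> U \<Longrightarrow> coord_vector A (U, \<phi>) p 0 = (\<lambda>f. 0)"
  using coord_vector_linear[of U \<phi> p 0 0 0 0] by simp

lemma coord_vector_sum:
  assumes "(U, \<phi>) \<in> A" "p \<in> U"
  shows "coord_vector A (U, \<phi>) p (\<Sum>i\<in>I. a i *\<^sub>R u i) = (\<lambda>f. \<Sum>i\<in>I. a i * coord_vector A (U, \<phi>) p (u i) f)"
proof (induction I rule: infinite_finite_induct)
  case (insert i I)
  then show ?case using coord_vector_linear[OF assms, of "a i" "u i" 1 "\<Sum>i\<in>I. a i *\<^sub>R u i"] by simp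
qed (simp_all add: coord_vector_zero[OF assms])

text \<open>As many orthonormal vectors as the dimension form a basis of the tangent space.\<close>

lemma orthonormal_expansion:
  fixes b :: "'n \<Rightarrow> 'm tvec"
  assumes b: "\<And>i. b i \<in> tangent_space A p" "\<And>i j. G (b i) (b j) = (if i = j then 1 else 0)"
    and G: "\<And>w. w \<in> tangent_space A p \<Longrightarrow> linear_tangent (tangent_space A p) (\<lambda>v. G v w)"
    and v: "v \<in> tangent_space A p"
  shows "v = (\<lambda>f. \<Sum>i\<in>UNIV. G v (b i) * b i f)"
proof -
  obtain U \<phi> where c: "(U, \<phi>) \<in> A" "p \<in> U" using chart_cover .
  have "\<forall>i. \<exists>u. b i = coord_vector A (U, \<phi>) p u" using tangent_in_chart[OF b(1) c] by metis
  then obtain u where u: "\<And>i. b i = coord_vector A (U, \<phi>) p (u i)" by metis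
  define E where "E = (\<lambda>y::real^'n. \<Sum>i\<in>UNIV. (y $ i) *\<^sub>R u i)"
  have E: "coord_vector A (U, \<phi>) p (E y) = (\<lambda>f. \<Sum>i\<in>UNIV. (y $ i) * b i f)" for y
    unfolding E_def u by (rule coord_vector_sum[OF c])
  have Gy: "G (\<lambda>f. \<Sum>i\<in>UNIV. (y $ i) * b i f) (b j) = y $ j" for y j
    using linear_tangent_sum[OF G[OF b(1)[of j]], of UNIV b "\<lambda>i. y $ i"] b
    by (simp add: if_distrib[of "\<lambda>x. _ * x"] cong: if_cong)
  have lin: "linear E"
    unfolding E_def by (rule linearI) (auto simp: scaleR_add_left sum.distrib scaleR_sum_right)
  have "inj E"
  proof (subst linear_injective_0[OF lin], intro allI impI)
    fix y assume "E y = 0"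
    then have "(\<lambda>f. \<Sum>i\<in>UNIV. (y $ i) * b i f) = (\<lambda>f. \<Sum>i\<in>UNIV. ((0::real^'n) $ i) * b i f)"
      using E[of y] coord_vector_zero[OF c] by simp
    then have "y $ j = (0::real^'n) $ j" for j using Gy[of y j] Gy[of 0 j] by simp
    then show "y = 0" by (simp add: vec_eq_iff)
  qed
  then have "surj E" by (rule linear_injective_imp_surjective[OF lin]) simp
  obtain w where w: "v = coord_vector A (U, \<phi>) p w" using tangent_in_chart[OF v c] .
  obtain y where "w = E y" using \<open>surj E\<close> by (metis surjD)
  then have vy: "v = (\<lambda>f. \<Sum>i\<in>UNIV. (y $ i) * b i f)" using w E by simp
  then have "G v (b j) = y $ j" for j using Gy by simp
  then show ?thesis using vy by simp
qed

subsection \<open>Tangent vectors as derivations\<close>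

lemma vderiv_cong:
  assumes "v \<in> tangent_space A p" "open W" "p \<in> W" "smooth_map A W F" "\<And>q. q \<in> W \<Longrightarrow> F q = G q"
  shows "vderiv v F = vderiv v G"
proof -
  obtain U \<phi> u where c: "(U, \<phi>) \<in> A" "p \<in> U" and v: "v = coord_vector A (U, \<phi>) p u"
    using tangent_cases[OF assms(1)] .
  have F: "smooth_near A p F" using smooth_nearI assms by blast
  have G: "smooth_near A p G" using smooth_nearI[OF smooth_map_cong[OF assms(2,5,4)] assms(2,3)] .
  have "((\<lambda>x. G (inv_into U \<phi> x)) has_derivative frechet_derivative (\<lambda>x. F (inv_into U \<phi> x)) (at (\<phi> p))) (at (\<phi> p))"
    by (rule has_derivative_transform_within_open[OF smooth_near_has_derivative[OF F c] chart_open_image[OF c(1) assms(2)]])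
      (use c assms in auto)
  from frechet_derivative_at[OF this] show ?thesis
    unfolding v vderiv_coord_vector[OF F c] vderiv_coord_vector[OF G c] by metis
qed

lemma vderiv_const: "v \<in> tangent_space A p \<Longrightarrow> vderiv v (\<lambda>q. c) = 0"
  by (erule tangent_cases) (simp add: vderiv_coord_vector smooth_nearI[OF smooth_map_const[OF open_UNIV]])

lemma vderiv_bounded_linear:
  assumes "v \<in> tangent_space A p" "smooth_near A p F" "bounded_linear L"
  shows "vderiv v (\<lambda>q. L (F q)) = L (vderiv v F)"
proof -
  obtain U \<phi> u where c: "(U, \<phi>) \<in> A" "p \<in> U" and v: "v = coord_vector A (U, \<phi>) p u"
    using tangent_cases[OF assms(1)] .
  note d = bounded_linear.has_derivative[OF assms(3) smooth_near_has_derivative[OF assms(2) c]]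
  show ?thesis
    unfolding v vderiv_coord_vector[OF assms(2) c]
      vderiv_coord_vector[OF smooth_near_bounded_linear[OF assms(3,2)] c]
    using frechet_derivative_at[OF d] by metis
qed

lemma smooth_near_bounded_bilinear:
  assumes "bounded_bilinear B" "smooth_near A p F" "smooth_near A p G"
  shows "smooth_near A p (\<lambda>q. B (F q) (G q))"
proof -
  obtain W V where W: "open W" "p \<in> W" "smooth_map A W F" and V: "open V" "p \<in> V" "smooth_map A V G"
    using assms unfolding smooth_near_def by blast
  have "smooth_map A (W \<inter> V) (\<lambda>q. B (F q) (G q))"
    by (rule smooth_map_bounded_bilinear[OF _ assms(1)])
      (use W V in \<open>auto intro: smooth_map_subset\<close>)
  then show ?thesis by (rule smooth_nearI) (use W V in auto)
qed

lemma vderiv_bounded_bilinear: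
  assumes "v \<in> tangent_space A p" "smooth_near A p F" "smooth_near A p G" "bounded_bilinear B"
  shows "vderiv v (\<lambda>q. B (F q) (G q)) = B (F p) (vderiv v G) + B (vderiv v F) (G p)"
proof -
  obtain U \<phi> u where c: "(U, \<phi>) \<in> A" "p \<in> U" and v: "v = coord_vector A (U, \<phi>) p u"
    using tangent_cases[OF assms(1)] .
  note d = bounded_bilinear.FDERIV[OF assms(4) smooth_near_has_derivative[OF assms(2) c] smooth_near_has_derivative[OF assms(3) c]]
  show ?thesis
    unfolding v vderiv_coord_vector[OF assms(2) c] vderiv_coord_vector[OF assms(3) c]
      vderiv_coord_vector[OF smooth_near_bounded_bilinear[OF assms(4,2,3)] c]
    using fun_cong[OF frechet_derivative_at[OF d], of u] c by simp
qed

lemma smooth_near_add: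
  assumes "smooth_near A p F" "smooth_near A p G"
  shows "smooth_near A p (\<lambda>q. F q + G q)"
proof -
  obtain W V where W: "open W" "p \<in> W" "smooth_map A W F" and V: "open V" "p \<in> V" "smooth_map A V G"
    using assms unfolding smooth_near_def by blast
  have "smooth_map A (W \<inter> V) (\<lambda>q. F q + G q)"
    by (rule smooth_map_add)
      (use W V in \<open>auto intro: smooth_map_subset\<close>)
  then show ?thesis by (rule smooth_nearI) (use W V in auto)
qed

lemma vderiv_add:
  assumes "v \<in> tangent_space A p" "smooth_near A p F" "smooth_near A p G"
  shows "vderiv v (\<lambda>q. F q + G q) = vderiv v F + vderiv v G"
proof -
  obtain U \<phi> u where c: "(U, \<phi>) \<in> A" "p \<in> U" and v: "v = coord_vector A (U, \<phi>) p u"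
    using tangent_cases[OF assms(1)] .
  note d = has_derivative_add[OF smooth_near_has_derivative[OF assms(2) c] smooth_near_has_derivative[OF assms(3) c]]
  show ?thesis
    unfolding v vderiv_coord_vector[OF assms(2) c] vderiv_coord_vector[OF assms(3) c]
      vderiv_coord_vector[OF smooth_near_add[OF assms(2,3)] c]
    using fun_cong[OF frechet_derivative_at[OF d], of u] by simp
qed

lemma smooth_near_const: "smooth_near A p (\<lambda>q. c)"
  using smooth_nearI[OF smooth_map_const[OF open_UNIV]] by simp

lemma smooth_near_sum:
  "(\<And>i. i \<in> I \<Longrightarrow> smooth_near A p (F i)) \<Longrightarrow> smooth_near A p (\<lambda>q. \<Sum>i\<in>I. F i q)"
  by (induction I rule: infinite_finite_induct) (auto intro: smooth_near_const smooth_near_add)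

lemma vderiv_sum:
  assumes "v \<in> tangent_space A p"
  shows "(\<And>i. i \<in> I \<Longrightarrow> smooth_near A p (F i)) \<Longrightarrow> vderiv v (\<lambda>q. \<Sum>i\<in>I. F i q) = (\<Sum>i\<in>I. vderiv v (F i))"
  by (induction I rule: infinite_finite_induct)
    (auto simp: vderiv_const[OF assms] vderiv_add[OF assms _ smooth_near_sum])

lemma vderiv_uminus:
  "v \<in> tangent_space A p \<Longrightarrow> smooth_near A p F \<Longrightarrow> vderiv v (\<lambda>q. - F q) = - vderiv v F"
  by (rule vderiv_bounded_linear[OF _ _ bounded_linear_minus[OF bounded_linear_ident]])

lemma smooth_near_uminus: "smooth_near A p F \<Longrightarrow> smooth_near A p (\<lambda>q. - F q)"
  by (rule smooth_near_bounded_linear[OF bounded_linear_minus[OF bounded_linear_ident]])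

lemma vderiv_diff:
  assumes "v \<in> tangent_space A p" "smooth_near A p F" "smooth_near A p G"
  shows "vderiv v (\<lambda>q. F q - G q) = vderiv v F - vderiv v G"
  using vderiv_add[OF assms(1,2) smooth_near_uminus[OF assms(3)]] vderiv_uminus[OF assms(1,3)] by simp

lemma vderiv_mult:
  fixes a b :: "'m \<Rightarrow> real"
  assumes "v \<in> tangent_space A p" "smooth_near A p a" "smooth_near A p b"
  shows "v (\<lambda>q. a q * b q) = v a * b p + a p * v b"
  using vderiv_bounded_bilinear[OF assms bounded_bilinear_mult] by (simp add: vderiv_real)

lemma vderiv_comb: "vderiv (\<lambda>f. a * v f + b * w f) F = a *\<^sub>R vderiv v F + b *\<^sub>R vderiv w F"
  by (simp add: vderiv_def sum.distrib scaleR_sum_right scaleR_add_left)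

subsection \<open>Smooth vector fields\<close>

lemma smooth_field_tangent: "smooth_field A W X \<Longrightarrow> p \<in> W \<Longrightarrow> X p \<in> tangent_space A p"
  unfolding smooth_field_def by blast

lemma smooth_field_apply:
  "smooth_field A W X \<Longrightarrow> open V \<Longrightarrow> V \<subseteq> W \<Longrightarrow> smooth_map A V f \<Longrightarrow> smooth_map A V (\<lambda>p. X p f)"
  unfolding smooth_field_def by simp

lemma smooth_field_vderiv:
  assumes "smooth_field A W X" "open V" "V \<subseteq> W" "smooth_map A V F"
  shows "smooth_map A V (\<lambda>p. vderiv (X p) F)"
  unfolding vderiv_def
  by (intro smooth_map_sum assms(2) smooth_map_scaleR smooth_map_const smooth_field_apply[OF assms(1-3)]
      smooth_map_bounded_linear[OF assms(2) bounded_linear_inner_left] assms(4))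

lemma smooth_field_subset: "smooth_field A W X \<Longrightarrow> W' \<subseteq> W \<Longrightarrow> smooth_field A W' X"
  unfolding smooth_field_def by (meson order.trans subsetD)

lemma smooth_field_cong:
  assumes "smooth_field A W X" "\<And>p. p \<in> W \<Longrightarrow> X p = Y p"
  shows "smooth_field A W Y"
  unfolding smooth_field_def
proof (intro conjI ballI allI impI)
  show "Y p \<in> tangent_space A p" if "p \<in> W" for p
    using smooth_field_tangent[OF assms(1) that] assms(2)[OF that] by simp
  fix V and f :: "'m \<Rightarrow> real" assume V: "open V \<and> V \<subseteq> W \<and> smooth_map A V f"
  then have "smooth_map A V (\<lambda>p. X p f)" using smooth_field_apply[OF assms(1)] by blast
  then show "smooth_map A V (\<lambda>p. Y p f)"
    by (rule smooth_map_cong[rotated 2]) (use V assms(2) in auto)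
qed

lemma smooth_field_add:
  assumes "smooth_field A W X" "smooth_field A W Y"
  shows "smooth_field A W (\<lambda>p f. X p f + Y p f)"
  using assms unfolding smooth_field_def by (auto intro!: tangent_add smooth_map_add)

lemma smooth_field_scale:
  assumes "smooth_map A W a" "smooth_field A W X"
  shows "smooth_field A W (\<lambda>p f. a p * X p f)"
  using assms unfolding smooth_field_def
  by (auto intro!: tangent_scale smooth_map_mult intro: smooth_map_subset)

lemma smooth_field_zero: "smooth_field A W (\<lambda>p f. 0)"
  unfolding smooth_field_def by (auto intro: tangent_zero smooth_map_const)

lemma smooth_field_sum:
  assumes "\<And>i. i \<in> I \<Longrightarrow> smooth_map A W (a i)" "\<And>i. i \<in> I \<Longrightarrow> smooth_field A W (X i)"
  shows "smooth_field A W (\<lambda>p f. \<Sum>i\<in>I. a i p * X i p f)"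
  using assms
  by (induction I rule: infinite_finite_induct)
    (auto intro!: smooth_field_zero smooth_field_add smooth_field_scale)

lemma smooth_field_coord_vector:
  assumes c: "(U, \<phi>) \<in> A"
  shows "smooth_field A U (\<lambda>p. coord_vector A (U, \<phi>) p u)"
  unfolding smooth_field_def
proof (intro conjI ballI allI impI)
  show "coord_vector A (U, \<phi>) p u \<in> tangent_space A p" if "p \<in> U" for p
    using coord_vector_tangent[OF c that] .
  fix V and f :: "'m \<Rightarrow> real" assume V: "open V \<and> V \<subseteq> U \<and> smooth_map A V f"
  then have UV: "U \<inter> V = V" by auto
  have "k_smooth_on k (\<phi> ` V) (\<lambda>x. frechet_derivative (\<lambda>x. f (inv_into U \<phi> x)) (at x) u)" for k
    using smooth_mapD[OF _ c, of V f "Suc k"] V UV by simp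
  then have "smooth_map A V (\<lambda>p. frechet_derivative (\<lambda>x. f (inv_into U \<phi> x)) (at (\<phi> p)) u)"
    using smooth_map_chart[OF c, of V "\<lambda>x. frechet_derivative (\<lambda>x. f (inv_into U \<phi> x)) (at x) u"] V by blast
  then show "smooth_map A V (\<lambda>p. coord_vector A (U, \<phi>) p u f)"
    by (rule smooth_map_cong[rotated 2]) (use V coord_vector_eq smooth_nearI in metis)+
qed

end

section \<open>Orthonormal frames and tensorial expressions\<close>

locale riemannian =
  fixes M :: "('m::{t2_space,second_countable_topology}, 'n::finite, 'z) riem_manifold_scheme"
  assumes riemannian: "riemannian_manifold M"
begin

sublocale smooth_manifold "atlas M"
  by unfold_locales (use riemannian in \<open>simp add: riemannian_manifold_def\<close>)

abbreviation "TS \<equiv> tangent_space (atlas M)"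

lemma metric_sym2: "sym2_tensor (atlas M) (metric M)"
  using riemannian by (simp add: riemannian_manifold_def riemannian_metric_def)

end

context smooth_manifold
begin

lemma sym2_linear_right:
  "sym2_tensor A h \<Longrightarrow> x \<in> tangent_space A p \<Longrightarrow> linear_tangent (tangent_space A p) (h p x)"
  unfolding sym2_tensor_def by simp

lemma sym2_sym:
  "sym2_tensor A h \<Longrightarrow> x \<in> tangent_space A p \<Longrightarrow> y \<in> tangent_space A p \<Longrightarrow> h p x y = h p y x"
  unfolding sym2_tensor_def by simp

lemma sym2_linear_left:
  assumes h: "sym2_tensor A h" and y: "y \<in> tangent_space A p"
  shows "linear_tangent (tangent_space A p) (\<lambda>x. h p x y)"
  using sym2_linear_right[OF h y]
  unfolding linear_tangent_def by (simp add: sym2_sym[OF h _ y] tangent_comb)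

lemma sym2_smooth:
  "sym2_tensor A h \<Longrightarrow> open W \<Longrightarrow> smooth_field A W X \<Longrightarrow> smooth_field A W Y \<Longrightarrow>
    smooth_map A W (\<lambda>p. h p (X p) (Y p))"
  unfolding sym2_tensor_def by simp

lemma linear_tangentD:
  assumes "linear_tangent (tangent_space A p) L" "v \<in> tangent_space A p" "w \<in> tangent_space A p"
  shows "L (\<lambda>f. v f + w f) = L v + L w" "L (\<lambda>f. a * v f) = a *\<^sub>R L v"
    "L (\<lambda>f. v f - w f) = L v - L w"
  using assms(1)[unfolded linear_tangent_def, rule_format, OF assms(2,3), of 1 1]
    assms(1)[unfolded linear_tangent_def, rule_format, OF assms(2,2), of a 0]
    assms(1)[unfolded linear_tangent_def, rule_format, OF assms(2,3), of 1 "-1"] by simp_all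

end

context riemannian
begin

lemmas metric_linear_right = sym2_linear_right[OF metric_sym2]
lemmas metric_linear_left = sym2_linear_left[OF metric_sym2]
lemmas metric_sym = sym2_sym[OF metric_sym2]
lemmas metric_smooth = sym2_smooth[OF metric_sym2]

context
  fixes W :: "'m set" and Y :: "'m \<Rightarrow> 'm tvec"
  assumes W: "open W" and Y: "smooth_field (atlas M) W Y"
begin

lemmas levi_civita_at = conjunct1[OF conjunct2[OF conjunct2[OF riemannian[unfolded riemannian_manifold_def]]],
    unfolded levi_civita_def, rule_format, OF conjI[OF W Y]]

lemma lc_tangent: "p \<in> W \<Longrightarrow> v \<in> TS p \<Longrightarrow> lc M p v Y \<in> TS p"
  using levi_civita_at[THEN conjunct1] by simp

lemma lc_local: "p \<in> W \<Longrightarrow> (\<And>q. q \<in> W \<Longrightarrow> Y' q = Y q) \<Longrightarrow> v \<in> TS p \<Longrightarrow> lc M p v Y' = lc M p v Y"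
  using levi_civita_at[THEN conjunct2, THEN conjunct1] by blast

lemma lc_linear: "p \<in> W \<Longrightarrow> linear_tangent (TS p) (\<lambda>v. lc M p v Y f)"
  using levi_civita_at[THEN conjunct2, THEN conjunct2, THEN conjunct1] by simp

lemma lc_smooth: "smooth_field (atlas M) W X \<Longrightarrow> smooth_field (atlas M) W (\<lambda>p. lc M p (X p) Y)"
  using levi_civita_at[THEN conjunct2, THEN conjunct2, THEN conjunct2, THEN conjunct1] by simp

lemma lc_add: "smooth_field (atlas M) W X \<Longrightarrow> p \<in> W \<Longrightarrow> v \<in> TS p \<Longrightarrow>
    lc M p v (\<lambda>q f. X q f + Y q f) = (\<lambda>f. lc M p v X f + lc M p v Y f)"
  using levi_civita_at[THEN conjunct2, THEN conjunct2, THEN conjunct2, THEN conjunct2, THEN conjunct1] by simp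

lemma lc_scale: "smooth_map (atlas M) W a \<Longrightarrow> p \<in> W \<Longrightarrow> v \<in> TS p \<Longrightarrow>
    lc M p v (\<lambda>q f. a q * Y q f) = (\<lambda>f. v a * Y p f + a p * lc M p v Y f)"
  using levi_civita_at[THEN conjunct2, THEN conjunct2, THEN conjunct2, THEN conjunct2, THEN conjunct2, THEN conjunct1] by simp

lemma lc_metric: "smooth_field (atlas M) W X \<Longrightarrow> p \<in> W \<Longrightarrow> v \<in> TS p \<Longrightarrow>
    v (\<lambda>q. metric M q (X q) (Y q)) = metric M p (lc M p v X) (Y p) + metric M p (X p) (lc M p v Y)"
  using levi_civita_at[THEN conjunct2, THEN conjunct2, THEN conjunct2, THEN conjunct2, THEN conjunct2, THEN conjunct2, THEN conjunct1] by simp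

lemma lc_torsion: "smooth_field (atlas M) W X \<Longrightarrow> p \<in> W \<Longrightarrow>
    lc M p (X p) Y f - lc M p (Y p) X f = lie_bracket (atlas M) X Y p f"
  using levi_civita_at[THEN conjunct2, THEN conjunct2, THEN conjunct2, THEN conjunct2, THEN conjunct2, THEN conjunct2, THEN conjunct2] by simp

end

lemma lc_zero:
  assumes "open W" "p \<in> W" "v \<in> TS p"
  shows "lc M p v (\<lambda>q f. 0) = (\<lambda>f. 0)"
  using lc_scale[OF assms(1) smooth_field_zero smooth_map_const[OF assms(1), of 0] assms(2,3)]
    vderiv_const[OF assms(3), of "0::real"] by (simp add: vderiv_real)

lemma lc_sum:
  assumes W: "open W" "p \<in> W" "v \<in> TS p"
    and aX: "\<And>i. i \<in> I \<Longrightarrow> smooth_map (atlas M) W (a i)" "\<And>i. i \<in> I \<Longrightarrow> smooth_field (atlas M) W (X i)"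
  shows "lc M p v (\<lambda>q f. \<Sum>i\<in>I. a i q * X i q f) =
    (\<lambda>f. \<Sum>i\<in>I. v (a i) * X i p f + a i p * lc M p v (X i) f)"
  using aX
proof (induction I rule: infinite_finite_induct)
  case (insert i I)
  have "lc M p v (\<lambda>q f. a i q * X i q f + (\<Sum>i\<in>I. a i q * X i q f)) =
    (\<lambda>f. lc M p v (\<lambda>q f. a i q * X i q f) f + lc M p v (\<lambda>q f. \<Sum>i\<in>I. a i q * X i q f) f)"
    by (rule lc_add[OF W(1) smooth_field_sum smooth_field_scale W(2,3)]) (use insert.prems in auto)
  also have "\<dots> = (\<lambda>f. v (a i) * X i p f + a i p * lc M p v (X i) f +
      (\<Sum>i\<in>I. v (a i) * X i p f + a i p * lc M p v (X i) f))"
    using lc_scale[OF W(1) insert.prems(2)[OF insertI1] insert.prems(1)[OF insertI1] W(2,3)] insert by simp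
  finally show ?case using insert.hyps by simp
qed (simp_all add: lc_zero[OF W])

text \<open>Locality and linearity over the smooth functions: the properties of an expression in a
  vector field that make it depend on the value of the field at \<open>p\<close> only. They allow
  the arbitrary extension \<open>extend_vector\<close> to be exchanged for any other field with
  the same value.\<close>

definition tensorial_at :: "'m \<Rightarrow> (('m \<Rightarrow> 'm tvec) \<Rightarrow> 'b::real_vector) \<Rightarrow> bool" where
  "tensorial_at p B \<longleftrightarrow> (\<forall>W X. open W \<longrightarrow> p \<in> W \<longrightarrow> smooth_field (atlas M) W X \<longrightarrow>
    (\<forall>X'. (\<forall>q\<in>W. X' q = X q) \<longrightarrow> B X' = B X) \<and>
    (\<forall>Y. smooth_field (atlas M) W Y \<longrightarrow> B (\<lambda>q f. X q f + Y q f) = B X + B Y) \<and>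
    (\<forall>a. smooth_map (atlas M) W a \<longrightarrow> B (\<lambda>q f. a q * X q f) = a p *\<^sub>R B X))"

text \<open>Fields near \<open>p\<close> suffice, as the other ingredients of the expression may
  be smooth only there.\<close>

lemma tensorial_atI:
  assumes N: "open N" "p \<in> N"
    and loc: "\<And>W X X'. open W \<Longrightarrow> p \<in> W \<Longrightarrow> W \<subseteq> N \<Longrightarrow> smooth_field (atlas M) W X \<Longrightarrow>
      (\<And>q. q \<in> W \<Longrightarrow> X' q = X q) \<Longrightarrow> B X' = B X"
    and add: "\<And>W X Y. open W \<Longrightarrow> p \<in> W \<Longrightarrow> W \<subseteq> N \<Longrightarrow> smooth_field (atlas M) W X \<Longrightarrow>
      smooth_field (atlas M) W Y \<Longrightarrow> B (\<lambda>q f. X q f + Y q f) = B X + B Y"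
    and scale: "\<And>W X a. open W \<Longrightarrow> p \<in> W \<Longrightarrow> W \<subseteq> N \<Longrightarrow> smooth_field (atlas M) W X \<Longrightarrow>
      smooth_map (atlas M) W a \<Longrightarrow> B (\<lambda>q f. a q * X q f) = a p *\<^sub>R B X"
  shows "tensorial_at p B"
  unfolding tensorial_at_def
proof (intro allI impI conjI)
  fix W X assume W: "open W" "p \<in> W" "smooth_field (atlas M) W X"
  let ?V = "W \<inter> N"
  have V: "open ?V" "p \<in> ?V" "?V \<subseteq> N" and X: "smooth_field (atlas M) ?V X"
    using W N smooth_field_subset[OF W(3)] by auto
  show "B X' = B X" if "\<forall>q\<in>W. X' q = X q" for X'
    by (rule loc[OF V X]) (use that in auto)
  show "B (\<lambda>q f. X q f + Y q f) = B X + B Y" if "smooth_field (atlas M) W Y" for Y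
    by (rule add[OF V X]) (use that in \<open>auto intro: smooth_field_subset\<close>)
  show "B (\<lambda>q f. a q * X q f) = a p *\<^sub>R B X" if "smooth_map (atlas M) W a" for a
    by (rule scale[OF V X]) (use that in \<open>auto intro: smooth_map_subset\<close>)
qed

lemma tensorial_point:
  assumes "linear_tangent (TS p) L"
  shows "tensorial_at p (\<lambda>X. L (X p))"
  by (rule tensorial_atI[OF open_UNIV])
    (auto intro: linear_tangentD[OF assms] smooth_field_tangent)

lemma tensorial_diff:
  assumes "tensorial_at p B" "tensorial_at p C"
  shows "tensorial_at p (\<lambda>X. B X - C X)"
  unfolding tensorial_at_def
proof (intro allI impI conjI)
  fix W X assume W: "open W" "p \<in> W" "smooth_field (atlas M) W X"
  note b = assms(1)[unfolded tensorial_at_def, rule_format, OF W]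
  note c = assms(2)[unfolded tensorial_at_def, rule_format, OF W]
  show "B X' - C X' = B X - C X" if "\<forall>q\<in>W. X' q = X q" for X'
    using b c that by metis
  show "B (\<lambda>q f. X q f + Y q f) - C (\<lambda>q f. X q f + Y q f) = B X - C X + (B Y - C Y)"
    if "smooth_field (atlas M) W Y" for Y
    using b[THEN conjunct2, THEN conjunct1] c[THEN conjunct2, THEN conjunct1] that by simp
  show "B (\<lambda>q f. a q * X q f) - C (\<lambda>q f. a q * X q f) = a p *\<^sub>R (B X - C X)"
    if "smooth_map (atlas M) W a" for a
    using b[THEN conjunct2, THEN conjunct2] c[THEN conjunct2, THEN conjunct2] that by (simp add: scaleR_diff_right)
qed

text \<open>Multiplying the field by a function \<open>a\<close> adds the same multiple of the
  derivative of \<open>a\<close> to both terms of the covariant derivative.\<close>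

lemma tensorial_cov:
  fixes \<omega> :: "'m \<Rightarrow> 'm tvec \<Rightarrow> 'b::euclidean_space"
  assumes N: "open N" "p \<in> N" and v: "v \<in> TS p"
    and lin: "\<And>q. q \<in> N \<Longrightarrow> linear_tangent (TS q) (\<omega> q)"
    and sm: "\<And>W X. open W \<Longrightarrow> W \<subseteq> N \<Longrightarrow> smooth_field (atlas M) W X \<Longrightarrow> smooth_map (atlas M) W (\<lambda>q. \<omega> q (X q))"
  shows "tensorial_at p (\<lambda>X. vderiv v (\<lambda>q. \<omega> q (X q)) - \<omega> p (lc M p v X))"
proof (rule tensorial_atI[OF N])
  fix W X X' assume W: "open W" "p \<in> W" "W \<subseteq> N" and X: "smooth_field (atlas M) W X"
    and eq: "\<And>q. q \<in> W \<Longrightarrow> X' q = X q"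
  have "vderiv v (\<lambda>q. \<omega> q (X q)) = vderiv v (\<lambda>q. \<omega> q (X' q))"
    by (rule vderiv_cong[OF v W(1,2) sm[OF W(1,3) X]]) (simp add: eq)
  then show "vderiv v (\<lambda>q. \<omega> q (X' q)) - \<omega> p (lc M p v X') = vderiv v (\<lambda>q. \<omega> q (X q)) - \<omega> p (lc M p v X)"
    using lc_local[OF W(1) X W(2) eq v] by simp
next
  fix W X Y assume W: "open W" "p \<in> W" "W \<subseteq> N" and X: "smooth_field (atlas M) W X" and Y: "smooth_field (atlas M) W Y"
  note s = sm[OF W(1,3) X] sm[OF W(1,3) Y]
  have "vderiv v (\<lambda>q. \<omega> q (X q) + \<omega> q (Y q)) = vderiv v (\<lambda>q. \<omega> q (\<lambda>f. X q f + Y q f))"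
    by (rule vderiv_cong[OF v W(1,2) smooth_map_add[OF W(1) s]])
      (use linear_tangentD(1)[OF lin smooth_field_tangent[OF X] smooth_field_tangent[OF Y]] W(3) in force)
  moreover have "vderiv v (\<lambda>q. \<omega> q (X q) + \<omega> q (Y q)) = vderiv v (\<lambda>q. \<omega> q (X q)) + vderiv v (\<lambda>q. \<omega> q (Y q))"
    by (rule vderiv_add[OF v]) (use s smooth_nearI W in auto)
  moreover have "\<omega> p (lc M p v (\<lambda>q f. X q f + Y q f)) = \<omega> p (lc M p v X) + \<omega> p (lc M p v Y)"
    unfolding lc_add[OF W(1) Y X W(2) v]
    by (rule linear_tangentD(1)[OF lin]) (use lc_tangent[OF W(1) _ W(2) v] X Y N in auto)
  ultimately show "vderiv v (\<lambda>q. \<omega> q (\<lambda>f. X q f + Y q f)) - \<omega> p (lc M p v (\<lambda>q f. X q f + Y q f)) =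
      vderiv v (\<lambda>q. \<omega> q (X q)) - \<omega> p (lc M p v X) + (vderiv v (\<lambda>q. \<omega> q (Y q)) - \<omega> p (lc M p v Y))"
    by simp
next
  fix W X and a :: "'m \<Rightarrow> real" assume W: "open W" "p \<in> W" "W \<subseteq> N" and X: "smooth_field (atlas M) W X" and a: "smooth_map (atlas M) W a"
  note s = sm[OF W(1,3) X]
  have "vderiv v (\<lambda>q. a q *\<^sub>R \<omega> q (X q)) = vderiv v (\<lambda>q. \<omega> q (\<lambda>f. a q * X q f))"
    by (rule vderiv_cong[OF v W(1,2) smooth_map_scaleR[OF W(1) a s]])
      (use linear_tangentD(2)[OF lin smooth_field_tangent[OF X] smooth_field_tangent[OF X]] W(3) in force)
  moreover have "vderiv v (\<lambda>q. a q *\<^sub>R \<omega> q (X q)) = a p *\<^sub>R vderiv v (\<lambda>q. \<omega> q (X q)) + v a *\<^sub>R \<omega> p (X p)"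
    using vderiv_bounded_bilinear[OF v smooth_nearI[OF a W(1,2)] smooth_nearI[OF s W(1,2)] bounded_bilinear_scaleR]
    by (simp add: vderiv_real)
  moreover have "\<omega> p (lc M p v (\<lambda>q f. a q * X q f)) = v a *\<^sub>R \<omega> p (X p) + a p *\<^sub>R \<omega> p (lc M p v X)"
    unfolding lc_scale[OF W(1) X a W(2) v]
    by (rule lin[OF N(2), unfolded linear_tangent_def, rule_format])
      (use lc_tangent[OF W(1) X W(2) v] smooth_field_tangent[OF X W(2)] in auto)
  ultimately show "vderiv v (\<lambda>q. \<omega> q (\<lambda>f. a q * X q f)) - \<omega> p (lc M p v (\<lambda>q f. a q * X q f)) =
      a p *\<^sub>R (vderiv v (\<lambda>q. \<omega> q (X q)) - \<omega> p (lc M p v X))"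
    by (simp add: algebra_simps)
qed

definition orthonormal :: "'m \<Rightarrow> ('n \<Rightarrow> 'm tvec) \<Rightarrow> bool" where
  "orthonormal p b \<longleftrightarrow> (\<forall>i. b i \<in> TS p) \<and> (\<forall>i j. metric M p (b i) (b j) = (if i = j then 1 else 0))"

lemma orthonormal_expand:
  assumes "orthonormal p b" "v \<in> TS p"
  shows "v = (\<lambda>f. \<Sum>i\<in>UNIV. metric M p v (b i) * b i f)"
  by (rule orthonormal_expansion)
    (use assms metric_linear_left in \<open>auto simp: orthonormal_def\<close>)

lemma linear_orthonormal_expand:
  assumes "orthonormal p b" "v \<in> TS p" "linear_tangent (TS p) L"
  shows "L v = (\<Sum>i\<in>UNIV. metric M p v (b i) *\<^sub>R L (b i))"
  by (subst orthonormal_expand[OF assms(1,2)], rule linear_tangent_sum[OF assms(3)])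
    (use assms(1) in \<open>auto simp: orthonormal_def\<close>)

text \<open>Expand the second argument in the basis \<open>b\<close>; by symmetry of the metric,
  the coefficients then serve to collect the first argument.\<close>

lemma trace_orthonormal:
  assumes b: "orthonormal p b" and c: "orthonormal p c"
    and l: "\<And>y. y \<in> TS p \<Longrightarrow> linear_tangent (TS p) (\<lambda>x. \<beta> x y)"
    and r: "\<And>x. x \<in> TS p \<Longrightarrow> linear_tangent (TS p) (\<beta> x)"
  shows "(\<Sum>i\<in>UNIV. \<beta> (c i) (c i)) = (\<Sum>i\<in>UNIV. \<beta> (b i) (b i))"
proof -
  have T: "b i \<in> TS p" "c i \<in> TS p" for i using b c by (auto simp: orthonormal_def)
  have "(\<Sum>i\<in>UNIV. \<beta> (c i) (c i)) = (\<Sum>i\<in>UNIV. \<Sum>j\<in>UNIV. metric M p (c i) (b j) *\<^sub>R \<beta> (c i) (b j))"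
    using linear_orthonormal_expand[OF b T(2) r[OF T(2)]] by (intro sum.cong) auto
  also have "\<dots> = (\<Sum>j\<in>UNIV. \<Sum>i\<in>UNIV. metric M p (b j) (c i) *\<^sub>R \<beta> (c i) (b j))"
    by (subst sum.swap) (simp add: metric_sym[OF T])
  also have "\<dots> = (\<Sum>j\<in>UNIV. \<beta> (b j) (b j))"
    using linear_orthonormal_expand[OF c T(1) l[OF T(1)]] by (intro sum.cong) auto
  finally show ?thesis .
qed

end

locale orthonormal_frame = riemannian M
  for M :: "('m::{t2_space,second_countable_topology}, 'n::finite, 'z) riem_manifold_scheme" +
  fixes P :: "'m set" and e :: "'n \<Rightarrow> 'm \<Rightarrow> 'm tvec"
  assumes open_domain: "open P"
    and frame_smooth: "smooth_field (atlas M) P (e i)"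
    and frame_metric: "p \<in> P \<Longrightarrow> metric M p (e i p) (e j p) = (if i = j then 1 else 0)"
begin

lemma frame_tangent: "p \<in> P \<Longrightarrow> e i p \<in> TS p"
  using smooth_field_tangent[OF frame_smooth] .

lemma frame_orthonormal: "p \<in> P \<Longrightarrow> orthonormal p (\<lambda>i. e i p)"
  unfolding orthonormal_def using frame_tangent frame_metric by simp

lemma onb_orthonormal: "p \<in> P \<Longrightarrow> orthonormal p (onb M p)"
  unfolding onb_def orthonormal_def[of p]
  by (rule someI[of _ "\<lambda>i. e i p"]) (simp add: frame_tangent frame_metric)

text \<open>Near \<open>p\<close> the field is a combination of the frame fields, with smooth
  coefficients.\<close>

lemma tensorial_expand:
  assumes B: "tensorial_at p B" and p: "p \<in> P" and W: "open W" "p \<in> W" and X: "smooth_field (atlas M) W X"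
  shows "B X = (\<Sum>i\<in>UNIV. metric M p (X p) (e i p) *\<^sub>R B (e i))"
proof -
  let ?V = "W \<inter> P"
  have V: "open ?V" "p \<in> ?V" using W p open_domain by auto
  have X': "smooth_field (atlas M) ?V X" using smooth_field_subset[OF X] by auto
  have e: "smooth_field (atlas M) ?V (e i)" for i using smooth_field_subset[OF frame_smooth] by auto
  define a where "a i q = metric M q (X q) (e i q)" for i q
  have a: "smooth_map (atlas M) ?V (a i)" for i
    unfolding a_def by (rule metric_smooth[OF V(1) X' e])
  note t = B[unfolded tensorial_at_def, rule_format, OF V]
  have "B (\<lambda>q f. \<Sum>i\<in>I. a i q * e i q f) = (\<Sum>i\<in>I. a i p *\<^sub>R B (e i))" for I
  proof (induction I rule: infinite_finite_induct)
    case (insert i I)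
    have "B (\<lambda>q f. a i q * e i q f + (\<Sum>i\<in>I. a i q * e i q f)) =
        B (\<lambda>q f. a i q * e i q f) + B (\<lambda>q f. \<Sum>i\<in>I. a i q * e i q f)"
      by (rule t[THEN conjunct2, THEN conjunct1, rule_format])
        (intro smooth_field_scale smooth_field_sum a e)+
    also have "B (\<lambda>q f. a i q * e i q f) = a i p *\<^sub>R B (e i)"
      by (rule t[THEN conjunct2, THEN conjunct2, rule_format]) (rule e a)+
    finally show ?case using insert by simp
  qed (use t[OF smooth_field_zero, THEN conjunct2, THEN conjunct2, rule_format, OF smooth_map_const[OF V(1)], of 0] in simp_all)
  moreover have "B X = B (\<lambda>q f. \<Sum>i\<in>UNIV. a i q * e i q f)"
    by (rule t[THEN conjunct1, rule_format])
      (use orthonormal_expand[OF frame_orthonormal] smooth_field_tangent[OF X] in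
        \<open>auto simp: a_def intro!: smooth_field_sum a[unfolded a_def] e\<close>)
  ultimately show ?thesis unfolding a_def by simp
qed

lemma extend_vector:
  assumes "p \<in> P" "x \<in> TS p"
  obtains W where "open W" "p \<in> W" "smooth_field (atlas M) W (extend_vector (atlas M) p x)"
    "extend_vector (atlas M) p x p = x"
proof -
  define X where "X = (\<lambda>q f. \<Sum>i\<in>UNIV. metric M p x (e i p) * e i q f)"
  have "smooth_field (atlas M) P X"
    unfolding X_def by (intro smooth_field_sum frame_smooth smooth_map_const open_domain)
  moreover have "X p = x"
    unfolding X_def using orthonormal_expand[OF frame_orthonormal[OF assms(1)] assms(2)] by simp
  ultimately have "\<exists>X. (\<exists>W. open W \<and> p \<in> W \<and> smooth_field (atlas M) W X) \<and> X p = x"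
    using open_domain assms(1) by blast
  from someI_ex[OF this] show ?thesis
    using that unfolding extend_vector_def by blast
qed

lemma tensorial_extend_expand:
  assumes "tensorial_at p B" "p \<in> P" "x \<in> TS p"
  shows "B (extend_vector (atlas M) p x) = (\<Sum>i\<in>UNIV. metric M p x (e i p) *\<^sub>R B (e i))"
proof -
  obtain W where W: "open W" "p \<in> W" "smooth_field (atlas M) W (extend_vector (atlas M) p x)"
    "extend_vector (atlas M) p x p = x" using extend_vector[OF assms(2,3)] .
  show ?thesis using tensorial_expand[OF assms(1,2) W(1-3)] W(4) by simp
qed

lemma tensorial_extend:
  assumes B: "tensorial_at p B" and p: "p \<in> P" and X: "open W" "p \<in> W" "smooth_field (atlas M) W X"
  shows "B (extend_vector (atlas M) p (X p)) = B X"
  using tensorial_extend_expand[OF B p smooth_field_tangent[OF X(3,2)]] tensorial_expand[OF B p X] by simp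

end

context smooth_manifold
begin

lemma smooth_map_euclidean:
  fixes F :: "'m \<Rightarrow> 'b::euclidean_space"
  assumes "open W" "\<And>b. b \<in> Basis \<Longrightarrow> smooth_map A W (\<lambda>q. F q \<bullet> b)"
  shows "smooth_map A W F"
proof -
  have "smooth_map A W (\<lambda>q. \<Sum>b\<in>Basis. (F q \<bullet> b) *\<^sub>R b)"
    by (intro smooth_map_sum smooth_map_scaleR smooth_map_const assms)
  then show ?thesis by (simp add: euclidean_representation)
qed

lemma smooth_map_vec:
  fixes F :: "'m \<Rightarrow> 'b::euclidean_space^'l::finite"
  assumes "open W" "\<And>i. smooth_map A W (\<lambda>q. F q $ i)"
  shows "smooth_map A W F"
proof (rule smooth_map_euclidean[OF assms(1)])
  fix b :: "'b^'l" assume "b \<in> Basis"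
  then obtain i u where "b = axis i u" by (auto simp: Basis_vec_def)
  then show "smooth_map A W (\<lambda>q. F q \<bullet> b)"
    by (simp add: inner_axis smooth_map_inner[OF assms(1) assms(2) smooth_map_const[OF assms(1)]])
qed

lemma vderiv_inner_Basis: "b \<in> Basis \<Longrightarrow> vderiv v F \<bullet> b = v (\<lambda>q. F q \<bullet> b)"
  by (simp add: vderiv_def inner_sum_left_Basis)

end

context riemannian
begin

lemma tensorial_cong:
  assumes C: "tensorial_at p C"
    and eq: "\<And>W X. open W \<Longrightarrow> p \<in> W \<Longrightarrow> smooth_field (atlas M) W X \<Longrightarrow> B X = C X"
  shows "tensorial_at p B"
  unfolding tensorial_at_def
proof (intro allI impI conjI)
  fix W X assume W: "open W" "p \<in> W" "smooth_field (atlas M) W X"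
  note c = C[unfolded tensorial_at_def, rule_format, OF W]
  show "B X' = B X" if "\<forall>q\<in>W. X' q = X q" for X'
  proof -
    have "smooth_field (atlas M) W X'" by (rule smooth_field_cong[OF W(3)]) (simp add: that)
    then show ?thesis
      using c[THEN conjunct1, rule_format, of X'] that eq[OF W] eq[OF W(1,2), of X'] by simp
  qed
  show "B (\<lambda>q f. X q f + Y q f) = B X + B Y" if "smooth_field (atlas M) W Y" for Y
    using c[THEN conjunct2, THEN conjunct1, rule_format, OF that] eq[OF W] eq[OF W(1,2) that]
      eq[OF W(1,2) smooth_field_add[OF W(3) that]] by simp
  show "B (\<lambda>q f. a q * X q f) = a p *\<^sub>R B X" if "smooth_map (atlas M) W a" for a
    using c[THEN conjunct2, THEN conjunct2, rule_format, OF that] eq[OF W]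
      eq[OF W(1,2) smooth_field_scale[OF that W(3)]] by simp
qed

text \<open>Tangent vectors are functions on functions, so a vector-valued expression is tensorial
  if it is so for each function \<open>f\<close>. A linear form on the tangent space turns it into
  a scalar.\<close>

lemma tensorial_tvec:
  assumes C: "\<And>f. tensorial_at p (\<lambda>X. C X f)" and L: "linear_tangent (TS p) L"
    and T: "\<And>W X. open W \<Longrightarrow> p \<in> W \<Longrightarrow> smooth_field (atlas M) W X \<Longrightarrow> C X \<in> TS p"
  shows "tensorial_at p (\<lambda>X. L (C X))"
  unfolding tensorial_at_def
proof (intro allI impI conjI)
  fix W X assume W: "open W" "p \<in> W" "smooth_field (atlas M) W X"
  note c = C[unfolded tensorial_at_def, rule_format, OF W]
  show "L (C X') = L (C X)" if "\<forall>q\<in>W. X' q = X q" for X'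
    using c[THEN conjunct1, rule_format, of X'] that by (metis ext)
  show "L (C (\<lambda>q f. X q f + Y q f)) = L (C X) + L (C Y)" if Y: "smooth_field (atlas M) W Y" for Y
  proof -
    have "C (\<lambda>q f. X q f + Y q f) = (\<lambda>f. C X f + C Y f)"
      by (rule ext) (rule c[THEN conjunct2, THEN conjunct1, rule_format, OF Y])
    then show ?thesis using linear_tangentD(1)[OF L T[OF W] T[OF W(1,2) Y]] by simp
  qed
  show "L (C (\<lambda>q f. a q * X q f)) = a p *\<^sub>R L (C X)" if a: "smooth_map (atlas M) W a" for a
  proof -
    have "C (\<lambda>q f. a q * X q f) = (\<lambda>f. a p * C X f)"
      by (rule ext) (use c[THEN conjunct2, THEN conjunct2, rule_format, OF a] in simp)
    then show ?thesis using linear_tangentD(2)[OF L T[OF W] T[OF W]] by simp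
  qed
qed

lemma tensorial_uminus: "tensorial_at p B \<Longrightarrow> tensorial_at p (\<lambda>X. - B X)"
  using tensorial_diff[OF tensorial_point[of p "\<lambda>_. 0"], of B] by (simp add: linear_tangent_def)

lemma lc_comb:
  assumes "open W" "p \<in> W" "smooth_field (atlas M) W Y" "v \<in> TS p" "w \<in> TS p"
  shows "lc M p (\<lambda>f. a * v f + b * w f) Y = (\<lambda>f. a * lc M p v Y f + b * lc M p w Y f)"
  using lc_linear[OF assms(1,3,2)] assms(4,5) by (auto simp: linear_tangent_def)

lemma lc_linear_compose:
  assumes "open W" "p \<in> W" "smooth_field (atlas M) W Y" "linear_tangent (TS p) L"
  shows "linear_tangent (TS p) (\<lambda>v. L (lc M p v Y))"
  unfolding linear_tangent_def
proof (intro ballI allI)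
  fix v w a b assume vw: "v \<in> TS p" "w \<in> TS p"
  show "L (lc M p (\<lambda>f. a * v f + b * w f) Y) = a *\<^sub>R L (lc M p v Y) + b *\<^sub>R L (lc M p w Y)"
    unfolding lc_comb[OF assms(1-3) vw]
    by (rule assms(4)[unfolded linear_tangent_def, rule_format])
      (rule lc_tangent[OF assms(1,3,2)], rule vw)+
qed

lemma lie_bracket_eq:
  assumes "open W" "p \<in> W" "smooth_field (atlas M) W X" "smooth_field (atlas M) W Y"
  shows "lie_bracket (atlas M) X Y p = (\<lambda>f. 1 * lc M p (X p) Y f + (-1) * lc M p (Y p) X f)"
  using lc_torsion[OF assms(1,4,3,2)] by (auto simp: algebra_simps)

lemma lie_bracket_tangent:
  assumes "open W" "p \<in> W" "smooth_field (atlas M) W X" "smooth_field (atlas M) W Y"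
  shows "lie_bracket (atlas M) X Y p \<in> TS p"
  unfolding lie_bracket_eq[OF assms]
  by (rule tangent_comb) (intro lc_tangent[OF assms(1) _ assms(2)] assms smooth_field_tangent[OF _ assms(2)])+

text \<open>As the torsion vanishes, the bracket is a difference of covariant derivatives, and the
  curvature is the antisymmetric part of a second covariant derivative.\<close>

lemma curvature_op_eq:
  assumes W: "open W" "p \<in> W" and X: "smooth_field (atlas M) W X" and Y: "smooth_field (atlas M) W Y"
    and Z: "smooth_field (atlas M) W Z"
  shows "curvature_op M X Y Z p f =
    (lc M p (lc M p (X p) Y) Z f - lc M p (X p) (\<lambda>q. lc M q (Y q) Z) f)
    - (lc M p (lc M p (Y p) X) Z f - lc M p (Y p) (\<lambda>q. lc M q (X q) Z) f)"
proof -
  have T: "lc M p (X p) Y \<in> TS p" "lc M p (Y p) X \<in> TS p"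
    by (intro lc_tangent[OF W(1) _ W(2)] X Y smooth_field_tangent[OF _ W(2)])+
  show ?thesis
    unfolding curvature_op_def lie_bracket_eq[OF W X Y] lc_comb[OF W Z T] by simp
qed

lemma curvature_op_tangent:
  assumes W: "open W" "p \<in> W" and X: "smooth_field (atlas M) W X" and Y: "smooth_field (atlas M) W Y"
    and Z: "smooth_field (atlas M) W Z"
  shows "curvature_op M X Y Z p \<in> TS p"
proof -
  have t: "lc M p v V \<in> TS p" if "v \<in> TS p" "smooth_field (atlas M) W V" for v V
    by (rule lc_tangent[OF W(1) that(2) W(2) that(1)])
  have "(\<lambda>f. 1 * ((-1) * lc M p (X p) (\<lambda>q. lc M q (Y q) Z) f + 1 * lc M p (Y p) (\<lambda>q. lc M q (X q) Z) f)
     + 1 * lc M p (lie_bracket (atlas M) X Y p) Z f) \<in> TS p"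
    by (intro tangent_comb t lc_smooth[OF W(1)] X Y Z lie_bracket_tangent[OF W] smooth_field_tangent[OF _ W(2)])
  then show ?thesis unfolding curvature_op_def by simp
qed

text \<open>In the two terms of the second covariant derivative, the derivatives of a coefficient
  of \<open>X\<close> cancel.\<close>

lemma tensorial_second:
  assumes N: "open N" "p \<in> N" and v: "v \<in> TS p" and Z: "smooth_field (atlas M) N Z"
  shows "tensorial_at p (\<lambda>X. lc M p (lc M p v X) Z f - lc M p v (\<lambda>q. lc M q (X q) Z) f)"
proof (rule tensorial_atI[OF N])
  fix W X X' assume W: "open W" "p \<in> W" "W \<subseteq> N" and X: "smooth_field (atlas M) W X"
    and eq: "\<And>q. q \<in> W \<Longrightarrow> X' q = X q"
  have ZW: "smooth_field (atlas M) W Z" using smooth_field_subset[OF Z W(3)] .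
  have "lc M p v (\<lambda>q. lc M q (X' q) Z) = lc M p v (\<lambda>q. lc M q (X q) Z)"
    by (rule lc_local[OF W(1) lc_smooth[OF W(1) ZW X] W(2) _ v]) (simp add: eq)
  moreover have "lc M p v X' = lc M p v X" by (rule lc_local[OF W(1) X W(2) eq v])
  ultimately show "lc M p (lc M p v X') Z f - lc M p v (\<lambda>q. lc M q (X' q) Z) f =
      lc M p (lc M p v X) Z f - lc M p v (\<lambda>q. lc M q (X q) Z) f" by simp
next
  fix W X Y assume W: "open W" "p \<in> W" "W \<subseteq> N" and X: "smooth_field (atlas M) W X" and Y: "smooth_field (atlas M) W Y"
  have ZW: "smooth_field (atlas M) W Z" using smooth_field_subset[OF Z W(3)] .
  have "lc M p v (\<lambda>q. lc M q (\<lambda>f. X q f + Y q f) Z) = lc M p v (\<lambda>q f. lc M q (X q) Z f + lc M q (Y q) Z f)"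
    using lc_comb[OF W(1) _ ZW smooth_field_tangent[OF X] smooth_field_tangent[OF Y], of _ 1 1]
    by (intro lc_local[OF W(1) smooth_field_add[OF lc_smooth[OF W(1) ZW X] lc_smooth[OF W(1) ZW Y]] W(2) _ v]) simp
  also have "\<dots> = (\<lambda>f. lc M p v (\<lambda>q. lc M q (X q) Z) f + lc M p v (\<lambda>q. lc M q (Y q) Z) f)"
    by (rule lc_add[OF W(1) lc_smooth[OF W(1) ZW Y] lc_smooth[OF W(1) ZW X] W(2) v])
  finally have 1: "lc M p v (\<lambda>q. lc M q (\<lambda>f. X q f + Y q f) Z) = \<dots>" .
  have 2: "lc M p (\<lambda>f. 1 * lc M p v X f + 1 * lc M p v Y f) Z = (\<lambda>f. 1 * lc M p (lc M p v X) Z f + 1 * lc M p (lc M p v Y) Z f)"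
    by (rule lc_comb[OF W(1,2) ZW]) (rule lc_tangent[OF W(1) _ W(2) v], rule X Y)+
  show "lc M p (lc M p v (\<lambda>q f. X q f + Y q f)) Z f - lc M p v (\<lambda>q. lc M q (\<lambda>f. X q f + Y q f) Z) f =
      lc M p (lc M p v X) Z f - lc M p v (\<lambda>q. lc M q (X q) Z) f +
      (lc M p (lc M p v Y) Z f - lc M p v (\<lambda>q. lc M q (Y q) Z) f)"
    using 2 unfolding 1 lc_add[OF W(1) Y X W(2) v] by simp
next
  fix W X and a :: "'m \<Rightarrow> real" assume W: "open W" "p \<in> W" "W \<subseteq> N" and X: "smooth_field (atlas M) W X" and a: "smooth_map (atlas M) W a"
  have ZW: "smooth_field (atlas M) W Z" using smooth_field_subset[OF Z W(3)] .
  have "lc M p v (\<lambda>q. lc M q (\<lambda>f. a q * X q f) Z) = lc M p v (\<lambda>q f. a q * lc M q (X q) Z f)"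
    using lc_comb[OF W(1) _ ZW smooth_field_tangent[OF X] smooth_field_tangent[OF X], of _ _ 0]
    by (intro lc_local[OF W(1) smooth_field_scale[OF a lc_smooth[OF W(1) ZW X]] W(2) _ v]) simp
  also have "\<dots> = (\<lambda>f. v a * lc M p (X p) Z f + a p * lc M p v (\<lambda>q. lc M q (X q) Z) f)"
    by (rule lc_scale[OF W(1) lc_smooth[OF W(1) ZW X] a W(2) v])
  finally have 1: "lc M p v (\<lambda>q. lc M q (\<lambda>f. a q * X q f) Z) = \<dots>" .
  have 2: "lc M p (\<lambda>f. v a * X p f + a p * lc M p v X f) Z = (\<lambda>f. v a * lc M p (X p) Z f + a p * lc M p (lc M p v X) Z f)"
    by (rule lc_comb[OF W(1,2) ZW smooth_field_tangent[OF X W(2)] lc_tangent[OF W(1) X W(2) v]])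
  show "lc M p (lc M p v (\<lambda>q f. a q * X q f)) Z f - lc M p v (\<lambda>q. lc M q (\<lambda>f. a q * X q f) Z) f =
      a p *\<^sub>R (lc M p (lc M p v X) Z f - lc M p v (\<lambda>q. lc M q (X q) Z) f)"
    unfolding 1 lc_scale[OF W(1) X a W(2) v] 2 by (simp add: algebra_simps)
qed

lemma curvature_op_tensorial_left:
  assumes N: "open N" "p \<in> N" and Y: "smooth_field (atlas M) N Y" and Z: "smooth_field (atlas M) N Z"
  shows "tensorial_at p (\<lambda>X. curvature_op M X Y Z p f)"
proof (rule tensorial_cong)
  have 1: "linear_tangent (TS p) (\<lambda>v. lc M p v V f)" if "smooth_field (atlas M) N V" for V f
    by (rule lc_linear[OF N(1) that N(2)])
  have 2: "linear_tangent (TS p) (\<lambda>v. lc M p (lc M p v Y) Z f)"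
    by (rule lc_linear_compose[OF N Y 1[OF Z]])
  show "tensorial_at p (\<lambda>X. (lc M p (lc M p (X p) Y) Z f - lc M p (X p) (\<lambda>q. lc M q (Y q) Z) f)
    - (lc M p (lc M p (Y p) X) Z f - lc M p (Y p) (\<lambda>q. lc M q (X q) Z) f))"
    by (intro tensorial_diff tensorial_second[OF N smooth_field_tangent[OF Y N(2)] Z]
        tensorial_point[OF 2] tensorial_point[OF 1[OF lc_smooth[OF N(1) Z Y]]])
  fix W X assume W: "open W" "p \<in> W" "smooth_field (atlas M) W X"
  show "curvature_op M X Y Z p f = (lc M p (lc M p (X p) Y) Z f - lc M p (X p) (\<lambda>q. lc M q (Y q) Z) f)
    - (lc M p (lc M p (Y p) X) Z f - lc M p (Y p) (\<lambda>q. lc M q (X q) Z) f)"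
    by (rule curvature_op_eq[of "W \<inter> N"])
      (use W N in \<open>auto intro: smooth_field_subset[OF W(3)] smooth_field_subset[OF Y] smooth_field_subset[OF Z]\<close>)
qed

lemma curvature_op_tensorial_middle:
  assumes N: "open N" "p \<in> N" and X: "smooth_field (atlas M) N X" and Z: "smooth_field (atlas M) N Z"
  shows "tensorial_at p (\<lambda>Y. curvature_op M X Y Z p f)"
proof (rule tensorial_cong)
  show "tensorial_at p (\<lambda>Y. - curvature_op M Y X Z p f)"
    by (rule tensorial_uminus[OF curvature_op_tensorial_left[OF N X Z]])
  fix W Y assume W: "open W" "p \<in> W" "smooth_field (atlas M) W Y"
  have V: "open (W \<inter> N)" "p \<in> W \<inter> N" "smooth_field (atlas M) (W \<inter> N) X" "smooth_field (atlas M) (W \<inter> N) Y"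
    "smooth_field (atlas M) (W \<inter> N) Z"
    using W N by (auto intro: smooth_field_subset[OF W(3)] smooth_field_subset[OF X] smooth_field_subset[OF Z])
  show "curvature_op M X Y Z p f = - curvature_op M Y X Z p f"
    unfolding curvature_op_eq[OF V(1,2,3,4,5)] curvature_op_eq[OF V(1,2,4,3,5)] by simp
qed

lemma lc_lc_scale:
  assumes W: "open W" "p \<in> W" and v: "v \<in> TS p" and Y: "smooth_field (atlas M) W Y" and Z: "smooth_field (atlas M) W Z"
    and a: "smooth_map (atlas M) W a"
  shows "lc M p v (\<lambda>q. lc M q (Y q) (\<lambda>q f. a q * Z q f)) =
    (\<lambda>f. v (\<lambda>q. Y q a) * Z p f + Y p a * lc M p v Z f + (v a * lc M p (Y p) Z f + a p * lc M p v (\<lambda>q. lc M q (Y q) Z) f))"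
proof -
  have Ya: "smooth_map (atlas M) W (\<lambda>q. Y q a)" by (rule smooth_field_apply[OF Y W(1) order_refl a])
  note s = smooth_field_scale[OF Ya Z] smooth_field_scale[OF a lc_smooth[OF W(1) Z Y]]
  have "lc M p v (\<lambda>q. lc M q (Y q) (\<lambda>q f. a q * Z q f)) =
      lc M p v (\<lambda>q f. Y q a * Z q f + a q * lc M q (Y q) Z f)"
    by (rule lc_local[OF W(1) smooth_field_add[OF s] W(2) _ v])
      (rule lc_scale[OF W(1) Z a _ smooth_field_tangent[OF Y]])
  also have "\<dots> = (\<lambda>f. lc M p v (\<lambda>q f. Y q a * Z q f) f + lc M p v (\<lambda>q f. a q * lc M q (Y q) Z f) f)"
    by (rule lc_add[OF W(1) s(2,1) W(2) v])
  finally show ?thesis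
    unfolding lc_scale[OF W(1) Z Ya W(2) v] lc_scale[OF W(1) lc_smooth[OF W(1) Z Y] a W(2) v] .
qed

text \<open>The first derivatives of a coefficient of \<open>Z\<close> cancel by antisymmetry in
  \<open>X\<close> and \<open>Y\<close>, its second derivatives against the derivative along the
  bracket.\<close>

lemma curvature_op_tensorial_right:
  assumes N: "open N" "p \<in> N" and X: "smooth_field (atlas M) N X" and Y: "smooth_field (atlas M) N Y"
  shows "tensorial_at p (\<lambda>Z. curvature_op M X Y Z p f)"
proof (rule tensorial_atI[OF N])
  note T = smooth_field_tangent[OF X N(2)] smooth_field_tangent[OF Y N(2)] lie_bracket_tangent[OF N X Y]
  {
    fix W Z Z' assume W: "open W" "p \<in> W" "W \<subseteq> N" and Z: "smooth_field (atlas M) W Z" and eq: "\<And>q. q \<in> W \<Longrightarrow> Z' q = Z q"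
    have l: "lc M p v (\<lambda>q. lc M q (V q) Z') = lc M p v (\<lambda>q. lc M q (V q) Z)"
      if "v \<in> TS p" "smooth_field (atlas M) N V" for v V
      by (rule lc_local[OF W(1) lc_smooth[OF W(1) Z smooth_field_subset[OF that(2) W(3)]] W(2) _ that(1)])
        (rule lc_local[OF W(1) Z _ eq], use smooth_field_tangent[OF that(2)] W(3) in auto)
    show "curvature_op M X Y Z' p f = curvature_op M X Y Z p f"
      unfolding curvature_op_def l[OF T(1) Y] l[OF T(2) X] lc_local[where Y'=Z', OF W(1) Z W(2) eq T(3), simplified] ..
  next
    fix W Z Z' assume W: "open W" "p \<in> W" "W \<subseteq> N" and Z: "smooth_field (atlas M) W Z" and Z': "smooth_field (atlas M) W Z'"
    have l: "lc M p v (\<lambda>q. lc M q (V q) (\<lambda>q f. Z q f + Z' q f)) =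
        (\<lambda>f. lc M p v (\<lambda>q. lc M q (V q) Z) f + lc M p v (\<lambda>q. lc M q (V q) Z') f)"
      if "v \<in> TS p" "smooth_field (atlas M) N V" for v V
    proof -
      note V = smooth_field_subset[OF that(2) W(3)]
      note s = lc_smooth[OF W(1) Z V] lc_smooth[OF W(1) Z' V]
      have "lc M p v (\<lambda>q. lc M q (V q) (\<lambda>q f. Z q f + Z' q f)) =
          lc M p v (\<lambda>q f. lc M q (V q) Z f + lc M q (V q) Z' f)"
        by (rule lc_local[OF W(1) smooth_field_add[OF s] W(2) _ that(1)])
          (rule lc_add[OF W(1) Z' Z _ smooth_field_tangent[OF V]])
      then show ?thesis using lc_add[OF W(1) s(2,1) W(2) that(1)] by simp
    qed
    show "curvature_op M X Y (\<lambda>q f. Z q f + Z' q f) p f = curvature_op M X Y Z p f + curvature_op M X Y Z' p f"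
      unfolding curvature_op_def l[OF T(1) Y] l[OF T(2) X] lc_add[OF W(1) Z' Z W(2) T(3)] by simp
  next
    fix W Z and a :: "'m \<Rightarrow> real" assume W: "open W" "p \<in> W" "W \<subseteq> N" and Z: "smooth_field (atlas M) W Z" and a: "smooth_map (atlas M) W a"
    note XY = smooth_field_subset[OF X W(3)] smooth_field_subset[OF Y W(3)]
    have lb: "lie_bracket (atlas M) X Y p a = X p (\<lambda>q. Y q a) - Y p (\<lambda>q. X q a)"
      using smooth_nearI[OF a W(1,2)] by (simp add: lie_bracket_def)
    show "curvature_op M X Y (\<lambda>q f. a q * Z q f) p f = a p *\<^sub>R curvature_op M X Y Z p f"
      unfolding curvature_op_def lc_lc_scale[OF W(1,2) T(1) XY(2) Z a] lc_lc_scale[OF W(1,2) T(2) XY(1) Z a]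
        lc_scale[OF W(1) Z a W(2) T(3)] lb
      by (simp add: algebra_simps)
  }
qed

end

section \<open>Calculus in an orthonormal frame\<close>

lemma bilinear_matrix_mult:
  "bounded_bilinear ((**) :: 'a::{euclidean_space,real_algebra_1}^'m::finite^'n::finite \<Rightarrow> 'a^'p::finite^'m \<Rightarrow> 'a^'p^'n)"
  unfolding bilinear_conv_bounded_bilinear[symmetric] bilinear_def
  by (auto intro!: linearI simp: matrix_matrix_mult_def vec_eq_iff sum.distrib algebra_simps scaleR_sum_right)

lemma bilinear_matrix_vector:
  "bounded_bilinear ((*v) :: 'a::{euclidean_space,real_algebra_1}^'m::finite^'n::finite \<Rightarrow> 'a^'m \<Rightarrow> 'a^'n)"
  unfolding bilinear_conv_bounded_bilinear[symmetric] bilinear_def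
  by (auto intro!: linearI simp: matrix_vector_mult_def vec_eq_iff sum.distrib algebra_simps scaleR_sum_right)

lemmas matrix_mult_simps =
  bounded_bilinear.add_left[OF bilinear_matrix_mult] bounded_bilinear.add_right[OF bilinear_matrix_mult]
  bounded_bilinear.diff_left[OF bilinear_matrix_mult] bounded_bilinear.diff_right[OF bilinear_matrix_mult]
  bounded_bilinear.minus_left[OF bilinear_matrix_mult] bounded_bilinear.minus_right[OF bilinear_matrix_mult]
  bounded_bilinear.scaleR_left[OF bilinear_matrix_mult] bounded_bilinear.scaleR_right[OF bilinear_matrix_mult]
  bounded_bilinear.sum_left[OF bilinear_matrix_mult] bounded_bilinear.sum_right[OF bilinear_matrix_mult]
  bounded_bilinear.zero_left[OF bilinear_matrix_mult] bounded_bilinear.zero_right[OF bilinear_matrix_mult]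

lemmas matrix_vector_simps =
  bounded_bilinear.add_left[OF bilinear_matrix_vector] bounded_bilinear.add_right[OF bilinear_matrix_vector]
  bounded_bilinear.diff_left[OF bilinear_matrix_vector] bounded_bilinear.diff_right[OF bilinear_matrix_vector]
  bounded_bilinear.minus_left[OF bilinear_matrix_vector] bounded_bilinear.minus_right[OF bilinear_matrix_vector]
  bounded_bilinear.scaleR_left[OF bilinear_matrix_vector] bounded_bilinear.scaleR_right[OF bilinear_matrix_vector]
  bounded_bilinear.sum_left[OF bilinear_matrix_vector] bounded_bilinear.sum_right[OF bilinear_matrix_vector]
  bounded_bilinear.zero_left[OF bilinear_matrix_vector] bounded_bilinear.zero_right[OF bilinear_matrix_vector]

text \<open>These are determined by the frame fields alone, whatever the open set on which the
  frame is considered, so that they are unchanged when a frame is restricted to a smaller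
  set.\<close>

definition fderiv :: "('n \<Rightarrow> 'm \<Rightarrow> 'm tvec) \<Rightarrow> 'n \<Rightarrow> ('m \<Rightarrow> 'b::euclidean_space) \<Rightarrow> 'm \<Rightarrow> 'b" where
  "fderiv e k F q = vderiv (e k q) F"

definition christoffel :: "('m::topological_space, 'n::finite, 'z) riem_manifold_scheme \<Rightarrow>
    ('n \<Rightarrow> 'm \<Rightarrow> 'm tvec) \<Rightarrow> 'n \<Rightarrow> 'm \<Rightarrow> real^'n^'n" where
  "christoffel M e k q = (\<chi> i j. metric M q (lc M q (e k q) (e i)) (e j q))"

definition curv_matrix :: "('m::topological_space, 'n::finite, 'z) riem_manifold_scheme \<Rightarrow>
    ('n \<Rightarrow> 'm \<Rightarrow> 'm tvec) \<Rightarrow> 'n \<Rightarrow> 'n \<Rightarrow> 'm \<Rightarrow> real^'n^'n" where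
  "curv_matrix M e k l q = (\<chi> i m. metric M q (curvature_op M (e k) (e l) (e i) q) (e m q))"

context orthonormal_frame
begin

abbreviation "dd \<equiv> fderiv e"
abbreviation "\<Gamma> \<equiv> christoffel M e"
abbreviation "Rm \<equiv> curv_matrix M e"
abbreviation "smo \<equiv> smooth_map (atlas M) P"

lemmas smo_const = smooth_map_const[OF open_domain]
  and smo_add = smooth_map_add[OF open_domain]
  and smo_diff = smooth_map_diff[OF open_domain]
  and smo_sum = smooth_map_sum[OF open_domain]
  and smo_mult = smooth_map_mult[OF open_domain]
  and smo_scaleR = smooth_map_scaleR[OF open_domain]
  and smo_bilinear = smooth_map_bounded_bilinear[OF open_domain]
  and smo_linear = smooth_map_bounded_linear[OF open_domain]
  and smo_vec = smooth_map_vec[OF open_domain]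

lemma smo_dd: "smo F \<Longrightarrow> smo (dd k F)"
  using smooth_field_vderiv[OF frame_smooth open_domain order_refl] by (simp add: fderiv_def[abs_def])

lemma smo_near: "smo F \<Longrightarrow> p \<in> P \<Longrightarrow> smooth_near (atlas M) p F"
  using smooth_nearI open_domain by blast

lemma dd_const: "p \<in> P \<Longrightarrow> dd k (\<lambda>q. c) p = 0"
  unfolding fderiv_def by (rule vderiv_const[OF frame_tangent])

lemma dd_add: "p \<in> P \<Longrightarrow> smo F \<Longrightarrow> smo G \<Longrightarrow> dd k (\<lambda>q. F q + G q) p = dd k F p + dd k G p"
  unfolding fderiv_def by (rule vderiv_add[OF frame_tangent smo_near smo_near])

lemma dd_diff: "p \<in> P \<Longrightarrow> smo F \<Longrightarrow> smo G \<Longrightarrow> dd k (\<lambda>q. F q - G q) p = dd k F p - dd k G p"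
  unfolding fderiv_def by (rule vderiv_diff[OF frame_tangent smo_near smo_near])

lemma dd_uminus: "p \<in> P \<Longrightarrow> smo F \<Longrightarrow> dd k (\<lambda>q. - F q) p = - dd k F p"
  unfolding fderiv_def by (rule vderiv_uminus[OF frame_tangent smo_near])

lemma dd_sum: "p \<in> P \<Longrightarrow> (\<And>i. i \<in> I \<Longrightarrow> smo (F i)) \<Longrightarrow> dd k (\<lambda>q. \<Sum>i\<in>I. F i q) p = (\<Sum>i\<in>I. dd k (F i) p)"
  unfolding fderiv_def by (rule vderiv_sum[OF frame_tangent smo_near])

lemma dd_bilinear: "bounded_bilinear B \<Longrightarrow> p \<in> P \<Longrightarrow> smo F \<Longrightarrow> smo G \<Longrightarrow>
    dd k (\<lambda>q. B (F q) (G q)) p = B (F p) (dd k G p) + B (dd k F p) (G p)"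
  unfolding fderiv_def by (rule vderiv_bounded_bilinear[OF frame_tangent smo_near smo_near])

lemma dd_linear: "bounded_linear L \<Longrightarrow> p \<in> P \<Longrightarrow> smo F \<Longrightarrow> dd k (\<lambda>q. L (F q)) p = L (dd k F p)"
  unfolding fderiv_def by (rule vderiv_bounded_linear[OF frame_tangent smo_near])

lemmas dd_mult = dd_bilinear[OF bounded_bilinear_mult]
  and dd_scaleR = dd_bilinear[OF bounded_bilinear_scaleR]

lemma dd_cong: "p \<in> P \<Longrightarrow> smo F \<Longrightarrow> (\<And>q. q \<in> P \<Longrightarrow> F q = G q) \<Longrightarrow> dd k F p = dd k G p"
  unfolding fderiv_def by (rule vderiv_cong[OF frame_tangent open_domain])

lemma dd_nth: "p \<in> P \<Longrightarrow> smo F \<Longrightarrow> dd k F p $ i = dd k (\<lambda>q. F q $ i) p"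
  by (rule dd_linear[OF bounded_linear_vec_nth, symmetric])

lemma smo_nth: "smo F \<Longrightarrow> smo (\<lambda>q. F q $ i)"
  by (rule smo_linear[OF bounded_linear_vec_nth])

lemma smo_christoffel: "smo (\<Gamma> k)"
proof (rule smo_vec, rule smo_vec)
  fix i j
  have "smo (\<lambda>q. metric M q (lc M q (e k q) (e i)) (e j q))"
    by (rule metric_smooth[OF open_domain lc_smooth[OF open_domain frame_smooth frame_smooth] frame_smooth])
  then show "smo (\<lambda>q. \<Gamma> k q $ i $ j)" by (simp add: christoffel_def)
qed

lemma smo_christoffel_nth: "smo (\<lambda>q. \<Gamma> k q $ i $ j)"
  by (rule smo_nth, rule smo_nth, rule smo_christoffel)

lemma lc_frame:
  assumes "p \<in> P"
  shows "lc M p (e k p) (e i) = (\<lambda>f. \<Sum>j\<in>UNIV. \<Gamma> k p $ i $ j * e j p f)"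
  using orthonormal_expand[OF frame_orthonormal[OF assms]
      lc_tangent[OF open_domain frame_smooth assms frame_tangent[OF assms]], of k i]
  by (simp add: christoffel_def)

lemma lc_frame_metric:
  assumes "p \<in> P" "v \<in> TS p"
  shows "metric M p (lc M p v (e i)) (e j p) = (\<Sum>k\<in>UNIV. metric M p v (e k p) * \<Gamma> k p $ i $ j)"
  using linear_orthonormal_expand[OF frame_orthonormal[OF assms(1)] assms(2)
      lc_linear_compose[OF open_domain assms(1) frame_smooth metric_linear_left[OF frame_tangent[OF assms(1)]]], of i j]
  by (simp add: christoffel_def)

text \<open>The metric is parallel and has constant components in the frame.\<close>

lemma christoffel_antisym:
  assumes p: "p \<in> P"
  shows "\<Gamma> k p $ i $ j = - \<Gamma> k p $ j $ i"
proof -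
  have t: "lc M p (e k p) (e j) \<in> TS p"
    by (rule lc_tangent[OF open_domain frame_smooth p frame_tangent[OF p]])
  have "e k p (\<lambda>q. metric M q (e i q) (e j q)) = dd k (\<lambda>q. metric M q (e i q) (e j q)) p"
    by (simp add: fderiv_def vderiv_real)
  also have "\<dots> = dd k (\<lambda>q. if i = j then 1 else (0::real)) p"
    by (rule dd_cong[OF p metric_smooth[OF open_domain frame_smooth frame_smooth]]) (rule frame_metric)
  also have "\<dots> = 0" by (rule dd_const[OF p])
  finally have "metric M p (lc M p (e k p) (e i)) (e j p) + metric M p (e i p) (lc M p (e k p) (e j)) = 0"
    using lc_metric[OF open_domain frame_smooth frame_smooth p frame_tangent[OF p], of k i j] by simp
  then show ?thesis
    using metric_sym[OF frame_tangent[OF p] t, of i] by (simp add: christoffel_def)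
qed

lemma christoffel_transpose: "p \<in> P \<Longrightarrow> transpose (\<Gamma> k p) = - \<Gamma> k p"
  by (simp add: transpose_def vec_eq_iff) (metis christoffel_antisym)

text \<open>Structure functions of the frame: vanishing torsion expresses the commutator of two frame
  vectors by the connection.\<close>

definition "struct k l m q = \<Gamma> k q $ l $ m - \<Gamma> l q $ k $ m"

lemma smo_struct: "smo (struct k l m)"
  unfolding struct_def[abs_def] by (intro smo_diff smo_nth smo_christoffel)

lemma dd_commute:
  fixes F :: "'m \<Rightarrow> 'b::euclidean_space"
  assumes p: "p \<in> P" and F: "smo F"
  shows "dd k (dd l F) p - dd l (dd k F) p = (\<Sum>m\<in>UNIV. struct k l m p *\<^sub>R dd m F p)"
proof (rule euclidean_eqI)
  fix b :: 'b assume b: "b \<in> Basis"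
  let ?f = "\<lambda>q. F q \<bullet> b"
  have f: "smo ?f" by (rule smo_linear[OF bounded_linear_inner_left F])
  have 2: "dd k (dd l F) p \<bullet> b = e k p (\<lambda>q. e l q ?f)" for k l
    unfolding fderiv_def vderiv_inner_Basis[OF b] ..
  have "e k p (\<lambda>q. e l q ?f) - e l p (\<lambda>q. e k q ?f) = lie_bracket (atlas M) (e k) (e l) p ?f"
    using smo_near[OF f p] by (simp add: lie_bracket_def)
  also have "\<dots> = lc M p (e k p) (e l) ?f - lc M p (e l p) (e k) ?f"
    by (rule lc_torsion[OF open_domain frame_smooth frame_smooth p, symmetric])
  also have "\<dots> = (\<Sum>m\<in>UNIV. struct k l m p * e m p ?f)"
    unfolding lc_frame[OF p] by (simp add: struct_def sum_subtractf algebra_simps)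
  also have "\<dots> = (\<Sum>m\<in>UNIV. struct k l m p *\<^sub>R dd m F p) \<bullet> b"
    by (simp add: fderiv_def inner_sum_left vderiv_inner_Basis[OF b])
  finally show "(dd k (dd l F) p - dd l (dd k F) p) \<bullet> b = (\<Sum>m\<in>UNIV. struct k l m p *\<^sub>R dd m F p) \<bullet> b"
    by (simp add: inner_diff_left 2)
qed

subsection \<open>Curvature\<close>

text \<open>Components of \<open>\<nabla>\<^bsub>\<nabla>\<^sub>k e\<^sub>l\<^esub> e\<^sub>i - \<nabla>\<^sub>k \<nabla>\<^sub>l e\<^sub>i\<close>.\<close>

definition "second_matrix k l q = (\<Sum>r\<in>UNIV. \<Gamma> k q $ l $ r *\<^sub>R \<Gamma> r q) - dd k (\<Gamma> l) q - \<Gamma> l q ** \<Gamma> k q"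

lemma metric_sum_frame:
  assumes "p \<in> P"
  shows "metric M p (\<lambda>f. \<Sum>j\<in>UNIV. a j * e j p f) (e m p) = a m"
  using linear_tangent_sum[OF metric_linear_left[OF frame_tangent[OF assms]], of UNIV "\<lambda>j. e j p" a m]
    frame_tangent[OF assms] frame_metric[OF assms]
  by (simp add: if_distrib[of "\<lambda>x. _ * x"] cong: if_cong)

lemma second_matrix:
  assumes p: "p \<in> P"
  shows "metric M p (\<lambda>f. lc M p (lc M p (e k p) (e l)) (e i) f - lc M p (e k p) (\<lambda>q. lc M q (e l q) (e i)) f) (e m p)
    = second_matrix k l p $ i $ m"
proof -
  note T = frame_tangent[OF p]
  have t: "lc M p v (e i) \<in> TS p" if "v \<in> TS p" for v i
    by (rule lc_tangent[OF open_domain frame_smooth p that])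
  note lin = metric_linear_left[OF T]
  have dn: "e k p (\<lambda>q. \<Gamma> l q $ i $ j) = dd k (\<Gamma> l) p $ i $ j" for j
    unfolding dd_nth[OF p smo_christoffel] dd_nth[OF p smo_nth[OF smo_christoffel]]
    by (simp add: fderiv_def vderiv_real)
  have "lc M p (e k p) (\<lambda>q. lc M q (e l q) (e i)) = lc M p (e k p) (\<lambda>q f. \<Sum>j\<in>UNIV. \<Gamma> l q $ i $ j * e j q f)"
    by (rule lc_local[OF open_domain smooth_field_sum p _ T])
      (auto simp: lc_frame intro!: smo_christoffel_nth frame_smooth)
  also have "\<dots> = (\<lambda>f. \<Sum>j\<in>UNIV. e k p (\<lambda>q. \<Gamma> l q $ i $ j) * e j p f + \<Gamma> l p $ i $ j * lc M p (e k p) (e j) f)"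
    by (rule lc_sum[OF open_domain p T]) (intro smo_christoffel_nth frame_smooth)+
  also have "\<dots> = (\<lambda>f. \<Sum>j\<in>UNIV. 1 * (e k p (\<lambda>q. \<Gamma> l q $ i $ j) * e j p f + \<Gamma> l p $ i $ j * lc M p (e k p) (e j) f))"
    by simp
  finally have 1: "lc M p (e k p) (\<lambda>q. lc M q (e l q) (e i)) = \<dots>" .
  have "metric M p \<dots> (e m p) = (\<Sum>j\<in>UNIV. 1 *\<^sub>R metric M p (\<lambda>f. e k p (\<lambda>q. \<Gamma> l q $ i $ j) * e j p f + \<Gamma> l p $ i $ j * lc M p (e k p) (e j) f) (e m p))"
    by (rule linear_tangent_sum[OF lin]) (intro tangent_comb T t)
  also have "\<dots> = (\<Sum>j\<in>UNIV. e k p (\<lambda>q. \<Gamma> l q $ i $ j) * (if j = m then 1 else 0) + \<Gamma> l p $ i $ j * \<Gamma> k p $ j $ m)"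
    using lin[unfolded linear_tangent_def, rule_format, OF T t[OF T]] frame_metric[OF p]
    by (simp add: christoffel_def)
  also have "\<dots> = dd k (\<Gamma> l) p $ i $ m + (\<Gamma> l p ** \<Gamma> k p) $ i $ m"
    by (simp add: sum.distrib matrix_matrix_mult_def dn if_distrib[of "\<lambda>x. _ * x"] cong: if_cong)
  finally have A: "metric M p (lc M p (e k p) (\<lambda>q. lc M q (e l q) (e i))) (e m p) =
      dd k (\<Gamma> l) p $ i $ m + (\<Gamma> l p ** \<Gamma> k p) $ i $ m" using 1 by simp
  have B: "metric M p (lc M p (lc M p (e k p) (e l)) (e i)) (e m p) = (\<Sum>r\<in>UNIV. \<Gamma> k p $ l $ r * \<Gamma> r p $ i $ m)"
    unfolding lc_frame_metric[OF p t[OF T]] by (simp add: christoffel_def)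
  have "metric M p (\<lambda>f. lc M p (lc M p (e k p) (e l)) (e i) f - lc M p (e k p) (\<lambda>q. lc M q (e l q) (e i)) f) (e m p) =
      metric M p (lc M p (lc M p (e k p) (e l)) (e i)) (e m p) - metric M p (lc M p (e k p) (\<lambda>q. lc M q (e l q) (e i))) (e m p)"
    by (rule linear_tangentD(3)[OF lin])
      (intro t T lc_tangent[OF open_domain lc_smooth[OF open_domain frame_smooth frame_smooth] p])+
  then show ?thesis unfolding A B second_matrix_def by simp
qed

lemma curv_matrix_eq:
  assumes p: "p \<in> P"
  shows "Rm k l p = second_matrix k l p - second_matrix l k p"
proof -
  note T = frame_tangent[OF p]
  have t: "(\<lambda>f. lc M p (lc M p (e k p) (e l)) (e i) f - lc M p (e k p) (\<lambda>q. lc M q (e l q) (e i)) f) \<in> TS p" for k l i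
  proof -
    have "lc M p (lc M p (e k p) (e l)) (e i) \<in> TS p" "lc M p (e k p) (\<lambda>q. lc M q (e l q) (e i)) \<in> TS p"
      by (intro lc_tangent[OF open_domain _ p] lc_smooth[OF open_domain] frame_smooth T)+
    from tangent_comb[OF this, of 1 "-1"] show ?thesis by simp
  qed
  have "Rm k l p $ i $ m = (second_matrix k l p - second_matrix l k p) $ i $ m" for i m
    unfolding curv_matrix_def vec_lambda_beta curvature_op_eq[OF open_domain p frame_smooth frame_smooth frame_smooth, abs_def]
      linear_tangentD(3)[OF metric_linear_left[OF T] t t] second_matrix[OF p] by simp
  then show ?thesis by (simp add: vec_eq_iff)
qed

lemma curv_matrix_formula:
  assumes p: "p \<in> P"
  shows "Rm k l p = dd l (\<Gamma> k) p - dd k (\<Gamma> l) p + \<Gamma> k p ** \<Gamma> l p - \<Gamma> l p ** \<Gamma> k p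
    + (\<Sum>r\<in>UNIV. struct k l r p *\<^sub>R \<Gamma> r p)"
  unfolding curv_matrix_eq[OF p] second_matrix_def struct_def
  by (simp add: scaleR_diff_left sum_subtractf)

lemma curv_matrix_swap: "p \<in> P \<Longrightarrow> Rm l k p = - Rm k l p"
  by (simp add: curv_matrix_eq)

lemma smo_curv_matrix: "smo (Rm k l)"
proof -
  have "smo (\<lambda>p. dd l (\<Gamma> k) p - dd k (\<Gamma> l) p + \<Gamma> k p ** \<Gamma> l p - \<Gamma> l p ** \<Gamma> k p
    + (\<Sum>r\<in>UNIV. struct k l r p *\<^sub>R \<Gamma> r p))"
    by (intro smo_add smo_diff smo_sum smo_scaleR smo_dd smo_struct smo_christoffel smo_bilinear[OF bilinear_matrix_mult])
  then show ?thesis by (rule smooth_map_cong[OF open_domain, rotated]) (simp add: curv_matrix_formula)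
qed

text \<open>The connection matrices are antisymmetric, hence so are their derivatives and
  commutators.\<close>

lemma curv_matrix_transpose:
  assumes p: "p \<in> P"
  shows "Rm k l p $ m $ i = - Rm k l p $ i $ m"
proof -
  have d: "dd k (\<Gamma> l) p $ m $ i = - dd k (\<Gamma> l) p $ i $ m" for k l
  proof -
    have "dd k (\<lambda>q. \<Gamma> l q $ m $ i) p = dd k (\<lambda>q. - \<Gamma> l q $ i $ m) p"
      by (rule dd_cong[OF p]) (rule smo_christoffel_nth, rule christoffel_antisym)
    then show ?thesis by (simp add: dd_nth[OF p] dd_uminus[OF p] smo_nth smo_christoffel)
  qed
  have m: "(\<Gamma> k p ** \<Gamma> l p) $ m $ i = (\<Gamma> l p ** \<Gamma> k p) $ i $ m" for k l
  proof -
    have "\<Gamma> k p $ m $ r * \<Gamma> l p $ r $ i = \<Gamma> l p $ i $ r * \<Gamma> k p $ r $ m" for r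
      using christoffel_antisym[OF p, of k m r] christoffel_antisym[OF p, of l r i] by simp
    then show ?thesis by (simp add: matrix_matrix_mult_def)
  qed
  have s: "(\<Sum>r\<in>UNIV. struct k l r p *\<^sub>R \<Gamma> r p) $ m $ i = - (\<Sum>r\<in>UNIV. struct k l r p *\<^sub>R \<Gamma> r p) $ i $ m"
    by (simp add: christoffel_antisym[OF p, of _ m i] sum_negf)
  show ?thesis
    unfolding curv_matrix_formula[OF p] using d[of l k] d[of k l] m[of k l] m[of l k] s by simp
qed

text \<open>The Jacobi identity for the frame fields, applied to a function: the six third
  derivatives of the function cancel in pairs, and their differences are evaluated by the
  commutators of frame derivatives.\<close>

lemma struct_jacobi_apply:
  assumes p: "p \<in> P" and f: "smo f"
  defines "J \<equiv> \<lambda>k l i m. dd k (struct l i m) p + (\<Sum>r\<in>UNIV. struct l i r p * struct k r m p)"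
  shows "(\<Sum>m\<in>UNIV. (J k l i m + J l i k m + J i k l m) * dd m f p) = (0::real)"
proof -
  have *: "(dd k (dd l (dd i f)) p - dd k (dd i (dd l f)) p) - (dd l (dd i (dd k f)) p - dd i (dd l (dd k f)) p)
      = (\<Sum>m\<in>UNIV. J k l i m * dd m f p)" for k l i
  proof -
    have "dd k (dd l (dd i f)) p - dd k (dd i (dd l f)) p = dd k (\<lambda>q. dd l (dd i f) q - dd i (dd l f) q) p"
      by (simp add: dd_diff[OF p] smo_dd f)
    also have "\<dots> = dd k (\<lambda>q. \<Sum>m\<in>UNIV. struct l i m q *\<^sub>R dd m f q) p"
      by (rule dd_cong[OF p]) (intro smo_diff smo_dd f, rule dd_commute[OF _ f])
    also have "\<dots> = (\<Sum>m\<in>UNIV. struct l i m p * dd k (dd m f) p + dd k (struct l i m) p * dd m f p)"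
      by (simp add: dd_sum[OF p] dd_mult[OF p] smo_mult smo_struct smo_dd f)
    finally have 1: "dd k (dd l (dd i f)) p - dd k (dd i (dd l f)) p = \<dots>" .
    have 2: "dd l (dd i (dd k f)) p - dd i (dd l (dd k f)) p = (\<Sum>m\<in>UNIV. struct l i m p * dd m (dd k f) p)"
      using dd_commute[OF p smo_dd[OF f]] by simp
    have "(\<Sum>m\<in>UNIV. struct l i m p * (dd k (dd m f) p - dd m (dd k f) p)) =
        (\<Sum>m\<in>UNIV. \<Sum>r\<in>UNIV. struct l i m p * struct k m r p * dd r f p)"
      using dd_commute[OF p f] by (simp add: sum_distrib_left mult.assoc)
    also have "\<dots> = (\<Sum>r\<in>UNIV. (\<Sum>m\<in>UNIV. struct l i m p * struct k m r p) * dd r f p)"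
      by (subst sum.swap) (simp add: sum_distrib_right)
    finally have 3: "(\<Sum>m\<in>UNIV. struct l i m p * (dd k (dd m f) p - dd m (dd k f) p)) = \<dots>" .
    show ?thesis
      unfolding 1 2 J_def distrib_right sum.distrib 3[symmetric]
      by (simp add: sum_subtractf algebra_simps)
  qed
  have "(\<Sum>m\<in>UNIV. (J k l i m + J l i k m + J i k l m) * dd m f p) =
     (\<Sum>m\<in>UNIV. J k l i m * dd m f p) + (\<Sum>m\<in>UNIV. J l i k m * dd m f p) + (\<Sum>m\<in>UNIV. J i k l m * dd m f p)"
    by (simp add: sum.distrib distrib_right)
  then show ?thesis unfolding *[symmetric] by simp
qed

end

lemma (in orthonormal_frame) restrict_frame:
  assumes "open W" "W \<subseteq> P"
  shows "orthonormal_frame M W e"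
  by unfold_locales (use assms smooth_field_subset[OF frame_smooth] frame_metric in auto)

context orthonormal_frame
begin

text \<open>A tangent vector is determined by its values on functions. A function that is smooth
  near \<open>p\<close> is smooth on some open set only, to which the frame is restricted; on all
  other functions tangent vectors vanish by convention.\<close>

lemma struct_jacobi:
  assumes p: "p \<in> P"
  defines "J \<equiv> \<lambda>k l i m. dd k (struct l i m) p + (\<Sum>r\<in>UNIV. struct l i r p * struct k r m p)"
  shows "J k l i m + J l i k m + J i k l m = 0"
proof -
  let ?a = "\<lambda>m. J k l i m + J l i k m + J i k l m"
  have "(\<Sum>m\<in>UNIV. ?a m * e m p f) = 0" for f
  proof (cases "smooth_near (atlas M) p f")
    case True
    then obtain W where W: "open W" "p \<in> W" "smooth_map (atlas M) W f" unfolding smooth_near_def by blast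
    interpret Q: orthonormal_frame M "W \<inter> P" e
      by (rule restrict_frame) (use W open_domain in auto)
    have "smooth_map (atlas M) (W \<inter> P) f" using smooth_map_subset[OF W(3)] by auto
    moreover have "Q.struct = struct" by (simp add: Q.struct_def[abs_def] struct_def[abs_def])
    ultimately show ?thesis
      using Q.struct_jacobi_apply[of p f k l i] W(2) p unfolding J_def by (simp add: fderiv_def vderiv_real)
  next
    case False
    have "e m p f = 0" for m
      using frame_tangent[OF p, of m] False by (auto simp: tangent_space_def coord_vector_def)
    then show ?thesis by simp
  qed
  then have "(\<lambda>f. \<Sum>m\<in>UNIV. ?a m * e m p f) = (\<lambda>f. \<Sum>m\<in>UNIV. 0 * e m p f)" by simp
  then show ?thesis
    using metric_sum_frame[OF p, of ?a m] metric_sum_frame[OF p, of "\<lambda>_. 0" m] by simp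
qed

text \<open>In terms of the connection matrices, the structure functions being their antisymmetric
  parts, this is the Jacobi identity for the frame fields.\<close>

lemma bianchi:
  assumes p: "p \<in> P"
  shows "Rm k l p $ i $ m + Rm l i p $ k $ m + Rm i k p $ l $ m = 0"
proof -
  have c: "Rm k l p $ i $ m = dd l (\<lambda>q. \<Gamma> k q $ i $ m) p - dd k (\<lambda>q. \<Gamma> l q $ i $ m) p
      + (\<Sum>r\<in>UNIV. \<Gamma> k p $ i $ r * \<Gamma> l p $ r $ m) - (\<Sum>r\<in>UNIV. \<Gamma> l p $ i $ r * \<Gamma> k p $ r $ m)
      + (\<Sum>r\<in>UNIV. struct k l r p * \<Gamma> r p $ i $ m)" for k l i
    unfolding curv_matrix_formula[OF p]
    by (simp add: matrix_matrix_mult_def dd_nth[OF p] smo_nth smo_christoffel)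
  have s: "dd k (struct l i m) p = dd k (\<lambda>q. \<Gamma> l q $ i $ m) p - dd k (\<lambda>q. \<Gamma> i q $ l $ m) p" for k l i
    unfolding struct_def[abs_def] by (simp add: dd_diff[OF p] smo_nth smo_christoffel)
  show ?thesis
    using struct_jacobi[OF p, of k l i m] unfolding s unfolding c struct_def
    by (simp add: algebra_simps sum.distrib sum_subtractf)
qed

text \<open>Four instances of the Bianchi identity, combined with the antisymmetry in either pair
  of indices.\<close>

lemma curv_matrix_pair:
  assumes p: "p \<in> P"
  shows "Rm k l p $ i $ m = Rm i m p $ k $ l"
proof -
  have sw: "Rm a b p $ c $ d = - Rm b a p $ c $ d" for a b c d
    using curv_matrix_swap[OF p, of a b] by simp
  note tr = curv_matrix_transpose[OF p]
  show ?thesis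
    using bianchi[OF p, of k l i m] bianchi[OF p, of k l m i] bianchi[OF p, of i m k l] bianchi[OF p, of i m l k]
      tr[of k l i m] tr[of i m k l] tr[of l i k m] tr[of m k l i]
      sw[of k i m l] tr[of i k l m] sw[of m l i k] tr[of l m k i]
    by linarith
qed

end

section \<open>Covariant derivatives of tensors\<close>

text \<open>In \<open>cov3\<close>, the first tangent vector is the direction of differentiation.
  For \<open>T = \<nabla>h\<close>, the tensor \<open>neg_trace M T\<close> is the rough Laplacian
  of \<open>h\<close>. Tensoriality makes these independent of the chosen extensions.\<close>

definition cov3 :: "('m::topological_space, 'n::finite, 'z) riem_manifold_scheme \<Rightarrow> 'm tensor3 \<Rightarrow>
    'm \<Rightarrow> 'm tvec \<Rightarrow> 'm tvec \<Rightarrow> 'm tvec \<Rightarrow> 'm tvec \<Rightarrow> real" where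
  "cov3 M T p v u x y = (let U = extend_vector (atlas M) p u; X = extend_vector (atlas M) p x;
      Y = extend_vector (atlas M) p y in
    v (\<lambda>q. T q (U q) (X q) (Y q)) - T p (lc M p v U) x y - T p u (lc M p v X) y - T p u x (lc M p v Y))"

definition neg_trace :: "('m::topological_space, 'n::finite, 'z) riem_manifold_scheme \<Rightarrow> 'm tensor3 \<Rightarrow> 'm tensor2" where
  "neg_trace M T p x y = - (\<Sum>k\<in>UNIV. cov3 M T p (onb M p k) (onb M p k) x y)"

definition divergence :: "('m::topological_space, 'n::finite, 'z) riem_manifold_scheme \<Rightarrow>
    ('m \<Rightarrow> 'm tvec \<Rightarrow> real) \<Rightarrow> 'm \<Rightarrow> real" where
  "divergence M \<omega> p = (\<Sum>k\<in>UNIV. let E = extend_vector (atlas M) p (onb M p k) in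
     onb M p k (\<lambda>q. \<omega> q (E q)) - \<omega> p (lc M p (onb M p k) E))"

definition one_form :: "('m::topological_space, 'n::finite) chart set \<Rightarrow> ('m \<Rightarrow> 'm tvec \<Rightarrow> real) \<Rightarrow> bool" where
  "one_form A \<omega> \<longleftrightarrow> (\<forall>p. linear_tangent (tangent_space A p) (\<omega> p)) \<and>
    (\<forall>W X. open W \<and> smooth_field A W X \<longrightarrow> smooth_map A W (\<lambda>p. \<omega> p (X p)))"

context smooth_manifold
begin

lemma cot_sym2_linear:
  assumes "cot_sym2_tensor A T" "x \<in> tangent_space A p" "y \<in> tangent_space A p"
  shows "linear_tangent (tangent_space A p) (\<lambda>v. T p v x y)"
    "linear_tangent (tangent_space A p) (T p x y)"
    "linear_tangent (tangent_space A p) (\<lambda>z. T p x z y)"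
proof -
  have *: "linear_tangent (tangent_space A p) (\<lambda>v. T p v x y) \<and> linear_tangent (tangent_space A p) (T p x y) \<and>
      (\<forall>v\<in>tangent_space A p. T p x y v = T p x v y)"
    if "x \<in> tangent_space A p" "y \<in> tangent_space A p" for x y
    using assms(1) that unfolding cot_sym2_tensor_def by simp
  show "linear_tangent (tangent_space A p) (\<lambda>v. T p v x y)" "linear_tangent (tangent_space A p) (T p x y)"
    using *[OF assms(2,3)] by auto
  have "T p x z y = T p x y z" if "z \<in> tangent_space A p" for z
    using *[OF assms(2,3)] that by simp
  then show "linear_tangent (tangent_space A p) (\<lambda>z. T p x z y)"
    using \<open>linear_tangent (tangent_space A p) (T p x y)\<close>
    unfolding linear_tangent_def by (auto simp: tangent_comb)
qed

lemma cot_sym2_sym: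
  "cot_sym2_tensor A T \<Longrightarrow> v \<in> tangent_space A p \<Longrightarrow> x \<in> tangent_space A p \<Longrightarrow> y \<in> tangent_space A p \<Longrightarrow>
    T p v x y = T p v y x"
  unfolding cot_sym2_tensor_def by simp

lemma cot_sym2_smooth:
  "cot_sym2_tensor A T \<Longrightarrow> open W \<Longrightarrow> smooth_field A W V \<Longrightarrow> smooth_field A W X \<Longrightarrow> smooth_field A W Y \<Longrightarrow>
    smooth_map A W (\<lambda>p. T p (V p) (X p) (Y p))"
  unfolding cot_sym2_tensor_def by simp

lemma linear_tangent_comb:
  assumes "linear_tangent S L" "linear_tangent S K"
  shows "linear_tangent S (\<lambda>v. L v + K v)" "linear_tangent S (\<lambda>v. L v - K v)"
  using assms unfolding linear_tangent_def by (simp_all add: algebra_simps)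

lemma linear_tangent_scale: "linear_tangent S L \<Longrightarrow> linear_tangent S (\<lambda>v. c *\<^sub>R L v)"
  unfolding linear_tangent_def by (simp add: algebra_simps)

lemma linear_tangent_sumI:
  "(\<And>i. i \<in> I \<Longrightarrow> linear_tangent S (L i)) \<Longrightarrow> linear_tangent S (\<lambda>v. \<Sum>i\<in>I. L i v)"
  unfolding linear_tangent_def by (simp add: sum.distrib scaleR_sum_right)

end

context orthonormal_frame
begin

lemma linear_tangent_tensorial:
  assumes "tensorial_at p B" "p \<in> P"
  shows "linear_tangent (TS p) (\<lambda>x. B (extend_vector (atlas M) p x))"
proof -
  have "linear_tangent (TS p) (\<lambda>x. \<Sum>i\<in>UNIV. metric M p x (e i p) *\<^sub>R B (e i))"
    using metric_linear_left[OF frame_tangent[OF assms(2)]]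
    unfolding linear_tangent_def by (simp add: sum.distrib algebra_simps scaleR_sum_right)
  then show ?thesis
    using tensorial_extend_expand[OF assms] unfolding linear_tangent_def by (simp add: tangent_comb)
qed

lemma linear_tangent_eq:
  assumes "linear_tangent (TS p) L" "\<And>v. v \<in> TS p \<Longrightarrow> K v = L v"
  shows "linear_tangent (TS p) K"
  using assms unfolding linear_tangent_def by (simp add: tangent_comb)

context
  fixes \<omega> assumes \<omega>: "one_form (atlas M) \<omega>"
begin

lemma one_form_linear: "linear_tangent (TS p) (\<omega> p)"
  using \<omega> by (simp add: one_form_def)

lemma one_form_smooth: "open W \<Longrightarrow> smooth_field (atlas M) W X \<Longrightarrow> smooth_map (atlas M) W (\<lambda>p. \<omega> p (X p))"
  using \<omega> by (simp add: one_form_def)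

text \<open>The trace over the basis \<open>onb\<close> is one over the frame vectors, and by
  tensoriality these may be extended by the frame fields.\<close>

lemma divergence_frame:
  assumes p: "p \<in> P"
  shows "divergence M \<omega> p = (\<Sum>k\<in>UNIV. dd k (\<lambda>q. \<omega> q (e k q)) p - (\<Sum>m\<in>UNIV. \<Gamma> k p $ k $ m * \<omega> p (e m p)))"
proof -
  define B where "B v X = vderiv v (\<lambda>q. \<omega> q (X q)) - \<omega> p (lc M p v X)" for v X
  have tens: "tensorial_at p (B v)" if "v \<in> TS p" for v
    unfolding B_def by (rule tensorial_cov[OF open_domain p that one_form_linear one_form_smooth])
  have lin: "linear_tangent (TS p) (\<lambda>v. B v (extend_vector (atlas M) p x))" if x: "x \<in> TS p" for x
  proof -
    obtain W where W: "open W" "p \<in> W" "smooth_field (atlas M) W (extend_vector (atlas M) p x)"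
      using extend_vector[OF p x] by blast
    have "linear_tangent (TS p) (\<lambda>v. vderiv v (\<lambda>q. \<omega> q (extend_vector (atlas M) p x q)))"
      unfolding linear_tangent_def by (simp add: vderiv_comb)
    then show ?thesis unfolding B_def
      by (rule linear_tangent_comb(2)[OF _ lc_linear_compose[OF W one_form_linear]])
  qed
  have "divergence M \<omega> p = (\<Sum>k\<in>UNIV. B (onb M p k) (extend_vector (atlas M) p (onb M p k)))"
    unfolding divergence_def B_def Let_def vderiv_real ..
  also have "\<dots> = (\<Sum>k\<in>UNIV. B (e k p) (extend_vector (atlas M) p (e k p)))"
    by (rule trace_orthonormal[OF frame_orthonormal[OF p] onb_orthonormal[OF p]])
      (auto intro: lin linear_tangent_tensorial[OF tens p])
  also have "\<dots> = (\<Sum>k\<in>UNIV. B (e k p) (e k))"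
    by (rule sum.cong[OF refl]) (rule tensorial_extend[OF tens[OF frame_tangent[OF p]] p open_domain p frame_smooth])
  also have "\<dots> = (\<Sum>k\<in>UNIV. dd k (\<lambda>q. \<omega> q (e k q)) p - (\<Sum>m\<in>UNIV. \<Gamma> k p $ k $ m * \<omega> p (e m p)))"
    unfolding B_def fderiv_def lc_frame[OF p]
    using linear_tangent_sum[OF one_form_linear, of UNIV "\<lambda>m. e m p"] frame_tangent[OF p] by simp
  finally show ?thesis .
qed

end

text \<open>The matrix \<open>cov_tmat T l k\<close> has the components of the covariant
  derivative of \<open>T\<close> along \<open>e\<^sub>l\<close> whose first argument is
  \<open>e\<^sub>k\<close>.\<close>

definition "hmat h q = (\<chi> i j. (h q (e i q) (e j q) :: real))"

definition "tmat T k q = (\<chi> i j. (T q (e k q) (e i q) (e j q) :: real))"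

definition "cov_tmat T l k q = dd l (tmat T k) q - \<Gamma> l q ** tmat T k q - tmat T k q ** transpose (\<Gamma> l q)
    - (\<Sum>m\<in>UNIV. \<Gamma> l q $ k $ m *\<^sub>R tmat T m q)"

subsection \<open>Symmetric 2-tensors\<close>

context
  fixes h assumes h: "sym2_tensor (atlas M) h"
begin

lemma nabla_tensorial:
  assumes p: "p \<in> P" and v: "v \<in> TS p" and W: "open W" "p \<in> W" and Y: "smooth_field (atlas M) W Y"
  shows "tensorial_at p (\<lambda>X. vderiv v (\<lambda>q. h q (X q) (Y q)) - h p (lc M p v X) (Y p) - h p (X p) (lc M p v Y))"
  by (intro tensorial_diff tensorial_cov[OF W v] tensorial_point sym2_linear_left[OF h]
      sym2_smooth[OF h _ _ smooth_field_subset[OF Y]] smooth_field_tangent[OF Y]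
      lc_tangent[OF W(1) Y W(2) v])

text \<open>Both arguments may be extended by any fields: the expression is tensorial in one of
  them and symmetric.\<close>

lemma nabla_eq:
  assumes p: "p \<in> P" and v: "v \<in> TS p" and W: "open W" "p \<in> W"
    and X: "smooth_field (atlas M) W X" and Y: "smooth_field (atlas M) W Y"
  shows "nabla M h p v (X p) (Y p) = v (\<lambda>q. h q (X q) (Y q)) - h p (lc M p v X) (Y p) - h p (X p) (lc M p v Y)"
proof -
  define N where "N X Y = vderiv v (\<lambda>q. h q (X q) (Y q)) - h p (lc M p v X) (Y p) - h p (X p) (lc M p v Y)" for X Y
  have sym: "N X Y = N Y X" if "open V" "p \<in> V" "smooth_field (atlas M) V X" "smooth_field (atlas M) V Y" for V X Y
  proof -
    have "vderiv v (\<lambda>q. h q (X q) (Y q)) = vderiv v (\<lambda>q. h q (Y q) (X q))"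
      by (rule vderiv_cong[OF v that(1,2) sym2_smooth[OF h that(1,3,4)]])
        (rule sym2_sym[OF h smooth_field_tangent[OF that(3)] smooth_field_tangent[OF that(4)]])
    then show ?thesis
      unfolding N_def
      using sym2_sym[OF h lc_tangent[OF that(1,3,2) v] smooth_field_tangent[OF that(4,2)]]
        sym2_sym[OF h smooth_field_tangent[OF that(3,2)] lc_tangent[OF that(1,4,2) v]] by simp
  qed
  note T = smooth_field_tangent[OF X W(2)] smooth_field_tangent[OF Y W(2)]
  let ?X = "extend_vector (atlas M) p (X p)" and ?Y = "extend_vector (atlas M) p (Y p)"
  obtain V where V: "open V" "p \<in> V" "smooth_field (atlas M) V ?X" "?X p = X p" using extend_vector[OF p T(1)] .
  obtain V' where V': "open V'" "p \<in> V'" "smooth_field (atlas M) V' ?Y" "?Y p = Y p" using extend_vector[OF p T(2)] .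
  note i = smooth_field_subset[OF V'(3), of "W \<inter> V'"] smooth_field_subset[OF X, of "W \<inter> V'"]
  have "nabla M h p v (X p) (Y p) = N ?X ?Y"
    unfolding nabla_def N_def Let_def vderiv_real V(4) V'(4) ..
  also have "\<dots> = N X ?Y"
    unfolding N_def by (rule tensorial_extend[OF nabla_tensorial[OF p v V'(1-3)] p W X])
  also have "\<dots> = N ?Y X" by (rule sym[of "W \<inter> V'"]) (use i W V' in auto)
  also have "\<dots> = N Y X"
    unfolding N_def by (rule tensorial_extend[OF nabla_tensorial[OF p v W X] p W Y])
  also have "\<dots> = N X Y" by (rule sym[OF W Y X])
  finally show ?thesis unfolding N_def vderiv_real .
qed

lemma smo_hmat: "smo (hmat h)"
proof (rule smo_vec, rule smo_vec)
  fix i j show "smo (\<lambda>q. hmat h q $ i $ j)"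
    using sym2_smooth[OF h open_domain frame_smooth frame_smooth] by (simp add: hmat_def)
qed

lemma nabla_frame:
  assumes p: "p \<in> P"
  shows "(\<chi> i j. nabla M h p (e k p) (e i p) (e j p)) = dd k (hmat h) p - \<Gamma> k p ** hmat h p - hmat h p ** transpose (\<Gamma> k p)"
proof -
  note T = frame_tangent[OF p]
  have "nabla M h p (e k p) (e i p) (e j p) =
      dd k (hmat h) p $ i $ j - (\<Gamma> k p ** hmat h p) $ i $ j - (hmat h p ** transpose (\<Gamma> k p)) $ i $ j" for i j
  proof -
    have "dd k (hmat h) p $ i $ j = e k p (\<lambda>q. h q (e i q) (e j q))"
      unfolding dd_nth[OF p smo_hmat] dd_nth[OF p smo_nth[OF smo_hmat]]
      by (simp add: fderiv_def vderiv_real hmat_def)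
    moreover have "(\<Gamma> k p ** hmat h p) $ i $ j = h p (lc M p (e k p) (e i)) (e j p)"
      unfolding lc_frame[OF p] linear_tangent_sum[OF sym2_linear_left[OF h T] T]
      by (simp add: matrix_matrix_mult_def hmat_def)
    moreover have "(hmat h p ** transpose (\<Gamma> k p)) $ i $ j = h p (e i p) (lc M p (e k p) (e j))"
      unfolding lc_frame[OF p] linear_tangent_sum[OF sym2_linear_right[OF h T] T]
      by (simp add: matrix_matrix_mult_def hmat_def transpose_def mult.commute)
    ultimately show ?thesis
      unfolding nabla_eq[OF p T open_domain p frame_smooth frame_smooth] by simp
  qed
  then show ?thesis by (simp add: vec_eq_iff)
qed

end

subsection \<open>Sections of the cotangent bundle tensored with symmetric 2-tensors\<close>

context
  fixes T assumes T: "cot_sym2_tensor (atlas M) T"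
begin

lemma cov3_tensorial:
  assumes v: "v \<in> TS p" and W: "open W" "p \<in> W" and X: "smooth_field (atlas M) W X" and Y: "smooth_field (atlas M) W Y"
  shows "tensorial_at p (\<lambda>U. vderiv v (\<lambda>q. T q (U q) (X q) (Y q)) - T p (lc M p v U) (X p) (Y p)
      - T p (U p) (lc M p v X) (Y p) - T p (U p) (X p) (lc M p v Y))"
    "tensorial_at p (\<lambda>U. vderiv v (\<lambda>q. T q (X q) (U q) (Y q)) - T p (lc M p v X) (U p) (Y p)
      - T p (X p) (lc M p v U) (Y p) - T p (X p) (U p) (lc M p v Y))"
    "tensorial_at p (\<lambda>U. vderiv v (\<lambda>q. T q (X q) (Y q) (U q)) - T p (lc M p v X) (Y p) (U p)
      - T p (X p) (lc M p v Y) (U p) - T p (X p) (Y p) (lc M p v U))"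
proof -
  note t = smooth_field_tangent[OF X] smooth_field_tangent[OF Y] lc_tangent[OF W(1) X W(2) v] lc_tangent[OF W(1) Y W(2) v]
  note l = cot_sym2_linear[OF T]
  note s = cot_sym2_smooth[OF T] smooth_field_subset[OF X] smooth_field_subset[OF Y]
  show "tensorial_at p (\<lambda>U. vderiv v (\<lambda>q. T q (U q) (X q) (Y q)) - T p (lc M p v U) (X p) (Y p)
      - T p (U p) (lc M p v X) (Y p) - T p (U p) (X p) (lc M p v Y))"
    by (intro tensorial_diff tensorial_cov[OF W v] tensorial_point l(1) s t W(2))
  have "tensorial_at p (\<lambda>U. (vderiv v (\<lambda>q. T q (X q) (U q) (Y q)) - T p (X p) (lc M p v U) (Y p))
      - T p (lc M p v X) (U p) (Y p) - T p (X p) (U p) (lc M p v Y))"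
    by (intro tensorial_diff tensorial_cov[OF W v, of "\<lambda>q z. T q (X q) z (Y q)"] tensorial_point l(3) s t W(2))
  then show "tensorial_at p (\<lambda>U. vderiv v (\<lambda>q. T q (X q) (U q) (Y q)) - T p (lc M p v X) (U p) (Y p)
      - T p (X p) (lc M p v U) (Y p) - T p (X p) (U p) (lc M p v Y))"
    by (simp add: algebra_simps)
  have "tensorial_at p (\<lambda>U. (vderiv v (\<lambda>q. T q (X q) (Y q) (U q)) - T p (X p) (Y p) (lc M p v U))
      - T p (lc M p v X) (Y p) (U p) - T p (X p) (lc M p v Y) (U p))"
    by (intro tensorial_diff tensorial_cov[OF W v] tensorial_point l(2) s t W(2))
  then show "tensorial_at p (\<lambda>U. vderiv v (\<lambda>q. T q (X q) (Y q) (U q)) - T p (lc M p v X) (Y p) (U p)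
      - T p (X p) (lc M p v Y) (U p) - T p (X p) (Y p) (lc M p v U))"
    by (simp add: algebra_simps)
qed

lemma cov3_eq:
  assumes p: "p \<in> P" and v: "v \<in> TS p" and W: "open W" "p \<in> W"
    and U: "smooth_field (atlas M) W U" and X: "smooth_field (atlas M) W X" and Y: "smooth_field (atlas M) W Y"
  shows "cov3 M T p v (U p) (X p) (Y p) = v (\<lambda>q. T q (U q) (X q) (Y q)) - T p (lc M p v U) (X p) (Y p)
      - T p (U p) (lc M p v X) (Y p) - T p (U p) (X p) (lc M p v Y)"
proof -
  define N where "N U X Y = vderiv v (\<lambda>q. T q (U q) (X q) (Y q)) - T p (lc M p v U) (X p) (Y p)
      - T p (U p) (lc M p v X) (Y p) - T p (U p) (X p) (lc M p v Y)" for U X Y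
  note t = smooth_field_tangent[OF U W(2)] smooth_field_tangent[OF X W(2)] smooth_field_tangent[OF Y W(2)]
  let ?U = "extend_vector (atlas M) p (U p)" and ?X = "extend_vector (atlas M) p (X p)" and ?Y = "extend_vector (atlas M) p (Y p)"
  obtain V1 where V1: "open V1" "p \<in> V1" "smooth_field (atlas M) V1 ?U" "?U p = U p" using extend_vector[OF p t(1)] .
  obtain V2 where V2: "open V2" "p \<in> V2" "smooth_field (atlas M) V2 ?X" "?X p = X p" using extend_vector[OF p t(2)] .
  obtain V3 where V3: "open V3" "p \<in> V3" "smooth_field (atlas M) V3 ?Y" "?Y p = Y p" using extend_vector[OF p t(3)] .
  let ?V = "V1 \<inter> V2 \<inter> V3 \<inter> W"
  have V: "open ?V" "p \<in> ?V" using V1 V2 V3 W by auto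
  have S: "smooth_field (atlas M) ?V ?X" "smooth_field (atlas M) ?V ?Y" "smooth_field (atlas M) ?V U" "smooth_field (atlas M) ?V X"
    by (rule smooth_field_subset[OF V2(3)] smooth_field_subset[OF V3(3)] smooth_field_subset[OF U] smooth_field_subset[OF X]; blast)+
  have "cov3 M T p v (U p) (X p) (Y p) = N ?U ?X ?Y"
    unfolding cov3_def N_def Let_def vderiv_real V1(4) V2(4) V3(4) ..
  also have "\<dots> = N U ?X ?Y"
    unfolding N_def by (rule tensorial_extend[OF cov3_tensorial(1)[OF v V S(1,2)] p W U])
  also have "\<dots> = N U X ?Y"
    unfolding N_def by (rule tensorial_extend[OF cov3_tensorial(2)[OF v V S(3,2)] p W X])
  also have "\<dots> = N U X Y"
    unfolding N_def by (rule tensorial_extend[OF cov3_tensorial(3)[OF v V S(3,4)] p W Y])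
  finally show ?thesis unfolding N_def vderiv_real .
qed

lemma cov3_linear:
  assumes p: "p \<in> P" and "u \<in> TS p" "x \<in> TS p" "y \<in> TS p"
  shows "linear_tangent (TS p) (\<lambda>v. cov3 M T p v u x y)" "linear_tangent (TS p) (\<lambda>v. cov3 M T p y v u x)"
    "linear_tangent (TS p) (\<lambda>v. cov3 M T p u x y v)"
proof -
  let ?ext = "\<lambda>x. extend_vector (atlas M) p x"
  have ext: "\<exists>W. open W \<and> p \<in> W \<and> smooth_field (atlas M) W (?ext x) \<and> smooth_field (atlas M) W (?ext y)" 
    if xy: "x \<in> TS p" "y \<in> TS p" for x y
  proof -
    obtain V1 where V1: "open V1" "p \<in> V1" "smooth_field (atlas M) V1 (?ext x)" using extend_vector[OF p xy(1)] by blast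
    obtain V2 where V2: "open V2" "p \<in> V2" "smooth_field (atlas M) V2 (?ext y)" using extend_vector[OF p xy(2)] by blast
    show ?thesis
      by (rule exI[of _ "V1 \<inter> V2"]) (use V1 V2 smooth_field_subset[OF V1(3)] smooth_field_subset[OF V2(3)] in auto)
  qed
  have at: "?ext x p = x" if "x \<in> TS p" for x using extend_vector[OF p that] by blast
  note l = cot_sym2_linear[OF T]
  have lc: "linear_tangent (TS p) (\<lambda>v. L (lc M p v (?ext x)))" if "x \<in> TS p" "linear_tangent (TS p) L" for x and L :: "'m tvec \<Rightarrow> real"
    using ext[OF that(1,1)] lc_linear_compose[OF _ _ _ that(2)] by blast
  have "linear_tangent (TS p) (\<lambda>v. v f)" for f by (simp add: linear_tangent_def)
  then show "linear_tangent (TS p) (\<lambda>v. cov3 M T p v u x y)"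
    unfolding cov3_def Let_def
    by (intro linear_tangent_comb(2) lc[OF assms(2) l(1)] lc[OF assms(3) l(3)] lc[OF assms(4) l(2)] assms)
  obtain W where W: "open W" "p \<in> W" "smooth_field (atlas M) W (?ext u)" "smooth_field (atlas M) W (?ext x)"
    using ext[OF assms(2,3)] by blast
  show "linear_tangent (TS p) (\<lambda>v. cov3 M T p y v u x)"
    by (rule linear_tangent_eq[OF linear_tangent_tensorial[OF cov3_tensorial(1)[OF assms(4) W] p]])
      (use at assms in \<open>simp add: cov3_def Let_def vderiv_real\<close>)
  obtain W' where W': "open W'" "p \<in> W'" "smooth_field (atlas M) W' (?ext x)" "smooth_field (atlas M) W' (?ext y)"
    using ext[OF assms(3,4)] by blast
  show "linear_tangent (TS p) (\<lambda>v. cov3 M T p u x y v)"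
    by (rule linear_tangent_eq[OF linear_tangent_tensorial[OF cov3_tensorial(3)[OF assms(2) W'] p]])
      (use at assms in \<open>simp add: cov3_def Let_def vderiv_real\<close>)
qed

lemma smo_tmat: "smo (tmat T k)"
proof (rule smo_vec, rule smo_vec)
  fix i j show "smo (\<lambda>q. tmat T k q $ i $ j)"
    using cot_sym2_smooth[OF T open_domain frame_smooth frame_smooth frame_smooth] by (simp add: tmat_def)
qed

lemma cov3_frame:
  assumes p: "p \<in> P"
  shows "cov3 M T p (e l p) (e k p) (e i p) (e j p) = cov_tmat T l k p $ i $ j"
proof -
  note t = frame_tangent[OF p]
  have "dd l (tmat T k) p $ i $ j = e l p (\<lambda>q. T q (e k q) (e i q) (e j q))"
    unfolding dd_nth[OF p smo_tmat] dd_nth[OF p smo_nth[OF smo_tmat]]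
    by (simp add: fderiv_def vderiv_real tmat_def)
  moreover have "(\<Gamma> l p ** tmat T k p) $ i $ j = T p (e k p) (lc M p (e l p) (e i)) (e j p)"
    unfolding lc_frame[OF p] linear_tangent_sum[OF cot_sym2_linear(3)[OF T t t] t]
    by (simp add: matrix_matrix_mult_def tmat_def)
  moreover have "(tmat T k p ** transpose (\<Gamma> l p)) $ i $ j = T p (e k p) (e i p) (lc M p (e l p) (e j))"
    unfolding lc_frame[OF p] linear_tangent_sum[OF cot_sym2_linear(2)[OF T t t] t]
    by (simp add: matrix_matrix_mult_def tmat_def transpose_def mult.commute)
  moreover have "(\<Sum>m\<in>UNIV. \<Gamma> l p $ k $ m *\<^sub>R tmat T m p) $ i $ j = T p (lc M p (e l p) (e k)) (e i p) (e j p)"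
    unfolding lc_frame[OF p] linear_tangent_sum[OF cot_sym2_linear(1)[OF T t t] t]
    by (simp add: tmat_def)
  ultimately show ?thesis
    unfolding cov3_eq[OF p t open_domain p frame_smooth frame_smooth frame_smooth] cov_tmat_def by simp
qed

lemma neg_trace_frame:
  assumes p: "p \<in> P" and "x \<in> TS p" "y \<in> TS p"
  shows "neg_trace M T p x y = - (\<Sum>k\<in>UNIV. cov3 M T p (e k p) (e k p) x y)"
proof -
  have "(\<Sum>k\<in>UNIV. cov3 M T p (onb M p k) (onb M p k) x y) = (\<Sum>k\<in>UNIV. cov3 M T p (e k p) (e k p) x y)"
    by (rule trace_orthonormal[OF frame_orthonormal[OF p] onb_orthonormal[OF p]])
      (rule cov3_linear[OF p] | rule assms | assumption)+
  then show ?thesis by (simp add: neg_trace_def)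
qed

end

end

text \<open>By Gram-Schmidt, this holds on every Riemannian manifold. It is an assumption here
  because a spin structure comes with such frames.\<close>

locale framed_manifold = riemannian M
  for M :: "('m::{t2_space,second_countable_topology}, 'n::finite, 'z) riem_manifold_scheme" +
  assumes frames: "\<exists>P e. orthonormal_frame M P e \<and> p \<in> P"
begin

lemma frame_at:
  obtains P e where "orthonormal_frame M P e" "p \<in> P"
  using frames by blast

lemma cot_sym2_nabla:
  assumes h: "sym2_tensor (atlas M) h"
  shows "cot_sym2_tensor (atlas M) (nabla M h)"
  unfolding cot_sym2_tensor_def
proof (intro conjI allI ballI impI)
  fix p x y assume xy: "x \<in> TS p" "y \<in> TS p"
  obtain P e where f: "orthonormal_frame M P e" and p: "p \<in> P" using frame_at .
  interpret orthonormal_frame M P e by (rule f)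
  obtain V1 where V1: "open V1" "p \<in> V1" "smooth_field (atlas M) V1 (extend_vector (atlas M) p x)" "extend_vector (atlas M) p x p = x"
    using extend_vector[OF p xy(1)] .
  obtain V2 where V2: "open V2" "p \<in> V2" "smooth_field (atlas M) V2 (extend_vector (atlas M) p y)" "extend_vector (atlas M) p y p = y"
    using extend_vector[OF p xy(2)] .
  have "linear_tangent (TS p) (\<lambda>v. v f)" for f by (simp add: linear_tangent_def)
  then show "linear_tangent (TS p) (\<lambda>v. nabla M h p v x y)"
    unfolding nabla_def Let_def
    by (intro linear_tangent_comb(2) lc_linear_compose[OF V1(1-3)] lc_linear_compose[OF V2(1-3)]
        sym2_linear_left[OF h xy(2)] sym2_linear_right[OF h xy(1)])
  have at: "extend_vector (atlas M) p z p = z" if "z \<in> TS p" for z using extend_vector[OF p that] by blast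
  have sym: "nabla M h p u x y = nabla M h p u y x" if u: "u \<in> TS p" and x: "x \<in> TS p" and y: "y \<in> TS p" for u x y
  proof -
    obtain V1 where V1: "open V1" "p \<in> V1" "smooth_field (atlas M) V1 (extend_vector (atlas M) p x)" "extend_vector (atlas M) p x p = x"
      using extend_vector[OF p x] .
    obtain V2 where V2: "open V2" "p \<in> V2" "smooth_field (atlas M) V2 (extend_vector (atlas M) p y)" "extend_vector (atlas M) p y p = y"
      using extend_vector[OF p y] .
    let ?X = "extend_vector (atlas M) p x" and ?Y = "extend_vector (atlas M) p y" and ?V = "V1 \<inter> V2"
    have S: "smooth_field (atlas M) ?V ?X" "smooth_field (atlas M) ?V ?Y" and V: "open ?V" "p \<in> ?V"
      using smooth_field_subset[OF V1(3)] smooth_field_subset[OF V2(3)] V1 V2 by auto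
    have "vderiv u (\<lambda>q. h q (?X q) (?Y q)) = vderiv u (\<lambda>q. h q (?Y q) (?X q))"
      by (rule vderiv_cong[OF u V sym2_smooth[OF h V(1) S]])
        (rule sym2_sym[OF h smooth_field_tangent[OF S(1)] smooth_field_tangent[OF S(2)]])
    then show ?thesis
      unfolding nabla_def Let_def vderiv_real
      using sym2_sym[OF h lc_tangent[OF V1(1,3,2) u] y] sym2_sym[OF h x lc_tangent[OF V2(1,3,2) u]] by simp
  qed
  have "linear_tangent (TS p) (\<lambda>z. nabla M h p x z y)"
    by (rule linear_tangent_eq[OF linear_tangent_tensorial[OF nabla_tensorial[OF h p xy(1) V2(1-3)] p]])
      (use at xy in \<open>simp add: nabla_def Let_def vderiv_real\<close>)
  then show "linear_tangent (TS p) (nabla M h p x y)"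
    by (rule linear_tangent_eq) (rule sym[OF xy])
  show "nabla M h p v x y = nabla M h p v y x" if "v \<in> TS p" for v
    by (rule sym[OF that xy])
next
  fix W V X Y assume W: "open W \<and> smooth_field (atlas M) W V \<and> smooth_field (atlas M) W X \<and> smooth_field (atlas M) W Y"
  have "smooth_map (atlas M) W (\<lambda>p. V p (\<lambda>q. h q (X q) (Y q)) - h p (lc M p (V p) X) (Y p) - h p (X p) (lc M p (V p) Y))"
    by (intro smooth_map_diff smooth_field_apply[of W V] sym2_smooth[OF h] lc_smooth) (use W in auto)
  then show "smooth_map (atlas M) W (\<lambda>p. nabla M h p (V p) (X p) (Y p))"
  proof (rule smooth_map_cong[rotated 2])
    fix p assume pW: "p \<in> W"
    obtain P e where f: "orthonormal_frame M P e" and p: "p \<in> P" using frame_at .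
    interpret orthonormal_frame M P e by (rule f)
    show "V p (\<lambda>q. h q (X q) (Y q)) - h p (lc M p (V p) X) (Y p) - h p (X p) (lc M p (V p) Y) = nabla M h p (V p) (X p) (Y p)"
      by (rule nabla_eq[OF h p _ _ pW, symmetric]) (use W pW smooth_field_tangent in auto)
  qed (use W in auto)
qed

lemma sym2_neg_trace:
  assumes T: "cot_sym2_tensor (atlas M) T"
  shows "sym2_tensor (atlas M) (neg_trace M T)"
  unfolding sym2_tensor_def
proof (intro conjI allI ballI impI)
  fix p x assume x: "x \<in> TS p"
  obtain P e where f: "orthonormal_frame M P e" and p: "p \<in> P" using frame_at .
  interpret orthonormal_frame M P e by (rule f)
  have "linear_tangent (TS p) (\<lambda>y. (-1) *\<^sub>R (\<Sum>k\<in>UNIV. cov3 M T p (onb M p k) (onb M p k) x y))"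
    using onb_orthonormal[OF p]
    by (intro linear_tangent_scale linear_tangent_sumI cov3_linear(3)[OF T p] x) (auto simp: orthonormal_def)
  then show "linear_tangent (TS p) (neg_trace M T p x)" by (simp add: neg_trace_def[abs_def])
  fix y assume y: "y \<in> TS p"
  have "cov3 M T p u u x y = cov3 M T p u u y x" if u: "u \<in> TS p" for u
  proof -
    obtain V0 where V0: "open V0" "p \<in> V0" "smooth_field (atlas M) V0 (extend_vector (atlas M) p u)" "extend_vector (atlas M) p u p = u"
      using extend_vector[OF p u] .
    obtain V1 where V1: "open V1" "p \<in> V1" "smooth_field (atlas M) V1 (extend_vector (atlas M) p x)" "extend_vector (atlas M) p x p = x"
      using extend_vector[OF p x] .
    obtain V2 where V2: "open V2" "p \<in> V2" "smooth_field (atlas M) V2 (extend_vector (atlas M) p y)" "extend_vector (atlas M) p y p = y"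
      using extend_vector[OF p y] .
    let ?U = "extend_vector (atlas M) p u" and ?X = "extend_vector (atlas M) p x" and ?Y = "extend_vector (atlas M) p y" and ?V = "V0 \<inter> V1 \<inter> V2"
    have V: "open ?V" "p \<in> ?V" using V0 V1 V2 by auto
    have S: "smooth_field (atlas M) ?V ?U" "smooth_field (atlas M) ?V ?X" "smooth_field (atlas M) ?V ?Y"
      by (rule smooth_field_subset[OF V0(3)] smooth_field_subset[OF V1(3)] smooth_field_subset[OF V2(3)]; blast)+
    have "vderiv u (\<lambda>q. T q (?U q) (?X q) (?Y q)) = vderiv u (\<lambda>q. T q (?U q) (?Y q) (?X q))"
      by (rule vderiv_cong[OF u V cot_sym2_smooth[OF T V(1) S]])
        (rule cot_sym2_sym[OF T smooth_field_tangent[OF S(1)] smooth_field_tangent[OF S(2)] smooth_field_tangent[OF S(3)]])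
    then show ?thesis
      unfolding cov3_def Let_def vderiv_real
      using cot_sym2_sym[OF T u lc_tangent[OF V1(1,3,2) u] y] cot_sym2_sym[OF T u x lc_tangent[OF V2(1,3,2) u]]
        cot_sym2_sym[OF T lc_tangent[OF V0(1,3,2) u] x y] by simp
  qed
  then show "neg_trace M T p x y = neg_trace M T p y x"
    using onb_orthonormal[OF p] by (simp add: neg_trace_def orthonormal_def)
next
  fix W X Y assume W: "open W \<and> smooth_field (atlas M) W X \<and> smooth_field (atlas M) W Y"
  show "smooth_map (atlas M) W (\<lambda>p. neg_trace M T p (X p) (Y p))"
  proof (rule smooth_map_local)
    fix p assume pW: "p \<in> W"
    obtain P e where f: "orthonormal_frame M P e" and p: "p \<in> P" using frame_at .
    interpret orthonormal_frame M P e by (rule f)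
    let ?V = "W \<inter> P"
    have V: "open ?V" using W open_domain by auto
    have S: "smooth_field (atlas M) ?V X" "smooth_field (atlas M) ?V Y" "smooth_field (atlas M) ?V (e k)" for k
      using W frame_smooth by (auto intro: smooth_field_subset)
    have "smooth_map (atlas M) ?V (\<lambda>p. - (\<Sum>k\<in>UNIV. e k p (\<lambda>q. T q (e k q) (X q) (Y q)) - T p (lc M p (e k p) (e k)) (X p) (Y p)
      - T p (e k p) (lc M p (e k p) X) (Y p) - T p (e k p) (X p) (lc M p (e k p) Y)))"
      by (intro smooth_map_uminus smooth_map_sum smooth_map_diff V cot_sym2_smooth[OF T V] lc_smooth[OF V] S
          smooth_field_apply[OF S(3) V order_refl])
    then have "smooth_map (atlas M) ?V (\<lambda>p. neg_trace M T p (X p) (Y p))"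
    proof (rule smooth_map_cong[rotated 2])
      fix p assume pV: "p \<in> ?V"
      then have p: "p \<in> P" by simp
      show "- (\<Sum>k\<in>UNIV. e k p (\<lambda>q. T q (e k q) (X q) (Y q)) - T p (lc M p (e k p) (e k)) (X p) (Y p)
        - T p (e k p) (lc M p (e k p) X) (Y p) - T p (e k p) (X p) (lc M p (e k p) Y)) = neg_trace M T p (X p) (Y p)"
        unfolding neg_trace_frame[OF T p smooth_field_tangent[OF S(1) pV] smooth_field_tangent[OF S(2) pV]]
          cov3_eq[OF T p frame_tangent[OF p] V pV S(3) S(1,2)] ..
    qed (rule V)
    then show "\<exists>V. open V \<and> p \<in> V \<and> smooth_map (atlas M) V (\<lambda>p. neg_trace M T p (X p) (Y p))"
      using V pW p by blast
  qed
qed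

end

section \<open>The Ricci identity and integration by parts for tensors\<close>

context orthonormal_frame
begin

lemma tmat_nabla:
  assumes h: "sym2_tensor (atlas M) h" and p: "p \<in> P"
  shows "tmat (nabla M h) k p = dd k (hmat h) p - \<Gamma> k p ** hmat h p + hmat h p ** \<Gamma> k p"
  unfolding tmat_def nabla_frame[OF h p] christoffel_transpose[OF p] by (simp add: matrix_mult_simps)

text \<open>Derivatives along frame vectors commute up to the structure functions, and the
  resulting first derivatives of \<open>h\<close> are those in the directions
  \<open>\<nabla>\<^sub>l e\<^sub>k - \<nabla>\<^sub>k e\<^sub>l\<close>. What remains are
  products of the components of \<open>h\<close> with the terms of the curvature matrix.\<close>

lemma ricci_identity:
  assumes h: "sym2_tensor (atlas M) h" and p: "p \<in> P"
  shows "cov_tmat (nabla M h) l k p - cov_tmat (nabla M h) k l p =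
    Rm l k p ** hmat h p + hmat h p ** transpose (Rm l k p)"
proof -
  let ?H = "hmat h" and ?T = "tmat (nabla M h)"
  note H = smo_hmat[OF h] and G = smo_christoffel
  note bil = bilinear_matrix_mult
  have T: "dd l (?T k) p = dd l (dd k ?H) p - (\<Gamma> k p ** dd l ?H p + dd l (\<Gamma> k) p ** ?H p)
      + (?H p ** dd l (\<Gamma> k) p + dd l ?H p ** \<Gamma> k p)" for l k
  proof -
    have "dd l (?T k) p = dd l (\<lambda>q. dd k ?H q - \<Gamma> k q ** ?H q + ?H q ** \<Gamma> k q) p"
      by (rule dd_cong[OF p, symmetric]) (intro smo_add smo_diff smo_bilinear[OF bil] smo_dd H G, simp add: tmat_nabla[OF h])
    also have "\<dots> = dd l (\<lambda>q. dd k ?H q - \<Gamma> k q ** ?H q) p + dd l (\<lambda>q. ?H q ** \<Gamma> k q) p"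
      by (rule dd_add[OF p]) (intro smo_add smo_diff smo_bilinear[OF bil] smo_dd H G)+
    also have "dd l (\<lambda>q. dd k ?H q - \<Gamma> k q ** ?H q) p = dd l (dd k ?H) p - dd l (\<lambda>q. \<Gamma> k q ** ?H q) p"
      by (rule dd_diff[OF p]) (intro smo_add smo_diff smo_bilinear[OF bil] smo_dd H G)+
    finally show ?thesis
      by (simp add: dd_bilinear[OF bil p G H] dd_bilinear[OF bil p H G])
  qed
  have c: "dd l (dd k ?H) p = dd k (dd l ?H) p + (\<Sum>m\<in>UNIV. struct l k m p *\<^sub>R dd m ?H p)"
    using dd_commute[OF p H, of l k] by (simp add: algebra_simps)
  have s: "(\<Sum>m\<in>UNIV. \<Gamma> l p $ k $ m *\<^sub>R ?T m p) - (\<Sum>m\<in>UNIV. \<Gamma> k p $ l $ m *\<^sub>R ?T m p) =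
      (\<Sum>m\<in>UNIV. struct l k m p *\<^sub>R dd m ?H p) - (\<Sum>m\<in>UNIV. struct l k m p *\<^sub>R \<Gamma> m p) ** ?H p
      + ?H p ** (\<Sum>m\<in>UNIV. struct l k m p *\<^sub>R \<Gamma> m p)"
  proof -
    have "(\<Sum>m\<in>UNIV. \<Gamma> l p $ k $ m *\<^sub>R ?T m p) - (\<Sum>m\<in>UNIV. \<Gamma> k p $ l $ m *\<^sub>R ?T m p) =
        (\<Sum>m\<in>UNIV. struct l k m p *\<^sub>R ?T m p)"
      by (simp only: struct_def scaleR_diff_left sum_subtractf)
    also have "\<dots> = (\<Sum>m\<in>UNIV. struct l k m p *\<^sub>R dd m ?H p - (struct l k m p *\<^sub>R \<Gamma> m p) ** ?H p
        + ?H p ** (struct l k m p *\<^sub>R \<Gamma> m p))"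
      by (simp only: tmat_nabla[OF h p] matrix_mult_simps scaleR_add_right scaleR_diff_right)
    finally show ?thesis by (simp only: sum.distrib sum_subtractf matrix_mult_simps)
  qed
  have tr: "transpose (Rm l k p) = - Rm l k p"
    by (simp add: transpose_def vec_eq_iff) (metis curv_matrix_transpose[OF p])
  define S where "S = (\<Sum>m\<in>UNIV. struct l k m p *\<^sub>R \<Gamma> m p)"
  define D where "D = (\<Sum>m\<in>UNIV. struct l k m p *\<^sub>R dd m ?H p)"
  note fold = S_def[symmetric] D_def[symmetric]
  have R: "Rm l k p = dd k (\<Gamma> l) p - dd l (\<Gamma> k) p + \<Gamma> l p ** \<Gamma> k p - \<Gamma> k p ** \<Gamma> l p + S"
    using curv_matrix_formula[OF p, of l k] by (simp only: fold)
  have "cov_tmat (nabla M h) l k p - cov_tmat (nabla M h) k l p =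
      dd l (?T k) p - dd k (?T l) p - (\<Gamma> l p ** ?T k p - \<Gamma> k p ** ?T l p) + (?T k p ** \<Gamma> l p - ?T l p ** \<Gamma> k p)
      - ((\<Sum>m\<in>UNIV. \<Gamma> l p $ k $ m *\<^sub>R ?T m p) - (\<Sum>m\<in>UNIV. \<Gamma> k p $ l $ m *\<^sub>R ?T m p))"
    unfolding cov_tmat_def christoffel_transpose[OF p] matrix_mult_simps by simp
  also have "\<dots> = dd l (?T k) p - dd k (?T l) p - (\<Gamma> l p ** ?T k p - \<Gamma> k p ** ?T l p) + (?T k p ** \<Gamma> l p - ?T l p ** \<Gamma> k p)
      - (D - S ** ?H p + ?H p ** S)"
    unfolding s fold ..
  also have "\<dots> = Rm l k p ** ?H p - ?H p ** Rm l k p"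
    unfolding T c[unfolded fold] R tmat_nabla[OF h p]
    by (simp only: matrix_mult_simps matrix_mul_assoc) simp
  finally show ?thesis unfolding tr matrix_mult_simps by simp
qed

end

subsection \<open>Inner products of tensors\<close>

context riemannian
begin

text \<open>The basis is changed in one index after the other.\<close>

lemma double_trace:
  assumes b: "orthonormal p b" and c: "orthonormal p c"
    and H: "\<And>x. x \<in> TS p \<Longrightarrow> linear_tangent (TS p) (H x)" "\<And>x. x \<in> TS p \<Longrightarrow> linear_tangent (TS p) (\<lambda>y. H y x)"
    and K: "\<And>x. x \<in> TS p \<Longrightarrow> linear_tangent (TS p) (K x)" "\<And>x. x \<in> TS p \<Longrightarrow> linear_tangent (TS p) (\<lambda>y. K y x)"
  shows "(\<Sum>i\<in>UNIV. \<Sum>j\<in>UNIV. H (c i) (c j) * K (c i) (c j)) = (\<Sum>i\<in>UNIV. \<Sum>j\<in>UNIV. H (b i) (b j) * K (b i) (b j) :: real)"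
proof -
  have t: "b i \<in> TS p" "c i \<in> TS p" for i using b c by (auto simp: orthonormal_def)
  have "(\<Sum>j\<in>UNIV. H (c i) (c j) * K (c i) (c j)) = (\<Sum>j\<in>UNIV. H (c i) (b j) * K (c i) (b j))" for i
    using H(1)[OF t(2)] K(1)[OF t(2)]
    by (intro trace_orthonormal[OF b c, of "\<lambda>x y. H (c i) x * K (c i) y"])
      (auto simp: linear_tangent_def algebra_simps)
  then have "(\<Sum>i\<in>UNIV. \<Sum>j\<in>UNIV. H (c i) (c j) * K (c i) (c j)) = (\<Sum>j\<in>UNIV. \<Sum>i\<in>UNIV. H (c i) (b j) * K (c i) (b j))"
    by (simp add: sum.swap[of "\<lambda>j i. H (c i) (b j) * K (c i) (b j)"])
  also have "(\<Sum>i\<in>UNIV. H (c i) (b j) * K (c i) (b j)) = (\<Sum>i\<in>UNIV. H (b i) (b j) * K (b i) (b j))" for j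
    using H(2)[OF t(1)] K(2)[OF t(1)]
    by (intro trace_orthonormal[OF b c, of "\<lambda>x y. H x (b j) * K y (b j)"])
      (auto simp: linear_tangent_def algebra_simps)
  then have "(\<Sum>j\<in>UNIV. \<Sum>i\<in>UNIV. H (c i) (b j) * K (c i) (b j)) = (\<Sum>j\<in>UNIV. \<Sum>i\<in>UNIV. H (b i) (b j) * K (b i) (b j))"
    by simp
  finally show ?thesis by (simp add: sum.swap[of "\<lambda>j i. H (b i) (b j) * K (b i) (b j)"])
qed

end

lemma inner_matrix: "A \<bullet> B = (\<Sum>i\<in>UNIV. \<Sum>j\<in>UNIV. A $ i $ j * B $ i $ j)" for A B :: "real^'n::finite^'m::finite"
  by (simp add: inner_vec_def)

text \<open>With these rules, the connection matrices cancel in the derivative of an inner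
  product.\<close>

lemma inner_matrix_mult_skew:
  fixes G H K :: "real^'n::finite^'n"
  assumes "transpose G = - G"
  shows "(G ** H) \<bullet> K = - (H \<bullet> (G ** K))" "(H ** G) \<bullet> K = - (H \<bullet> (K ** G))"
proof -
  have G: "G $ i $ j = - G $ j $ i" for i j
    using assms by (metis (mono_tags) transpose_def vec_lambda_beta vector_uminus_component)
  have "(G ** H) \<bullet> K = (\<Sum>i\<in>UNIV. \<Sum>r\<in>UNIV. \<Sum>j\<in>UNIV. G $ i $ r * H $ r $ j * K $ i $ j)"
    unfolding inner_matrix matrix_matrix_mult_def
    by (rule sum.cong[OF refl], subst sum.swap) (simp add: sum_distrib_right)
  also have "\<dots> = (\<Sum>r\<in>UNIV. \<Sum>i\<in>UNIV. \<Sum>j\<in>UNIV. - (H $ r $ j * (G $ r $ i * K $ i $ j)))"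
    by (subst sum.swap) (intro sum.cong refl, subst G, simp)
  also have "\<dots> = (\<Sum>r\<in>UNIV. \<Sum>j\<in>UNIV. \<Sum>i\<in>UNIV. - (H $ r $ j * (G $ r $ i * K $ i $ j)))"
    by (rule sum.cong[OF refl], rule sum.swap)
  also have "\<dots> = - (H \<bullet> (G ** K))"
    unfolding inner_matrix matrix_matrix_mult_def by (simp add: sum_distrib_left sum_negf)
  finally show "(G ** H) \<bullet> K = - (H \<bullet> (G ** K))" .
  have "(H ** G) \<bullet> K = (\<Sum>i\<in>UNIV. \<Sum>r\<in>UNIV. \<Sum>j\<in>UNIV. H $ i $ r * G $ r $ j * K $ i $ j)"
    unfolding inner_matrix matrix_matrix_mult_def
    by (rule sum.cong[OF refl], subst sum.swap) (simp add: sum_distrib_right)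
  also have "\<dots> = (\<Sum>i\<in>UNIV. \<Sum>r\<in>UNIV. \<Sum>j\<in>UNIV. - (H $ i $ r * (K $ i $ j * G $ j $ r)))"
    by (intro sum.cong refl, subst G, simp)
  also have "\<dots> = - (H \<bullet> (K ** G))"
    unfolding inner_matrix matrix_matrix_mult_def by (simp add: sum_distrib_left sum_negf)
  finally show "(H ** G) \<bullet> K = - (H \<bullet> (K ** G))" .
qed

text \<open>The 1-form whose divergence appears when the covariant derivative is integrated by
  parts.\<close>

definition contraction :: "('m::topological_space, 'n::finite, 'z) riem_manifold_scheme \<Rightarrow> 'm tensor2 \<Rightarrow>
    'm tensor3 \<Rightarrow> 'm \<Rightarrow> 'm tvec \<Rightarrow> real" where
  "contraction M s T q u = inner_tensor2 M s (\<lambda>q. T q u) q"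

context orthonormal_frame
begin

lemma inner_tensor2_frame:
  assumes s: "sym2_tensor (atlas M) s" and p: "p \<in> P"
    and K: "\<And>x. x \<in> TS p \<Longrightarrow> linear_tangent (TS p) (K p x)" "\<And>x. x \<in> TS p \<Longrightarrow> linear_tangent (TS p) (\<lambda>y. K p y x)"
  shows "inner_tensor2 M s K p = hmat s p \<bullet> (\<chi> i j. K p (e i p) (e j p))"
  unfolding inner_tensor2_def inner_matrix hmat_def vec_lambda_beta
  by (rule double_trace[OF frame_orthonormal[OF p] onb_orthonormal[OF p]])
    (intro sym2_linear_left[OF s] sym2_linear_right[OF s] K; assumption)+

context
  fixes s T assumes s: "sym2_tensor (atlas M) s" and T: "cot_sym2_tensor (atlas M) T"
begin

lemma contraction_frame:
  assumes p: "p \<in> P" and u: "u \<in> TS p"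
  shows "contraction M s T p u = hmat s p \<bullet> (\<chi> i j. T p u (e i p) (e j p))"
  unfolding contraction_def
  by (rule inner_tensor2_frame[OF s p, of "\<lambda>q. T q u"]) (rule cot_sym2_linear[OF T u], assumption)+

lemma inner_tensor3_frame:
  assumes S: "cot_sym2_tensor (atlas M) S" and p: "p \<in> P"
  shows "inner_tensor3 M S T p = (\<Sum>k\<in>UNIV. tmat S k p \<bullet> tmat T k p)"
proof -
  let ?b = "onb M p"
  note on = frame_orthonormal[OF p] onb_orthonormal[OF p]
  have t: "?b i \<in> TS p" for i using on by (simp add: orthonormal_def)
  have "inner_tensor3 M S T p = (\<Sum>k\<in>UNIV. \<Sum>i\<in>UNIV. \<Sum>j\<in>UNIV. S p (?b k) (e i p) (e j p) * T p (?b k) (e i p) (e j p))"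
    unfolding inner_tensor3_def
    by (intro sum.cong refl double_trace[OF on]) (rule cot_sym2_linear[OF T t] cot_sym2_linear[OF S t], assumption)+
  also have "\<dots> = (\<Sum>k\<in>UNIV. \<Sum>i\<in>UNIV. \<Sum>j\<in>UNIV. S p (e k p) (e i p) (e j p) * T p (e k p) (e i p) (e j p))"
  proof (rule trace_orthonormal[OF on, of "\<lambda>x y. \<Sum>i\<in>UNIV. \<Sum>j\<in>UNIV. S p x (e i p) (e j p) * T p y (e i p) (e j p)"])
    fix y assume y: "y \<in> TS p"
    show "linear_tangent (TS p) (\<lambda>x. \<Sum>i\<in>UNIV. \<Sum>j\<in>UNIV. S p x (e i p) (e j p) * T p y (e i p) (e j p))"
      using cot_sym2_linear(1)[OF S frame_tangent[OF p] frame_tangent[OF p]]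
      by (intro linear_tangent_sumI) (simp add: linear_tangent_def algebra_simps)
    show "linear_tangent (TS p) (\<lambda>x. \<Sum>i\<in>UNIV. \<Sum>j\<in>UNIV. S p y (e i p) (e j p) * T p x (e i p) (e j p))"
      using linear_tangent_scale[OF cot_sym2_linear(1)[OF T frame_tangent[OF p] frame_tangent[OF p]]]
      by (intro linear_tangent_sumI) simp
  qed
  finally show ?thesis by (simp add: inner_matrix tmat_def)
qed

lemma hmat_neg_trace:
  assumes p: "p \<in> P"
  shows "hmat (neg_trace M T) p = - (\<Sum>k\<in>UNIV. cov_tmat T k k p)"
  by (simp add: hmat_def vec_eq_iff neg_trace_frame[OF T p frame_tangent[OF p] frame_tangent[OF p]] cov3_frame[OF T p])

text \<open>By the product rule; the connection matrices acting on the last two indices are moved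
  from one factor to the other, and that acting on the first index is the one in the
  divergence.\<close>

lemma divergence_contraction_frame:
  assumes c: "one_form (atlas M) (contraction M s T)" and S: "cot_sym2_tensor (atlas M) (nabla M s)"
    and N: "sym2_tensor (atlas M) (neg_trace M T)" and p: "p \<in> P"
  shows "divergence M (contraction M s T) p = inner_tensor3 M (nabla M s) T p - inner_tensor2 M s (neg_trace M T) p"
proof -
  let ?H = "hmat s" and ?T = "tmat T"
  have cf: "contraction M s T q (e k q) = ?H q \<bullet> ?T k q" if "q \<in> P" for q k
    using contraction_frame[OF that frame_tangent[OF that]] by (simp add: tmat_def)
  have d: "dd k (\<lambda>q. contraction M s T q (e k q)) p = dd k ?H p \<bullet> ?T k p + ?H p \<bullet> dd k (?T k) p" for k
  proof -
    have "dd k (\<lambda>q. contraction M s T q (e k q)) p = dd k (\<lambda>q. ?H q \<bullet> ?T k q) p"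
      by (rule dd_cong[OF p one_form_smooth[OF c open_domain frame_smooth] cf])
    then show ?thesis
      using dd_bilinear[OF bounded_bilinear_inner p smo_hmat[OF s] smo_tmat[OF T]] by simp
  qed
  have "dd k ?H p \<bullet> ?T k p + ?H p \<bullet> dd k (?T k) p - (\<Sum>m\<in>UNIV. \<Gamma> k p $ k $ m * (?H p \<bullet> ?T m p)) =
      tmat (nabla M s) k p \<bullet> ?T k p + ?H p \<bullet> cov_tmat T k k p" for k
  proof -
    note sk = inner_matrix_mult_skew[OF christoffel_transpose[OF p, of k]]
    show ?thesis
      unfolding tmat_nabla[OF s p] cov_tmat_def christoffel_transpose[OF p] matrix_mult_simps
      by (simp add: inner_add_left inner_add_right inner_diff_left inner_diff_right inner_sum_right sk)
  qed
  moreover have "inner_tensor2 M s (neg_trace M T) p = hmat s p \<bullet> hmat (neg_trace M T) p"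
    unfolding hmat_def[of "neg_trace M T"]
    by (rule inner_tensor2_frame[OF s p]) (rule sym2_linear_right[OF N] sym2_linear_left[OF N], assumption)+
  ultimately show ?thesis
    unfolding divergence_frame[OF c p] d cf[OF p] inner_tensor3_frame[OF S p]
    by (simp add: hmat_neg_trace[OF p] inner_sum_right sum.distrib)
qed

end

subsection \<open>The action of the curvature on 2-tensors\<close>

text \<open>The curvature is tensorial in each of its three fields, which are replaced by frame
  fields one at a time.\<close>

lemma riem_curv_frame:
  assumes p: "p \<in> P" and x: "x \<in> TS p" and y: "y \<in> TS p" and z: "z \<in> TS p" and w: "w \<in> TS p"
  shows "riem_curv M p x y z w = (\<Sum>k\<in>UNIV. \<Sum>l\<in>UNIV. \<Sum>i\<in>UNIV. \<Sum>m\<in>UNIV.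
    metric M p x (e k p) * metric M p y (e l p) * metric M p z (e i p) * metric M p w (e m p) * Rm k l p $ i $ m)"
proof -
  let ?X = "extend_vector (atlas M) p x" and ?Y = "extend_vector (atlas M) p y" and ?Z = "extend_vector (atlas M) p z"
  obtain V1 where V1: "open V1" "p \<in> V1" "smooth_field (atlas M) V1 ?X" using extend_vector[OF p x] .
  obtain V2 where V2: "open V2" "p \<in> V2" "smooth_field (atlas M) V2 ?Y" using extend_vector[OF p y] .
  obtain V3 where V3: "open V3" "p \<in> V3" "smooth_field (atlas M) V3 ?Z" using extend_vector[OF p z] .
  let ?V = "V1 \<inter> V2 \<inter> V3 \<inter> P"
  have V: "open ?V" "p \<in> ?V" using V1 V2 V3 p open_domain by auto
  have S: "smooth_field (atlas M) ?V ?X" "smooth_field (atlas M) ?V ?Y" "smooth_field (atlas M) ?V ?Z" "smooth_field (atlas M) ?V (e k)" for k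
    by (rule smooth_field_subset[OF V1(3)] smooth_field_subset[OF V2(3)] smooth_field_subset[OF V3(3)] smooth_field_subset[OF frame_smooth]; blast)+
  define R where "R X Y Z = metric M p (curvature_op M X Y Z p) w" for X Y Z
  note lin = metric_linear_left[OF w]
  have T: "curvature_op M X Y Z p \<in> TS p" if "open W" "p \<in> W" "smooth_field (atlas M) W X" "smooth_field (atlas M) ?V Y" "smooth_field (atlas M) ?V Z" for W X Y Z
    by (rule curvature_op_tangent[of "W \<inter> ?V"])
      (use V that(1,2) in \<open>auto intro: smooth_field_subset[OF that(3)] smooth_field_subset[OF that(4)] smooth_field_subset[OF that(5)]\<close>)
  have T': "curvature_op M X Y Z p \<in> TS p" if "open W" "p \<in> W" "smooth_field (atlas M) ?V X" "smooth_field (atlas M) W Y" "smooth_field (atlas M) ?V Z" for W X Y Z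
    by (rule curvature_op_tangent[of "W \<inter> ?V"])
      (use V that(1,2) in \<open>auto intro: smooth_field_subset[OF that(3)] smooth_field_subset[OF that(4)] smooth_field_subset[OF that(5)]\<close>)
  have T'': "curvature_op M X Y Z p \<in> TS p" if "open W" "p \<in> W" "smooth_field (atlas M) ?V X" "smooth_field (atlas M) ?V Y" "smooth_field (atlas M) W Z" for W X Y Z
    by (rule curvature_op_tangent[of "W \<inter> ?V"])
      (use V that(1,2) in \<open>auto intro: smooth_field_subset[OF that(3)] smooth_field_subset[OF that(4)] smooth_field_subset[OF that(5)]\<close>)
  have t1: "tensorial_at p (\<lambda>X. R X Y Z)" if "smooth_field (atlas M) ?V Y" "smooth_field (atlas M) ?V Z" for Y Z
    unfolding R_def by (rule tensorial_tvec[OF curvature_op_tensorial_left[OF V that] lin T[OF _ _ _ that]])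
  have t2: "tensorial_at p (\<lambda>Y. R X Y Z)" if "smooth_field (atlas M) ?V X" "smooth_field (atlas M) ?V Z" for X Z
    unfolding R_def by (rule tensorial_tvec[OF curvature_op_tensorial_middle[OF V that] lin T'[OF _ _ that(1) _ that(2)]])
  have t3: "tensorial_at p (\<lambda>Z. R X Y Z)" if "smooth_field (atlas M) ?V X" "smooth_field (atlas M) ?V Y" for X Y
    unfolding R_def by (rule tensorial_tvec[OF curvature_op_tensorial_right[OF V that] lin T''[OF _ _ that]])
  have m: "R (e k) (e l) (e i) = (\<Sum>m\<in>UNIV. metric M p w (e m p) * Rm k l p $ i $ m)" for k l i
    unfolding R_def curv_matrix_def vec_lambda_beta
    using linear_orthonormal_expand[OF frame_orthonormal[OF p] w
        metric_linear_right[OF curvature_op_tangent[OF open_domain p frame_smooth frame_smooth frame_smooth]]] by simp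
  have "riem_curv M p x y z w = R ?X ?Y ?Z" unfolding riem_curv_def R_def ..
  also have "\<dots> = (\<Sum>k\<in>UNIV. metric M p x (e k p) * R (e k) ?Y ?Z)"
    using tensorial_extend_expand[OF t1[OF S(2,3)] p x] by simp
  also have "\<dots> = (\<Sum>k\<in>UNIV. metric M p x (e k p) * (\<Sum>l\<in>UNIV. metric M p y (e l p) * R (e k) (e l) ?Z))"
    using tensorial_extend_expand[OF t2[OF S(4,3)] p y] by simp
  also have "\<dots> = (\<Sum>k\<in>UNIV. metric M p x (e k p) * (\<Sum>l\<in>UNIV. metric M p y (e l p) * (\<Sum>i\<in>UNIV. metric M p z (e i p) * R (e k) (e l) (e i))))"
    using tensorial_extend_expand[OF t3[OF S(4,4)] p z] by simp
  finally show ?thesis unfolding m by (simp add: sum_distrib_left mult.assoc)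
qed

lemma riem_curv_linear:
  assumes p: "p \<in> P" and x: "x \<in> TS p" and y: "y \<in> TS p" and z: "z \<in> TS p"
  shows "linear_tangent (TS p) (\<lambda>w. riem_curv M p w x y z)" "linear_tangent (TS p) (\<lambda>w. riem_curv M p x w y z)"
    "linear_tangent (TS p) (\<lambda>w. riem_curv M p x y w z)" "linear_tangent (TS p) (riem_curv M p x y z)"
proof -
  note l = metric_linear_left[OF frame_tangent[OF p], unfolded linear_tangent_def]
  show "linear_tangent (TS p) (\<lambda>w. riem_curv M p w x y z)"
    by (rule linear_tangent_eq[rotated], rule riem_curv_frame[OF p _ x y z], assumption, intro linear_tangent_sumI)
      (use l in \<open>simp add: linear_tangent_def algebra_simps\<close>)
  show "linear_tangent (TS p) (\<lambda>w. riem_curv M p x w y z)"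
    by (rule linear_tangent_eq[rotated], rule riem_curv_frame[OF p x _ y z], assumption, intro linear_tangent_sumI)
      (use l in \<open>simp add: linear_tangent_def algebra_simps\<close>)
  show "linear_tangent (TS p) (\<lambda>w. riem_curv M p x y w z)"
    by (rule linear_tangent_eq[rotated], rule riem_curv_frame[OF p x y _ z], assumption, intro linear_tangent_sumI)
      (use l in \<open>simp add: linear_tangent_def algebra_simps\<close>)
  show "linear_tangent (TS p) (riem_curv M p x y z)"
    by (rule linear_tangent_eq[rotated], rule riem_curv_frame[OF p x y z], assumption, intro linear_tangent_sumI)
      (use l in \<open>simp add: linear_tangent_def algebra_simps\<close>)
qed

lemma sum_delta_mult: "(\<Sum>k\<in>UNIV. (if a = k then 1 else 0) * f k) = (f a :: real)" for a :: "'l::finite"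
  by (simp add: if_distrib[of "\<lambda>x. x * _"] cong: if_cong)

lemma riem_curv_frame_frame:
  assumes p: "p \<in> P"
  shows "riem_curv M p (e k p) (e l p) (e i p) (e m p) = Rm k l p $ i $ m"
proof -
  note t = frame_tangent[OF p] and m = frame_metric[OF p]
  show ?thesis
    unfolding riem_curv_frame[OF p t t t t] m mult.assoc sum_distrib_left[symmetric] sum_delta_mult ..
qed

lemma curv_action_frame:
  assumes h: "sym2_tensor (atlas M) h" and p: "p \<in> P"
  shows "curv_action M h p (e i p) (e j p) = (\<Sum>k\<in>UNIV. \<Sum>l\<in>UNIV. Rm i k p $ j $ l * hmat h p $ k $ l)"
proof -
  note t = frame_tangent[OF p]
  have "curv_action M h p (e i p) (e j p) =
      (\<Sum>k\<in>UNIV. \<Sum>l\<in>UNIV. riem_curv M p (e i p) (e k p) (e j p) (e l p) * h p (e k p) (e l p))"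
    unfolding curv_action_def
    by (rule double_trace[OF frame_orthonormal[OF p] onb_orthonormal[OF p],
          of "\<lambda>x y. riem_curv M p (e i p) x (e j p) y" "h p"])
      (intro riem_curv_linear[OF p] t sym2_linear_left[OF h] sym2_linear_right[OF h]; assumption)+
  then show ?thesis by (simp add: riem_curv_frame_frame[OF p] hmat_def)
qed

end

section \<open>Clifford modules\<close>

lemma sum_if_const: "(\<Sum>i\<in>I. if c then f i else 0) = (if c then \<Sum>i\<in>I. f i else 0)"
  by simp

lemma sum_cycle: "(\<Sum>l\<in>UNIV. \<Sum>k\<in>UNIV. \<Sum>i\<in>UNIV. f l k i) = (\<Sum>l\<in>UNIV. \<Sum>k\<in>UNIV. \<Sum>i\<in>UNIV. f k i l)"
proof -
  have "(\<Sum>l\<in>UNIV. \<Sum>k\<in>UNIV. \<Sum>i\<in>UNIV. f k i l) = (\<Sum>k\<in>UNIV. \<Sum>l\<in>UNIV. \<Sum>i\<in>UNIV. f k i l)" by (rule sum.swap)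
  also have "\<dots> = (\<Sum>k\<in>UNIV. \<Sum>i\<in>UNIV. \<Sum>l\<in>UNIV. f k i l)" by (rule sum.cong[OF refl], rule sum.swap)
  finally show ?thesis by simp
qed

text \<open>Clifford multiplication by an orthonormal basis. Its skewness refers to the real inner
  product, so that the algebra below takes place over the reals.\<close>

locale clifford_module =
  fixes G :: "'n::finite \<Rightarrow> 'v::euclidean_space \<Rightarrow> 'v"
  assumes linear_G: "linear (G i)"
    and clifford: "G i (G j z) + G j (G i z) = (if i = j then (-2) *\<^sub>R z else 0)"
    and skew_G: "G i y \<bullet> z = - (y \<bullet> G i z)"
begin

lemmas G_simps = linear_add[OF linear_G] linear_diff[OF linear_G] linear_neg[OF linear_G]
  linear_cmul[OF linear_G] linear_sum[OF linear_G] linear_0[OF linear_G]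

lemma clifford_swap: "G i (G j z) = (if i = j then (-2) *\<^sub>R z else 0) - G j (G i z)"
  using clifford[of i j z] by (simp add: algebra_simps)

lemma clifford_commute:
  "G l (G k (G i z)) = G i (G l (G k z)) + (if k = i then (-2) *\<^sub>R G l z else 0) - (if l = i then (-2) *\<^sub>R G k z else 0)"
proof -
  have "G l (G k (G i z)) = (if k = i then (-2) *\<^sub>R G l z else 0) - G l (G i (G k z))"
    by (subst clifford_swap[of k i]) (auto simp: G_simps)
  also have "G l (G i (G k z)) = (if l = i then (-2) *\<^sub>R G k z else 0) - G i (G l (G k z))"
    by (rule clifford_swap)
  finally show ?thesis by simp
qed

text \<open>The image of an antisymmetric matrix in the Clifford algebra, under the isomorphism of the
  orthogonal Lie algebra with the Lie algebra of the spin group.\<close>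

definition spin_lie :: "real^'n^'n \<Rightarrow> 'v \<Rightarrow> 'v" where
  "spin_lie X z = (1/4) *\<^sub>R (\<Sum>i\<in>UNIV. \<Sum>j\<in>UNIV. X $ i $ j *\<^sub>R G i (G j z))"

lemma bilinear_spin_lie: "bounded_bilinear spin_lie"
  unfolding bilinear_conv_bounded_bilinear[symmetric] bilinear_def spin_lie_def
  by (auto intro!: linearI simp: G_simps sum.distrib algebra_simps scaleR_sum_right add_divide_distrib)

lemmas spin_lie_simps =
  bounded_bilinear.add_left[OF bilinear_spin_lie] bounded_bilinear.add_right[OF bilinear_spin_lie]
  bounded_bilinear.diff_left[OF bilinear_spin_lie] bounded_bilinear.diff_right[OF bilinear_spin_lie]
  bounded_bilinear.minus_left[OF bilinear_spin_lie] bounded_bilinear.minus_right[OF bilinear_spin_lie]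
  bounded_bilinear.scaleR_left[OF bilinear_spin_lie] bounded_bilinear.scaleR_right[OF bilinear_spin_lie]
  bounded_bilinear.sum_left[OF bilinear_spin_lie] bounded_bilinear.sum_right[OF bilinear_spin_lie]
  bounded_bilinear.zero_right[OF bilinear_spin_lie]

context
  fixes X :: "real^'n^'n"
  assumes X: "\<And>i j. X $ i $ j = - X $ j $ i"
begin

text \<open>A factor \<open>G l\<close> passes two others, leaving two contractions with
  \<open>X\<close>, which agree by antisymmetry and are normalised by the factor
  \<open>1/4\<close>. So the commutator with \<open>spin_lie X\<close> is the action of
  \<open>X\<close> on the vectors of the Clifford algebra.\<close>

lemma spin_lie_commute: "spin_lie X (G l z) = G l (spin_lie X z) + (\<Sum>j\<in>UNIV. X $ l $ j *\<^sub>R G j z)"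
proof -
  have "(\<Sum>i\<in>UNIV. \<Sum>j\<in>UNIV. X $ i $ j *\<^sub>R G i (G j (G l z))) =
      (\<Sum>i\<in>UNIV. \<Sum>j\<in>UNIV. X $ i $ j *\<^sub>R G l (G i (G j z)))
      + (\<Sum>i\<in>UNIV. \<Sum>j\<in>UNIV. if j = l then X $ i $ j *\<^sub>R (-2) *\<^sub>R G i z else 0)
      - (\<Sum>i\<in>UNIV. \<Sum>j\<in>UNIV. if i = l then X $ i $ j *\<^sub>R (-2) *\<^sub>R G j z else 0)"
    unfolding sum.distrib[symmetric] sum_subtractf[symmetric]
    by (intro sum.cong refl, subst clifford_commute) (auto simp: algebra_simps)
  also have "(\<Sum>i\<in>UNIV. \<Sum>j\<in>UNIV. if j = l then X $ i $ j *\<^sub>R (-2) *\<^sub>R G i z else 0) = (\<Sum>i\<in>UNIV. (2 * X $ l $ i) *\<^sub>R G i z)"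
    by (simp add: X[of _ l] mult.commute)
  also have "(\<Sum>i\<in>UNIV. \<Sum>j\<in>UNIV. if i = l then X $ i $ j *\<^sub>R (-2) *\<^sub>R G j z else 0) = - (\<Sum>j\<in>UNIV. (2 * X $ l $ j) *\<^sub>R G j z)"
    unfolding sum_if_const by (simp add: sum_negf mult.commute)
  finally have "(\<Sum>i\<in>UNIV. \<Sum>j\<in>UNIV. X $ i $ j *\<^sub>R G i (G j (G l z))) =
      (\<Sum>i\<in>UNIV. \<Sum>j\<in>UNIV. X $ i $ j *\<^sub>R G l (G i (G j z)))
      + ((\<Sum>i\<in>UNIV. (2 * X $ l $ i) *\<^sub>R G i z) + (\<Sum>j\<in>UNIV. (2 * X $ l $ j) *\<^sub>R G j z))"
    by (simp only: diff_minus_eq_add add.assoc)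
  also have "(\<Sum>i\<in>UNIV. (2 * X $ l $ i) *\<^sub>R G i z) + (\<Sum>j\<in>UNIV. (2 * X $ l $ j) *\<^sub>R G j z) = 4 *\<^sub>R (\<Sum>j\<in>UNIV. X $ l $ j *\<^sub>R G j z)"
    by (simp add: scaleR_sum_right flip: sum.distrib scaleR_add_left)
  also have "(\<Sum>i\<in>UNIV. \<Sum>j\<in>UNIV. X $ i $ j *\<^sub>R G l (G i (G j z))) = G l (\<Sum>i\<in>UNIV. \<Sum>j\<in>UNIV. X $ i $ j *\<^sub>R G i (G j z))"
    by (simp only: G_simps)
  finally have "(\<Sum>i\<in>UNIV. \<Sum>j\<in>UNIV. X $ i $ j *\<^sub>R G i (G j (G l z))) =
      G l (\<Sum>i\<in>UNIV. \<Sum>j\<in>UNIV. X $ i $ j *\<^sub>R G i (G j z)) + 4 *\<^sub>R (\<Sum>j\<in>UNIV. X $ l $ j *\<^sub>R G j z)" .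
  then show ?thesis unfolding spin_lie_def by (simp add: G_simps scaleR_add_right)
qed

lemma spin_lie_skew: "spin_lie X y \<bullet> z = - (y \<bullet> spin_lie X z)"
proof -
  have "(\<Sum>i\<in>UNIV. \<Sum>j\<in>UNIV. X $ i $ j *\<^sub>R G i (G j y)) \<bullet> z = (\<Sum>i\<in>UNIV. \<Sum>j\<in>UNIV. X $ i $ j * (y \<bullet> G j (G i z)))"
    by (simp add: inner_sum_left skew_G)
  also have "\<dots> = (\<Sum>j\<in>UNIV. \<Sum>i\<in>UNIV. - (X $ j $ i * (y \<bullet> G j (G i z))))"
    by (subst sum.swap) (intro sum.cong refl, subst X, simp)
  finally show ?thesis unfolding spin_lie_def by (simp add: inner_sum_right sum_negf)
qed

text \<open>The matrices act on the vectors \<open>G l\<close> by \<open>\<Sum>\<^sub>j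
  X\<^sub>l\<^sub>j G j\<close>, so that composing two actions multiplies the matrices in the
  opposite order.\<close>

lemma spin_lie_bracket: "spin_lie X (spin_lie Y z) - spin_lie Y (spin_lie X z) = spin_lie (Y ** X - X ** Y) z"
proof -
  have "spin_lie X (G a (G b z)) = G a (G b (spin_lie X z)) + (\<Sum>c\<in>UNIV. X $ b $ c *\<^sub>R G a (G c z)) + (\<Sum>c\<in>UNIV. X $ a $ c *\<^sub>R G c (G b z))" for a b
    by (simp add: spin_lie_commute G_simps)
  then have "(\<Sum>a\<in>UNIV. \<Sum>b\<in>UNIV. Y $ a $ b *\<^sub>R spin_lie X (G a (G b z))) =
      (\<Sum>a\<in>UNIV. \<Sum>b\<in>UNIV. Y $ a $ b *\<^sub>R G a (G b (spin_lie X z)))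
      + (\<Sum>a\<in>UNIV. \<Sum>b\<in>UNIV. \<Sum>c\<in>UNIV. (Y $ a $ b * X $ b $ c) *\<^sub>R G a (G c z))
      + (\<Sum>a\<in>UNIV. \<Sum>b\<in>UNIV. \<Sum>c\<in>UNIV. (Y $ a $ b * X $ a $ c) *\<^sub>R G c (G b z))"
    by (simp add: scaleR_add_right sum.distrib scaleR_sum_right)
  also have "(\<Sum>a\<in>UNIV. \<Sum>b\<in>UNIV. \<Sum>c\<in>UNIV. (Y $ a $ b * X $ b $ c) *\<^sub>R G a (G c z)) =
      (\<Sum>a\<in>UNIV. \<Sum>c\<in>UNIV. (Y ** X) $ a $ c *\<^sub>R G a (G c z))"
    by (rule sum.cong[OF refl], subst sum.swap) (simp add: matrix_matrix_mult_def scaleR_sum_left)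
  also have "(\<Sum>a\<in>UNIV. \<Sum>b\<in>UNIV. \<Sum>c\<in>UNIV. (Y $ a $ b * X $ a $ c) *\<^sub>R G c (G b z)) =
      (\<Sum>c\<in>UNIV. \<Sum>b\<in>UNIV. \<Sum>a\<in>UNIV. (Y $ a $ b * X $ a $ c) *\<^sub>R G c (G b z))"
    by (subst sum_cycle, rule sum.cong[OF refl], rule sum.swap)
  also have "\<dots> = (\<Sum>c\<in>UNIV. \<Sum>b\<in>UNIV. - ((X ** Y) $ c $ b *\<^sub>R G c (G b z)))"
  proof (intro sum.cong refl)
    fix c b
    have "(\<Sum>a\<in>UNIV. Y $ a $ b * X $ a $ c) = - (X ** Y) $ c $ b"
      unfolding matrix_matrix_mult_def vec_lambda_beta sum_negf[symmetric]
      by (rule sum.cong[OF refl], subst X, simp)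
    then show "(\<Sum>a\<in>UNIV. (Y $ a $ b * X $ a $ c) *\<^sub>R G c (G b z)) = - ((X ** Y) $ c $ b *\<^sub>R G c (G b z))"
      unfolding scaleR_sum_left[symmetric] by simp
  qed
  finally have "(\<Sum>a\<in>UNIV. \<Sum>b\<in>UNIV. Y $ a $ b *\<^sub>R spin_lie X (G a (G b z))) =
      (\<Sum>a\<in>UNIV. \<Sum>b\<in>UNIV. Y $ a $ b *\<^sub>R G a (G b (spin_lie X z))) + 4 *\<^sub>R spin_lie (Y ** X - X ** Y) z"
    by (simp add: spin_lie_def scaleR_diff_left sum_subtractf sum_negf)
  moreover have "spin_lie X (spin_lie Y z) = (1/4) *\<^sub>R (\<Sum>a\<in>UNIV. \<Sum>b\<in>UNIV. Y $ a $ b *\<^sub>R spin_lie X (G a (G b z)))"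
    unfolding spin_lie_def[of Y z] by (simp only: spin_lie_simps)
  ultimately show ?thesis
    by (simp add: spin_lie_def[of Y "spin_lie X z"] scaleR_add_right)
qed

end

subsection \<open>Spinors annihilated by the curvature\<close>

text \<open>The conditions on \<open>R\<close> and \<open>z\<close> are satisfied by the curvature
  at a point and by the value of a parallel spinor.\<close>

context
  fixes R :: "'n \<Rightarrow> 'n \<Rightarrow> 'n \<Rightarrow> 'n \<Rightarrow> real" and z :: 'v
  assumes R_swap: "\<And>k l i m. R l k i m = - R k l i m"
    and R_bianchi: "\<And>k l i m. R k l i m + R l i k m + R i k l m = 0"
    and R_annihilates: "\<And>i m. (\<Sum>l\<in>UNIV. \<Sum>k\<in>UNIV. R l k i m *\<^sub>R G l (G k z)) = 0"
begin

text \<open>Once \<open>G i\<close> is moved to the front, the remaining two factors annihilate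
  \<open>z\<close>, and the two contractions agree by antisymmetry.\<close>

lemma curvature_contract:
  "(\<Sum>l\<in>UNIV. \<Sum>k\<in>UNIV. R l k a b *\<^sub>R G l (G k (G i z))) = 4 *\<^sub>R (\<Sum>k\<in>UNIV. R i k a b *\<^sub>R G k z)"
proof -
  have "(\<Sum>l\<in>UNIV. \<Sum>k\<in>UNIV. R l k a b *\<^sub>R G l (G k (G i z))) =
      G i (\<Sum>l\<in>UNIV. \<Sum>k\<in>UNIV. R l k a b *\<^sub>R G l (G k z))
      + (\<Sum>l\<in>UNIV. \<Sum>k\<in>UNIV. if k = i then R l k a b *\<^sub>R (-2) *\<^sub>R G l z else 0)
      - (\<Sum>l\<in>UNIV. \<Sum>k\<in>UNIV. if l = i then R l k a b *\<^sub>R (-2) *\<^sub>R G k z else 0)"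
    unfolding G_simps sum.distrib[symmetric] sum_subtractf[symmetric]
    by (intro sum.cong refl, subst clifford_commute) (auto simp: algebra_simps)
  also have "(\<Sum>l\<in>UNIV. \<Sum>k\<in>UNIV. if k = i then R l k a b *\<^sub>R (-2) *\<^sub>R G l z else 0) = (\<Sum>l\<in>UNIV. (2 * R i l a b) *\<^sub>R G l z)"
    by (simp add: R_swap[of _ i] mult.commute)
  also have "(\<Sum>l\<in>UNIV. \<Sum>k\<in>UNIV. if l = i then R l k a b *\<^sub>R (-2) *\<^sub>R G k z else 0) = - (\<Sum>k\<in>UNIV. (2 * R i k a b) *\<^sub>R G k z)"
    unfolding sum_if_const by (simp add: sum_negf mult.commute)
  finally show ?thesis
    unfolding R_annihilates G_simps
    by (simp add: scaleR_sum_right sum.distrib[symmetric] scaleR_add_left[symmetric])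
qed

text \<open>The Ricci curvature annihilates the spinor: a sum over three Clifford factors is evaluated
  in two ways, by commuting one factor to the left and by the Bianchi identity.\<close>

lemma ricci_annihilates: "(\<Sum>i\<in>UNIV. \<Sum>k\<in>UNIV. R i k i b *\<^sub>R G k z) = 0"
proof -
  let ?ric = "\<Sum>i\<in>UNIV. \<Sum>k\<in>UNIV. R i k i b *\<^sub>R G k z"
  define f where "f l k i = R l k i b *\<^sub>R G l (G k (G i z))" for l k i
  define S where "S = (\<Sum>l\<in>UNIV. \<Sum>k\<in>UNIV. \<Sum>i\<in>UNIV. f l k i)"
  have S2: "S = (\<Sum>l\<in>UNIV. \<Sum>k\<in>UNIV. \<Sum>i\<in>UNIV. f k i l)" unfolding S_def by (rule sum_cycle)
  have S3: "S = (\<Sum>l\<in>UNIV. \<Sum>k\<in>UNIV. \<Sum>i\<in>UNIV. f i l k)" unfolding S2 by (rule sum_cycle)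
  have sw: "R i i a c = 0" for i a c using R_swap[of i i a c] by simp
  have "S = (\<Sum>i\<in>UNIV. \<Sum>l\<in>UNIV. \<Sum>k\<in>UNIV. f l k i)"
    unfolding S_def by (rule sum_cycle)
  also have "\<dots> = 4 *\<^sub>R ?ric"
    unfolding f_def curvature_contract scaleR_sum_right ..
  finally have S4: "S = 4 *\<^sub>R ?ric" .
  have p: "f l k i + f k i l + f i l k =
      (if i = l then (2 * R i k i b) *\<^sub>R G k z else 0) + (if k = l then (2 * R k i k b) *\<^sub>R G i z else 0)
      + (if k = i then (2 * R i l i b) *\<^sub>R G l z else 0)" for l k i
  proof -
    have x: "G k (G i (G l z)) = G l (G k (G i z)) + (if i = l then (-2) *\<^sub>R G k z else 0) - (if k = l then (-2) *\<^sub>R G i z else 0)"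
      by (rule clifford_commute)
    have y: "G i (G l (G k z)) = G l (G k (G i z)) - (if k = i then (-2) *\<^sub>R G l z else 0) + (if l = i then (-2) *\<^sub>R G k z else 0)"
      using clifford_commute[of l k i z] by (simp add: algebra_simps)
    have "f l k i + f k i l + f i l k = (R l k i b + R k i l b + R i l k b) *\<^sub>R G l (G k (G i z))
      + R k i l b *\<^sub>R ((if i = l then (-2) *\<^sub>R G k z else 0) - (if k = l then (-2) *\<^sub>R G i z else 0))
      + R i l k b *\<^sub>R ((if l = i then (-2) *\<^sub>R G k z else 0) - (if k = i then (-2) *\<^sub>R G l z else 0))"
      unfolding f_def x y by (simp add: scaleR_add_left scaleR_add_right scaleR_diff_right)
    also have "R l k i b + R k i l b + R i l k b = 0" by (rule R_bianchi)
    finally show ?thesis using R_swap[of k i i b] sw by (auto simp: algebra_simps)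
  qed
  have "3 *\<^sub>R S = S + S + S" using scaleR_add_left[of 1 2 S] by (simp add: scaleR_2 add.assoc)
  also have "\<dots> = (\<Sum>l\<in>UNIV. \<Sum>k\<in>UNIV. \<Sum>i\<in>UNIV. f l k i + f k i l + f i l k)"
    unfolding sum.distrib using S_def S2 S3 by simp
  also have "\<dots> = (\<Sum>l\<in>UNIV. \<Sum>k\<in>UNIV. \<Sum>i\<in>UNIV. if i = l then (2 * R i k i b) *\<^sub>R G k z else 0)
      + (\<Sum>l\<in>UNIV. \<Sum>k\<in>UNIV. \<Sum>i\<in>UNIV. if k = l then (2 * R k i k b) *\<^sub>R G i z else 0)
      + (\<Sum>l\<in>UNIV. \<Sum>k\<in>UNIV. \<Sum>i\<in>UNIV. if k = i then (2 * R i l i b) *\<^sub>R G l z else 0)"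
    unfolding p sum.distrib ..
  also have "(\<Sum>l\<in>UNIV. \<Sum>k\<in>UNIV. \<Sum>i\<in>UNIV. if i = l then (2 * R i k i b) *\<^sub>R G k z else 0) = 2 *\<^sub>R ?ric"
    by (simp add: scaleR_sum_right)
  also have "(\<Sum>l\<in>UNIV. \<Sum>k\<in>UNIV. \<Sum>i\<in>UNIV. if k = l then (2 * R k i k b) *\<^sub>R G i z else 0) = 2 *\<^sub>R ?ric"
    unfolding sum_if_const by (simp add: scaleR_sum_right)
  also have "(\<Sum>l\<in>UNIV. \<Sum>k\<in>UNIV. \<Sum>i\<in>UNIV. if k = i then (2 * R i l i b) *\<^sub>R G l z else 0) = 2 *\<^sub>R ?ric"
    by (simp add: scaleR_sum_right sum.swap[of "\<lambda>l k. (2 * R k l k b) *\<^sub>R G l z"])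
  finally have "3 *\<^sub>R S = 6 *\<^sub>R ?ric" by (simp flip: scaleR_add_left)
  \<comment> \<open>The sum of the three cyclic copies of \<open>S\<close> is \<open>6 ?ric\<close>, while each of them is \<open>4 ?ric\<close>.\<close>
  then have "12 *\<^sub>R ?ric = 6 *\<^sub>R ?ric" unfolding S4 by simp
  then show ?thesis by (simp add: scaleR_cancel_right)
qed

text \<open>Here \<open>N l k i\<close> stands for \<open>(\<nabla>\<^sub>l\<nabla>\<^sub>k
  h)\<^sub>i\<^sub>j\<close> with \<open>j\<close> fixed, \<open>H\<close> for the components of
  \<open>h\<close>, and \<open>h m\<close> for \<open>h\<^sub>m\<^sub>j\<close>. The part of
  \<open>N\<close> symmetric in \<open>l\<close> and \<open>k\<close> gives the trace by the
  Clifford relation. In the antisymmetric part, the first sum contracts to the Ricci curvature,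
  which annihilates \<open>z\<close>, and the second one to the curvature action.\<close>

lemma second_derivative_contract:
  assumes N: "\<And>l k i. N l k i - N k l i = (\<Sum>m\<in>UNIV. R l k i m * h m) + (\<Sum>m\<in>UNIV. H i m * R l k j m)"
  shows "(\<Sum>l\<in>UNIV. \<Sum>k\<in>UNIV. \<Sum>i\<in>UNIV. N l k i *\<^sub>R G l (G k (G i z))) =
    (\<Sum>i\<in>UNIV. (- (\<Sum>k\<in>UNIV. N k k i) - 2 * (\<Sum>a\<in>UNIV. \<Sum>b\<in>UNIV. R i a j b * H a b)) *\<^sub>R G i z)"
proof -
  let ?S = "\<lambda>i. \<Sum>l\<in>UNIV. \<Sum>k\<in>UNIV. N l k i *\<^sub>R G l (G k (G i z))"
  \<comment> \<open>Exchanging \<open>l\<close> and \<open>k\<close> in the product of Clifford factors costs a trace.\<close>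
  have sym: "2 *\<^sub>R ?S i = (\<Sum>l\<in>UNIV. \<Sum>k\<in>UNIV. (N l k i - N k l i) *\<^sub>R G l (G k (G i z))) - 2 *\<^sub>R (\<Sum>k\<in>UNIV. N k k i *\<^sub>R G i z)" for i
  proof -
    have "(\<Sum>l\<in>UNIV. \<Sum>k\<in>UNIV. N k l i *\<^sub>R G l (G k (G i z))) = (\<Sum>k\<in>UNIV. \<Sum>l\<in>UNIV. N k l i *\<^sub>R G l (G k (G i z)))"
      by (rule sum.swap)
    also have "\<dots> = (\<Sum>k\<in>UNIV. \<Sum>l\<in>UNIV. (if l = k then N k l i *\<^sub>R (-2) *\<^sub>R G i z else 0) - N k l i *\<^sub>R G k (G l (G i z)))"
      by (intro sum.cong refl, subst clifford_swap) (auto simp: scaleR_diff_right)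
    also have "\<dots> = - 2 *\<^sub>R (\<Sum>k\<in>UNIV. N k k i *\<^sub>R G i z) - ?S i"
      by (simp add: sum_subtractf scaleR_sum_right sum_negf mult.commute)
    finally show ?thesis by (simp add: scaleR_diff_left sum_subtractf scaleR_2)
  qed
  \<comment> \<open>The curvature contracts with the third factor.\<close>
  have asym: "(\<Sum>l\<in>UNIV. \<Sum>k\<in>UNIV. (N l k i - N k l i) *\<^sub>R G l (G k (G i z))) =
      (\<Sum>m\<in>UNIV. (4 * h m) *\<^sub>R (\<Sum>k\<in>UNIV. R i k i m *\<^sub>R G k z)) + (\<Sum>m\<in>UNIV. (4 * H i m) *\<^sub>R (\<Sum>k\<in>UNIV. R i k j m *\<^sub>R G k z))" for i
  proof -
    have c: "(\<Sum>l\<in>UNIV. \<Sum>k\<in>UNIV. (\<Sum>m\<in>UNIV. c m * R l k a m) *\<^sub>R G l (G k (G i z))) = (\<Sum>m\<in>UNIV. (4 * c m) *\<^sub>R (\<Sum>k\<in>UNIV. R i k a m *\<^sub>R G k z))" for c a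
    proof -
      have "(\<Sum>l\<in>UNIV. \<Sum>k\<in>UNIV. (\<Sum>m\<in>UNIV. c m * R l k a m) *\<^sub>R G l (G k (G i z))) =
          (\<Sum>m\<in>UNIV. \<Sum>l\<in>UNIV. \<Sum>k\<in>UNIV. c m *\<^sub>R R l k a m *\<^sub>R G l (G k (G i z)))"
        unfolding scaleR_sum_left scaleR_scaleR[symmetric] by (rule sum_cycle)
      also have "\<dots> = (\<Sum>m\<in>UNIV. c m *\<^sub>R (\<Sum>l\<in>UNIV. \<Sum>k\<in>UNIV. R l k a m *\<^sub>R G l (G k (G i z))))"
        by (simp add: scaleR_sum_right)
      finally show ?thesis unfolding curvature_contract by (simp add: mult.commute)
    qed
    show ?thesis
      unfolding N scaleR_add_left sum.distrib c[symmetric] by (simp add: mult.commute)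
  qed
  have "2 *\<^sub>R (\<Sum>l\<in>UNIV. \<Sum>k\<in>UNIV. \<Sum>i\<in>UNIV. N l k i *\<^sub>R G l (G k (G i z))) = (\<Sum>i\<in>UNIV. 2 *\<^sub>R ?S i)"
    unfolding scaleR_sum_right[symmetric] by (rule arg_cong[where f="scaleR 2"], rule sum_cycle)
  also have "\<dots> = (\<Sum>i\<in>UNIV. \<Sum>m\<in>UNIV. (4 * h m) *\<^sub>R (\<Sum>k\<in>UNIV. R i k i m *\<^sub>R G k z))
      + (\<Sum>i\<in>UNIV. \<Sum>m\<in>UNIV. (4 * H i m) *\<^sub>R (\<Sum>k\<in>UNIV. R i k j m *\<^sub>R G k z))
      - 2 *\<^sub>R (\<Sum>i\<in>UNIV. \<Sum>k\<in>UNIV. N k k i *\<^sub>R G i z)"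
    unfolding sym asym by (simp add: sum.distrib sum_subtractf scaleR_sum_right)
  also have "(\<Sum>i\<in>UNIV. \<Sum>m\<in>UNIV. (4 * h m) *\<^sub>R (\<Sum>k\<in>UNIV. R i k i m *\<^sub>R G k z)) = 0"
    by (subst sum.swap) (simp add: scaleR_sum_right[symmetric] ricci_annihilates)
  also have "(\<Sum>i\<in>UNIV. \<Sum>m\<in>UNIV. (4 * H i m) *\<^sub>R (\<Sum>k\<in>UNIV. R i k j m *\<^sub>R G k z)) =
      (\<Sum>k\<in>UNIV. (- 4 * (\<Sum>a\<in>UNIV. \<Sum>b\<in>UNIV. R k a j b * H a b)) *\<^sub>R G k z)"
  proof -
    have "(\<Sum>i\<in>UNIV. \<Sum>m\<in>UNIV. (4 * H i m) *\<^sub>R (\<Sum>k\<in>UNIV. R i k j m *\<^sub>R G k z)) =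
        (\<Sum>i\<in>UNIV. \<Sum>m\<in>UNIV. \<Sum>k\<in>UNIV. (4 * H i m * R i k j m) *\<^sub>R G k z)"
      by (simp add: scaleR_sum_right)
    also have "\<dots> = (\<Sum>k\<in>UNIV. \<Sum>i\<in>UNIV. \<Sum>m\<in>UNIV. (4 * H i m * R i k j m) *\<^sub>R G k z)"
      by (rule sum_cycle)
    also have "\<dots> = (\<Sum>k\<in>UNIV. (\<Sum>i\<in>UNIV. \<Sum>m\<in>UNIV. 4 * H i m * R i k j m) *\<^sub>R G k z)"
      by (simp add: scaleR_sum_left)
    finally have 1: "(\<Sum>i\<in>UNIV. \<Sum>m\<in>UNIV. (4 * H i m) *\<^sub>R (\<Sum>k\<in>UNIV. R i k j m *\<^sub>R G k z)) = \<dots>" .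
    have "(\<Sum>i\<in>UNIV. \<Sum>m\<in>UNIV. 4 * H i m * R i k j m) = - 4 * (\<Sum>a\<in>UNIV. \<Sum>b\<in>UNIV. R k a j b * H a b)" for k
      unfolding sum_distrib_left by (intro sum.cong refl, subst R_swap, simp)
    then show ?thesis unfolding 1 by simp
  qed
  finally have "2 *\<^sub>R (\<Sum>l\<in>UNIV. \<Sum>k\<in>UNIV. \<Sum>i\<in>UNIV. N l k i *\<^sub>R G l (G k (G i z))) =
      2 *\<^sub>R (\<Sum>i\<in>UNIV. (- (\<Sum>k\<in>UNIV. N k k i) - 2 * (\<Sum>a\<in>UNIV. \<Sum>b\<in>UNIV. R i a j b * H a b)) *\<^sub>R G i z)"
    unfolding scaleR_sum_right sum_subtractf[symmetric] add_0_left
    by (simp only: scaleR_sum_left[symmetric] scaleR_diff_left[symmetric] scaleR_scaleR sum_distrib_left[symmetric])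
      (intro sum.cong refl arg_cong2[where f=scaleR], simp)
  then show ?thesis by simp
qed

end

end

section \<open>Spinors in an orthonormal frame\<close>

locale spin_frame = orthonormal_frame M P e + clifford_module G
  for M :: "('m::{t2_space,second_countable_topology}, 'n::finite, 'z) riem_manifold_scheme"
    and P :: "'m set" and e :: "'n \<Rightarrow> 'm \<Rightarrow> 'm tvec" and G :: "'n \<Rightarrow> 'v::euclidean_space \<Rightarrow> 'v"
begin

lemma bounded_linear_G: "bounded_linear (G i)"
  using linear_G by (simp add: linear_conv_bounded_linear)

lemma smo_G: "smo \<psi> \<Longrightarrow> smo (\<lambda>q. G i (\<psi> q))"
  by (rule smo_linear[OF bounded_linear_G])

lemma dd_G: "p \<in> P \<Longrightarrow> smo \<psi> \<Longrightarrow> dd k (\<lambda>q. G i (\<psi> q)) p = G i (dd k \<psi> p)"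
  by (rule dd_linear[OF bounded_linear_G])

text \<open>The spin connection, and the connection and Dirac operator on spinor-valued 1-forms, whose
  value on the \<open>j\<close>-th frame vector is \<open>\<Psi> j\<close>.\<close>

definition "spin_cov k \<psi> q = dd k \<psi> q + spin_lie (\<Gamma> k q) (\<psi> q)"

definition "tw_cov k \<Psi> j q = spin_cov k (\<Psi> j) q - (\<Sum>m\<in>UNIV. \<Gamma> k q $ j $ m *\<^sub>R \<Psi> m q)"

definition "tw_dirac \<Psi> j q = (\<Sum>k\<in>UNIV. G k (tw_cov k \<Psi> j q))"

lemma spin_cov_cong:
  "p \<in> P \<Longrightarrow> smo \<psi> \<Longrightarrow> (\<And>q. q \<in> P \<Longrightarrow> \<psi> q = \<phi> q) \<Longrightarrow> spin_cov k \<psi> p = spin_cov k \<phi> p"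
  unfolding spin_cov_def using dd_cong[of p \<psi> \<phi> k] by simp

lemma tw_dirac_cong:
  assumes "p \<in> P" "\<And>j. smo (\<Psi> j)" "\<And>j q. q \<in> P \<Longrightarrow> \<Psi> j q = \<Xi> j q"
  shows "tw_dirac \<Psi> j p = tw_dirac \<Xi> j p"
  unfolding tw_dirac_def tw_cov_def
  using spin_cov_cong[OF assms(1,2,3)] assms(1,3) by simp

text \<open>Clifford multiplication is parallel: by \<open>spin_lie_commute\<close>, the
  connection term of the spinor bundle acts on \<open>G i\<close> as the connection matrix acts on
  \<open>e\<^sub>i\<close>.\<close>

lemma spin_cov_G:
  assumes p: "p \<in> P" and \<psi>: "\<And>i. smo (\<psi> i)"
  shows "spin_cov k (\<lambda>q. \<Sum>i\<in>UNIV. G i (\<psi> i q)) p = (\<Sum>i\<in>UNIV. G i (spin_cov k (\<psi> i) p - (\<Sum>m\<in>UNIV. \<Gamma> k p $ i $ m *\<^sub>R \<psi> m p)))"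
proof -
  have d: "dd k (\<lambda>q. \<Sum>i\<in>UNIV. G i (\<psi> i q)) p = (\<Sum>i\<in>UNIV. G i (dd k (\<psi> i) p))"
    by (simp add: dd_sum[OF p] smo_G \<psi> dd_G[OF p])
  have "spin_lie (\<Gamma> k p) (\<Sum>i\<in>UNIV. G i (\<psi> i p)) = (\<Sum>i\<in>UNIV. G i (spin_lie (\<Gamma> k p) (\<psi> i p)))
      + (\<Sum>i\<in>UNIV. \<Sum>j\<in>UNIV. \<Gamma> k p $ i $ j *\<^sub>R G j (\<psi> i p))"
    unfolding spin_lie_simps spin_lie_commute[OF christoffel_antisym[OF p]] sum.distrib ..
  also have "(\<Sum>i\<in>UNIV. \<Sum>j\<in>UNIV. \<Gamma> k p $ i $ j *\<^sub>R G j (\<psi> i p)) = (\<Sum>j\<in>UNIV. \<Sum>i\<in>UNIV. - (\<Gamma> k p $ j $ i *\<^sub>R G j (\<psi> i p)))"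
    by (subst sum.swap) (intro sum.cong refl, subst christoffel_antisym[OF p], simp)
  finally show ?thesis
    unfolding spin_cov_def d by (simp add: G_simps sum.distrib sum_subtractf sum_negf)
qed

text \<open>Local integration by parts: Clifford multiplication and the connection terms are skew,
  and the term remaining of their commutator is the one in the divergence of the 1-form that maps
  \<open>v\<close> to \<open>\<Sum>\<^sub>j \<langle>v \<cdot> \<Psi>\<^sub>j,
  \<Xi>\<^sub>j\<rangle>\<close>.\<close>

lemma tw_dirac_divergence:
  assumes p: "p \<in> P" and \<Psi>: "\<And>j. smo (\<Psi> j)" and \<Xi>: "\<And>j. smo (\<Xi> j)"
  shows "(\<Sum>j\<in>UNIV. tw_dirac \<Psi> j p \<bullet> \<Xi> j p) - (\<Sum>j\<in>UNIV. \<Psi> j p \<bullet> tw_dirac \<Xi> j p) =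
    (\<Sum>k\<in>UNIV. dd k (\<lambda>q. \<Sum>j\<in>UNIV. G k (\<Psi> j q) \<bullet> \<Xi> j q) p
      - (\<Sum>m\<in>UNIV. \<Gamma> k p $ k $ m * (\<Sum>j\<in>UNIV. G m (\<Psi> j p) \<bullet> \<Xi> j p)))"
proof -
  let ?X = "\<lambda>m. \<Sum>j\<in>UNIV. G m (\<Psi> j p) \<bullet> \<Xi> j p"
  have d: "dd k (\<lambda>q. \<Sum>j\<in>UNIV. G k (\<Psi> j q) \<bullet> \<Xi> j q) p =
      (\<Sum>j\<in>UNIV. G k (dd k (\<Psi> j) p) \<bullet> \<Xi> j p + G k (\<Psi> j p) \<bullet> dd k (\<Xi> j) p)" for k
  proof -
    have "dd k (\<lambda>q. \<Sum>j\<in>UNIV. G k (\<Psi> j q) \<bullet> \<Xi> j q) p = (\<Sum>j\<in>UNIV. dd k (\<lambda>q. G k (\<Psi> j q) \<bullet> \<Xi> j q) p)"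
      by (rule dd_sum[OF p]) (intro smo_bilinear[OF bounded_bilinear_inner] smo_G \<Psi> \<Xi>)
    then show ?thesis
      by (simp add: dd_bilinear[OF bounded_bilinear_inner p smo_G[OF \<Psi>] \<Xi>] dd_G[OF p \<Psi>] add.commute)
  qed
  have tw: "G k (tw_cov k \<Psi> j p) \<bullet> \<Xi> j p - \<Psi> j p \<bullet> G k (tw_cov k \<Xi> j p) =
      G k (dd k (\<Psi> j) p) \<bullet> \<Xi> j p + G k (\<Psi> j p) \<bullet> dd k (\<Xi> j) p
      - (\<Sum>m\<in>UNIV. \<Gamma> k p $ k $ m * (G m (\<Psi> j p) \<bullet> \<Xi> j p))
      - (\<Sum>m\<in>UNIV. \<Gamma> k p $ j $ m * (G k (\<Psi> m p) \<bullet> \<Xi> j p)) - (\<Sum>m\<in>UNIV. \<Gamma> k p $ j $ m * (G k (\<Psi> j p) \<bullet> \<Xi> m p))" for k j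
  proof -
    have s: "\<Psi> j p \<bullet> G k y = - (G k (\<Psi> j p) \<bullet> y)" for y by (simp add: skew_G)
    have l: "G k (spin_lie (\<Gamma> k p) (\<Psi> j p)) \<bullet> \<Xi> j p + G k (\<Psi> j p) \<bullet> spin_lie (\<Gamma> k p) (\<Xi> j p) =
        - (\<Sum>m\<in>UNIV. \<Gamma> k p $ k $ m * (G m (\<Psi> j p) \<bullet> \<Xi> j p))"
      using spin_lie_skew[OF christoffel_antisym[OF p], of k "G k (\<Psi> j p)" "\<Xi> j p"]
      unfolding spin_lie_commute[OF christoffel_antisym[OF p]] by (simp add: inner_add_left inner_sum_left)
    show ?thesis
      unfolding s using l
      by (simp add: tw_cov_def spin_cov_def G_simps inner_add_left inner_add_right inner_diff_left inner_diff_right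
          inner_sum_left inner_sum_right)
  qed
  \<comment> \<open>The connection terms of the cotangent factor cancel after summation over \<open>j\<close>.\<close>
  have z: "(\<Sum>j\<in>UNIV. \<Sum>m\<in>UNIV. \<Gamma> k p $ j $ m * (G k (\<Psi> m p) \<bullet> \<Xi> j p)) = - (\<Sum>j\<in>UNIV. \<Sum>m\<in>UNIV. \<Gamma> k p $ j $ m * (G k (\<Psi> j p) \<bullet> \<Xi> m p))" for k
    unfolding sum_negf[symmetric]
    by (subst sum.swap) (intro sum.cong refl, subst christoffel_antisym[OF p], simp)
  have "(\<Sum>j\<in>UNIV. tw_dirac \<Psi> j p \<bullet> \<Xi> j p) - (\<Sum>j\<in>UNIV. \<Psi> j p \<bullet> tw_dirac \<Xi> j p) =
      (\<Sum>k\<in>UNIV. \<Sum>j\<in>UNIV. G k (tw_cov k \<Psi> j p) \<bullet> \<Xi> j p - \<Psi> j p \<bullet> G k (tw_cov k \<Xi> j p))"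
    unfolding tw_dirac_def inner_sum_left inner_sum_right sum_subtractf[symmetric] by (rule sum.swap)
  also have "\<dots> = (\<Sum>k\<in>UNIV. dd k (\<lambda>q. \<Sum>j\<in>UNIV. G k (\<Psi> j q) \<bullet> \<Xi> j q) p - (\<Sum>m\<in>UNIV. \<Gamma> k p $ k $ m * ?X m))"
  proof (rule sum.cong[OF refl])
    fix k
    have "(\<Sum>j\<in>UNIV. \<Sum>m\<in>UNIV. \<Gamma> k p $ k $ m * (G m (\<Psi> j p) \<bullet> \<Xi> j p)) = (\<Sum>m\<in>UNIV. \<Gamma> k p $ k $ m * ?X m)"
      by (subst sum.swap) (simp add: sum_distrib_left)
    then show "(\<Sum>j\<in>UNIV. G k (tw_cov k \<Psi> j p) \<bullet> \<Xi> j p - \<Psi> j p \<bullet> G k (tw_cov k \<Xi> j p)) =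
        dd k (\<lambda>q. \<Sum>j\<in>UNIV. G k (\<Psi> j q) \<bullet> \<Xi> j q) p - (\<Sum>m\<in>UNIV. \<Gamma> k p $ k $ m * ?X m)"
      unfolding tw d sum_subtractf sum.distrib z by simp
  qed
  finally show ?thesis .
qed

subsection \<open>Parallel spinors\<close>

context
  fixes \<sigma> :: "'m \<Rightarrow> 'v"
  assumes \<sigma>: "smo \<sigma>" and parallel: "\<And>k q. q \<in> P \<Longrightarrow> spin_cov k \<sigma> q = 0"
begin

lemma spin_cov_scale:
  assumes p: "p \<in> P" and a: "smo a"
  shows "spin_cov k (\<lambda>q. a q *\<^sub>R \<sigma> q) p = dd k a p *\<^sub>R \<sigma> p"
proof -
  have "spin_cov k (\<lambda>q. a q *\<^sub>R \<sigma> q) p = dd k a p *\<^sub>R \<sigma> p + a p *\<^sub>R spin_cov k \<sigma> p"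
    unfolding spin_cov_def dd_scaleR[OF p a \<sigma>] by (simp add: spin_lie_simps scaleR_add_right)
  then show ?thesis using parallel[OF p] by simp
qed

text \<open>The commutator of two derivatives of a parallel spinor is computed in two ways, by the
  structure functions and by differentiating \<open>d\<sigma> = - spin_lie \<Gamma>
  \<sigma>\<close> twice. The difference is the curvature, because \<open>spin_lie\<close> is
  compatible with brackets.\<close>

lemma parallel_curvature:
  assumes p: "p \<in> P"
  shows "spin_lie (Rm l k p) (\<sigma> p) = 0"
proof -
  note bil = bilinear_spin_lie and G = smo_christoffel
  note ant = christoffel_antisym[OF p]
  have d1: "dd k \<sigma> q = - spin_lie (\<Gamma> k q) (\<sigma> q)" if "q \<in> P" for k q
    using parallel[OF that, of k] by (simp add: spin_cov_def eq_neg_iff_add_eq_0)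
  have d2: "dd l (dd k \<sigma>) p = spin_lie (\<Gamma> k p) (spin_lie (\<Gamma> l p) (\<sigma> p)) - spin_lie (dd l (\<Gamma> k) p) (\<sigma> p)" for l k
  proof -
    have "dd l (dd k \<sigma>) p = dd l (\<lambda>q. - spin_lie (\<Gamma> k q) (\<sigma> q)) p"
      by (rule dd_cong[OF p smo_dd[OF \<sigma>] d1])
    also have "\<dots> = - dd l (\<lambda>q. spin_lie (\<Gamma> k q) (\<sigma> q)) p"
      by (rule dd_uminus[OF p smo_bilinear[OF bil G \<sigma>]])
    finally show ?thesis
      unfolding dd_bilinear[OF bil p G \<sigma>] d1[OF p] spin_lie_simps by simp
  qed
  let ?S = "spin_lie (\<Sum>m\<in>UNIV. struct l k m p *\<^sub>R \<Gamma> m p) (\<sigma> p)"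
  have e1: "dd l (dd k \<sigma>) p - dd k (dd l \<sigma>) p = - ?S"
    unfolding dd_commute[OF p \<sigma>] d1[OF p] spin_lie_simps by (simp add: sum_negf)
  have "spin_lie (Rm l k p) (\<sigma> p) = spin_lie (dd k (\<Gamma> l) p) (\<sigma> p) - spin_lie (dd l (\<Gamma> k) p) (\<sigma> p)
      + spin_lie (\<Gamma> l p ** \<Gamma> k p - \<Gamma> k p ** \<Gamma> l p) (\<sigma> p) + ?S"
    unfolding curv_matrix_formula[OF p] by (simp only: spin_lie_simps) simp
  also have "\<dots> = (dd l (dd k \<sigma>) p - dd k (dd l \<sigma>) p) + ?S"
    unfolding spin_lie_bracket[OF ant, symmetric] d2 by simp
  finally show ?thesis unfolding e1 by simp
qed

text \<open>Clifford multiplication and \<open>\<sigma>\<close> being parallel, only the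
  components of \<open>h\<close> are differentiated.\<close>

lemma tw_cov_Phi:
  assumes h: "sym2_tensor (atlas M) h" and p: "p \<in> P"
  shows "tw_cov k (\<lambda>j q. \<Sum>i\<in>UNIV. G i (hmat h q $ i $ j *\<^sub>R \<sigma> q)) j p =
    (\<Sum>i\<in>UNIV. G i (tmat (nabla M h) k p $ i $ j *\<^sub>R \<sigma> p))"
proof -
  let ?H = "hmat h"
  have H: "smo (\<lambda>q. ?H q $ i $ j)" for i j by (rule smo_nth, rule smo_nth, rule smo_hmat[OF h])
  have dH: "dd k (\<lambda>q. ?H q $ i $ j) p = dd k ?H p $ i $ j" for i j
    by (simp add: dd_nth[OF p] smo_nth smo_hmat[OF h])
  have t: "tmat (nabla M h) k p $ i $ j = dd k ?H p $ i $ j - (\<Sum>m\<in>UNIV. \<Gamma> k p $ i $ m * ?H p $ m $ j)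
      - (\<Sum>m\<in>UNIV. \<Gamma> k p $ j $ m * ?H p $ i $ m)" for i
    unfolding tmat_def nabla_frame[OF h p] by (simp add: matrix_matrix_mult_def transpose_def mult.commute)
  show ?thesis
    unfolding tw_cov_def t spin_cov_G[OF p smo_scaleR[OF H \<sigma>]] spin_cov_scale[OF p H] dH scaleR_sum_right
    by (subst sum.swap) (simp add: sum_subtractf G_simps scaleR_diff_left scaleR_sum_left)
qed

text \<open>The same argument with two Clifford factors, each accounting for one of the connection
  terms in \<open>cov_tmat\<close>.\<close>

lemma tw_cov_Dirac_Phi:
  assumes h: "sym2_tensor (atlas M) h" and T: "cot_sym2_tensor (atlas M) T" and p: "p \<in> P"
  shows "tw_cov l (\<lambda>j q. \<Sum>k\<in>UNIV. G k (\<Sum>i\<in>UNIV. G i (tmat T k q $ i $ j *\<^sub>R \<sigma> q))) j p =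
    (\<Sum>k\<in>UNIV. \<Sum>i\<in>UNIV. cov_tmat T l k p $ i $ j *\<^sub>R G k (G i (\<sigma> p)))"
proof -
  let ?T = "tmat T"
  have S: "smo (\<lambda>q. ?T k q $ i $ j)" for k i j by (rule smo_nth, rule smo_nth, rule smo_tmat[OF T])
  have dT: "dd l (\<lambda>q. ?T k q $ i $ j) p = dd l (?T k) p $ i $ j" for k i j
    by (simp add: dd_nth[OF p] smo_nth smo_tmat[OF T])
  have Y: "smo (\<lambda>q. \<Sum>i\<in>UNIV. G i (?T k q $ i $ j *\<^sub>R \<sigma> q))" for k j
    by (intro smo_sum smo_G smo_scaleR S \<sigma>)
  have t: "cov_tmat T l k p $ i $ j = dd l (?T k) p $ i $ j - (\<Sum>m\<in>UNIV. \<Gamma> l p $ i $ m * ?T k p $ m $ j)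
      - (\<Sum>m\<in>UNIV. \<Gamma> l p $ j $ m * ?T k p $ i $ m) - (\<Sum>m\<in>UNIV. \<Gamma> l p $ k $ m * ?T m p $ i $ j)" for k i
    unfolding cov_tmat_def by (simp add: matrix_matrix_mult_def transpose_def mult.commute)
  have "(\<Sum>m\<in>UNIV. \<Gamma> l p $ k $ m *\<^sub>R (\<Sum>i\<in>UNIV. G i (?T m p $ i $ j *\<^sub>R \<sigma> p))) =
      (\<Sum>i\<in>UNIV. (\<Sum>m\<in>UNIV. \<Gamma> l p $ k $ m * ?T m p $ i $ j) *\<^sub>R G i (\<sigma> p))" for k
    unfolding scaleR_sum_right by (subst sum.swap) (simp add: G_simps scaleR_sum_left)
  moreover have "(\<Sum>m\<in>UNIV. \<Gamma> l p $ j $ m *\<^sub>R (\<Sum>k\<in>UNIV. G k (\<Sum>i\<in>UNIV. G i (?T k p $ i $ m *\<^sub>R \<sigma> p)))) =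
      (\<Sum>k\<in>UNIV. \<Sum>i\<in>UNIV. (\<Sum>m\<in>UNIV. \<Gamma> l p $ j $ m * ?T k p $ i $ m) *\<^sub>R G k (G i (\<sigma> p)))"
    unfolding scaleR_sum_right G_simps scaleR_scaleR scaleR_sum_left by (rule sum_cycle[symmetric])
  ultimately show ?thesis
    unfolding tw_cov_def spin_cov_G[OF p Y] spin_cov_G[OF p smo_scaleR[OF S \<sigma>]] spin_cov_scale[OF p S] dT t
    by (simp add: G_simps sum_subtractf scaleR_diff_left scaleR_sum_left)
qed

text \<open>The curvature of the spinor bundle contracts the last two indices of the curvature
  with Clifford factors, the second covariant derivative the first two; the pair symmetry
  identifies these.\<close>

lemma tw_dirac_tw_dirac_Phi:
  assumes h: "sym2_tensor (atlas M) h" and T: "cot_sym2_tensor (atlas M) (nabla M h)" and p: "p \<in> P"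
  shows "tw_dirac (\<lambda>j q. \<Sum>k\<in>UNIV. G k (\<Sum>i\<in>UNIV. G i (tmat (nabla M h) k q $ i $ j *\<^sub>R \<sigma> q))) j p =
    (\<Sum>i\<in>UNIV. (neg_trace M (nabla M h) p (e i p) (e j p) - 2 * curv_action M h p (e i p) (e j p)) *\<^sub>R G i (\<sigma> p))"
proof -
  let ?N = "\<lambda>l k i. cov_tmat (nabla M h) l k p $ i $ j" and ?R = "\<lambda>l k i m. Rm l k p $ i $ m"
  have sw: "?R l k i m = - ?R k l i m" for l k i m by (simp add: curv_matrix_swap[OF p, of l k])
  have bi: "?R k l i m + ?R l i k m + ?R i k l m = 0" for k l i m by (rule bianchi[OF p])
  have an: "(\<Sum>l\<in>UNIV. \<Sum>k\<in>UNIV. ?R l k i m *\<^sub>R G l (G k (\<sigma> p))) = 0" for i m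
    using parallel_curvature[OF p, of i m] unfolding spin_lie_def curv_matrix_pair[OF p, of i m] by simp
  have ri: "?N l k i - ?N k l i = (\<Sum>m\<in>UNIV. ?R l k i m * hmat h p $ m $ j) + (\<Sum>m\<in>UNIV. hmat h p $ i $ m * ?R l k j m)" for l k i
  proof -
    have "?N l k i - ?N k l i = (Rm l k p ** hmat h p + hmat h p ** transpose (Rm l k p)) $ i $ j"
      unfolding ricci_identity[OF h p, symmetric] by simp
    then show ?thesis by (simp add: matrix_matrix_mult_def transpose_def)
  qed
  have tr: "neg_trace M (nabla M h) p (e i p) (e j p) = - (\<Sum>k\<in>UNIV. ?N k k i)" for i
    by (simp add: neg_trace_frame[OF T p frame_tangent[OF p] frame_tangent[OF p]] cov3_frame[OF T p])
  have "tw_dirac (\<lambda>j q. \<Sum>k\<in>UNIV. G k (\<Sum>i\<in>UNIV. G i (tmat (nabla M h) k q $ i $ j *\<^sub>R \<sigma> q))) j p =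
      (\<Sum>l\<in>UNIV. \<Sum>k\<in>UNIV. \<Sum>i\<in>UNIV. ?N l k i *\<^sub>R G l (G k (G i (\<sigma> p))))"
    unfolding tw_dirac_def tw_cov_Dirac_Phi[OF h T p] by (simp only: G_simps)
  also have "\<dots> = (\<Sum>i\<in>UNIV. (- (\<Sum>k\<in>UNIV. ?N k k i) - 2 * (\<Sum>a\<in>UNIV. \<Sum>b\<in>UNIV. ?R i a j b * hmat h p $ a $ b)) *\<^sub>R G i (\<sigma> p))"
    by (rule second_derivative_contract[of ?R "\<sigma> p" ?N "\<lambda>m. hmat h p $ m $ j" "\<lambda>i m. hmat h p $ i $ m" j, OF sw bi an ri])
  finally show ?thesis unfolding tr curv_action_frame[OF h p] .
qed

end

end

section \<open>The divergence in a chart\<close>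

text \<open>The integral of a directional derivative of a compactly supported function vanishes: it is the
  limit of integrals of difference quotients, which vanish by translation invariance.\<close>

lemma integral_derivative_compact_support:
  fixes F :: "'a::euclidean_space \<Rightarrow> real"
  assumes d: "\<And>x. (F has_derivative F' x) (at x)" and c: "continuous_on UNIV (\<lambda>x. F' x v)"
    and K: "compact K" "\<And>x. x \<notin> K \<Longrightarrow> F x = 0"
  shows "integrable lborel (\<lambda>x. F' x v)" "(\<integral>x. F' x v \<partial>lborel) = 0"
proof -
  define G where "G x = F' x v" for x
  have Fc: "continuous_on UNIV F"
    by (intro continuous_at_imp_continuous_on ballI has_derivative_continuous[OF d])
  have G0: "G x = 0" if "x \<notin> K" for x
  proof -
    have o: "open (- K)" using K(1) by (simp add: compact_imp_closed open_Compl)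
    have "(F has_derivative (\<lambda>_. 0)) (at x)"
      by (rule has_derivative_transform_within_open[OF has_derivative_const o]) (use that K(2) in auto)
    then show ?thesis using has_derivative_unique[OF d] unfolding G_def by metis
  qed
  have "bounded (G ` K)"
    by (rule compact_imp_bounded, rule compact_continuous_image)
      (use c continuous_on_subset K(1) in \<open>auto simp: G_def[abs_def]\<close>)
  then obtain C where C: "C > 0" "\<And>x. x \<in> K \<Longrightarrow> \<bar>G x\<bar> \<le> C" unfolding bounded_pos by auto
  have C': "\<bar>G x\<bar> \<le> C" for x using C G0[of x] by (cases "x \<in> K") auto
  obtain r where r: "\<And>x. x \<in> K \<Longrightarrow> norm x \<le> r" using compact_imp_bounded[OF K(1)] unfolding bounded_iff by blast
  \<comment> \<open>As the steps \<open>h m\<close> are at most 1, all difference quotients are supported in the ball \<open>B\<close>.\<close>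
  define B where "B = cball (0::'a) (r + norm v)"
  define h where "h m = inverse (real (Suc m))" for m
  have h: "h m > 0" "h m \<le> 1" for m unfolding h_def by (auto simp: field_simps)
  define s where "s m x = (F (x + h m *\<^sub>R v) - F x) / h m" for m x
  have dl: "((\<lambda>t. F (x + t *\<^sub>R v)) has_derivative (\<lambda>\<tau>. F' (x + t *\<^sub>R v) (\<tau> *\<^sub>R v))) (at t within S)" for x t S
  proof -
    have "((\<lambda>t. x + t *\<^sub>R v) has_derivative (\<lambda>\<tau>. \<tau> *\<^sub>R v)) (at t within S)"
      by (auto intro!: derivative_eq_intros)
    from has_derivative_compose[OF this d] show ?thesis .
  qed
  have lin: "F' x (\<tau> *\<^sub>R v) = \<tau> * G x" for x \<tau>
    unfolding G_def using linear_cmul[OF has_derivative_linear[OF d]] by simp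
  have bound: "norm (s m x) \<le> C * indicator B x" for m x
  proof (cases "x \<in> B")
    case True
    obtain t where "F (x + h m *\<^sub>R v) - F (x + 0 *\<^sub>R v) = F' (x + t *\<^sub>R v) ((h m - 0) *\<^sub>R v)"
      using mvt_simple[OF h(1)[of m] dl[of x]] by auto
    then have "F (x + h m *\<^sub>R v) - F x = h m * G (x + t *\<^sub>R v)" using lin by simp
    then have "s m x = G (x + t *\<^sub>R v)" unfolding s_def using h(1)[of m] by simp
    then show ?thesis using C' True by simp
  next
    case False
    then have n: "norm x > r + norm v" unfolding B_def by simp
    have "norm (h m *\<^sub>R v) \<le> norm v" using h[of m] by (simp add: mult_left_le_one_le)
    then have "norm (x + h m *\<^sub>R v) > r" using n norm_triangle_ineq2[of x "- (h m *\<^sub>R v)"] by simp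
    moreover have "norm x > r" using n norm_ge_zero[of v] by linarith
    ultimately have "x + h m *\<^sub>R v \<notin> K" "x \<notin> K" using r by force+
    then show ?thesis using K(2) False by (simp add: s_def)
  qed
  have lim: "(\<lambda>m. s m x) \<longlonglongrightarrow> G x" for x
  proof -
    have "((\<lambda>t. F (x + t *\<^sub>R v)) has_real_derivative G x) (at 0)"
      using dl[of x 0 UNIV] lin unfolding has_field_derivative_def by (simp add: mult_commute_abs)
    then have "((\<lambda>t. (F (x + t *\<^sub>R v) - F x) / t) \<longlongrightarrow> G x) (at 0)"
      by (simp add: has_field_derivative_iff)
    moreover have "filterlim h (at 0) sequentially"
      unfolding filterlim_at using h LIMSEQ_inverse_real_of_nat by (auto simp: h_def[abs_def])
    ultimately show ?thesis unfolding s_def by (rule filterlim_compose)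
  qed
  have Gm: "G \<in> borel_measurable lborel" using c borel_measurable_continuous_onI by (simp add: G_def[abs_def])
  have Fm: "F \<in> borel_measurable borel" using Fc borel_measurable_continuous_onI by blast
  have sm: "s m \<in> borel_measurable lborel" for m
  proof -
    have "continuous_on UNIV (s m)" unfolding s_def[abs_def]
      using h(1)[of m] by (intro continuous_intros continuous_on_compose2[OF Fc]) auto
    then show ?thesis using borel_measurable_continuous_onI by simp
  qed
  have w: "integrable lborel (\<lambda>x. C * indicator B x)"
    unfolding B_def
    by (intro integrable_mult_right integrable_real_indicator) (simp_all add: emeasure_lborel_cball_finite[unfolded infinity_ennreal_def])
  have Fi: "integrable lborel F"
  proof -
    have "indicator K x *\<^sub>R F x = F x" for x using K(2)[of x] by (cases "x \<in> K") auto
    then have "(\<lambda>x. indicator K x *\<^sub>R F x) = F" by (rule ext)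
    then show ?thesis using borel_integrable_compact[OF K(1) continuous_on_subset[OF Fc]] by auto
  qed
  have "integral\<^sup>L lborel (s m) = 0" for m
  proof -
    have l: "lborel = distr lborel borel (\<lambda>x. h m *\<^sub>R v + x)" using lborel_distr_plus[of "h m *\<^sub>R v"] by simp
    have "integrable (distr lborel borel (\<lambda>x. h m *\<^sub>R v + x)) F" using Fi l by simp
    then have i: "integrable lborel (\<lambda>x. F (x + h m *\<^sub>R v))"
      by (subst (asm) integrable_distr_eq) (use Fm in \<open>auto simp: add.commute\<close>)
    have "integral\<^sup>L lborel F = integral\<^sup>L (distr lborel borel (\<lambda>x. h m *\<^sub>R v + x)) F" using l by simp
    also have "\<dots> = (\<integral>x. F (x + h m *\<^sub>R v) \<partial>lborel)"
      by (subst integral_distr) (use Fm in \<open>auto simp: add.commute\<close>)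
    finally show ?thesis unfolding s_def using i Fi by simp
  qed
  moreover note integral_dominated_convergence[OF Gm sm w AE_I2[OF lim] AE_I2[OF bound]]
  ultimately have "(\<lambda>m::nat. 0::real) \<longlonglongrightarrow> integral\<^sup>L lborel G" by simp
  then show "(\<integral>x. F' x v \<partial>lborel) = 0" unfolding G_def[symmetric] using LIMSEQ_const_iff by metis
  have "AE x in lborel. norm (G x) \<le> norm (C * indicator B x)"
  proof (rule AE_I2)
    fix x show "norm (G x) \<le> norm (C * indicator B x)"
      using tendsto_norm[OF lim[of x]] bound[of _ x] C(1)
      by (intro order_trans[OF LIMSEQ_le_const2[of "\<lambda>m. norm (s m x)" "norm (G x)" "C * indicator B x"]]) auto
  qed
  from Bochner_Integration.integrable_bound[OF w Gm this]
  show "integrable lborel (\<lambda>x. F' x v)" by (simp add: G_def[abs_def])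
qed

subsection \<open>Smooth products and determinants\<close>

context smooth_manifold
begin

lemma smooth_map_prod:
  fixes f :: "'i \<Rightarrow> 'm \<Rightarrow> real"
  shows "open W \<Longrightarrow> (\<And>i. i \<in> I \<Longrightarrow> smooth_map A W (f i)) \<Longrightarrow> smooth_map A W (\<lambda>q. \<Prod>i\<in>I. f i q)"
  by (induction I rule: infinite_finite_induct) (auto intro: smooth_map_const smooth_map_mult)

lemma smooth_map_det:
  fixes F :: "'m \<Rightarrow> real^'l::finite^'l"
  assumes "open W" "\<And>i j. smooth_map A W (\<lambda>q. F q $ i $ j)"
  shows "smooth_map A W (\<lambda>q. det (F q))"
  unfolding det_def
  by (intro smooth_map_sum smooth_map_mult smooth_map_const smooth_map_prod assms)

lemma vderiv_prod:
  fixes f :: "'i \<Rightarrow> 'm \<Rightarrow> real"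
  assumes v: "v \<in> tangent_space A p" and W: "open W" "p \<in> W"
  shows "finite I \<Longrightarrow> (\<And>i. i \<in> I \<Longrightarrow> smooth_map A W (f i)) \<Longrightarrow>
    v (\<lambda>q. \<Prod>i\<in>I. f i q) = (\<Sum>i\<in>I. v (f i) * (\<Prod>j\<in>I - {i}. f j p))"
proof (induction I rule: finite_induct)
  case empty
  show ?case using vderiv_const[OF v, of "1::real"] by (simp add: vderiv_real)
next
  case (insert i I)
  have "v (\<lambda>q. f i q * (\<Prod>i\<in>I. f i q)) = v (f i) * (\<Prod>i\<in>I. f i p) + f i p * v (\<lambda>q. \<Prod>i\<in>I. f i q)"
    by (rule vderiv_mult[OF v]) (use insert.prems W in \<open>auto intro!: smooth_nearI smooth_map_prod\<close>)
  also have "f i p * v (\<lambda>q. \<Prod>i\<in>I. f i q) = (\<Sum>k\<in>I. v (f k) * (\<Prod>j\<in>insert i I - {k}. f j p))"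
  proof -
    have "f i p * (\<Prod>j\<in>I - {k}. f j p) = (\<Prod>j\<in>insert i I - {k}. f j p)" if "k \<in> I" for k
    proof -
      have "insert i I - {k} = insert i (I - {k})" using insert.hyps that by auto
      then show ?thesis using insert.hyps by simp
    qed
    then have "(\<Sum>k\<in>I. v (f k) * (\<Prod>j\<in>insert i I - {k}. f j p)) = (\<Sum>k\<in>I. f i p * (v (f k) * (\<Prod>j\<in>I - {k}. f j p)))"
      by (intro sum.cong refl) (simp add: algebra_simps)
    then show ?thesis using insert by (simp add: sum_distrib_left)
  qed
  finally show ?case using insert.hyps by (simp add: insert_Diff_if)
qed

text \<open>Jacobi's formula at the identity: any other permutation moves at least two indices, so
  that after differentiating one factor of its product some factor is still an off-diagonal entry,
  hence zero.\<close>

lemma vderiv_det_identity: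
  fixes F :: "'m \<Rightarrow> real^'l::finite^'l"
  assumes v: "v \<in> tangent_space A p" and W: "open W" "p \<in> W"
    and F: "\<And>i j. smooth_map A W (\<lambda>q. F q $ i $ j)" and Fp: "F p = mat 1"
  shows "v (\<lambda>q. det (F q)) = (\<Sum>i\<in>UNIV. v (\<lambda>q. F q $ i $ i))"
proof -
  let ?P = "{\<pi>. \<pi> permutes (UNIV :: 'l set)}"
  have fin: "finite ?P" by (rule finite_permutations) simp
  have s: "smooth_near A p (\<lambda>q. of_int (sign \<pi>) * (\<Prod>i\<in>UNIV. F q $ i $ \<pi> i))" for \<pi>
    by (rule smooth_nearI[OF smooth_map_mult[OF W(1) smooth_map_const[OF W(1)] smooth_map_prod[OF W(1) F]] W])
  have "v (\<lambda>q. det (F q)) = (\<Sum>\<pi>\<in>?P. v (\<lambda>q. of_int (sign \<pi>) * (\<Prod>i\<in>UNIV. F q $ i $ \<pi> i)))"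
    using vderiv_sum[OF v, of ?P "\<lambda>\<pi> q. of_int (sign \<pi>) * (\<Prod>i\<in>UNIV. F q $ i $ \<pi> i)", OF s]
    by (simp add: det_def vderiv_real)
  also have "\<dots> = (\<Sum>\<pi>\<in>?P. if \<pi> = id then (\<Sum>i\<in>UNIV. v (\<lambda>q. F q $ i $ i)) else 0)"
  proof (rule sum.cong[OF refl])
    fix \<pi> assume "\<pi> \<in> ?P"
    have sp: "smooth_near A p (\<lambda>q. \<Prod>i\<in>UNIV. F q $ i $ \<pi> i)"
      by (rule smooth_nearI[OF smooth_map_prod[OF W(1) F] W])
    have "v (\<lambda>q. of_int (sign \<pi>) * (\<Prod>i\<in>UNIV. F q $ i $ \<pi> i)) =
        of_int (sign \<pi>) * v (\<lambda>q. \<Prod>i\<in>UNIV. F q $ i $ \<pi> i)"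
      using vderiv_mult[OF v smooth_near_const sp, of "of_int (sign \<pi>)"]
        vderiv_const[OF v, of "of_int (sign \<pi>) :: real"]
      by (simp add: vderiv_real)
    also have "v (\<lambda>q. \<Prod>i\<in>UNIV. F q $ i $ \<pi> i) = (\<Sum>i\<in>UNIV. v (\<lambda>q. F q $ i $ \<pi> i) * (\<Prod>j\<in>UNIV - {i}. F p $ j $ \<pi> j))"
      by (rule vderiv_prod[OF v W]) (auto intro: F)
    also have "(of_int (sign \<pi>) :: real) * \<dots> = (if \<pi> = id then (\<Sum>i\<in>UNIV. v (\<lambda>q. F q $ i $ i)) else 0)"
    proof (cases "\<pi> = id")
      case True
      then show ?thesis by (simp add: Fp mat_def)
    next
      case False
      have z: "(\<Prod>j\<in>UNIV - {i}. F p $ j $ \<pi> j) = 0" for i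
      proof -
        have "\<exists>j. j \<noteq> i \<and> \<pi> j \<noteq> j"
        proof (rule ccontr)
          assume a: "\<not> (\<exists>j. j \<noteq> i \<and> \<pi> j \<noteq> j)"
          have "inj \<pi>" using \<open>\<pi> \<in> ?P\<close> permutes_inj by auto
          have "\<pi> i = i"
          proof (rule ccontr)
            assume "\<pi> i \<noteq> i"
            then have "\<pi> (\<pi> i) = \<pi> i" using a by auto
            then show False using \<open>inj \<pi>\<close> \<open>\<pi> i \<noteq> i\<close> by (meson injD)
          qed
          then have "\<pi> = id" using a by (metis eq_id_iff)
          then show False using False by simp
        qed
        then obtain j where j: "j \<noteq> i" "\<pi> j \<noteq> j" by blast
        then have "F p $ j $ \<pi> j = 0" by (auto simp: Fp mat_def)
        then show ?thesis using j(1) by (intro prod_zero) auto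
      qed
      show ?thesis using False by (simp only: z mult_zero_right sum.neutral_const if_False)
    qed
    finally show "v (\<lambda>q. of_int (sign \<pi>) * (\<Prod>i\<in>UNIV. F q $ i $ \<pi> i)) =
      (if \<pi> = id then (\<Sum>i\<in>UNIV. v (\<lambda>q. F q $ i $ i)) else 0)" .
  qed
  also have "\<dots> = (\<Sum>i\<in>UNIV. v (\<lambda>q. F q $ i $ i))"
    using fin permutes_id by (simp add: sum.delta)
  finally show ?thesis .
qed

text \<open>Multiplication by the constant matrix \<open>E\<close> reduces this to the identity
  matrix.\<close>

lemma vderiv_det:
  fixes F :: "'m \<Rightarrow> real^'l::finite^'l"
  assumes v: "v \<in> tangent_space A p" and W: "open W" "p \<in> W"
    and F: "\<And>i j. smooth_map A W (\<lambda>q. F q $ i $ j)" and E: "E ** F p = mat 1"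
  shows "v (\<lambda>q. det (F q)) = det (F p) * (\<Sum>k\<in>UNIV. \<Sum>b\<in>UNIV. E $ k $ b * v (\<lambda>q. F q $ b $ k))"
proof -
  have EF: "smooth_map A W (\<lambda>q. (E ** F q) $ i $ j)" for i j
    unfolding matrix_matrix_mult_def vec_lambda_beta
    by (intro smooth_map_sum smooth_map_mult smooth_map_const F W(1))
  have det: "det (F p) * det E = 1" using E det_mul[of E "F p"] by (simp add: mult.commute)
  have "(\<lambda>q. det (F q)) = (\<lambda>q. det (F p) * det (E ** F q))"
    using det by (simp add: det_mul mult.assoc[symmetric])
  then have "v (\<lambda>q. det (F q)) = v (\<lambda>q. det (F p) * det (E ** F q))" by simp
  also have "\<dots> = det (F p) * v (\<lambda>q. det (E ** F q))"
    using vderiv_mult[OF v smooth_near_const smooth_nearI[OF smooth_map_det[OF W(1) EF] W], of "det (F p)"]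
      vderiv_const[OF v, of "det (F p)"] by (simp add: vderiv_real)
  also have "v (\<lambda>q. det (E ** F q)) = (\<Sum>i\<in>UNIV. v (\<lambda>q. (E ** F q) $ i $ i))"
    by (rule vderiv_det_identity[OF v W EF E])
  finally have "v (\<lambda>q. det (F q)) = det (F p) * (\<Sum>i\<in>UNIV. v (\<lambda>q. (E ** F q) $ i $ i))" .
  moreover have "v (\<lambda>q. (E ** F q) $ k $ k) = (\<Sum>b\<in>UNIV. E $ k $ b * v (\<lambda>q. F q $ b $ k))" for k
  proof -
    have "v (\<lambda>q. (E ** F q) $ k $ k) = (\<Sum>b\<in>UNIV. v (\<lambda>q. E $ k $ b * F q $ b $ k))"
      using vderiv_sum[OF v, of UNIV "\<lambda>b q. E $ k $ b * F q $ b $ k"]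
        smooth_nearI[OF smooth_map_mult[OF W(1) smooth_map_const[OF W(1)] F] W]
      by (simp add: vderiv_real matrix_matrix_mult_def)
    moreover have "v (\<lambda>q. E $ k $ b * F q $ b $ k) = E $ k $ b * v (\<lambda>q. F q $ b $ k)" for b
      using vderiv_mult[OF v smooth_near_const smooth_nearI[OF F W], of "E $ k $ b"]
        vderiv_const[OF v, of "E $ k $ b"] by (simp add: vderiv_real)
    ultimately show ?thesis by simp
  qed
  ultimately show ?thesis by simp
qed

end

subsection \<open>The volume density and the divergence\<close>

definition volume_density :: "('m::topological_space, 'n::finite, 'z) riem_manifold_scheme \<Rightarrow> ('m, 'n) chart \<Rightarrow> 'm \<Rightarrow> real" where
  "volume_density M c q = sqrt (det (gram_matrix (atlas M) (metric M) c q))"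

text \<open>The coordinate components of the vector field dual to a 1-form. A trace over an
  orthonormal basis gives them without inverting the Gram matrix.\<close>

definition sharp_coord :: "('m::topological_space, 'n::finite, 'z) riem_manifold_scheme \<Rightarrow> ('m, 'n) chart \<Rightarrow>
    ('m \<Rightarrow> 'm tvec \<Rightarrow> real) \<Rightarrow> 'n \<Rightarrow> 'm \<Rightarrow> real" where
  "sharp_coord M c \<omega> a q = (\<Sum>k\<in>UNIV. \<omega> q (onb M q k) * onb M q k (\<lambda>r. snd c r $ a))"

locale chart_frame = orthonormal_frame M P e
  for M :: "('m::{t2_space,second_countable_topology}, 'n::finite, 'z) riem_manifold_scheme"
    and P :: "'m set" and e :: "'n \<Rightarrow> 'm \<Rightarrow> 'm tvec" +
  fixes U :: "'m set" and \<phi> :: "'m \<Rightarrow> real^'n"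
  assumes chart: "(U, \<phi>) \<in> atlas M" and dom: "P \<subseteq> U"
begin

abbreviation "partial a q \<equiv> coord_vector (atlas M) (U, \<phi>) q (axis a 1)"

text \<open>The rows of \<open>to_frame\<close> are the components of the coordinate vectors in
  the frame, those of \<open>to_coord\<close> the coordinate components of the frame
  vectors.\<close>

definition "to_frame q = (\<chi> b k. metric M q (partial b q) (e k q))"
definition "to_coord q = (\<chi> k a. e k q (\<lambda>r. \<phi> r $ a))"

lemma partial_smooth: "smooth_field (atlas M) P (partial a)"
  using smooth_field_subset[OF smooth_field_coord_vector[OF chart] dom] .

lemma partial_tangent: "p \<in> P \<Longrightarrow> partial a p \<in> TS p"
  using smooth_field_tangent[OF partial_smooth] .

lemma smo_coord: "smo (\<lambda>r. \<phi> r $ a)"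
  using smooth_map_subset[OF smooth_map_chart_coord[OF chart] dom] .

lemma smo_to_frame: "smo (\<lambda>q. to_frame q $ b $ k)"
  using metric_smooth[OF open_domain partial_smooth frame_smooth] by (simp add: to_frame_def)

lemma smo_to_coord: "smo (\<lambda>q. to_coord q $ k $ a)"
  using smooth_field_apply[OF frame_smooth open_domain order_refl smo_coord] by (simp add: to_coord_def)

lemma partial_eq: "p \<in> P \<Longrightarrow> partial b p = (\<lambda>f. \<Sum>k\<in>UNIV. to_frame p $ b $ k * e k p f)"
  unfolding to_frame_def vec_lambda_beta by (rule orthonormal_expand[OF frame_orthonormal partial_tangent])

lemma to_frame_to_coord: "p \<in> P \<Longrightarrow> to_frame p ** to_coord p = mat 1"
proof -
  assume p: "p \<in> P"
  have "(\<Sum>k\<in>UNIV. to_frame p $ b $ k * to_coord p $ k $ a) = (if b = a then 1 else 0)" for a b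
    using fun_cong[OF partial_eq[OF p, of b], of "\<lambda>r. \<phi> r $ a"] coord_vector_coord[OF chart, of p "axis b 1" a] p dom
    by (auto simp: to_coord_def axis_def)
  then show ?thesis by (simp add: matrix_matrix_mult_def mat_def vec_eq_iff)
qed

lemma to_coord_to_frame: "p \<in> P \<Longrightarrow> to_coord p ** to_frame p = mat 1"
  using to_frame_to_coord matrix_left_right_inverse by blast

lemma frame_eq_partial:
  assumes p: "p \<in> P"
  shows "e l p f = (\<Sum>a\<in>UNIV. to_coord p $ l $ a * partial a p f)"
proof -
  have "(\<Sum>a\<in>UNIV. to_coord p $ l $ a * partial a p f) = (\<Sum>k\<in>UNIV. (to_coord p ** to_frame p) $ l $ k * e k p f)"
    unfolding partial_eq[OF p] matrix_matrix_mult_def vec_lambda_beta sum_distrib_left sum_distrib_right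
    by (subst sum.swap) (simp add: mult.assoc)
  also have "\<dots> = e l p f" unfolding to_coord_to_frame[OF p] by (simp add: mat_def if_distrib[of "\<lambda>x. x * _"] cong: if_cong)
  finally show ?thesis by simp
qed

lemma gram_matrix_eq: "p \<in> P \<Longrightarrow> gram_matrix (atlas M) (metric M) (U, \<phi>) p = to_frame p ** transpose (to_frame p)"
proof -
  assume p: "p \<in> P"
  have "metric M p (partial a p) (partial b p) = (\<Sum>k\<in>UNIV. to_frame p $ a $ k * to_frame p $ b $ k)" for a b
    using linear_orthonormal_expand[OF frame_orthonormal[OF p] partial_tangent[OF p] metric_linear_left[OF partial_tangent[OF p]], of a b]
      metric_sym[OF partial_tangent[OF p] frame_tangent[OF p]]
    by (simp add: to_frame_def)
  then show ?thesis by (simp add: gram_matrix_def matrix_matrix_mult_def transpose_def vec_eq_iff)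
qed

abbreviation "J \<equiv> volume_density M (U, \<phi>)"

lemma volume_density_eq: "p \<in> P \<Longrightarrow> J p = \<bar>det (to_frame p)\<bar>"
  by (simp add: volume_density_def gram_matrix_eq det_mul det_transpose flip: power2_eq_square)

lemma det_to_frame_nonzero: "p \<in> P \<Longrightarrow> det (to_frame p) \<noteq> 0"
proof
  assume "p \<in> P" "det (to_frame p) = 0"
  then show False using arg_cong[OF to_frame_to_coord, of p det] by (simp add: det_mul)
qed

lemma volume_density_pos: "p \<in> P \<Longrightarrow> J p > 0"
  using volume_density_eq det_to_frame_nonzero by simp

lemma smo_det: "smo (\<lambda>q. det (to_frame q))"
  by (rule smooth_map_det[OF open_domain smo_to_frame])

text \<open>The volume density is an absolute value; it is smooth because the sign of the
  determinant is locally constant.\<close>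

lemma volume_density_local:
  assumes p: "p \<in> P"
  obtains W where "open W" "p \<in> W" "W \<subseteq> P" "\<forall>q\<in>W. J q = sgn (det (to_frame p)) * det (to_frame q)"
proof -
  let ?s = "sgn (det (to_frame p))"
  have "continuous_on P (\<lambda>q. ?s * det (to_frame q))"
    by (intro continuous_intros smooth_map_continuous_on[OF open_domain smo_det])
  then have "open (P \<inter> (\<lambda>q. ?s * det (to_frame q)) -` {0<..})"
    by (rule continuous_open_preimage[OF _ open_domain open_greaterThan])
  moreover have "?s * det (to_frame p) > 0" using det_to_frame_nonzero[OF p] by (simp add: sgn_mult_self_eq sgn_if)
  moreover have "J q = ?s * det (to_frame q)" if "q \<in> P" "?s * det (to_frame q) > 0" for q
    using volume_density_eq[OF that(1)] that(2) by (auto simp: sgn_if split: if_splits)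
  ultimately show ?thesis using p by (intro that[of "P \<inter> (\<lambda>q. ?s * det (to_frame q)) -` {0<..}"]) auto
qed

lemma smo_volume_density: "smo J"
proof (rule smooth_map_local)
  fix p assume p: "p \<in> P"
  obtain W where W: "open W" "p \<in> W" "W \<subseteq> P" "\<forall>q\<in>W. J q = sgn (det (to_frame p)) * det (to_frame q)"
    using volume_density_local[OF p] .
  have "smooth_map (atlas M) W (\<lambda>q. sgn (det (to_frame p)) * det (to_frame q))"
    by (intro smooth_map_mult smooth_map_const W smooth_map_subset[OF smo_det])
  then have "smooth_map (atlas M) W J" by (rule smooth_map_cong[OF W(1), rotated]) (simp add: W)
  then show "\<exists>V. open V \<and> p \<in> V \<and> smooth_map (atlas M) V J" using W by blast
qed

lemma deriv_volume_density:
  assumes p: "p \<in> P" and v: "v \<in> TS p"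
  shows "v J = J p * (\<Sum>k\<in>UNIV. \<Sum>b\<in>UNIV. to_coord p $ k $ b * v (\<lambda>q. to_frame q $ b $ k))"
proof -
  obtain W where W: "open W" "p \<in> W" "W \<subseteq> P" "\<forall>q\<in>W. J q = sgn (det (to_frame p)) * det (to_frame q)"
    using volume_density_local[OF p] .
  have "v J = v (\<lambda>q. sgn (det (to_frame p)) * det (to_frame q))"
    using vderiv_cong[OF v W(1,2) smooth_map_subset[OF smo_volume_density W(3)] W(4)[rule_format]] by (simp add: vderiv_real)
  also have "\<dots> = sgn (det (to_frame p)) * v (\<lambda>q. det (to_frame q))"
    using vderiv_mult[OF v smooth_near_const smo_near[OF smo_det p], of "sgn (det (to_frame p))"]
      vderiv_const[OF v, of "sgn (det (to_frame p))"] by (simp add: vderiv_real)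
  also have "v (\<lambda>q. det (to_frame q)) = det (to_frame p) * (\<Sum>k\<in>UNIV. \<Sum>b\<in>UNIV. to_coord p $ k $ b * v (\<lambda>q. to_frame q $ b $ k))"
    by (rule vderiv_det[OF v open_domain p smo_to_frame to_coord_to_frame[OF p]])
  finally show ?thesis using W(2,4) by simp
qed

lemma dd_real: "dd k f p = e k p f" for f :: "'m \<Rightarrow> real"
  by (simp add: fderiv_def vderiv_real)

text \<open>The divergence of the frame field \<open>e\<^sub>l\<close> in coordinates. The
  derivative of the density is given by Jacobi's formula, and together with the derivatives of the
  components it forms the commutators of \<open>e\<^sub>l\<close> with the frame fields. Their
  trace is that of the connection, since \<open>\<Gamma>\<close> is antisymmetric.\<close>

lemma divergence_frame_field:
  assumes p: "p \<in> P"
  shows "(\<Sum>a\<in>UNIV. partial a p (\<lambda>q. J q * to_coord q $ l $ a)) = J p * (\<Sum>k\<in>UNIV. \<Gamma> k p $ l $ k)"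
proof -
  let ?E = "to_coord p" and ?T = "to_frame p"
  have 1: "partial a p (\<lambda>q. J q * to_coord q $ l $ a) = ?E $ l $ a * partial a p J + J p * partial a p (\<lambda>q. to_coord q $ l $ a)" for a
    using vderiv_mult[OF partial_tangent[OF p] smo_near[OF smo_volume_density p] smo_near[OF smo_to_coord p]] by simp
  have 2: "(\<Sum>a\<in>UNIV. ?E $ l $ a * partial a p J) = J p * (\<Sum>k\<in>UNIV. \<Sum>b\<in>UNIV. ?E $ k $ b * e l p (\<lambda>q. to_frame q $ b $ k))"
    unfolding frame_eq_partial[OF p, symmetric] by (rule deriv_volume_density[OF p frame_tangent[OF p]])
  have 3: "(\<Sum>b\<in>UNIV. ?E $ k $ b * e l p (\<lambda>q. to_frame q $ b $ k)) = - (\<Sum>b\<in>UNIV. ?T $ b $ k * e l p (\<lambda>q. to_coord q $ k $ b))" for k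
  proof -
    have "dd l (\<lambda>q. \<Sum>b\<in>UNIV. to_coord q $ k $ b * to_frame q $ b $ k) p = dd l (\<lambda>q. 1::real) p"
    proof (rule dd_cong[OF p])
      fix q assume "q \<in> P"
      then have "(to_coord q ** to_frame q) $ k $ k = 1" using to_coord_to_frame by (simp add: mat_def)
      then show "(\<Sum>b\<in>UNIV. to_coord q $ k $ b * to_frame q $ b $ k) = 1" by (simp add: matrix_matrix_mult_def)
    qed (intro smo_sum smo_mult smo_to_coord smo_to_frame)
    also have "dd l (\<lambda>q. \<Sum>b\<in>UNIV. to_coord q $ k $ b * to_frame q $ b $ k) p =
        (\<Sum>b\<in>UNIV. ?E $ k $ b * dd l (\<lambda>q. to_frame q $ b $ k) p + dd l (\<lambda>q. to_coord q $ k $ b) p * ?T $ b $ k)"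
      by (simp add: dd_sum[OF p] smo_mult smo_to_coord smo_to_frame dd_mult[OF p])
    also have "\<dots> = (\<Sum>b\<in>UNIV. ?E $ k $ b * e l p (\<lambda>q. to_frame q $ b $ k) + e l p (\<lambda>q. to_coord q $ k $ b) * ?T $ b $ k)"
      by (simp only: dd_real)
    finally show ?thesis by (simp add: dd_const[OF p] sum.distrib mult.commute eq_neg_iff_add_eq_0)
  qed
  have 4: "(\<Sum>a\<in>UNIV. partial a p (\<lambda>q. to_coord q $ l $ a)) = (\<Sum>k\<in>UNIV. \<Sum>a\<in>UNIV. ?T $ a $ k * e k p (\<lambda>q. to_coord q $ l $ a))"
    unfolding partial_eq[OF p] by (rule sum.swap)
  have 5: "(\<Sum>a\<in>UNIV. ?T $ a $ k * (e k p (\<lambda>q. to_coord q $ l $ a) - e l p (\<lambda>q. to_coord q $ k $ a))) = struct k l k p" for k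
  proof -
    have "e k p (\<lambda>q. to_coord q $ l $ a) - e l p (\<lambda>q. to_coord q $ k $ a) = (\<Sum>m\<in>UNIV. struct k l m p * ?E $ m $ a)" for a
      using dd_commute[OF p smo_coord, of k l a] by (simp add: to_coord_def fderiv_def[abs_def] vderiv_real)
    then have "(\<Sum>a\<in>UNIV. ?T $ a $ k * (e k p (\<lambda>q. to_coord q $ l $ a) - e l p (\<lambda>q. to_coord q $ k $ a))) =
        (\<Sum>a\<in>UNIV. \<Sum>m\<in>UNIV. struct k l m p * (?E $ m $ a * ?T $ a $ k))"
      by (simp add: sum_distrib_left algebra_simps)
    also have "\<dots> = (\<Sum>m\<in>UNIV. struct k l m p * (?E ** ?T) $ m $ k)"
      by (subst sum.swap) (simp add: sum_distrib_left matrix_matrix_mult_def)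
    also have "\<dots> = struct k l k p"
      unfolding to_coord_to_frame[OF p] by (simp add: mat_def if_distrib[of "\<lambda>x. _ * x"] cong: if_cong)
    finally show ?thesis .
  qed
  have 6: "struct k l k p = \<Gamma> k p $ l $ k" for k
    using christoffel_antisym[OF p, of l k k] by (simp add: struct_def)
  have "(\<Sum>a\<in>UNIV. partial a p (\<lambda>q. J q * to_coord q $ l $ a)) =
      J p * (\<Sum>k\<in>UNIV. \<Sum>a\<in>UNIV. ?T $ a $ k * (e k p (\<lambda>q. to_coord q $ l $ a) - e l p (\<lambda>q. to_coord q $ k $ a)))"
    unfolding 1 sum.distrib 2 3 sum_distrib_left[symmetric] 4
    by (simp add: algebra_simps sum_subtractf sum_negf)
  then show ?thesis unfolding 5 6 .
qed

context
  fixes \<omega> assumes \<omega>: "one_form (atlas M) \<omega>"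
begin

lemma sharp_coord_frame:
  assumes p: "p \<in> P"
  shows "sharp_coord M (U, \<phi>) \<omega> a p = (\<Sum>k\<in>UNIV. to_coord p $ k $ a * \<omega> p (e k p))"
proof -
  have "sharp_coord M (U, \<phi>) \<omega> a p = (\<Sum>k\<in>UNIV. \<omega> p (e k p) * e k p (\<lambda>r. \<phi> r $ a))"
    unfolding sharp_coord_def snd_conv
    by (rule trace_orthonormal[OF frame_orthonormal[OF p] onb_orthonormal[OF p], of "\<lambda>x y. \<omega> p x * y (\<lambda>r. \<phi> r $ a)"])
      (use one_form_linear[OF \<omega>] in \<open>simp_all add: linear_tangent_def algebra_simps\<close>)
  then show ?thesis by (simp add: to_coord_def mult.commute)
qed

lemma smo_one_form: "smo (\<lambda>q. \<omega> q (e k q))"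
  by (rule one_form_smooth[OF \<omega> open_domain frame_smooth])

lemma smo_sharp_coord: "smo (sharp_coord M (U, \<phi>) \<omega> a)"
proof -
  have "smo (\<lambda>p. \<Sum>k\<in>UNIV. to_coord p $ k $ a * \<omega> p (e k p))"
    by (intro smo_sum smo_mult smo_to_coord smo_one_form)
  then show ?thesis by (rule smooth_map_cong[OF open_domain, rotated]) (simp add: sharp_coord_frame)
qed

text \<open>The Voss-Weyl formula, obtained from the case of the frame fields by the product
  rule.\<close>

lemma divergence_chart:
  assumes p: "p \<in> P"
  shows "(\<Sum>a\<in>UNIV. partial a p (\<lambda>q. J q * sharp_coord M (U, \<phi>) \<omega> a q)) = J p * divergence M \<omega> p"
proof -
  let ?w = "\<lambda>k q. \<omega> q (e k q)"
  have JE: "smo (\<lambda>q. J q * to_coord q $ k $ a)" for k a by (intro smo_mult smo_volume_density smo_to_coord)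
  have "partial a p (\<lambda>q. J q * sharp_coord M (U, \<phi>) \<omega> a q) =
      (\<Sum>k\<in>UNIV. partial a p (\<lambda>q. J q * to_coord q $ k $ a) * ?w k p + J p * (to_coord p $ k $ a * partial a p (?w k)))" for a
  proof -
    have "vderiv (partial a p) (\<lambda>q. J q * sharp_coord M (U, \<phi>) \<omega> a q) =
        vderiv (partial a p) (\<lambda>q. \<Sum>k\<in>UNIV. (J q * to_coord q $ k $ a) * ?w k q)"
      by (rule vderiv_cong[OF partial_tangent[OF p] open_domain p])
        (auto intro!: smo_mult smo_volume_density smo_sharp_coord simp: sharp_coord_frame sum_distrib_left algebra_simps)
    also have "\<dots> = (\<Sum>k\<in>UNIV. vderiv (partial a p) (\<lambda>q. (J q * to_coord q $ k $ a) * ?w k q))"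
      by (rule vderiv_sum[OF partial_tangent[OF p]]) (intro smo_near[OF _ p] smo_mult JE smo_one_form)
    finally have 1: "vderiv (partial a p) (\<lambda>q. J q * sharp_coord M (U, \<phi>) \<omega> a q) = \<dots>" .
    have "vderiv (partial a p) (\<lambda>q. (J q * to_coord q $ k $ a) * ?w k q) =
        partial a p (\<lambda>q. J q * to_coord q $ k $ a) * ?w k p + (J p * to_coord p $ k $ a) * partial a p (?w k)" for k
      unfolding vderiv_real
      by (rule vderiv_mult[OF partial_tangent[OF p] smo_near[OF JE p] smo_near[OF smo_one_form p]])
    with 1 show ?thesis by (simp add: vderiv_real mult.assoc)
  qed
  then have "(\<Sum>a\<in>UNIV. partial a p (\<lambda>q. J q * sharp_coord M (U, \<phi>) \<omega> a q)) =
      (\<Sum>k\<in>UNIV. (\<Sum>a\<in>UNIV. partial a p (\<lambda>q. J q * to_coord q $ k $ a)) * ?w k p)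
      + (\<Sum>k\<in>UNIV. J p * (\<Sum>a\<in>UNIV. to_coord p $ k $ a * partial a p (?w k)))"
    unfolding sum_distrib_left sum_distrib_right
    by (simp only: sum.distrib) (rule arg_cong2[where f="(+)"]; rule sum.swap)
  also have "\<dots> = J p * ((\<Sum>k\<in>UNIV. (\<Sum>m\<in>UNIV. \<Gamma> m p $ k $ m) * ?w k p) + (\<Sum>k\<in>UNIV. e k p (?w k)))"
    unfolding divergence_frame_field[OF p] frame_eq_partial[OF p, symmetric]
    by (simp only: distrib_left sum_distrib_left sum_distrib_right mult.assoc)
  also have "(\<Sum>k\<in>UNIV. (\<Sum>m\<in>UNIV. \<Gamma> m p $ k $ m) * ?w k p) = - (\<Sum>m\<in>UNIV. \<Sum>k\<in>UNIV. \<Gamma> m p $ m $ k * ?w k p)"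
    unfolding sum_distrib_right sum_negf[symmetric]
    by (subst sum.swap, intro sum.cong refl, subst christoffel_antisym[OF p], simp)
  finally show ?thesis
    unfolding divergence_frame[OF \<omega> p] by (simp add: dd_real sum_subtractf)
qed

end

end

section \<open>The divergence theorem\<close>

lemma (in orthonormal_frame) chart_frame_restrict:
  assumes "(U, \<phi>) \<in> atlas M"
  shows "chart_frame M (U \<inter> P) e U \<phi>"
proof -
  interpret Q: orthonormal_frame M "U \<inter> P" e
    by (rule restrict_frame) (use chart_homeomorphism(1)[OF assms] open_domain in auto)
  show ?thesis by unfold_locales (use assms in auto)
qed

text \<open>Total functions on the Euclidean space, measurable because the image of the chart is
  open. Points outside that image have weight zero.\<close>

definition chart_weight :: "('m::topological_space, 'n::finite, 'z) riem_manifold_scheme \<Rightarrow> 'm set \<Rightarrow> ('m \<Rightarrow> real^'n) \<Rightarrow> real^'n \<Rightarrow> real" where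
  "chart_weight M U \<phi> x = (if x \<in> \<phi> ` U then volume_density M (U, \<phi>) (inv_into U \<phi> x) else 0)"

definition chart_inverse :: "'m set \<Rightarrow> ('m \<Rightarrow> real^'n::finite) \<Rightarrow> real^'n \<Rightarrow> 'm" where
  "chart_inverse U \<phi> x = (if x \<in> \<phi> ` U then inv_into U \<phi> x else undefined)"

context framed_manifold
begin

lemma sets_vol: "sets (vol M) = sets borel"
  using riemannian by (simp add: riemannian_manifold_def riemannian_volume_def)

lemma chart_frame_at:
  assumes "(U, \<phi>) \<in> atlas M" "p \<in> U"
  obtains P e where "chart_frame M P e U \<phi>" "p \<in> P"
proof -
  obtain P e where "orthonormal_frame M P e" "p \<in> P" using frame_at .
  then show ?thesis using that orthonormal_frame.chart_frame_restrict[OF _ assms(1)] assms(2) by blast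
qed

lemma one_form_mult:
  assumes "one_form (atlas M) \<omega>" "smooth_map (atlas M) UNIV \<eta>"
  shows "one_form (atlas M) (\<lambda>q v. \<eta> q * \<omega> q v)"
  using assms unfolding one_form_def
  by (auto simp: linear_tangent_def algebra_simps intro!: smooth_map_mult intro: smooth_map_subset)

lemma smooth_divergence:
  assumes \<omega>: "one_form (atlas M) \<omega>"
  shows "smooth_map (atlas M) UNIV (divergence M \<omega>)"
proof (rule smooth_map_local)
  fix p
  obtain P e where f: "orthonormal_frame M P e" and p: "p \<in> P" using frame_at .
  interpret orthonormal_frame M P e by (rule f)
  have w: "smo (\<lambda>q. \<omega> q (e k q))" for k by (rule one_form_smooth[OF \<omega> open_domain frame_smooth])
  have "smo (\<lambda>p. \<Sum>k\<in>UNIV. dd k (\<lambda>q. \<omega> q (e k q)) p - (\<Sum>m\<in>UNIV. \<Gamma> k p $ k $ m * \<omega> p (e m p)))"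
    by (intro smo_sum smo_diff smo_dd w smo_mult smo_christoffel_nth)
  then have "smo (divergence M \<omega>)"
    by (rule smooth_map_cong[OF open_domain, rotated]) (simp add: divergence_frame[OF \<omega>])
  then show "\<exists>V. open V \<and> p \<in> V \<and> smooth_map (atlas M) V (divergence M \<omega>)" using open_domain p by blast
qed

lemma divergence_sum:
  assumes "finite I" and \<omega>: "\<And>i. i \<in> I \<Longrightarrow> one_form (atlas M) (\<omega> i)"
    and s: "one_form (atlas M) (\<lambda>q v. \<Sum>i\<in>I. \<omega> i q v)"
  shows "divergence M (\<lambda>q v. \<Sum>i\<in>I. \<omega> i q v) p = (\<Sum>i\<in>I. divergence M (\<omega> i) p)"
proof -
  obtain P e where f: "orthonormal_frame M P e" and p: "p \<in> P" using frame_at .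
  interpret orthonormal_frame M P e by (rule f)
  have w: "smo (\<lambda>q. \<omega> i q (e k q))" if "i \<in> I" for i k
    by (rule one_form_smooth[OF \<omega>[OF that] open_domain frame_smooth])
  have "(\<Sum>i\<in>I. divergence M (\<omega> i) p) =
      (\<Sum>i\<in>I. \<Sum>k\<in>UNIV. dd k (\<lambda>q. \<omega> i q (e k q)) p - (\<Sum>m\<in>UNIV. \<Gamma> k p $ k $ m * \<omega> i p (e m p)))"
    by (intro sum.cong refl divergence_frame \<omega> p)
  also have "\<dots> = (\<Sum>k\<in>UNIV. \<Sum>i\<in>I. dd k (\<lambda>q. \<omega> i q (e k q)) p - (\<Sum>m\<in>UNIV. \<Gamma> k p $ k $ m * \<omega> i p (e m p)))"
    by (rule sum.swap)
  also have "\<dots> = (\<Sum>k\<in>UNIV. (\<Sum>i\<in>I. dd k (\<lambda>q. \<omega> i q (e k q)) p) - (\<Sum>m\<in>UNIV. \<Gamma> k p $ k $ m * (\<Sum>i\<in>I. \<omega> i p (e m p))))"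
    unfolding sum_subtractf sum_distrib_left
    by (rule arg_cong2[where f="(-)", OF refl], rule sum.cong[OF refl], rule sum.swap)
  also have "\<dots> = divergence M (\<lambda>q v. \<Sum>i\<in>I. \<omega> i q v) p"
    unfolding divergence_frame[OF s p] by (intro sum.cong refl arg_cong2[where f="(-)"] dd_sum[symmetric] p w)
  finally show ?thesis by simp
qed

lemma divergence_eq_0:
  assumes \<omega>: "one_form (atlas M) \<omega>" and V: "open V" "p \<in> V" "\<And>q v. q \<in> V \<Longrightarrow> \<omega> q v = 0"
  shows "divergence M \<omega> p = 0"
proof -
  obtain P e where f: "orthonormal_frame M P e" and p: "p \<in> P" using frame_at .
  interpret P: orthonormal_frame M P e by (rule f)
  interpret orthonormal_frame M "P \<inter> V" e
    by (rule P.restrict_frame) (use V P.open_domain in auto)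
  have p': "p \<in> P \<inter> V" using p V by simp
  have "fderiv e k (\<lambda>q. \<omega> q (e k q)) p = fderiv e k (\<lambda>q. 0) p" for k
    by (rule dd_cong[OF p' one_form_smooth[OF \<omega> open_domain frame_smooth]]) (simp add: V)
  then show ?thesis
    unfolding divergence_frame[OF \<omega> p'] using V(2,3) by (simp add: dd_const[OF p'])
qed

context
  fixes U :: "'m set" and \<phi> :: "'m \<Rightarrow> real^'n"
  assumes chart: "(U, \<phi>) \<in> atlas M"
begin

abbreviation "dens \<equiv> volume_density M (U, \<phi>)"

lemma density_pos: "p \<in> U \<Longrightarrow> dens p > 0"
proof -
  assume pU: "p \<in> U"
  obtain P e where f: "chart_frame M P e U \<phi>" and p: "p \<in> P" using chart_frame_at[OF chart pU] .
  interpret chart_frame M P e U \<phi> by (rule f)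
  show ?thesis by (rule volume_density_pos[OF p])
qed

lemma smooth_density: "smooth_map (atlas M) U dens"
proof (rule smooth_map_local)
  fix p assume pU: "p \<in> U"
  obtain P e where f: "chart_frame M P e U \<phi>" and p: "p \<in> P" using chart_frame_at[OF chart pU] .
  interpret chart_frame M P e U \<phi> by (rule f)
  show "\<exists>V. open V \<and> p \<in> V \<and> smooth_map (atlas M) V dens"
    using smo_volume_density open_domain p by blast
qed

lemma smooth_sharp_coord:
  assumes \<omega>: "one_form (atlas M) \<omega>"
  shows "smooth_map (atlas M) U (sharp_coord M (U, \<phi>) \<omega> a)"
proof (rule smooth_map_local)
  fix p assume pU: "p \<in> U"
  obtain P e where f: "chart_frame M P e U \<phi>" and p: "p \<in> P" using chart_frame_at[OF chart pU] .
  interpret chart_frame M P e U \<phi> by (rule f)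
  show "\<exists>V. open V \<and> p \<in> V \<and> smooth_map (atlas M) V (sharp_coord M (U, \<phi>) \<omega> a)"
    using smo_sharp_coord[OF \<omega>] open_domain p by blast
qed

lemma divergence_in_chart:
  assumes \<omega>: "one_form (atlas M) \<omega>" and "p \<in> U"
  shows "(\<Sum>a\<in>UNIV. coord_vector (atlas M) (U, \<phi>) p (axis a 1) (\<lambda>q. dens q * sharp_coord M (U, \<phi>) \<omega> a q)) = dens p * divergence M \<omega> p"
proof -
  obtain P e where f: "chart_frame M P e U \<phi>" and p: "p \<in> P" using chart_frame_at[OF chart \<open>p \<in> U\<close>] .
  interpret chart_frame M P e U \<phi> by (rule f)
  show ?thesis by (rule divergence_chart[OF \<omega> p])
qed

subsection \<open>Integration in a chart\<close>

lemma emeasure_vol: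
  assumes "B \<in> sets borel" "B \<subseteq> U"
  shows "emeasure (vol M) B = (\<integral>\<^sup>+x. ennreal (dens (inv_into U \<phi> x)) * indicator (\<phi> ` B) x \<partial>lborel)"
proof -
  have "\<forall>(U, \<phi>)\<in>atlas M. \<forall>B\<in>sets borel. B \<subseteq> U \<longrightarrow>
      emeasure (vol M) B = (\<integral>\<^sup>+x. ennreal (J' (U, \<phi>) (inv_into U \<phi> x)) * indicator (\<phi> ` B) x \<partial>lborel)"
    if "J' = volume_density M" for J'
    using riemannian that unfolding riemannian_manifold_def riemannian_volume_def
    by (simp add: volume_density_def[abs_def])
  from this[OF refl] show ?thesis using chart assms by fast
qed

lemma chart_image_open: "open (\<phi> ` U)"
  by (rule chart_homeomorphism(2)[OF chart])

lemma chart_inv_continuous: "continuous_on (\<phi> ` U) (inv_into U \<phi>)"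
  using chart_homeomorphism(3)[OF chart] by (simp add: homeomorphism_def)

lemma chart_continuous: "continuous_on U \<phi>"
  using chart_homeomorphism(3)[OF chart] by (simp add: homeomorphism_def)

lemma density_continuous: "continuous_on (\<phi> ` U) (\<lambda>x. dens (inv_into U \<phi> x))"
  using k_smooth_on_continuous[OF smooth_mapD[OF smooth_density chart, of 0]] by simp

lemma chart_weight_nonneg: "chart_weight M U \<phi> x \<ge> 0"
  by (auto simp: chart_weight_def chart_inv[OF chart] intro!: less_imp_le density_pos)

lemma measurable_chart_weight: "chart_weight M U \<phi> \<in> borel_measurable borel"
proof -
  have "(\<lambda>x. if x \<in> \<phi> ` U then dens (inv_into U \<phi> x) else 0) \<in> borel_measurable borel"
    by (rule borel_measurable_continuous_on_if)
      (use chart_image_open density_continuous in auto)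
  then show ?thesis by (simp add: chart_weight_def[abs_def])
qed

lemma measurable_chart_inverse: "chart_inverse U \<phi> \<in> borel_measurable borel"
proof -
  have "(\<lambda>x. if x \<in> \<phi> ` U then inv_into U \<phi> x else undefined) \<in> borel_measurable borel"
    by (rule borel_measurable_continuous_on_if)
      (use chart_image_open chart_inv_continuous in auto)
  then show ?thesis by (simp add: chart_inverse_def[abs_def])
qed

lemma open_chart_domain: "open U"
  by (rule chart_homeomorphism(1)[OF chart])

text \<open>On a chart domain, the volume is the image of a weighted Lebesgue measure under the
  inverse of the chart; this transports integrals to the Euclidean space.\<close>

lemma volume_in_chart:
  "density (vol M) (\<lambda>q. ennreal (indicator U q)) = distr (density lborel (\<lambda>x. ennreal (chart_weight M U \<phi> x))) borel (chart_inverse U \<phi>)"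
proof (rule measure_eqI)
  show "sets (density (vol M) (\<lambda>q. ennreal (indicator U q))) = sets (distr (density lborel (\<lambda>x. ennreal (chart_weight M U \<phi> x))) borel (chart_inverse U \<phi>))"
    by (simp add: sets_vol)
  fix B assume "B \<in> sets (density (vol M) (\<lambda>q. ennreal (indicator U q)))"
  then have B: "B \<in> sets borel" by (simp add: sets_vol)
  have UB: "U \<inter> B \<in> sets borel" using B open_chart_domain by simp
  have Us: "U \<in> sets (vol M)" using open_chart_domain by (simp add: sets_vol)
  have Bs: "B \<in> sets (vol M)" using B by (simp add: sets_vol)
  have "emeasure (density (vol M) (\<lambda>q. ennreal (indicator U q))) B = (\<integral>\<^sup>+q. indicator (U \<inter> B) q \<partial>vol M)"
  proof -
    have "ennreal (indicator U q) * indicator B q = (indicator (U \<inter> B) q :: ennreal)" for q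
      by (cases "q \<in> U"; cases "q \<in> B") auto
    moreover have "(\<lambda>q. ennreal (indicator U q)) \<in> borel_measurable (vol M)" using Us by simp
    ultimately show ?thesis using Bs by (simp add: emeasure_density)
  qed
  also have "\<dots> = emeasure (vol M) (U \<inter> B)" using UB by (simp add: sets_vol)
  also have "\<dots> = (\<integral>\<^sup>+x. ennreal (dens (inv_into U \<phi> x)) * indicator (\<phi> ` (U \<inter> B)) x \<partial>lborel)"
    by (rule emeasure_vol[OF UB]) simp
  also have "\<dots> = (\<integral>\<^sup>+x. ennreal (chart_weight M U \<phi> x) * indicator (chart_inverse U \<phi> -` B) x \<partial>lborel)"
  proof (rule nn_integral_cong)
    fix x
    have "x \<in> \<phi> ` (U \<inter> B) \<longleftrightarrow> inv_into U \<phi> x \<in> B" if "x \<in> \<phi> ` U"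
      using that chart chart_image_eq[OF chart, of B] by auto
    then show "ennreal (dens (inv_into U \<phi> x)) * indicator (\<phi> ` (U \<inter> B)) x = ennreal (chart_weight M U \<phi> x) * indicator (chart_inverse U \<phi> -` B) x"
      by (auto simp: chart_weight_def chart_inverse_def indicator_def)
  qed
  also have "\<dots> = emeasure (density lborel (\<lambda>x. ennreal (chart_weight M U \<phi> x))) (chart_inverse U \<phi> -` B)"
    by (rule emeasure_density[symmetric])
      (use measurable_chart_weight measurable_sets[OF measurable_chart_inverse B] in auto)
  also have "\<dots> = emeasure (distr (density lborel (\<lambda>x. ennreal (chart_weight M U \<phi> x))) borel (chart_inverse U \<phi>)) B"
    by (subst emeasure_distr) (use measurable_chart_inverse B in auto)
  finally show "emeasure (density (vol M) (\<lambda>q. ennreal (indicator U q))) B =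
    emeasure (distr (density lborel (\<lambda>x. ennreal (chart_weight M U \<phi> x))) borel (chart_inverse U \<phi>)) B" .
qed

lemma integral_in_chart:
  fixes f :: "'m \<Rightarrow> real"
  assumes f: "f \<in> borel_measurable borel" and z: "\<And>q. q \<notin> U \<Longrightarrow> f q = 0"
  shows "(\<integral>q. f q \<partial>vol M) = (\<integral>x. chart_weight M U \<phi> x * f (chart_inverse U \<phi> x) \<partial>lborel)"
proof -
  have fm: "f \<in> borel_measurable (vol M)" using f measurable_cong_sets[OF sets_vol refl] by blast
  have "indicator U q *\<^sub>R f q = f q" for q using z[of q] by (cases "q \<in> U") auto
  then have "(\<integral>q. f q \<partial>vol M) = (\<integral>q. indicator U q *\<^sub>R f q \<partial>vol M)" by (simp only:)
  also have "\<dots> = integral\<^sup>L (density (vol M) (\<lambda>q. ennreal (indicator U q))) f"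
    by (rule integral_density[symmetric]) (use fm borel_measurable_indicator[of U "vol M"] open_chart_domain in \<open>simp_all add: sets_vol\<close>)
  also have "\<dots> = integral\<^sup>L (density lborel (\<lambda>x. ennreal (chart_weight M U \<phi> x))) (\<lambda>x. f (chart_inverse U \<phi> x))"
    unfolding volume_in_chart by (rule integral_distr) (use f measurable_chart_inverse in auto)
  also have "\<dots> = (\<integral>x. chart_weight M U \<phi> x *\<^sub>R f (chart_inverse U \<phi> x) \<partial>lborel)"
    by (rule integral_density)
      (use measurable_compose[OF measurable_chart_inverse f] measurable_chart_weight chart_weight_nonneg in auto)
  finally show ?thesis by simp
qed

lemma vol_locally_finite:
  assumes p: "p \<in> U"
  shows "\<exists>V. open V \<and> p \<in> V \<and> emeasure (vol M) V < \<infinity>"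
proof -
  obtain r where r: "r > 0" "cball (\<phi> p) r \<subseteq> \<phi> ` U"
    using chart_image_open p open_contains_cball by blast
  let ?V = "U \<inter> \<phi> -` ball (\<phi> p) r"
  have V: "open ?V" "p \<in> ?V" using chart_preimage_open[OF chart open_ball] p r by auto
  have "compact ((\<lambda>x. dens (inv_into U \<phi> x)) ` cball (\<phi> p) r)"
    by (rule compact_continuous_image[OF continuous_on_subset[OF density_continuous r(2)] compact_cball])
  from compact_imp_bounded[OF this] obtain C where C': "\<forall>y\<in>(\<lambda>x. dens (inv_into U \<phi> x)) ` cball (\<phi> p) r. norm y \<le> C"
    unfolding bounded_iff by blast
  have C: "dens (inv_into U \<phi> x) \<le> C" if "x \<in> cball (\<phi> p) r" for x
  proof -
    have "norm (dens (inv_into U \<phi> x)) \<le> C" using C' that by blast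
    then show ?thesis by simp
  qed
  have "emeasure (vol M) ?V = (\<integral>\<^sup>+x. ennreal (dens (inv_into U \<phi> x)) * indicator (\<phi> ` ?V) x \<partial>lborel)"
    by (rule emeasure_vol) (use V in auto)
  also have "\<dots> \<le> (\<integral>\<^sup>+x. ennreal C * indicator (cball (\<phi> p) r) x \<partial>lborel)"
  proof (rule nn_integral_mono)
    fix x
    show "ennreal (dens (inv_into U \<phi> x)) * indicator (\<phi> ` ?V) x \<le> ennreal C * indicator (cball (\<phi> p) r) x"
      using C[of x] by (auto simp: indicator_def intro!: ennreal_leI)
  qed
  also have "\<dots> = ennreal C * emeasure lborel (cball (\<phi> p) r)" by (rule nn_integral_cmult_indicator) simp
  also have "\<dots> < \<infinity>"
    using emeasure_lborel_cball_finite[of "\<phi> p" r] by (simp add: ennreal_mult_less_top)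
  finally show ?thesis using V by blast
qed

text \<open>The density is positive, and nonempty open subsets of the Euclidean space are not
  negligible.\<close>

lemma emeasure_vol_open_pos:
  assumes V: "open V" "V \<subseteq> U" "V \<noteq> {}"
  shows "emeasure (vol M) V \<noteq> 0"
proof
  assume z: "emeasure (vol M) V = 0"
  have "(\<integral>\<^sup>+x. ennreal (chart_weight M U \<phi> x) * indicator (\<phi> ` V) x \<partial>lborel) =
      (\<integral>\<^sup>+x. ennreal (dens (inv_into U \<phi> x)) * indicator (\<phi> ` V) x \<partial>lborel)"
    by (rule nn_integral_cong) (use V(2) in \<open>auto simp: chart_weight_def indicator_def\<close>)
  also have "\<dots> = emeasure (vol M) V" by (rule emeasure_vol[symmetric]) (use V in auto)
  finally have "(\<integral>\<^sup>+x. ennreal (chart_weight M U \<phi> x) * indicator (\<phi> ` V) x \<partial>lborel) = 0" using z by simp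
  moreover have o: "open (\<phi> ` V)" using chart_open_image[OF chart V(1)] V(2) by (simp add: Int_absorb1)
  have m: "(\<lambda>x. ennreal (chart_weight M U \<phi> x) * indicator (\<phi> ` V) x) \<in> borel_measurable lborel"
    using measurable_chart_weight o by simp
  ultimately have "AE x in lborel. ennreal (chart_weight M U \<phi> x) * indicator (\<phi> ` V) x = 0"
    using nn_integral_0_iff_AE[OF m] by simp
  then have "AE x in lborel. x \<notin> \<phi> ` V"
  proof (rule AE_mp, intro AE_I2 impI notI)
    fix x assume z: "ennreal (chart_weight M U \<phi> x) * indicator (\<phi> ` V) x = 0" and x: "x \<in> \<phi> ` V"
    then have "x \<in> \<phi> ` U" "inv_into U \<phi> x \<in> U" using V(2) chart by auto
    then have "chart_weight M U \<phi> x > 0" using density_pos by (simp add: chart_weight_def)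
    then show False using z x by simp
  qed
  then have "\<phi> ` V \<in> null_sets lborel" using AE_iff_null_sets[of "\<phi> ` V" lborel] o by simp
  then have "negligible (\<phi> ` V)" by (simp add: negligible_iff_null_sets null_sets_completionI)
  then show False using open_not_negligible[OF o] V(3) by simp
qed

text \<open>The bump is extended by zero outside the chart domain. It remains smooth because its
  support is compact, hence closed in the manifold.\<close>

lemma bump_in_chart:
  assumes p: "p \<in> U"
  obtains \<eta> :: "'m \<Rightarrow> real" and K where "smooth_map (atlas M) UNIV \<eta>" "\<And>q. \<eta> q \<ge> 0" "\<eta> p > 0"
    "compact K" "K \<subseteq> U" "\<And>q. q \<notin> K \<Longrightarrow> \<eta> q = 0"
proof -
  obtain r where r: "r > 0" "cball (\<phi> p) r \<subseteq> \<phi> ` U"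
    using chart_image_open p open_contains_cball by blast
  define \<eta> where "\<eta> q = (if q \<in> U then bump (\<phi> p) r (\<phi> q) else 0)" for q
  define K where "K = inv_into U \<phi> ` cball (\<phi> p) r"
  have K: "compact K"
    unfolding K_def by (rule compact_continuous_image[OF continuous_on_subset[OF chart_inv_continuous r(2)] compact_cball])
  have KU: "K \<subseteq> U" unfolding K_def using r(2) chart by auto
  have z: "\<eta> q = 0" if "q \<notin> K" for q
  proof (rule ccontr)
    assume "\<eta> q \<noteq> 0"
    then have q: "q \<in> U" "bump (\<phi> p) r (\<phi> q) \<noteq> 0" by (auto simp: \<eta>_def split: if_splits)
    then have "bump (\<phi> p) r (\<phi> q) > 0" using bump_nonneg[of "\<phi> p" r "\<phi> q"] by linarith
    then have "\<phi> q \<in> cball (\<phi> p) r" using bump_pos_iff[OF r(1)] by (metis ball_subset_cball subsetD)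
    then have "inv_into U \<phi> (\<phi> q) \<in> K" unfolding K_def by blast
    then show False using that q chart by simp
  qed
  have "smooth_map (atlas M) UNIV \<eta>"
  proof (rule smooth_map_local)
    fix q
    show "\<exists>V. open V \<and> q \<in> V \<and> smooth_map (atlas M) V \<eta>"
    proof (cases "q \<in> U")
      case True
      have "k_smooth_on k (\<phi> ` U) (bump (\<phi> p) r)" for k
        by (rule k_smooth_on_subset[of k UNIV]) (use smooth_on_bump[of "\<phi> p" r] in \<open>auto simp: smooth_on_def\<close>)
      then have "smooth_map (atlas M) U (\<lambda>q. bump (\<phi> p) r (\<phi> q))"
        by (rule smooth_map_chart[OF chart open_chart_domain order_refl])
      then have "smooth_map (atlas M) U \<eta>"
        by (rule smooth_map_cong[OF open_chart_domain, rotated]) (simp add: \<eta>_def)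
      then show ?thesis using True open_chart_domain by blast
    next
      case False
      have o: "open (- K)" using K by (simp add: compact_imp_closed open_Compl)
      have "smooth_map (atlas M) (- K) \<eta>"
        by (rule smooth_map_cong[OF o _ smooth_map_const[OF o, of 0]]) (simp add: z)
      then show ?thesis using o False KU by blast
    qed
  qed
  moreover have "\<eta> p > 0" using bump_pos_iff[OF r(1), of "\<phi> p" "\<phi> p"] p r(1) by (simp add: \<eta>_def)
  moreover have "\<eta> q \<ge> 0" for q by (simp add: \<eta>_def bump_nonneg)
  ultimately show ?thesis using that K KU z by blast
qed

text \<open>By the Voss-Weyl formula, the integral is that of a sum of partial derivatives of
  functions with compact support on the Euclidean space.\<close>

lemma divergence_integral_in_chart:
  assumes \<omega>: "one_form (atlas M) \<omega>" and K: "compact K" "K \<subseteq> U" "\<And>q v. q \<notin> K \<Longrightarrow> \<omega> q v = 0"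
  shows "(\<integral>p. divergence M \<omega> p \<partial>vol M) = 0"
proof -
  let ?K = "\<phi> ` K"
  have Kc: "compact ?K"
    by (rule compact_continuous_image[OF continuous_on_subset[OF chart_continuous K(2)] K(1)])
  have oK: "open (- K)" "open (- ?K)" using K(1) Kc by (simp_all add: compact_imp_closed open_Compl)
  define f where "f a q = dens q * sharp_coord M (U, \<phi>) \<omega> a q" for a q
  have f: "smooth_map (atlas M) U (f a)" for a
    unfolding f_def by (intro smooth_map_mult open_chart_domain smooth_density smooth_sharp_coord \<omega>)
  have f0: "f a q = 0" if "q \<notin> K" for a q
    unfolding f_def sharp_coord_def using K(3)[OF that] by simp
  define F where "F a x = (if x \<in> \<phi> ` U then f a (inv_into U \<phi> x) else 0)" for a x
  define F' where "F' a x v = (if x \<in> \<phi> ` U then frechet_derivative (\<lambda>x. f a (inv_into U \<phi> x)) (at x) v else 0)" for a x v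
  have F0: "F a x = 0" if "x \<notin> ?K" for a x
  proof -
    have "inv_into U \<phi> x \<notin> K" if "x \<in> \<phi> ` U"
      using that \<open>x \<notin> ?K\<close> chart by auto
    then show ?thesis using f0 by (simp add: F_def)
  qed
  have UU: "\<phi> ` (U \<inter> U) = \<phi> ` U" by simp
  have ks: "k_smooth_on k (\<phi> ` U) (\<lambda>x. f a (inv_into U \<phi> x))" for k a
    using smooth_mapD[OF f chart, of k a] by simp
  have d: "(F a has_derivative F' a x) (at x)" for a x
  proof (cases "x \<in> \<phi> ` U")
    case True
    have "F' a x = frechet_derivative (\<lambda>x. f a (inv_into U \<phi> x)) (at x)" using True by (simp add: F'_def[abs_def])
    moreover have "(F a has_derivative frechet_derivative (\<lambda>x. f a (inv_into U \<phi> x)) (at x)) (at x)"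
      by (rule has_derivative_transform_within_open[OF k_smooth_on_SucE[OF ks True] chart_image_open True]) (simp add: F_def)
    ultimately show ?thesis by simp
  next
    case False
    have "(F a has_derivative (\<lambda>_. 0)) (at x)"
      by (rule has_derivative_transform_within_open[OF has_derivative_const oK(2)]) (use False F0 K(2) in auto)
    then show ?thesis using False by (simp add: F'_def[abs_def])
  qed
  have F'0: "F' a x v = 0" if "x \<notin> ?K" for a x v
  proof -
    have "(F a has_derivative (\<lambda>_. 0)) (at x)"
      by (rule has_derivative_transform_within_open[OF has_derivative_const oK(2)]) (use that F0 in auto)
    then show ?thesis using has_derivative_unique[OF d] by metis
  qed
  have c: "continuous_on UNIV (\<lambda>x. F' a x v)" for a v
  proof -
    have "continuous_on (\<phi> ` U) (\<lambda>x. frechet_derivative (\<lambda>x. f a (inv_into U \<phi> x)) (at x) v)"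
      using k_smooth_on_continuous[of 0] ks[of "Suc 0" a] by simp
    then have 1: "continuous_on (\<phi> ` U) (\<lambda>x. F' a x v)"
      by (rule continuous_on_eq) (simp add: F'_def)
    have 2: "continuous_on (- ?K) (\<lambda>x. F' a x v)"
      by (rule continuous_on_eq[OF continuous_on_const[of _ 0]]) (simp add: F'0)
    have "\<phi> ` U \<union> - ?K = UNIV" using K(2) by auto
    then show ?thesis using continuous_on_open_Un[OF chart_image_open oK(2) 1 2] by simp
  qed
  note int = integral_derivative_compact_support[OF d c Kc F0]
  have dz: "divergence M \<omega> q = 0" if "q \<notin> K" for q
    by (rule divergence_eq_0[OF \<omega> oK(1)]) (use that K(3) in auto)
  have weight: "chart_weight M U \<phi> x * divergence M \<omega> (chart_inverse U \<phi> x) = (\<Sum>a\<in>UNIV. F' a x (axis a 1))" for x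
  proof (cases "x \<in> \<phi> ` U")
    case True
    then obtain q where q: "q \<in> U" "x = \<phi> q" by auto
    have "chart_weight M U \<phi> x * divergence M \<omega> (chart_inverse U \<phi> x) = dens q * divergence M \<omega> q"
      using True q chart by (simp add: chart_weight_def chart_inverse_def)
    also have "\<dots> = (\<Sum>a\<in>UNIV. coord_vector (atlas M) (U, \<phi>) q (axis a 1) (f a))"
      unfolding f_def by (rule divergence_in_chart[OF \<omega> q(1), symmetric])
    also have "\<dots> = (\<Sum>a\<in>UNIV. F' a x (axis a 1))"
      unfolding coord_vector_eq[OF smooth_nearI[OF f open_chart_domain q(1)]]
      using True q(2) by (simp add: F'_def)
    finally show ?thesis .
  qed (simp add: chart_weight_def F'_def)
  have "divergence M \<omega> \<in> borel_measurable borel"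
    by (rule borel_measurable_continuous_onI[OF smooth_map_continuous_on[OF open_UNIV smooth_divergence[OF \<omega>]]])
  then have "(\<integral>p. divergence M \<omega> p \<partial>vol M) = (\<integral>x. chart_weight M U \<phi> x * divergence M \<omega> (chart_inverse U \<phi> x) \<partial>lborel)"
    by (rule integral_in_chart) (use dz K(2) in auto)
  also have "\<dots> = (\<Sum>a\<in>UNIV. \<integral>x. F' a x (axis a 1) \<partial>lborel)"
    unfolding weight by (rule Bochner_Integration.integral_sum) (rule int(1))
  also have "\<dots> = 0" using int(2) by simp
  finally show ?thesis .
qed

end

end

subsection \<open>Compact manifolds\<close>

locale closed_manifold = framed_manifold M
  for M :: "('m::{t2_space,second_countable_topology}, 'n::finite, 'z) riem_manifold_scheme" +
  assumes compact_space: "compact (UNIV :: 'm set)"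
begin

text \<open>Finitely many of the open sets of finite volume cover the compact manifold.\<close>

lemma finite_measure_vol: "finite_measure (vol M)"
proof (rule finite_measureI)
  have "\<exists>V. open V \<and> p \<in> V \<and> emeasure (vol M) V < \<infinity>" for p
  proof -
    obtain U \<phi> where "(U, \<phi>) \<in> atlas M" "p \<in> U" using chart_cover .
    then show ?thesis by (rule vol_locally_finite)
  qed
  then obtain V where V: "\<And>p. open (V p)" "\<And>p. p \<in> V p" "\<And>p. emeasure (vol M) (V p) < \<infinity>" by metis
  obtain C where C: "finite C" "UNIV \<subseteq> \<Union> (V ` C)"
    by (rule compactE_image[OF compact_space, of UNIV V]) (use V in auto)
  have "emeasure (vol M) (space (vol M)) \<le> emeasure (vol M) (\<Union> (V ` C))"
    by (rule emeasure_mono) (use C V(1) in \<open>auto simp: sets_vol\<close>)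
  also have "\<dots> \<le> (\<Sum>p\<in>C. emeasure (vol M) (V p))"
    by (rule emeasure_subadditive_finite[OF C(1)]) (use V(1) in \<open>auto simp: sets_vol\<close>)
  also have "\<dots> < \<infinity>" using V(3) C(1) by (simp add: less_top[symmetric] infinity_ennreal_def)
  finally show "emeasure (vol M) (space (vol M)) \<noteq> \<infinity>" by simp
qed

lemma measurable_continuous_vol:
  fixes f :: "'m \<Rightarrow> 'b::topological_space"
  assumes "continuous_on UNIV f"
  shows "f \<in> borel_measurable (vol M)"
  using borel_measurable_continuous_onI[OF assms] measurable_cong_sets[OF sets_vol refl] by blast

lemma integrable_continuous:
  fixes f :: "'m \<Rightarrow> 'b::{banach, second_countable_topology}"
  assumes c: "continuous_on UNIV f"
  shows "integrable (vol M) f"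
proof -
  have "bounded (range f)"
    by (rule compact_imp_bounded[OF compact_continuous_image[OF c compact_space]])
  then obtain C where "\<And>x. norm (f x) \<le> C" unfolding bounded_iff by auto
  then show ?thesis
    by (intro finite_measure.integrable_const_bound[OF finite_measure_vol] AE_I2 measurable_continuous_vol[OF c])
qed

lemma integral_zero_imp_zero:
  fixes f :: "'m \<Rightarrow> real"
  assumes c: "continuous_on UNIV f" and nn: "\<And>q. f q \<ge> 0" and z: "(\<integral>q. f q \<partial>vol M) = 0"
  shows "f p = 0"
proof (rule ccontr)
  assume "f p \<noteq> 0"
  obtain U \<phi> where U: "(U, \<phi>) \<in> atlas M" "p \<in> U" using chart_cover .
  have "AE q in vol M. f q = 0"
    using integral_nonneg_eq_0_iff_AE[OF integrable_continuous[OF c]] nn z by simp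
  then have "AE q in vol M. q \<notin> U \<inter> f -` (- {0})" by eventually_elim auto
  moreover have o: "open (U \<inter> f -` (- {0}))"
    by (intro open_Int open_vimage open_chart_domain[OF U(1)] c) auto
  ultimately have "emeasure (vol M) (U \<inter> f -` (- {0})) = 0"
    using AE_iff_null_sets[of "U \<inter> f -` (- {0})" "vol M"] by (simp add: sets_vol null_setsD1)
  moreover have "emeasure (vol M) (U \<inter> f -` (- {0})) \<noteq> 0"
    by (rule emeasure_vol_open_pos[OF U(1) o]) (use U \<open>f p \<noteq> 0\<close> in auto)
  ultimately show False by simp
qed

text \<open>Normalised bump functions form a finite partition of unity, which splits the 1-form
  into summands supported in charts.\<close>

theorem divergence_theorem:
  assumes \<omega>: "one_form (atlas M) \<omega>"
  shows "(\<integral>p. divergence M \<omega> p \<partial>vol M) = 0"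
proof -
  have "\<exists>\<eta> :: 'm \<Rightarrow> real. \<exists>U \<phi> K. (U, \<phi>) \<in> atlas M \<and> smooth_map (atlas M) UNIV \<eta> \<and> (\<forall>q. \<eta> q \<ge> 0) \<and> \<eta> p > 0 \<and>
      compact K \<and> K \<subseteq> U \<and> (\<forall>q. q \<notin> K \<longrightarrow> \<eta> q = 0)" for p
  proof -
    obtain U \<phi> where U: "(U, \<phi>) \<in> atlas M" "p \<in> U" using chart_cover .
    show ?thesis by (rule bump_in_chart[OF U]) (use U in blast)
  qed
  then obtain \<eta> :: "'m \<Rightarrow> 'm \<Rightarrow> real" where \<eta>:
    "\<forall>p. \<exists>U \<phi> K. (U, \<phi>) \<in> atlas M \<and> smooth_map (atlas M) UNIV (\<eta> p) \<and> (\<forall>q. \<eta> p q \<ge> 0) \<and> \<eta> p p > 0 \<and>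
      compact K \<and> K \<subseteq> U \<and> (\<forall>q. q \<notin> K \<longrightarrow> \<eta> p q = 0)" by metis
  have sm: "smooth_map (atlas M) UNIV (\<eta> p)" for p using \<eta>[rule_format, of p] by blast
  have nn: "\<eta> p q \<ge> 0" for p q using \<eta>[rule_format, of p] by blast
  have pos: "\<eta> p p > 0" for p using \<eta>[rule_format, of p] by blast
  have supp: "\<exists>U \<phi> K. (U, \<phi>) \<in> atlas M \<and> compact K \<and> K \<subseteq> U \<and> (\<forall>q. q \<notin> K \<longrightarrow> \<eta> p q = 0)" for p
    using \<eta>[rule_format, of p] by blast
  have cont: "continuous_on UNIV (\<eta> p)" for p by (rule smooth_map_continuous_on[OF open_UNIV sm])
  obtain C where C: "finite C" "UNIV \<subseteq> (\<Union>p\<in>C. \<eta> p -` {0<..})"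
    by (rule compactE_image[OF compact_space, of UNIV "\<lambda>p. \<eta> p -` {0<..}"])
      (use pos cont in \<open>auto intro!: open_vimage\<close>)
  define s where "s q = (\<Sum>p\<in>C. \<eta> p q)" for q
  have spos: "s q > 0" for q
  proof -
    obtain p where "p \<in> C" "\<eta> p q > 0" using C(2) by auto
    then show ?thesis unfolding s_def using nn by (intro sum_pos2[OF C(1)]) auto
  qed
  have ss: "smooth_map (atlas M) UNIV (\<lambda>q. inverse (s q))"
    by (rule smooth_map_inverse) (use spos in \<open>auto simp: s_def[abs_def] less_imp_neq[symmetric] intro!: smooth_map_sum sm\<close>)
  \<comment> \<open>Dividing by the sum \<open>s\<close> of the bumps first avoids normalising each of them.\<close>
  define \<omega>' where "\<omega>' q v = inverse (s q) * \<omega> q v" for q v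
  have \<omega>': "one_form (atlas M) \<omega>'" unfolding \<omega>'_def by (rule one_form_mult[OF \<omega> ss])
  have \<eta>\<omega>: "one_form (atlas M) (\<lambda>q v. \<eta> p q * \<omega>' q v)" for p by (rule one_form_mult[OF \<omega>' sm])
  have "(\<Sum>p\<in>C. \<eta> p q * \<omega>' q v) = \<omega> q v" for q v
    unfolding \<omega>'_def sum_distrib_right[symmetric] s_def[symmetric] using spos[of q] by simp
  then have eq: "\<omega> = (\<lambda>q v. \<Sum>p\<in>C. \<eta> p q * \<omega>' q v)" by (intro ext) simp
  have "divergence M \<omega> q = (\<Sum>p\<in>C. divergence M (\<lambda>q v. \<eta> p q * \<omega>' q v) q)" for q
    by (subst eq, rule divergence_sum[OF C(1) \<eta>\<omega>]) (use eq \<omega> in simp)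
  then have "(\<integral>q. divergence M \<omega> q \<partial>vol M) = (\<integral>q. (\<Sum>p\<in>C. divergence M (\<lambda>q v. \<eta> p q * \<omega>' q v) q) \<partial>vol M)" by simp
  also have "\<dots> = (\<Sum>p\<in>C. \<integral>q. divergence M (\<lambda>q v. \<eta> p q * \<omega>' q v) q \<partial>vol M)"
    by (rule Bochner_Integration.integral_sum)
      (rule integrable_continuous[OF smooth_map_continuous_on[OF open_UNIV smooth_divergence[OF \<eta>\<omega>]]])
  also have "\<dots> = 0"
  proof (rule sum.neutral, rule ballI)
    fix p
    obtain U \<phi> K where U: "(U, \<phi>) \<in> atlas M" "compact K" "K \<subseteq> U" "\<forall>q. q \<notin> K \<longrightarrow> \<eta> p q = 0" using supp[of p] by blast
    show "(\<integral>q. divergence M (\<lambda>q v. \<eta> p q * \<omega>' q v) q \<partial>vol M) = 0"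
      by (rule divergence_integral_in_chart[OF U(1) \<eta>\<omega> U(2,3)]) (use U(4) in simp)
  qed
  finally show ?thesis .
qed

end

section \<open>The adjoint of the covariant derivative\<close>

context closed_manifold
begin

lemma smooth_inner_tensor2:
  assumes s: "sym2_tensor (atlas M) s" and k: "sym2_tensor (atlas M) k"
  shows "smooth_map (atlas M) UNIV (inner_tensor2 M s k)"
proof (rule smooth_map_local)
  fix p
  obtain P e where f: "orthonormal_frame M P e" and p: "p \<in> P" using frame_at .
  interpret orthonormal_frame M P e by (rule f)
  have "smo (\<lambda>q. hmat s q \<bullet> hmat k q)"
    by (intro smooth_map_inner open_domain smo_hmat s k)
  then have "smo (inner_tensor2 M s k)"
  proof (rule smooth_map_cong[OF open_domain, rotated])
    fix q assume q: "q \<in> P"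
    have "inner_tensor2 M s k q = hmat s q \<bullet> (\<chi> i j. k q (e i q) (e j q))"
      by (rule inner_tensor2_frame[OF s q]) (rule sym2_linear_right[OF k] sym2_linear_left[OF k], assumption)+
    then show "hmat s q \<bullet> hmat k q = inner_tensor2 M s k q" by (simp add: hmat_def[of k])
  qed
  then show "\<exists>V. open V \<and> p \<in> V \<and> smooth_map (atlas M) V (inner_tensor2 M s k)" using open_domain p by blast
qed

lemma one_form_contraction:
  assumes s: "sym2_tensor (atlas M) s" and T: "cot_sym2_tensor (atlas M) T"
  shows "one_form (atlas M) (contraction M s T)"
  unfolding one_form_def
proof (intro conjI allI impI)
  fix p
  obtain P e where f: "orthonormal_frame M P e" and p: "p \<in> P" using frame_at .
  interpret orthonormal_frame M P e by (rule f)
  have "linear_tangent (TS p) (\<lambda>u. \<Sum>i\<in>UNIV. \<Sum>j\<in>UNIV. s p (onb M p i) (onb M p j) *\<^sub>R T p u (onb M p i) (onb M p j))"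
    using onb_orthonormal[OF p] unfolding orthonormal_def
    by (intro linear_tangent_sumI linear_tangent_scale cot_sym2_linear(1)[OF T]) auto
  then show "linear_tangent (TS p) (contraction M s T p)"
    by (simp add: contraction_def[abs_def] inner_tensor2_def)
next
  fix W X assume W: "open W \<and> smooth_field (atlas M) W X"
  show "smooth_map (atlas M) W (\<lambda>p. contraction M s T p (X p))"
  proof (rule smooth_map_local)
    fix p assume pW: "p \<in> W"
    obtain P e where f: "orthonormal_frame M P e" and p: "p \<in> P" using frame_at .
    interpret orthonormal_frame M P e by (rule f)
    let ?V = "W \<inter> P"
    have V: "open ?V" using W open_domain by auto
    have S: "smooth_field (atlas M) ?V X" "smooth_field (atlas M) ?V (e k)" for k
      using W frame_smooth by (auto intro: smooth_field_subset)
    have "smooth_map (atlas M) ?V (\<lambda>q. \<Sum>i\<in>UNIV. \<Sum>j\<in>UNIV. s q (e i q) (e j q) * T q (X q) (e i q) (e j q))"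
      by (intro smooth_map_sum smooth_map_mult V sym2_smooth[OF s V] cot_sym2_smooth[OF T V] S)
    then have "smooth_map (atlas M) ?V (\<lambda>p. contraction M s T p (X p))"
    proof (rule smooth_map_cong[OF V, rotated])
      fix q assume q: "q \<in> ?V"
      then have "q \<in> P" by simp
      from contraction_frame[OF s T this smooth_field_tangent[OF S(1) q]]
      show "(\<Sum>i\<in>UNIV. \<Sum>j\<in>UNIV. s q (e i q) (e j q) * T q (X q) (e i q) (e j q)) = contraction M s T q (X q)"
        by (simp add: hmat_def inner_matrix)
    qed
    then show "\<exists>V. open V \<and> p \<in> V \<and> smooth_map (atlas M) V (\<lambda>p. contraction M s T p (X p))"
      using V pW p by blast
  qed
qed

lemma divergence_contraction:
  assumes s: "sym2_tensor (atlas M) s" and T: "cot_sym2_tensor (atlas M) T"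
  shows "inner_tensor3 M (nabla M s) T p = divergence M (contraction M s T) p + inner_tensor2 M s (neg_trace M T) p"
proof -
  obtain P e where f: "orthonormal_frame M P e" and p: "p \<in> P" using frame_at .
  interpret orthonormal_frame M P e by (rule f)
  show ?thesis
    using divergence_contraction_frame[OF s T one_form_contraction[OF s T] cot_sym2_nabla[OF s] sym2_neg_trace[OF T] p] by simp
qed

text \<open>The difference \<open>k\<close> of the two sides is a symmetric 2-tensor orthogonal to
  all others in the \<open>L\<^sup>2\<close> inner product, since the negative trace satisfies the
  adjoint relation by the divergence theorem. Hence it is orthogonal to itself.\<close>

lemma nabla_adjoint_eq:
  assumes adj: "nabla_adjoint M Q" and T: "cot_sym2_tensor (atlas M) T" and xy: "x \<in> TS p" "y \<in> TS p"
  shows "Q T p x y = neg_trace M T p x y"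
proof -
  let ?N = "neg_trace M T"
  have N: "sym2_tensor (atlas M) ?N" by (rule sym2_neg_trace[OF T])
  have QT: "sym2_tensor (atlas M) (Q T)" using adj T by (simp add: nabla_adjoint_def)
  define k where "k q u v = Q T q u v - ?N q u v" for q u v
  have k: "sym2_tensor (atlas M) k"
    unfolding sym2_tensor_def
  proof (intro conjI allI ballI impI)
    fix q u assume u: "u \<in> TS q"
    show "linear_tangent (TS q) (k q u)"
      using linear_tangent_comb(2)[OF sym2_linear_right[OF QT u] sym2_linear_right[OF N u]] by (simp add: k_def[abs_def])
    fix v assume "v \<in> TS q"
    then show "k q u v = k q v u" using sym2_sym[OF QT u] sym2_sym[OF N u] by (simp add: k_def)
  next
    fix W X Y assume "open W \<and> smooth_field (atlas M) W X \<and> smooth_field (atlas M) W Y"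
    then show "smooth_map (atlas M) W (\<lambda>p. k p (X p) (Y p))"
      unfolding k_def by (intro smooth_map_diff sym2_smooth[OF QT] sym2_smooth[OF N]) auto
  qed
  have int: "integrable (vol M) f" if "smooth_map (atlas M) UNIV f" for f :: "'m \<Rightarrow> real"
    by (rule integrable_continuous[OF smooth_map_continuous_on[OF open_UNIV that]])
  note c = one_form_contraction[OF k T]
  have "(\<integral>p. inner_tensor2 M k (Q T) p \<partial>vol M) = (\<integral>p. inner_tensor3 M (nabla M k) T p \<partial>vol M)"
    using adj k T by (simp add: nabla_adjoint_def)
  also have "\<dots> = (\<integral>p. divergence M (contraction M k T) p \<partial>vol M) + (\<integral>p. inner_tensor2 M k ?N p \<partial>vol M)"
    unfolding divergence_contraction[OF k T]
    by (rule Bochner_Integration.integral_add[OF int[OF smooth_divergence[OF c]] int[OF smooth_inner_tensor2[OF k N]]])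
  also have "(\<integral>p. divergence M (contraction M k T) p \<partial>vol M) = 0" by (rule divergence_theorem[OF c])
  finally have "(\<integral>p. inner_tensor2 M k (Q T) p - inner_tensor2 M k ?N p \<partial>vol M) = 0"
    by (subst Bochner_Integration.integral_diff[OF int[OF smooth_inner_tensor2[OF k QT]] int[OF smooth_inner_tensor2[OF k N]]]) simp
  moreover have "inner_tensor2 M k (Q T) q - inner_tensor2 M k ?N q = inner_tensor2 M k k q" for q
    unfolding inner_tensor2_def sum_subtractf[symmetric] right_diff_distrib[symmetric] by (simp add: k_def)
  ultimately have z: "(\<integral>p. inner_tensor2 M k k p \<partial>vol M) = 0" by simp
  have nn: "inner_tensor2 M k k q \<ge> 0" for q unfolding inner_tensor2_def by (intro sum_nonneg) simp
  have "inner_tensor2 M k k p = 0"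
    by (rule integral_zero_imp_zero[OF smooth_map_continuous_on[OF open_UNIV smooth_inner_tensor2[OF k k]] nn z])
  obtain P e where f: "orthonormal_frame M P e" and p: "p \<in> P" using frame_at .
  interpret orthonormal_frame M P e by (rule f)
  have "k p (onb M p i) (onb M p j) = 0" for i j
  proof -
    have "(\<Sum>i\<in>UNIV. \<Sum>j\<in>UNIV. k p (onb M p i) (onb M p j) * k p (onb M p i) (onb M p j)) = 0"
      using \<open>inner_tensor2 M k k p = 0\<close> by (simp add: inner_tensor2_def)
    then show ?thesis by (simp add: sum_nonneg_eq_0_iff sum_nonneg)
  qed
  then have "k p (onb M p i) y = 0" for i
    using linear_orthonormal_expand[OF onb_orthonormal[OF p] xy(2) sym2_linear_right[OF k]] onb_orthonormal[OF p]
    by (simp add: orthonormal_def)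
  then have "k p x y = 0"
    using linear_orthonormal_expand[OF onb_orthonormal[OF p] xy(1) sym2_linear_left[OF k xy(2)]] by simp
  then show ?thesis by (simp add: k_def)
qed

end

section \<open>Spinor-valued 1-forms\<close>

lemma inner_complex_cnj: "inner (c * x) y = inner x (cnj c * y)" for c x y :: complex
  by (simp add: inner_complex_def algebra_simps)

locale spin_geometry =
  fixes M :: "('m::{t2_space,second_countable_topology}, 'n::finite, 'i, 'k::finite, 'z) spin_manifold_scheme"
  assumes riem_M: "riemannian_manifold M" and spin_M: "spin_structure M"
begin

abbreviation "\<gamma> i z \<equiv> gam M i *v z"

lemmas spin_structure_clifford = spin_M[unfolded spin_structure_def, THEN conjunct1]
  and spin_structure_cover = spin_M[unfolded spin_structure_def, THEN conjunct2, THEN conjunct1]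
  and spin_structure_frame = spin_M[unfolded spin_structure_def, THEN conjunct2, THEN conjunct2, THEN conjunct1, THEN bspec]
  and spin_structure_transition = spin_M[unfolded spin_structure_def, THEN conjunct2, THEN conjunct2, THEN conjunct2, THEN conjunct1,
    THEN bspec, THEN bspec]

lemma clifford_module_gam: "clifford_module (\<lambda>i. (*v) (gam M i))"
proof (rule clifford_module.intro)
  have c: "gam M i ** gam M j + gam M j ** gam M i = (if i = j then - 2 *\<^sub>R mat 1 else 0)"
    and s: "gam M i $ b $ a = - cnj (gam M i $ a $ b)" for i j a b
    using spin_structure_clifford unfolding clifford_rep_def by blast+
  show "linear ((*v) (gam M i))" for i
    using bounded_bilinear.bounded_linear_right[OF bilinear_matrix_vector, of "gam M i"] by (rule bounded_linear.linear)
  show "\<gamma> i (\<gamma> j z) + \<gamma> j (\<gamma> i z) = (if i = j then (- 2) *\<^sub>R z else 0)" for i j z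
  proof -
    have "\<gamma> i (\<gamma> j z) + \<gamma> j (\<gamma> i z) = (gam M i ** gam M j + gam M j ** gam M i) *v z"
      by (simp add: matrix_vector_mul_assoc matrix_vector_simps)
    then show ?thesis unfolding c
      using matrix_vector_simps(7)[of "- 2" "mat 1" z] matrix_vector_simps(5)[of "2 *\<^sub>R mat 1" z]
      by (auto simp: matrix_vector_simps)
  qed
  show "\<gamma> i y \<bullet> z = - (y \<bullet> \<gamma> i z)" for i y z
  proof -
    have "\<gamma> i y \<bullet> z = (\<Sum>a\<in>UNIV. \<Sum>b\<in>UNIV. y $ b \<bullet> (cnj (gam M i $ a $ b) * z $ a))"
      by (simp add: inner_vec_def matrix_vector_mult_def inner_sum_left inner_complex_cnj)
    also have "\<dots> = (\<Sum>b\<in>UNIV. \<Sum>a\<in>UNIV. - (y $ b \<bullet> (gam M i $ b $ a * z $ a)))"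
    proof (subst sum.swap, intro sum.cong refl)
      fix a b
      have "cnj (gam M i $ a $ b) = - gam M i $ b $ a" using s[of i b a] by simp
      then show "y $ b \<bullet> (cnj (gam M i $ a $ b) * z $ a) = - (y $ b \<bullet> (gam M i $ b $ a * z $ a))"
        by (simp only: mult_minus_left inner_minus_right)
    qed
    also have "\<dots> = - (y \<bullet> \<gamma> i z)"
      by (simp add: inner_vec_def matrix_vector_mult_def inner_sum_right sum_negf)
    finally show ?thesis .
  qed
qed

sublocale clifford_module "\<lambda>i. (*v) (gam M i)"
  by (rule clifford_module_gam)

sublocale riemannian M
  by unfold_locales (rule riem_M)

lemma orthonormal_frame_patch:
  assumes \<alpha>: "\<alpha> \<in> indices M"
  shows "orthonormal_frame M (patch M \<alpha>) (frame M \<alpha>)"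
proof unfold_locales
  have "open (patch M \<alpha>) \<and> (\<forall>i. smooth_field (atlas M) (patch M \<alpha>) (frame M \<alpha> i)) \<and>
      (\<forall>p\<in>patch M \<alpha>. \<forall>i j. metric M p (frame M \<alpha> i p) (frame M \<alpha> j p) = (if i = j then 1 else 0))"
    by (rule spin_structure_frame[OF \<alpha>])
  then show "open (patch M \<alpha>)" "smooth_field (atlas M) (patch M \<alpha>) (frame M \<alpha> i)"
    "p \<in> patch M \<alpha> \<Longrightarrow> metric M p (frame M \<alpha> i p) (frame M \<alpha> j p) = (if i = j then 1 else 0)" for i j p
    by auto
qed

lemma patch_at:
  obtains \<alpha> where "\<alpha> \<in> indices M" "p \<in> patch M \<alpha>"
proof -
  have "p \<in> (\<Union>\<alpha>\<in>indices M. patch M \<alpha>)" using spin_structure_cover by simp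
  then show ?thesis using that by blast
qed

sublocale framed_manifold M
proof
  fix p
  obtain \<alpha> where "\<alpha> \<in> indices M" "p \<in> patch M \<alpha>" using patch_at .
  then show "\<exists>P e. orthonormal_frame M P e \<and> p \<in> P" using orthonormal_frame_patch by blast
qed

lemma spin_frame_patch: "\<alpha> \<in> indices M \<Longrightarrow> spin_frame M (patch M \<alpha>) (frame M \<alpha>) (\<lambda>i. (*v) (gam M i))"
  unfolding spin_frame_def using orthonormal_frame_patch clifford_module_gam by blast

subsection \<open>Clifford multiplication and the transition functions\<close>

lemma clifford_mult_linear:
  assumes "\<alpha> \<in> indices M" "p \<in> patch M \<alpha>"
  shows "linear_tangent (TS p) (\<lambda>v. clifford_mult M \<alpha> p v z)"
proof -
  interpret orthonormal_frame M "patch M \<alpha>" "frame M \<alpha>" by (rule orthonormal_frame_patch[OF assms(1)])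
  show ?thesis
    unfolding clifford_mult_def
    using metric_linear_left[OF frame_tangent[OF assms(2)]]
    by (intro linear_tangent_sumI) (simp add: linear_tangent_def algebra_simps)
qed

lemma linear_clifford_mult: "linear (clifford_mult M \<alpha> p v)"
  unfolding clifford_mult_def by (rule linearI) (simp_all add: G_simps scaleR_add_right sum.distrib scaleR_sum_right mult.commute)

lemma clifford_mult_frame:
  assumes "\<alpha> \<in> indices M" "p \<in> patch M \<alpha>"
  shows "clifford_mult M \<alpha> p (frame M \<alpha> k p) z = \<gamma> k z"
proof -
  interpret orthonormal_frame M "patch M \<alpha>" "frame M \<alpha>" by (rule orthonormal_frame_patch[OF assms(1)])
  show ?thesis
    unfolding clifford_mult_def frame_metric[OF assms(2)]
    by (simp add: if_distrib[of "\<lambda>x. x *\<^sub>R _"] cong: if_cong)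
qed

text \<open>The transition function lifts the change between the two frames to the spin group, so
  it intertwines Clifford multiplication by the same tangent vector in the two
  trivialisations.\<close>

lemma clifford_mult_transition:
  assumes \<alpha>: "\<alpha> \<in> indices M" "p \<in> patch M \<alpha>" and \<beta>: "\<beta> \<in> indices M" "p \<in> patch M \<beta>" and v: "v \<in> TS p"
  shows "transition M \<alpha> \<beta> p *v clifford_mult M \<beta> p v z = clifford_mult M \<alpha> p v (transition M \<alpha> \<beta> p *v z)"
proof -
  interpret A: orthonormal_frame M "patch M \<alpha>" "frame M \<alpha>" by (rule orthonormal_frame_patch[OF \<alpha>(1)])
  interpret B: orthonormal_frame M "patch M \<beta>" "frame M \<beta>" by (rule orthonormal_frame_patch[OF \<beta>(1)])
  let ?t = "transition M \<alpha> \<beta> p" and ?O = "\<lambda>i j. metric M p (frame M \<alpha> i p) (frame M \<beta> j p)"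
  have "?t ** gam M j = (\<Sum>i\<in>UNIV. ?O i j *\<^sub>R gam M i) ** ?t" for j
    using spin_structure_transition[OF \<alpha>(1) \<beta>(1)] \<alpha>(2) \<beta>(2) by simp
  then have t: "?t *v (\<gamma> j z) = (\<Sum>i\<in>UNIV. ?O i j *\<^sub>R \<gamma> i (?t *v z))" for j
    by (simp add: matrix_vector_mul_assoc matrix_vector_simps matrix_mult_simps)
  have "?t *v clifford_mult M \<beta> p v z = (\<Sum>j\<in>UNIV. \<Sum>i\<in>UNIV. (metric M p v (frame M \<beta> j p) * ?O i j) *\<^sub>R \<gamma> i (?t *v z))"
    unfolding clifford_mult_def matrix_vector_simps t by (simp add: scaleR_sum_right)
  also have "\<dots> = (\<Sum>i\<in>UNIV. (\<Sum>j\<in>UNIV. metric M p v (frame M \<beta> j p) * ?O i j) *\<^sub>R \<gamma> i (?t *v z))"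
    by (subst sum.swap) (simp add: scaleR_sum_left)
  also have "\<dots> = (\<Sum>i\<in>UNIV. metric M p v (frame M \<alpha> i p) *\<^sub>R \<gamma> i (?t *v z))"
  proof (intro sum.cong refl arg_cong2[where f=scaleR])
    fix i
    show "(\<Sum>j\<in>UNIV. metric M p v (frame M \<beta> j p) * ?O i j) = metric M p v (frame M \<alpha> i p)"
      using linear_orthonormal_expand[OF B.frame_orthonormal[OF \<beta>(2)] v metric_linear_left[OF A.frame_tangent[OF \<alpha>(2)]], of i]
        metric_sym[OF A.frame_tangent[OF \<alpha>(2)] B.frame_tangent[OF \<beta>(2)]] by simp
  qed
  finally show ?thesis unfolding clifford_mult_def .
qed


text \<open>The transition functions are isometries, as Clifford multiplication by a unit vector is one.\<close>

lemma inner_clifford_unit: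
  fixes v :: "real^'n"
  assumes "norm v = 1"
  defines "c \<equiv> \<Sum>i\<in>UNIV. v $ i *\<^sub>R gam M i"
  shows "(c *v y) \<bullet> (c *v z) = y \<bullet> z"
proof -
  have c: "c *v y = (\<Sum>i\<in>UNIV. v $ i *\<^sub>R \<gamma> i y)" for y
    unfolding c_def by (simp add: matrix_vector_simps)
  have "(c *v y) \<bullet> (c *v z) = - (y \<bullet> (c *v (c *v z)))"
    unfolding c[of y] c[of "c *v z"] by (simp add: inner_sum_left inner_sum_right skew_G sum_negf)
  also have "c *v (c *v z) = - z"
  proof -
    let ?S = "\<Sum>i\<in>UNIV. \<Sum>j\<in>UNIV. (v $ i * v $ j) *\<^sub>R \<gamma> i (\<gamma> j z)"
    have "?S + ?S = ?S + (\<Sum>i\<in>UNIV. \<Sum>j\<in>UNIV. (v $ i * v $ j) *\<^sub>R \<gamma> j (\<gamma> i z))"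
      by (subst (3) sum.swap) (simp add: mult.commute)
    also have "\<dots> = (\<Sum>i\<in>UNIV. \<Sum>j\<in>UNIV. (v $ i * v $ j) *\<^sub>R (\<gamma> i (\<gamma> j z) + \<gamma> j (\<gamma> i z)))"
      by (simp add: sum.distrib scaleR_add_right)
    also have "\<dots> = (\<Sum>i\<in>UNIV. (v $ i * v $ i) *\<^sub>R (-2) *\<^sub>R z)"
      unfolding clifford by (simp add: if_distrib[of "scaleR _"] cong: if_cong)
    also have "\<dots> = (v \<bullet> v) *\<^sub>R (-2) *\<^sub>R z"
      unfolding scaleR_sum_left[symmetric] by (simp add: inner_vec_def)
    also have "\<dots> = (-2) *\<^sub>R z" using assms(1) by (simp add: dot_square_norm)
    finally have "2 *\<^sub>R ?S = 2 *\<^sub>R (- z)" by (simp add: scaleR_2)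
    then have "?S = - z" by (simp only: scaleR_cancel_left) simp
    moreover have "c *v (c *v z) = ?S"
      unfolding c by (simp add: G_simps scaleR_sum_right)
    ultimately show ?thesis by simp
  qed
  finally show ?thesis by simp
qed

lemma inner_transition:
  assumes "\<alpha> \<in> indices M" "\<beta> \<in> indices M" "p \<in> patch M \<alpha>" "p \<in> patch M \<beta>"
  shows "(transition M \<alpha> \<beta> p *v y) \<bullet> (transition M \<alpha> \<beta> p *v z) = y \<bullet> z"
proof -
  have "transition M \<alpha> \<beta> p \<in> spin_group (gam M)"
    using spin_structure_transition[OF assms(1,2)] assms(3,4) by simp
  then obtain vs where vs: "transition M \<alpha> \<beta> p = foldr (\<lambda>v s. (\<Sum>i\<in>UNIV. v $ i *\<^sub>R gam M i) ** s) vs (mat 1)"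
    "\<forall>v\<in>set vs. norm (v :: real^'n) = 1"
    unfolding spin_group_def by blast
  have "(foldr (\<lambda>v s. (\<Sum>i\<in>UNIV. v $ i *\<^sub>R gam M i) ** s) vs (mat 1) *v y) \<bullet>
      (foldr (\<lambda>v s. (\<Sum>i\<in>UNIV. v $ i *\<^sub>R gam M i) ** s) vs (mat 1) *v z) = y \<bullet> z"
    using vs(2)
  proof (induction vs)
    case (Cons v vs)
    then show ?case by (simp add: inner_clifford_unit matrix_vector_mul_assoc[symmetric])
  qed simp
  then show ?thesis unfolding vs(1) .
qed

subsection \<open>Sections and their pairing\<close>

lemma tspinor_linear:
  "tspinor_field M \<Psi> \<Longrightarrow> \<alpha> \<in> indices M \<Longrightarrow> p \<in> patch M \<alpha> \<Longrightarrow> linear_tangent (TS p) (\<Psi> \<alpha> p)"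
  unfolding tspinor_field_def by simp

lemma tspinor_smooth:
  "tspinor_field M \<Psi> \<Longrightarrow> \<alpha> \<in> indices M \<Longrightarrow> open W \<Longrightarrow> W \<subseteq> patch M \<alpha> \<Longrightarrow> smooth_field (atlas M) W X \<Longrightarrow>
    smooth_map (atlas M) W (\<lambda>p. \<Psi> \<alpha> p (X p))"
  unfolding tspinor_field_def by simp

lemma tspinor_transition:
  "tspinor_field M \<Psi> \<Longrightarrow> \<alpha> \<in> indices M \<Longrightarrow> \<beta> \<in> indices M \<Longrightarrow> p \<in> patch M \<alpha> \<Longrightarrow> p \<in> patch M \<beta> \<Longrightarrow> w \<in> TS p \<Longrightarrow>
    \<Psi> \<alpha> p w = transition M \<alpha> \<beta> p *v \<Psi> \<beta> p w"
  unfolding tspinor_field_def by (drule conjunct2, drule conjunct2) blast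

text \<open>The trivialisation in which \<open>inner_tspinor\<close> is computed.\<close>

definition "patch_index p = (SOME \<alpha>. \<alpha> \<in> indices M \<and> p \<in> patch M \<alpha>)"

lemma patch_index: "patch_index p \<in> indices M" "p \<in> patch M (patch_index p)"
proof -
  have "\<exists>\<alpha>. \<alpha> \<in> indices M \<and> p \<in> patch M \<alpha>" using patch_at[of p] by blast
  from someI_ex[OF this] show "patch_index p \<in> indices M" "p \<in> patch M (patch_index p)"
    unfolding patch_index_def by auto
qed

text \<open>The real part of the Hermitian product, in a given trivialisation.\<close>

definition "pairing \<Psi> \<Xi> \<alpha> p = (\<Sum>i\<in>UNIV. \<Psi> \<alpha> p (onb M p i) \<bullet> \<Xi> \<alpha> p (onb M p i))"

lemma onb_patch: "orthonormal p (onb M p)"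
  using orthonormal_frame.onb_orthonormal[OF orthonormal_frame_patch[OF patch_index(1)] patch_index(2)] .

lemma onb_tangent: "onb M p i \<in> TS p"
  using onb_patch by (simp add: orthonormal_def)

lemma pairing_frame:
  assumes \<alpha>: "\<alpha> \<in> indices M" "p \<in> patch M \<alpha>"
    and \<Psi>: "linear_tangent (TS p) (\<Psi> \<alpha> p)" and \<Xi>: "linear_tangent (TS p) (\<Xi> \<alpha> p)"
  shows "pairing \<Psi> \<Xi> \<alpha> p = (\<Sum>i\<in>UNIV. \<Psi> \<alpha> p (frame M \<alpha> i p) \<bullet> \<Xi> \<alpha> p (frame M \<alpha> i p))"
proof -
  interpret orthonormal_frame M "patch M \<alpha>" "frame M \<alpha>" by (rule orthonormal_frame_patch[OF \<alpha>(1)])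
  show ?thesis
    unfolding pairing_def
    by (rule trace_orthonormal[OF frame_orthonormal[OF \<alpha>(2)] onb_patch, of "\<lambda>x y. \<Psi> \<alpha> p x \<bullet> \<Xi> \<alpha> p y"])
      (use \<Psi> \<Xi> in \<open>simp_all add: linear_tangent_def inner_add_left inner_add_right\<close>)
qed

lemma pairing_transition:
  assumes \<Psi>: "tspinor_field M \<Psi>" and \<Xi>: "tspinor_field M \<Xi>"
    and "\<alpha> \<in> indices M" "p \<in> patch M \<alpha>" "\<beta> \<in> indices M" "p \<in> patch M \<beta>"
  shows "pairing \<Psi> \<Xi> \<alpha> p = pairing \<Psi> \<Xi> \<beta> p"
  unfolding pairing_def
  by (simp add: tspinor_transition[OF \<Psi> assms(3,5,4,6) onb_tangent] tspinor_transition[OF \<Xi> assms(3,5,4,6) onb_tangent]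
      inner_transition[OF assms(3,5,4,6)])

lemma smooth_pairing:
  assumes \<Psi>: "tspinor_field M \<Psi>" and \<Xi>: "tspinor_field M \<Xi>"
  shows "smooth_map (atlas M) UNIV (\<lambda>p. pairing \<Psi> \<Xi> (patch_index p) p)"
proof (rule smooth_map_local)
  fix p
  obtain \<alpha> where \<alpha>: "\<alpha> \<in> indices M" "p \<in> patch M \<alpha>" using patch_at .
  interpret orthonormal_frame M "patch M \<alpha>" "frame M \<alpha>" by (rule orthonormal_frame_patch[OF \<alpha>(1)])
  have "smo (\<lambda>q. \<Sum>i\<in>UNIV. \<Psi> \<alpha> q (frame M \<alpha> i q) \<bullet> \<Xi> \<alpha> q (frame M \<alpha> i q))"
    by (intro smo_sum smooth_map_inner open_domain tspinor_smooth[OF \<Psi> \<alpha>(1)] tspinor_smooth[OF \<Xi> \<alpha>(1)] frame_smooth order_refl)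
  then have "smo (\<lambda>p. pairing \<Psi> \<Xi> (patch_index p) p)"
  proof (rule smooth_map_cong[OF open_domain, rotated])
    fix q assume q: "q \<in> patch M \<alpha>"
    show "(\<Sum>i\<in>UNIV. \<Psi> \<alpha> q (frame M \<alpha> i q) \<bullet> \<Xi> \<alpha> q (frame M \<alpha> i q)) = pairing \<Psi> \<Xi> (patch_index q) q"
      using pairing_frame[OF \<alpha>(1) q, of \<Psi> \<Xi>] tspinor_linear[OF \<Psi> \<alpha>(1) q] tspinor_linear[OF \<Xi> \<alpha>(1) q]
        pairing_transition[OF \<Psi> \<Xi> \<alpha>(1) q patch_index] by simp
  qed
  then show "\<exists>V. open V \<and> p \<in> V \<and> smooth_map (atlas M) V (\<lambda>p. pairing \<Psi> \<Xi> (patch_index p) p)"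
    using open_domain \<alpha>(2) by blast
qed

text \<open>The Hermitian product is expressed by the real inner product and multiplication by the
  imaginary unit.\<close>

definition rot :: "complex^'k \<Rightarrow> complex^'k" where "rot z = (\<chi> a. \<i> * z $ a)"

lemma linear_rot: "linear rot"
  unfolding rot_def by (rule linearI) (simp_all add: vec_eq_iff algebra_simps)

lemma bounded_linear_rot: "bounded_linear rot"
  using linear_rot by (simp add: linear_conv_bounded_linear)

lemma rot_matrix: "B *v rot z = rot (B *v z)"
  unfolding rot_def by (simp add: vec_eq_iff matrix_vector_mult_def sum_distrib_left algebra_simps)

lemma inner_tspinor_eq:
  "inner_tspinor M \<Psi> \<Xi> p = Complex (pairing \<Psi> \<Xi> (patch_index p) p) (pairing \<Psi> (\<lambda>\<alpha> p w. rot (\<Xi> \<alpha> p w)) (patch_index p) p)"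
  unfolding inner_tspinor_def pairing_def patch_index_def Let_def
  by (rule complex_eqI) (simp_all add: Re_sum Im_sum inner_vec_def inner_complex_def rot_def algebra_simps)

lemma tspinor_rot:
  assumes \<Xi>: "tspinor_field M \<Xi>"
  shows "tspinor_field M (\<lambda>\<alpha> p w. rot (\<Xi> \<alpha> p w))"
  unfolding tspinor_field_def
proof (intro conjI ballI allI impI)
  show "linear_tangent (TS p) (\<lambda>w. rot (\<Xi> \<alpha> p w))" if "\<alpha> \<in> indices M" "p \<in> patch M \<alpha>" for \<alpha> p
    using tspinor_linear[OF \<Xi> that] unfolding linear_tangent_def
    by (simp add: linear_add[OF linear_rot] linear_cmul[OF linear_rot])
  show "smooth_map (atlas M) W (\<lambda>p. rot (\<Xi> \<alpha> p (X p)))"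
    if "\<alpha> \<in> indices M" "open W \<and> W \<subseteq> patch M \<alpha> \<and> smooth_field (atlas M) W X" for \<alpha> W X
    by (rule smooth_map_bounded_linear[OF _ bounded_linear_rot]) (use that tspinor_smooth[OF \<Xi> that(1)] in auto)
  show "rot (\<Xi> \<alpha> p w) = transition M \<alpha> \<beta> p *v rot (\<Xi> \<beta> p w)"
    if "\<alpha> \<in> indices M" "\<beta> \<in> indices M" "p \<in> patch M \<alpha> \<inter> patch M \<beta>" "w \<in> TS p" for \<alpha> \<beta> p w
    using tspinor_transition[OF \<Xi> that(1,2)] that(3,4) by (simp add: rot_matrix)
qed

lemma tspinor_diff:
  assumes \<Psi>: "tspinor_field M \<Psi>" and \<Xi>: "tspinor_field M \<Xi>"
  shows "tspinor_field M (\<lambda>\<alpha> p w. \<Psi> \<alpha> p w - \<Xi> \<alpha> p w)"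
  unfolding tspinor_field_def
proof (intro conjI ballI allI impI)
  show "linear_tangent (TS p) (\<lambda>w. \<Psi> \<alpha> p w - \<Xi> \<alpha> p w)" if "\<alpha> \<in> indices M" "p \<in> patch M \<alpha>" for \<alpha> p
    by (rule linear_tangent_comb(2)[OF tspinor_linear[OF \<Psi> that] tspinor_linear[OF \<Xi> that]])
  show "smooth_map (atlas M) W (\<lambda>p. \<Psi> \<alpha> p (X p) - \<Xi> \<alpha> p (X p))"
    if "\<alpha> \<in> indices M" "open W \<and> W \<subseteq> patch M \<alpha> \<and> smooth_field (atlas M) W X" for \<alpha> W X
    using that by (intro smooth_map_diff tspinor_smooth[OF \<Psi> that(1)] tspinor_smooth[OF \<Xi> that(1)]) auto
  show "\<Psi> \<alpha> p w - \<Xi> \<alpha> p w = transition M \<alpha> \<beta> p *v (\<Psi> \<beta> p w - \<Xi> \<beta> p w)"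
    if "\<alpha> \<in> indices M" "\<beta> \<in> indices M" "p \<in> patch M \<alpha> \<inter> patch M \<beta>" "w \<in> TS p" for \<alpha> \<beta> p w
    using tspinor_transition[OF \<Psi> that(1,2)] tspinor_transition[OF \<Xi> that(1,2)] that(3,4)
    by (simp add: matrix_vector_simps)
qed

subsection \<open>The Dirac operator in a frame\<close>

definition "frame_coord \<Psi> \<alpha> j q = \<Psi> \<alpha> q (frame M \<alpha> j q)"

lemma smooth_frame_coord:
  "tspinor_field M \<Psi> \<Longrightarrow> \<alpha> \<in> indices M \<Longrightarrow> smooth_map (atlas M) (patch M \<alpha>) (frame_coord \<Psi> \<alpha> j)"
  unfolding frame_coord_def[abs_def]
  using tspinor_smooth[of \<Psi> \<alpha> "patch M \<alpha>"] orthonormal_frame.open_domain[OF orthonormal_frame_patch]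
    orthonormal_frame.frame_smooth[OF orthonormal_frame_patch] by blast

context
  fixes \<alpha> assumes \<alpha>: "\<alpha> \<in> indices M"
begin

interpretation F: spin_frame M "patch M \<alpha>" "frame M \<alpha>" "\<lambda>i. (*v) (gam M i)"
  by (rule spin_frame_patch[OF \<alpha>])

lemma spin_nabla_frame: "spin_nabla M (frame M \<alpha> k p) \<psi> \<alpha> p = F.spin_cov k (\<psi> \<alpha>) p"
  unfolding spin_nabla_def F.spin_cov_def fderiv_def spin_lie_def by (simp add: christoffel_def)

text \<open>The expression is tensorial in the field extending \<open>w\<close>, which is
  exchanged for the frame fields.\<close>

lemma twisted_nabla_frame:
  assumes \<Psi>: "tspinor_field M \<Psi>" and p: "p \<in> patch M \<alpha>" and w: "w \<in> TS p"
  shows "twisted_nabla M (frame M \<alpha> k p) \<Psi> \<alpha> p w =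
    (\<Sum>j\<in>UNIV. metric M p w (frame M \<alpha> j p) *\<^sub>R F.tw_cov k (frame_coord \<Psi> \<alpha>) j p)"
proof -
  let ?v = "frame M \<alpha> k p"
  have v: "?v \<in> TS p" by (rule F.frame_tangent[OF p])
  define B where "B X = (vderiv ?v (\<lambda>q. \<Psi> \<alpha> q (X q)) - \<Psi> \<alpha> p (lc M p ?v X)) - (- spin_lie (christoffel M (frame M \<alpha>) k p) (\<Psi> \<alpha> p (X p)))" for X
  have "linear_tangent (TS p) (\<lambda>x. - spin_lie (christoffel M (frame M \<alpha>) k p) (\<Psi> \<alpha> p x))"
    using tspinor_linear[OF \<Psi> \<alpha> p] unfolding linear_tangent_def by (simp add: spin_lie_simps)
  then have B: "tensorial_at p B"
    unfolding B_def
    by (intro tensorial_diff tensorial_point tensorial_cov[OF F.open_domain p v tspinor_linear[OF \<Psi> \<alpha>] tspinor_smooth[OF \<Psi> \<alpha>]])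
  have "twisted_nabla M ?v \<Psi> \<alpha> p w = B (extend_vector (atlas M) p w)"
    unfolding twisted_nabla_def Let_def spin_nabla_frame F.spin_cov_def fderiv_def B_def by simp
  also have "\<dots> = (\<Sum>j\<in>UNIV. metric M p w (frame M \<alpha> j p) *\<^sub>R B (frame M \<alpha> j))"
    by (rule F.tensorial_extend_expand[OF B p w])
  finally have 1: "twisted_nabla M ?v \<Psi> \<alpha> p w = \<dots>" .
  have "B (frame M \<alpha> j) = F.tw_cov k (frame_coord \<Psi> \<alpha>) j p" for j
    unfolding B_def F.tw_cov_def F.spin_cov_def fderiv_def frame_coord_def[abs_def] F.lc_frame[OF p]
      linear_tangent_sum[OF tspinor_linear[OF \<Psi> \<alpha> p] F.frame_tangent[OF p]] by simp
  then show ?thesis unfolding 1 by simp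
qed

end


lemma twisted_dirac_frame:
  assumes \<alpha>: "\<alpha> \<in> indices M" and \<Psi>: "tspinor_field M \<Psi>" and p: "p \<in> patch M \<alpha>" and w: "w \<in> TS p"
  shows "twisted_dirac M \<Psi> \<alpha> p w = (\<Sum>j\<in>UNIV. metric M p w (frame M \<alpha> j p) *\<^sub>R
    spin_frame.tw_dirac M (frame M \<alpha>) (\<lambda>i. (*v) (gam M i)) (frame_coord \<Psi> \<alpha>) j p)"
proof -
  interpret F: spin_frame M "patch M \<alpha>" "frame M \<alpha>" "\<lambda>i. (*v) (gam M i)" by (rule spin_frame_patch[OF \<alpha>])
  have "twisted_dirac M \<Psi> \<alpha> p w =
      (\<Sum>k\<in>UNIV. \<Sum>j\<in>UNIV. metric M p w (frame M \<alpha> j p) *\<^sub>R \<gamma> k (F.tw_cov k (frame_coord \<Psi> \<alpha>) j p))"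
    unfolding twisted_dirac_def clifford_mult_frame[OF \<alpha> p] twisted_nabla_frame[OF \<alpha> \<Psi> p w] by (simp only: G_simps)
  also have "\<dots> = (\<Sum>j\<in>UNIV. \<Sum>k\<in>UNIV. metric M p w (frame M \<alpha> j p) *\<^sub>R \<gamma> k (F.tw_cov k (frame_coord \<Psi> \<alpha>) j p))"
    by (rule sum.swap)
  finally show ?thesis unfolding F.tw_dirac_def scaleR_sum_right .
qed

lemma twisted_dirac_frame_vector:
  assumes \<alpha>: "\<alpha> \<in> indices M" and \<Psi>: "tspinor_field M \<Psi>" and p: "p \<in> patch M \<alpha>"
  shows "twisted_dirac M \<Psi> \<alpha> p (frame M \<alpha> j p) =
    spin_frame.tw_dirac M (frame M \<alpha>) (\<lambda>i. (*v) (gam M i)) (frame_coord \<Psi> \<alpha>) j p"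
proof -
  interpret F: spin_frame M "patch M \<alpha>" "frame M \<alpha>" "\<lambda>i. (*v) (gam M i)" by (rule spin_frame_patch[OF \<alpha>])
  show ?thesis
    unfolding twisted_dirac_frame[OF \<alpha> \<Psi> p F.frame_tangent[OF p]] F.frame_metric[OF p]
    by (simp add: if_distrib[of "\<lambda>x. x *\<^sub>R _"] cong: if_cong)
qed

lemma linear_twisted_dirac:
  assumes \<alpha>: "\<alpha> \<in> indices M" and \<Psi>: "tspinor_field M \<Psi>" and p: "p \<in> patch M \<alpha>"
  shows "linear_tangent (TS p) (twisted_dirac M \<Psi> \<alpha> p)"
proof -
  interpret F: spin_frame M "patch M \<alpha>" "frame M \<alpha>" "\<lambda>i. (*v) (gam M i)" by (rule spin_frame_patch[OF \<alpha>])
  show ?thesis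
    by (rule F.linear_tangent_eq[rotated], rule twisted_dirac_frame[OF \<alpha> \<Psi> p], assumption, intro linear_tangent_sumI)
      (use metric_linear_left[OF F.frame_tangent[OF p]] in \<open>simp add: linear_tangent_def algebra_simps\<close>)
qed

subsection \<open>The Dirac operator is symmetric up to a divergence\<close>

text \<open>The 1-form by whose divergence the Dirac operator fails to be symmetric pointwise.
  Like the pairing it is defined by a choice of a trivialisation and a basis, on neither of which
  it depends.\<close>

definition "current \<Psi> \<Xi> p v = (\<Sum>i\<in>UNIV.
  clifford_mult M (patch_index p) p v (\<Psi> (patch_index p) p (onb M p i)) \<bullet> \<Xi> (patch_index p) p (onb M p i))"

context
  fixes \<Psi> \<Xi>
  assumes \<Psi>: "tspinor_field M \<Psi>" and \<Xi>: "tspinor_field M \<Xi>"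
begin

lemma current_patch:
  assumes \<alpha>: "\<alpha> \<in> indices M" and p: "p \<in> patch M \<alpha>" and v: "v \<in> TS p"
  shows "current \<Psi> \<Xi> p v =
    (\<Sum>i\<in>UNIV. clifford_mult M \<alpha> p v (\<Psi> \<alpha> p (frame M \<alpha> i p)) \<bullet> \<Xi> \<alpha> p (frame M \<alpha> i p))"
proof -
  interpret F: spin_frame M "patch M \<alpha>" "frame M \<alpha>" "\<lambda>i. (*v) (gam M i)" by (rule spin_frame_patch[OF \<alpha>])
  have "clifford_mult M (patch_index p) p v (\<Psi> (patch_index p) p (onb M p i)) \<bullet> \<Xi> (patch_index p) p (onb M p i) =
      clifford_mult M \<alpha> p v (\<Psi> \<alpha> p (onb M p i)) \<bullet> \<Xi> \<alpha> p (onb M p i)" for i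
    unfolding tspinor_transition[OF \<Psi> patch_index(1) \<alpha> patch_index(2) p onb_tangent]
      tspinor_transition[OF \<Xi> patch_index(1) \<alpha> patch_index(2) p onb_tangent]
      clifford_mult_transition[OF patch_index \<alpha> p v, symmetric]
    by (rule inner_transition[OF patch_index(1) \<alpha> patch_index(2) p])
  then have "current \<Psi> \<Xi> p v = (\<Sum>i\<in>UNIV. clifford_mult M \<alpha> p v (\<Psi> \<alpha> p (onb M p i)) \<bullet> \<Xi> \<alpha> p (onb M p i))"
    by (simp add: current_def)
  also have "\<dots> = (\<Sum>i\<in>UNIV. clifford_mult M \<alpha> p v (\<Psi> \<alpha> p (frame M \<alpha> i p)) \<bullet> \<Xi> \<alpha> p (frame M \<alpha> i p))"
    by (rule trace_orthonormal[OF F.frame_orthonormal[OF p] onb_patch, of "\<lambda>x y. clifford_mult M \<alpha> p v (\<Psi> \<alpha> p x) \<bullet> \<Xi> \<alpha> p y"])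
      (use tspinor_linear[OF \<Psi> \<alpha> p] tspinor_linear[OF \<Xi> \<alpha> p] in \<open>simp_all add: linear_tangent_def inner_add_left inner_add_right
        linear_add[OF linear_clifford_mult] linear_cmul[OF linear_clifford_mult]\<close>)
  finally show ?thesis .
qed

lemma one_form_current: "one_form (atlas M) (current \<Psi> \<Xi>)"
  unfolding one_form_def
proof (intro conjI allI impI)
  fix p
  obtain \<alpha> where \<alpha>: "\<alpha> \<in> indices M" and p: "p \<in> patch M \<alpha>" using patch_at .
  interpret F: spin_frame M "patch M \<alpha>" "frame M \<alpha>" "\<lambda>i. (*v) (gam M i)" by (rule spin_frame_patch[OF \<alpha>])
  show "linear_tangent (TS p) (current \<Psi> \<Xi> p)"
    by (rule F.linear_tangent_eq[rotated], rule current_patch[OF \<alpha> p], assumption, intro linear_tangent_sumI)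
      (use clifford_mult_linear[OF \<alpha> p] in \<open>simp add: linear_tangent_def inner_add_left\<close>)
next
  fix W X assume W: "open W \<and> smooth_field (atlas M) W X"
  show "smooth_map (atlas M) W (\<lambda>p. current \<Psi> \<Xi> p (X p))"
  proof (rule smooth_map_local)
    fix p assume pW: "p \<in> W"
    obtain \<alpha> where \<alpha>: "\<alpha> \<in> indices M" and p: "p \<in> patch M \<alpha>" using patch_at .
    interpret F: spin_frame M "patch M \<alpha>" "frame M \<alpha>" "\<lambda>i. (*v) (gam M i)" by (rule spin_frame_patch[OF \<alpha>])
    let ?V = "W \<inter> patch M \<alpha>"
    have V: "open ?V" using W F.open_domain by auto
    have S: "smooth_field (atlas M) ?V X" "smooth_field (atlas M) ?V (frame M \<alpha> k)" for k
      using W F.frame_smooth by (auto intro: smooth_field_subset)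
    have G: "bounded_linear ((*v) (gam M i))" for i by (rule F.bounded_linear_G)
    have "smooth_map (atlas M) ?V (\<lambda>q. \<Sum>i\<in>UNIV. (\<Sum>k\<in>UNIV. metric M q (X q) (frame M \<alpha> k q) *\<^sub>R
        \<gamma> k (\<Psi> \<alpha> q (frame M \<alpha> i q))) \<bullet> \<Xi> \<alpha> q (frame M \<alpha> i q))"
      by (intro smooth_map_sum smooth_map_inner smooth_map_scaleR V metric_smooth[OF V] S
          smooth_map_bounded_linear[OF V G] tspinor_smooth[OF \<Psi> \<alpha> V] tspinor_smooth[OF \<Xi> \<alpha> V] Int_lower2)
    then have "smooth_map (atlas M) ?V (\<lambda>q. current \<Psi> \<Xi> q (X q))"
    proof (rule smooth_map_cong[OF V, rotated])
      fix q assume q: "q \<in> ?V"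
      show "(\<Sum>i\<in>UNIV. (\<Sum>k\<in>UNIV. metric M q (X q) (frame M \<alpha> k q) *\<^sub>R
        \<gamma> k (\<Psi> \<alpha> q (frame M \<alpha> i q))) \<bullet> \<Xi> \<alpha> q (frame M \<alpha> i q)) = current \<Psi> \<Xi> q (X q)"
        unfolding current_patch[OF \<alpha> IntD2[OF q] smooth_field_tangent[OF S(1) q]] clifford_mult_def ..
    qed
    then show "\<exists>V. open V \<and> p \<in> V \<and> smooth_map (atlas M) V (\<lambda>p. current \<Psi> \<Xi> p (X p))"
      using V pW p by blast
  qed
qed

lemma twisted_dirac_divergence:
  assumes \<alpha>: "\<alpha> \<in> indices M" and p: "p \<in> patch M \<alpha>"
  shows "pairing (twisted_dirac M \<Psi>) \<Xi> \<alpha> p = pairing \<Psi> (twisted_dirac M \<Xi>) \<alpha> p + divergence M (current \<Psi> \<Xi>) p"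
proof -
  interpret F: spin_frame M "patch M \<alpha>" "frame M \<alpha>" "\<lambda>i. (*v) (gam M i)" by (rule spin_frame_patch[OF \<alpha>])
  let ?\<psi> = "frame_coord \<Psi> \<alpha>" and ?\<xi> = "frame_coord \<Xi> \<alpha>"
  have c: "current \<Psi> \<Xi> q (frame M \<alpha> k q) = (\<Sum>j\<in>UNIV. \<gamma> k (?\<psi> j q) \<bullet> ?\<xi> j q)" if "q \<in> patch M \<alpha>" for k q
    unfolding current_patch[OF \<alpha> that F.frame_tangent[OF that]] clifford_mult_frame[OF \<alpha> that] frame_coord_def ..
  have d: "F.dd k (\<lambda>q. current \<Psi> \<Xi> q (frame M \<alpha> k q)) p = F.dd k (\<lambda>q. \<Sum>j\<in>UNIV. \<gamma> k (?\<psi> j q) \<bullet> ?\<xi> j q) p" for k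
    by (rule F.dd_cong[OF p F.one_form_smooth[OF one_form_current F.open_domain F.frame_smooth] c])
  have "(\<Sum>j\<in>UNIV. F.tw_dirac ?\<psi> j p \<bullet> ?\<xi> j p) - (\<Sum>j\<in>UNIV. ?\<psi> j p \<bullet> F.tw_dirac ?\<xi> j p) = divergence M (current \<Psi> \<Xi>) p"
    unfolding F.tw_dirac_divergence[OF p smooth_frame_coord[OF \<Psi> \<alpha>] smooth_frame_coord[OF \<Xi> \<alpha>]]
      F.divergence_frame[OF one_form_current p] d c[OF p] ..
  moreover have "pairing (twisted_dirac M \<Psi>) \<Xi> \<alpha> p = (\<Sum>j\<in>UNIV. F.tw_dirac ?\<psi> j p \<bullet> ?\<xi> j p)"
    unfolding pairing_frame[of \<alpha> p "twisted_dirac M \<Psi>" \<Xi>, OF \<alpha> p linear_twisted_dirac[OF \<alpha> \<Psi> p] tspinor_linear[OF \<Xi> \<alpha> p]]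
      twisted_dirac_frame_vector[OF \<alpha> \<Psi> p] frame_coord_def ..
  moreover have "pairing \<Psi> (twisted_dirac M \<Xi>) \<alpha> p = (\<Sum>j\<in>UNIV. ?\<psi> j p \<bullet> F.tw_dirac ?\<xi> j p)"
    unfolding pairing_frame[of \<alpha> p \<Psi> "twisted_dirac M \<Xi>", OF \<alpha> p tspinor_linear[OF \<Psi> \<alpha> p] linear_twisted_dirac[OF \<alpha> \<Xi> p]]
      twisted_dirac_frame_vector[OF \<alpha> \<Xi> p] frame_coord_def ..
  ultimately show ?thesis by simp
qed

end

subsection \<open>The sections built from a spinor\<close>

text \<open>The regularity that makes \<open>\<Phi>(K)\<close> a section, with smoothness tested
  in the given frames only.\<close>

definition "smooth_bilinear K \<longleftrightarrow>
  (\<forall>p. \<forall>x\<in>TS p. linear_tangent (TS p) (K p x) \<and> linear_tangent (TS p) (\<lambda>y. K p y x)) \<and>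
  (\<forall>\<alpha>\<in>indices M. \<forall>i j. smooth_map (atlas M) (patch M \<alpha>) (\<lambda>q. K q (frame M \<alpha> i q) (frame M \<alpha> j q) :: real))"

lemma Phi_eq:
  assumes \<alpha>: "\<alpha> \<in> indices M" and p: "p \<in> patch M \<alpha>" and w: "w \<in> TS p"
    and K: "\<And>x. x \<in> TS p \<Longrightarrow> linear_tangent (TS p) (K p x)"
  shows "Phi M \<sigma> K \<alpha> p w = (\<Sum>i\<in>UNIV. K p (frame M \<alpha> i p) w *\<^sub>R \<gamma> i (\<sigma> \<alpha> p))"
proof -
  interpret F: spin_frame M "patch M \<alpha>" "frame M \<alpha>" "\<lambda>i. (*v) (gam M i)" by (rule spin_frame_patch[OF \<alpha>])
  have "(\<Sum>j\<in>UNIV. K p (frame M \<alpha> i p) (frame M \<alpha> j p) * metric M p (frame M \<alpha> j p) w) = K p (frame M \<alpha> i p) w" for i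
    using linear_orthonormal_expand[OF F.frame_orthonormal[OF p] w K[OF F.frame_tangent[OF p]], of i]
    by (simp add: metric_sym[OF w F.frame_tangent[OF p]] mult.commute)
  then show ?thesis
    unfolding Phi_def clifford_mult_frame[OF \<alpha> p] scaleR_sum_left[symmetric] by simp
qed

context
  fixes \<sigma> assumes \<sigma>: "spinor_field M \<sigma>"
begin

lemma spinor_smooth: "\<alpha> \<in> indices M \<Longrightarrow> smooth_map (atlas M) (patch M \<alpha>) (\<sigma> \<alpha>)"
  using \<sigma> by (simp add: spinor_field_def)

lemma spinor_transition:
  "\<alpha> \<in> indices M \<Longrightarrow> \<beta> \<in> indices M \<Longrightarrow> p \<in> patch M \<alpha> \<Longrightarrow> p \<in> patch M \<beta> \<Longrightarrow> transition M \<alpha> \<beta> p *v \<sigma> \<beta> p = \<sigma> \<alpha> p"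
  using \<sigma>[unfolded spinor_field_def, THEN conjunct2, THEN bspec, THEN bspec, THEN bspec, of \<alpha> \<beta> p] by simp

text \<open>Compatibility with the transition functions holds because \<open>\<Phi>(K)\<close> is
  a trace over the frame, and the trace is the same in the two frames.\<close>

lemma tspinor_Phi:
  assumes K: "smooth_bilinear K"
  shows "tspinor_field M (Phi M \<sigma> K)"
  unfolding tspinor_field_def
proof (intro conjI ballI allI impI)
  have K1: "linear_tangent (TS p) (K p x)" and K2: "linear_tangent (TS p) (\<lambda>y. K p y x)" if "x \<in> TS p" for p x
    using K that unfolding smooth_bilinear_def by auto
  have e: "Phi M \<sigma> K \<delta> p w = (\<Sum>i\<in>UNIV. K p (frame M \<delta> i p) w *\<^sub>R \<gamma> i (\<sigma> \<delta> p))"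
    if "\<delta> \<in> indices M" "p \<in> patch M \<delta>" "w \<in> TS p" for \<delta> p w
    by (rule Phi_eq[OF that]) (rule K1)
  fix \<alpha> assume \<alpha>: "\<alpha> \<in> indices M"
  interpret F: spin_frame M "patch M \<alpha>" "frame M \<alpha>" "\<lambda>i. (*v) (gam M i)" by (rule spin_frame_patch[OF \<alpha>])
  show "linear_tangent (TS p) (Phi M \<sigma> K \<alpha> p)" if p: "p \<in> patch M \<alpha>" for p
    by (rule F.linear_tangent_eq[rotated], rule e[OF \<alpha> p], assumption, intro linear_tangent_sumI)
      (use K1[OF F.frame_tangent[OF p]] in \<open>simp add: linear_tangent_def algebra_simps\<close>)
  show "smooth_map (atlas M) W (\<lambda>p. Phi M \<sigma> K \<alpha> p (X p))" if W: "open W \<and> W \<subseteq> patch M \<alpha> \<and> smooth_field (atlas M) W X" for W X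
  proof -
    have W': "open W" "W \<subseteq> patch M \<alpha>" "smooth_field (atlas M) W X" using W by auto
    have G: "bounded_linear ((*v) (gam M i))" for i by (rule F.bounded_linear_G)
    have "smooth_map (atlas M) W (\<lambda>q. K q (frame M \<alpha> i q) (frame M \<alpha> j q))" for i j
      by (rule smooth_map_subset[OF _ W'(2)]) (use K \<alpha> in \<open>simp add: smooth_bilinear_def\<close>)
    then show ?thesis
      unfolding Phi_def clifford_mult_def
      by (intro smooth_map_sum smooth_map_scaleR smooth_map_mult metric_smooth W'
        smooth_field_subset[OF F.frame_smooth W'(2)] smooth_map_bounded_linear[OF W'(1) G] smooth_map_subset[OF spinor_smooth[OF \<alpha>] W'(2)])
  qed
  fix \<beta> p w assume \<beta>: "\<beta> \<in> indices M" and "p \<in> patch M \<alpha> \<inter> patch M \<beta>" and w: "w \<in> TS p"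
  then have p: "p \<in> patch M \<alpha>" "p \<in> patch M \<beta>" by auto
  interpret B: spin_frame M "patch M \<beta>" "frame M \<beta>" "\<lambda>i. (*v) (gam M i)" by (rule spin_frame_patch[OF \<beta>])
  have "transition M \<alpha> \<beta> p *v Phi M \<sigma> K \<beta> p w =
      (\<Sum>i\<in>UNIV. K p (frame M \<beta> i p) w *\<^sub>R clifford_mult M \<alpha> p (frame M \<beta> i p) (\<sigma> \<alpha> p))"
    unfolding e[OF \<beta> p(2) w] matrix_vector_simps clifford_mult_frame[OF \<beta> p(2), symmetric]
      clifford_mult_transition[OF \<alpha> p(1) \<beta> p(2) B.frame_tangent[OF p(2)]] spinor_transition[OF \<alpha> \<beta> p] ..
  also have "\<dots> = (\<Sum>i\<in>UNIV. K p (frame M \<alpha> i p) w *\<^sub>R clifford_mult M \<alpha> p (frame M \<alpha> i p) (\<sigma> \<alpha> p))"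
    by (rule trace_orthonormal[OF F.frame_orthonormal[OF p(1)] B.frame_orthonormal[OF p(2)],
          of "\<lambda>x y. K p x w *\<^sub>R clifford_mult M \<alpha> p y (\<sigma> \<alpha> p)"])
      (use K2[OF w] clifford_mult_linear[OF \<alpha> p(1)] in \<open>simp_all add: linear_tangent_def algebra_simps\<close>)
  also have "\<dots> = Phi M \<sigma> K \<alpha> p w"
    unfolding e[OF \<alpha> p(1) w] clifford_mult_frame[OF \<alpha> p(1)] ..
  finally show "Phi M \<sigma> K \<alpha> p w = transition M \<alpha> \<beta> p *v Phi M \<sigma> K \<beta> p w" by simp
qed

end


subsection \<open>The formal adjoint of the Dirac operator\<close>

lemma tspinor_cong:
  assumes \<Psi>: "tspinor_field M \<Psi>"
    and e: "\<And>\<alpha> p w. \<alpha> \<in> indices M \<Longrightarrow> p \<in> patch M \<alpha> \<Longrightarrow> w \<in> TS p \<Longrightarrow> \<Xi> \<alpha> p w = \<Psi> \<alpha> p w"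
  shows "tspinor_field M \<Xi>"
  unfolding tspinor_field_def
proof (intro conjI ballI allI impI)
  fix \<alpha> assume \<alpha>: "\<alpha> \<in> indices M"
  interpret F: spin_frame M "patch M \<alpha>" "frame M \<alpha>" "\<lambda>i. (*v) (gam M i)" by (rule spin_frame_patch[OF \<alpha>])
  show "linear_tangent (TS p) (\<Xi> \<alpha> p)" if p: "p \<in> patch M \<alpha>" for p
    by (rule F.linear_tangent_eq[OF tspinor_linear[OF \<Psi> \<alpha> p] e[OF \<alpha> p]])
  show "smooth_map (atlas M) W (\<lambda>p. \<Xi> \<alpha> p (X p))" if W: "open W \<and> W \<subseteq> patch M \<alpha> \<and> smooth_field (atlas M) W X" for W X
  proof (rule smooth_map_cong)
    show "\<Psi> \<alpha> q (X q) = \<Xi> \<alpha> q (X q)" if "q \<in> W" for q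
      using e[OF \<alpha>, of q "X q"] W that smooth_field_tangent[of W X q] by auto
    show "smooth_map (atlas M) W (\<lambda>p. \<Psi> \<alpha> p (X p))" using tspinor_smooth[OF \<Psi> \<alpha>] W by blast
  qed (use W in blast)
  show "\<Xi> \<alpha> p w = transition M \<alpha> \<beta> p *v \<Xi> \<beta> p w"
    if "\<beta> \<in> indices M" "p \<in> patch M \<alpha> \<inter> patch M \<beta>" "w \<in> TS p" for \<beta> p w
    using tspinor_transition[OF \<Psi> \<alpha> that(1) _ _ that(3)] e[OF \<alpha> _ that(3)] e[OF that(1) _ that(3)] that(2) by simp
qed

text \<open>The connection and Clifford multiplication are complex linear.\<close>

lemma twisted_dirac_rot:
  assumes \<Psi>: "tspinor_field M \<Psi>" and \<alpha>: "\<alpha> \<in> indices M" and p: "p \<in> patch M \<alpha>" and w: "w \<in> TS p"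
  shows "twisted_dirac M (\<lambda>\<alpha> p w. rot (\<Psi> \<alpha> p w)) \<alpha> p w = rot (twisted_dirac M \<Psi> \<alpha> p w)"
proof -
  interpret F: spin_frame M "patch M \<alpha>" "frame M \<alpha>" "\<lambda>i. (*v) (gam M i)" by (rule spin_frame_patch[OF \<alpha>])
  let ?\<psi> = "frame_coord \<Psi> \<alpha>"
  note r = linear_add[OF linear_rot] linear_diff[OF linear_rot] linear_cmul[OF linear_rot] linear_sum[OF linear_rot]
  have c: "frame_coord (\<lambda>\<alpha> p w. rot (\<Psi> \<alpha> p w)) \<alpha> = (\<lambda>j q. rot (?\<psi> j q))"
    by (simp add: frame_coord_def fun_eq_iff)
  have "F.spin_cov k (\<lambda>q. rot (?\<psi> j q)) p = rot (F.spin_cov k (?\<psi> j) p)" for k j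
    unfolding F.spin_cov_def F.dd_linear[OF bounded_linear_rot p smooth_frame_coord[OF \<Psi> \<alpha>]] spin_lie_def rot_matrix r ..
  then have "F.tw_cov k (\<lambda>j q. rot (?\<psi> j q)) j p = rot (F.tw_cov k ?\<psi> j p)" for k j
    unfolding F.tw_cov_def r by simp
  then show ?thesis
    unfolding twisted_dirac_frame[OF \<alpha> tspinor_rot[OF \<Psi>] p w] twisted_dirac_frame[OF \<alpha> \<Psi> p w] c F.tw_dirac_def
    by (simp add: rot_matrix r)
qed

lemma pairing_cong:
  assumes "\<And>w. w \<in> TS p \<Longrightarrow> \<Psi> \<alpha> p w = \<Psi>' \<alpha> p w" "\<And>w. w \<in> TS p \<Longrightarrow> \<Xi> \<alpha> p w = \<Xi>' \<alpha> p w"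
  shows "pairing \<Psi> \<Xi> \<alpha> p = pairing \<Psi>' \<Xi>' \<alpha> p"
  unfolding pairing_def using assms onb_tangent by simp

text \<open>The imaginary part follows from the real part for \<open>\<i>\<Xi>\<close> in place of
  \<open>\<Xi>\<close>.\<close>

lemma inner_tspinor_dirac:
  assumes \<Psi>: "tspinor_field M \<Psi>" and \<Xi>: "tspinor_field M \<Xi>"
  shows "inner_tspinor M (twisted_dirac M \<Psi>) \<Xi> p = inner_tspinor M \<Psi> (twisted_dirac M \<Xi>) p +
    Complex (divergence M (current \<Psi> \<Xi>) p) (divergence M (current \<Psi> (\<lambda>\<alpha> p w. rot (\<Xi> \<alpha> p w))) p)"
proof -
  have "pairing \<Psi> (twisted_dirac M (\<lambda>\<alpha> p w. rot (\<Xi> \<alpha> p w))) (patch_index p) p =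
      pairing \<Psi> (\<lambda>\<alpha> p w. rot (twisted_dirac M \<Xi> \<alpha> p w)) (patch_index p) p"
    by (rule pairing_cong) (simp_all add: twisted_dirac_rot[OF \<Xi> patch_index])
  then show ?thesis
    unfolding inner_tspinor_eq twisted_dirac_divergence[OF \<Psi> \<Xi> patch_index] twisted_dirac_divergence[OF \<Psi> tspinor_rot[OF \<Xi>] patch_index]
    by (simp add: complex_eq_iff)
qed

text \<open>By the divergence theorem the Dirac operator satisfies the adjoint relation itself, so
  a formal adjoint differs from it by a section orthogonal to all others. This difference is a
  section, hence orthogonal to itself, provided that \<open>\<D>\<Xi>\<close> is one.\<close>

lemma twisted_dirac_adjoint_eq:
  assumes compact: "compact (UNIV :: 'm set)" and adj: "twisted_dirac_adjoint M D"
    and \<Xi>: "tspinor_field M \<Xi>" and D\<Xi>: "tspinor_field M (twisted_dirac M \<Xi>)"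
    and \<alpha>: "\<alpha> \<in> indices M" and p: "p \<in> patch M \<alpha>" and w: "w \<in> TS p"
  shows "D \<Xi> \<alpha> p w = twisted_dirac M \<Xi> \<alpha> p w"
proof -
  interpret closed_manifold M by unfold_locales (rule compact)
  let ?\<Lambda> = "twisted_dirac M \<Xi>"
  have int: "integrable (vol M) f" if "smooth_map (atlas M) UNIV f" for f :: "'m \<Rightarrow> real"
    by (rule integrable_continuous[OF smooth_map_continuous_on[OF open_UNIV that]])
  have intC: "(\<integral>p. Complex (a p) (b p) \<partial>vol M) = Complex (\<integral>p. a p \<partial>vol M) (\<integral>p. b p \<partial>vol M)"
    if "integrable (vol M) a" "integrable (vol M) b" for a b
    unfolding Complex_eq using that by simp
  have plus: "Complex a b + Complex c d = Complex (a + c) (b + d)" for a b c d by (simp add: complex_eq_iff)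
  note P = int[OF smooth_pairing]
  have S: "tspinor_field M (D \<Xi>)" using adj \<Xi> by (simp add: twisted_dirac_adjoint_def)
  \<comment> \<open>The test section.\<close>
  define \<Psi> where "\<Psi> = (\<lambda>\<alpha> p w. D \<Xi> \<alpha> p w - ?\<Lambda> \<alpha> p w)"
  have \<Psi>: "tspinor_field M \<Psi>" unfolding \<Psi>_def by (rule tspinor_diff[OF S D\<Xi>])
  let ?pair = "\<lambda>\<Psi> \<Xi> p. pairing \<Psi> \<Xi> (patch_index p) p"
  note d1 = one_form_current[OF \<Psi> \<Xi>] and d2 = one_form_current[OF \<Psi> tspinor_rot[OF \<Xi>]]
  note i1 = int[OF smooth_divergence[OF d1]] and i2 = int[OF smooth_divergence[OF d2]]
  have "(\<integral>p. inner_tspinor M (twisted_dirac M \<Psi>) \<Xi> p \<partial>vol M) = (\<integral>p. inner_tspinor M \<Psi> (D \<Xi>) p \<partial>vol M)"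
    using adj \<Psi> \<Xi> by (simp add: twisted_dirac_adjoint_def)
  then have "(\<integral>p. Complex (?pair \<Psi> ?\<Lambda> p + divergence M (current \<Psi> \<Xi>) p)
        (?pair \<Psi> (\<lambda>\<alpha> p w. rot (?\<Lambda> \<alpha> p w)) p + divergence M (current \<Psi> (\<lambda>\<alpha> p w. rot (\<Xi> \<alpha> p w))) p) \<partial>vol M) =
      (\<integral>p. Complex (?pair \<Psi> (D \<Xi>) p) (?pair \<Psi> (\<lambda>\<alpha> p w. rot (D \<Xi> \<alpha> p w)) p) \<partial>vol M)"
    unfolding inner_tspinor_dirac[OF \<Psi> \<Xi>] unfolding inner_tspinor_eq plus .
  then have "(\<integral>p. ?pair \<Psi> ?\<Lambda> p + divergence M (current \<Psi> \<Xi>) p \<partial>vol M) = (\<integral>p. ?pair \<Psi> (D \<Xi>) p \<partial>vol M)"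
    unfolding intC[OF Bochner_Integration.integrable_add[OF P[OF \<Psi> D\<Xi>] i1]
        Bochner_Integration.integrable_add[OF P[OF \<Psi> tspinor_rot[OF D\<Xi>]] i2]]
      intC[OF P[OF \<Psi> S] P[OF \<Psi> tspinor_rot[OF S]]] by simp
  also have "(\<integral>p. ?pair \<Psi> ?\<Lambda> p + divergence M (current \<Psi> \<Xi>) p \<partial>vol M) = (\<integral>p. ?pair \<Psi> ?\<Lambda> p \<partial>vol M)"
    unfolding Bochner_Integration.integral_add[OF P[OF \<Psi> D\<Xi>] i1] divergence_theorem[OF d1] by simp
  finally have "(\<integral>p. ?pair \<Psi> (D \<Xi>) p - ?pair \<Psi> ?\<Lambda> p \<partial>vol M) = 0"
    unfolding Bochner_Integration.integral_diff[OF P[OF \<Psi> S] P[OF \<Psi> D\<Xi>]] by simp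
  moreover have "?pair \<Psi> (D \<Xi>) q - ?pair \<Psi> ?\<Lambda> q = ?pair \<Psi> \<Psi> q" for q
    unfolding pairing_def sum_subtractf[symmetric] inner_diff_right[symmetric] by (simp add: \<Psi>_def)
  ultimately have z: "(\<integral>p. ?pair \<Psi> \<Psi> p \<partial>vol M) = 0" by simp
  have nn: "?pair \<Psi> \<Psi> q \<ge> 0" for q unfolding pairing_def by (intro sum_nonneg) simp
  have "?pair \<Psi> \<Psi> p = 0"
    by (rule integral_zero_imp_zero[OF smooth_map_continuous_on[OF open_UNIV smooth_pairing[OF \<Psi> \<Psi>]] nn z])
  then have "pairing \<Psi> \<Psi> \<alpha> p = 0"
    using pairing_transition[OF \<Psi> \<Psi> \<alpha> p patch_index] by simp
  then have "\<Psi> \<alpha> p (onb M p i) = 0" for i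
    unfolding pairing_def by (simp add: sum_nonneg_eq_0_iff)
  then have "\<Psi> \<alpha> p w = 0"
    using linear_orthonormal_expand[OF onb_patch w tspinor_linear[OF \<Psi> \<alpha> p]] by simp
  then show ?thesis by (simp add: \<Psi>_def)
qed

subsection \<open>The square of the Dirac operator\<close>

text \<open>For \<open>T = \<nabla>h\<close> this is \<open>\<D>\<Phi>(h)\<close>, in a form that
  shows that it is a section.\<close>

definition "dirac_Phi \<sigma> T \<alpha> p w = (\<Sum>k\<in>UNIV. \<Sum>i\<in>UNIV.
  T p (frame M \<alpha> k p) (frame M \<alpha> i p) w *\<^sub>R \<gamma> k (\<gamma> i (\<sigma> \<alpha> p)))"

text \<open>As for \<open>\<Phi>\<close>, this is a trace over the frame, now a double one, and it
  changes frames in one index after the other.\<close>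

lemma tspinor_dirac_Phi:
  assumes \<sigma>: "spinor_field M \<sigma>" and T: "cot_sym2_tensor (atlas M) T"
  shows "tspinor_field M (dirac_Phi \<sigma> T)"
  unfolding tspinor_field_def
proof (intro conjI ballI allI impI)
  fix \<alpha> assume \<alpha>: "\<alpha> \<in> indices M"
  interpret F: spin_frame M "patch M \<alpha>" "frame M \<alpha>" "\<lambda>i. (*v) (gam M i)" by (rule spin_frame_patch[OF \<alpha>])
  show "linear_tangent (TS p) (dirac_Phi \<sigma> T \<alpha> p)" if p: "p \<in> patch M \<alpha>" for p
    unfolding dirac_Phi_def[abs_def]
    by (intro linear_tangent_sumI)
      (use cot_sym2_linear(2)[OF T F.frame_tangent[OF p] F.frame_tangent[OF p]] in \<open>simp add: linear_tangent_def algebra_simps\<close>)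
  show "smooth_map (atlas M) W (\<lambda>p. dirac_Phi \<sigma> T \<alpha> p (X p))" if W: "open W \<and> W \<subseteq> patch M \<alpha> \<and> smooth_field (atlas M) W X" for W X
  proof -
    have W': "open W" "W \<subseteq> patch M \<alpha>" "smooth_field (atlas M) W X" using W by auto
    have G: "bounded_linear ((*v) (gam M i))" for i by (rule F.bounded_linear_G)
    show ?thesis
      unfolding dirac_Phi_def
      by (intro smooth_map_sum smooth_map_scaleR cot_sym2_smooth[OF T] W' smooth_map_bounded_linear[OF W'(1) G]
        smooth_field_subset[OF F.frame_smooth W'(2)] smooth_map_subset[OF spinor_smooth[OF \<sigma> \<alpha>] W'(2)])
  qed
  fix \<beta> p w assume \<beta>: "\<beta> \<in> indices M" and "p \<in> patch M \<alpha> \<inter> patch M \<beta>" and w: "w \<in> TS p"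
  then have p: "p \<in> patch M \<alpha>" "p \<in> patch M \<beta>" by auto
  interpret B: spin_frame M "patch M \<beta>" "frame M \<beta>" "\<lambda>i. (*v) (gam M i)" by (rule spin_frame_patch[OF \<beta>])
  let ?c = "clifford_mult M \<alpha> p" and ?a = "\<lambda>i. frame M \<alpha> i p" and ?b = "\<lambda>i. frame M \<beta> i p" and ?z = "\<sigma> \<alpha> p"
  note o = F.frame_orthonormal[OF p(1)] B.frame_orthonormal[OF p(2)]
  note t = F.frame_tangent[OF p(1)] B.frame_tangent[OF p(2)]
  note c = clifford_mult_linear[OF \<alpha> p(1)] linear_add[OF linear_clifford_mult] linear_cmul[OF linear_clifford_mult]
  have "transition M \<alpha> \<beta> p *v dirac_Phi \<sigma> T \<beta> p w =
      (\<Sum>k\<in>UNIV. \<Sum>i\<in>UNIV. T p (?b k) (?b i) w *\<^sub>R ?c (?b k) (?c (?b i) ?z))"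
    unfolding dirac_Phi_def matrix_vector_simps clifford_mult_frame[OF \<beta> p(2), symmetric]
      clifford_mult_transition[OF \<alpha> p(1) \<beta> p(2) t(2)] spinor_transition[OF \<sigma> \<alpha> \<beta> p] ..
  also have "\<dots> = (\<Sum>k\<in>UNIV. \<Sum>i\<in>UNIV. T p (?b k) (?a i) w *\<^sub>R ?c (?b k) (?c (?a i) ?z))"
    by (rule sum.cong[OF refl], rule trace_orthonormal[OF o, of "\<lambda>x y. T p (?b k) x w *\<^sub>R ?c (?b k) (?c y ?z)" for k])
      (use cot_sym2_linear(3)[OF T t(2) w] c in \<open>simp_all add: linear_tangent_def algebra_simps\<close>)
  also have "\<dots> = (\<Sum>k\<in>UNIV. \<Sum>i\<in>UNIV. T p (?a k) (?a i) w *\<^sub>R ?c (?a k) (?c (?a i) ?z))"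
    by (rule trace_orthonormal[OF o, of "\<lambda>x y. \<Sum>i\<in>UNIV. T p x (?a i) w *\<^sub>R ?c y (?c (?a i) ?z)"])
      (intro linear_tangent_sumI, use cot_sym2_linear(1)[OF T t(1) w] c in \<open>simp add: linear_tangent_def algebra_simps\<close>)+
  also have "\<dots> = dirac_Phi \<sigma> T \<alpha> p w"
    unfolding dirac_Phi_def clifford_mult_frame[OF \<alpha> p(1)] ..
  finally show "dirac_Phi \<sigma> T \<alpha> p w = transition M \<alpha> \<beta> p *v dirac_Phi \<sigma> T \<beta> p w" by simp
qed

lemma linear_eq_on_frame:
  assumes \<alpha>: "\<alpha> \<in> indices M" and p: "p \<in> patch M \<alpha>" and w: "w \<in> TS p"
    and "linear_tangent (TS p) L" "linear_tangent (TS p) K" "\<And>j. L (frame M \<alpha> j p) = K (frame M \<alpha> j p)"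
  shows "L w = K w"
proof -
  interpret F: orthonormal_frame M "patch M \<alpha>" "frame M \<alpha>" by (rule orthonormal_frame_patch[OF \<alpha>])
  show ?thesis
    unfolding linear_orthonormal_expand[OF F.frame_orthonormal[OF p] w assms(4)]
      linear_orthonormal_expand[OF F.frame_orthonormal[OF p] w assms(5)] assms(6) ..
qed

lemma smooth_bilinear_sym2:
  assumes h: "sym2_tensor (atlas M) h"
  shows "smooth_bilinear h"
  unfolding smooth_bilinear_def
  using sym2_linear_right[OF h] sym2_linear_left[OF h]
    sym2_smooth[OF h orthonormal_frame.open_domain[OF orthonormal_frame_patch]
      orthonormal_frame.frame_smooth[OF orthonormal_frame_patch] orthonormal_frame.frame_smooth[OF orthonormal_frame_patch]]
  by blast

lemma parallel_field: "parallel_spinor M \<sigma> \<Longrightarrow> spinor_field M \<sigma>"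
  by (simp add: parallel_spinor_def)

text \<open>The operator \<open>\<nabla>\<^sup>*\<nabla> - 2\<R>\<close> of the theorem, where
  \<open>\<R>\<close> is the action of the curvature.\<close>

definition "lichnerowicz h p x y = neg_trace M (nabla M h) p x y - 2 * curv_action M h p x y"

context
  fixes h assumes h: "sym2_tensor (atlas M) h"
begin

lemma smooth_bilinear_lichnerowicz: "smooth_bilinear (lichnerowicz h)"
  unfolding smooth_bilinear_def
proof (intro conjI ballI allI)
  note N = sym2_neg_trace[OF cot_sym2_nabla[OF h]]
  show "linear_tangent (TS p) (lichnerowicz h p x)" "linear_tangent (TS p) (\<lambda>y. lichnerowicz h p y x)" if x: "x \<in> TS p" for p x
  proof -
    obtain P e where f: "orthonormal_frame M P e" and p: "p \<in> P" using frame_at .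
    interpret orthonormal_frame M P e by (rule f)
    have "linear_tangent (TS p) (curv_action M h p x)" "linear_tangent (TS p) (\<lambda>y. curv_action M h p y x)"
      unfolding curv_action_def[abs_def]
      by (intro linear_tangent_sumI, use riem_curv_linear(1,3)[OF p _ _ onb_tangent] onb_tangent x in
          \<open>simp add: linear_tangent_def algebra_simps\<close>)+
    then show "linear_tangent (TS p) (lichnerowicz h p x)" "linear_tangent (TS p) (\<lambda>y. lichnerowicz h p y x)"
      using sym2_linear_right[OF N x] sym2_linear_left[OF N x]
      unfolding linear_tangent_def lichnerowicz_def by (simp_all add: algebra_simps)
  qed
  fix \<alpha> i j assume \<alpha>: "\<alpha> \<in> indices M"
  interpret F: spin_frame M "patch M \<alpha>" "frame M \<alpha>" "\<lambda>i. (*v) (gam M i)" by (rule spin_frame_patch[OF \<alpha>])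
  have "F.smo (\<lambda>q. neg_trace M (nabla M h) q (frame M \<alpha> i q) (frame M \<alpha> j q)
      - 2 * (\<Sum>k\<in>UNIV. \<Sum>l\<in>UNIV. F.Rm i k q $ j $ l * F.hmat h q $ k $ l))"
    by (intro F.smo_diff F.smo_mult F.smo_const F.smo_sum F.smo_nth F.smo_curv_matrix F.smo_hmat[OF h]
        sym2_smooth[OF N] F.open_domain F.frame_smooth)
  then show "F.smo (\<lambda>q. lichnerowicz h q (frame M \<alpha> i q) (frame M \<alpha> j q))"
    by (rule smooth_map_cong[OF F.open_domain, rotated]) (simp add: lichnerowicz_def F.curv_action_frame[OF h])
qed

context
  fixes \<sigma> assumes \<sigma>: "parallel_spinor M \<sigma>"
begin

lemma twisted_dirac_Phi:
  assumes \<alpha>: "\<alpha> \<in> indices M" and p: "p \<in> patch M \<alpha>" and w: "w \<in> TS p"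
  shows "twisted_dirac M (Phi M \<sigma> h) \<alpha> p w = dirac_Phi \<sigma> (nabla M h) \<alpha> p w"
proof -
  interpret F: spin_frame M "patch M \<alpha>" "frame M \<alpha>" "\<lambda>i. (*v) (gam M i)" by (rule spin_frame_patch[OF \<alpha>])
  note T = tspinor_Phi[OF parallel_field[OF \<sigma>] smooth_bilinear_sym2[OF h]]
  have c: "frame_coord (Phi M \<sigma> h) \<alpha> j q = (\<Sum>i\<in>UNIV. \<gamma> i (F.hmat h q $ i $ j *\<^sub>R \<sigma> \<alpha> q))" if q: "q \<in> patch M \<alpha>" for j q
  proof -
    have "Phi M \<sigma> h \<alpha> q (frame M \<alpha> j q) = (\<Sum>i\<in>UNIV. h q (frame M \<alpha> i q) (frame M \<alpha> j q) *\<^sub>R \<gamma> i (\<sigma> \<alpha> q))"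
      by (rule Phi_eq[OF \<alpha> q F.frame_tangent[OF q]]) (rule sym2_linear_right[OF h])
    then show ?thesis by (simp add: frame_coord_def F.hmat_def G_simps)
  qed
  have par: "F.spin_cov k (\<sigma> \<alpha>) q = 0" if q: "q \<in> patch M \<alpha>" for k q
    unfolding spin_nabla_frame[OF \<alpha>, symmetric] using \<sigma> \<alpha> q F.frame_tangent[OF q] by (simp add: parallel_spinor_def)
  have cong: "F.tw_dirac (frame_coord (Phi M \<sigma> h) \<alpha>) j p =
      F.tw_dirac (\<lambda>j q. \<Sum>i\<in>UNIV. \<gamma> i (F.hmat h q $ i $ j *\<^sub>R \<sigma> \<alpha> q)) j p" for j
    by (rule F.tw_dirac_cong[OF p smooth_frame_coord[OF T \<alpha>]]) (rule c)
  have "F.tw_dirac (frame_coord (Phi M \<sigma> h) \<alpha>) j p = dirac_Phi \<sigma> (nabla M h) \<alpha> p (frame M \<alpha> j p)" for j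
  proof -
    have "F.tw_cov k (\<lambda>j q. \<Sum>i\<in>UNIV. \<gamma> i (F.hmat h q $ i $ j *\<^sub>R \<sigma> \<alpha> q)) j p =
        (\<Sum>i\<in>UNIV. \<gamma> i (F.tmat (nabla M h) k p $ i $ j *\<^sub>R \<sigma> \<alpha> p))" for k
      by (rule F.tw_cov_Phi[OF spinor_smooth[OF parallel_field[OF \<sigma>] \<alpha>] _ h p]) (rule par)
    then show ?thesis unfolding cong unfolding F.tw_dirac_def dirac_Phi_def by (simp add: F.tmat_def G_simps)
  qed
  then show ?thesis
    by (intro linear_eq_on_frame[OF \<alpha> p w linear_twisted_dirac[OF \<alpha> T p]
        tspinor_linear[OF tspinor_dirac_Phi[OF parallel_field[OF \<sigma>] cot_sym2_nabla[OF h]] \<alpha> p]])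
      (simp add: twisted_dirac_frame_vector[OF \<alpha> T p])
qed

lemma tspinor_twisted_dirac_Phi: "tspinor_field M (twisted_dirac M (Phi M \<sigma> h))"
  by (rule tspinor_cong[OF tspinor_dirac_Phi[OF parallel_field[OF \<sigma>] cot_sym2_nabla[OF h]] twisted_dirac_Phi])

lemma twisted_dirac_twisted_dirac_Phi:
  assumes \<alpha>: "\<alpha> \<in> indices M" and p: "p \<in> patch M \<alpha>" and w: "w \<in> TS p"
  shows "twisted_dirac M (twisted_dirac M (Phi M \<sigma> h)) \<alpha> p w = Phi M \<sigma> (lichnerowicz h) \<alpha> p w"
proof -
  interpret F: spin_frame M "patch M \<alpha>" "frame M \<alpha>" "\<lambda>i. (*v) (gam M i)" by (rule spin_frame_patch[OF \<alpha>])
  note T = tspinor_twisted_dirac_Phi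
  have L: "linear_tangent (TS p) (lichnerowicz h p x)" if "x \<in> TS p" for x
    using smooth_bilinear_lichnerowicz that by (simp add: smooth_bilinear_def)
  have c: "frame_coord (twisted_dirac M (Phi M \<sigma> h)) \<alpha> j q =
      (\<Sum>k\<in>UNIV. \<gamma> k (\<Sum>i\<in>UNIV. \<gamma> i (F.tmat (nabla M h) k q $ i $ j *\<^sub>R \<sigma> \<alpha> q)))" if q: "q \<in> patch M \<alpha>" for j q
    unfolding frame_coord_def twisted_dirac_Phi[OF \<alpha> q F.frame_tangent[OF q]] dirac_Phi_def by (simp add: F.tmat_def G_simps)
  have par: "F.spin_cov k (\<sigma> \<alpha>) q = 0" if q: "q \<in> patch M \<alpha>" for k q
    unfolding spin_nabla_frame[OF \<alpha>, symmetric] using \<sigma> \<alpha> q F.frame_tangent[OF q] by (simp add: parallel_spinor_def)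
  have cong: "F.tw_dirac (frame_coord (twisted_dirac M (Phi M \<sigma> h)) \<alpha>) j p =
      F.tw_dirac (\<lambda>j q. \<Sum>k\<in>UNIV. \<gamma> k (\<Sum>i\<in>UNIV. \<gamma> i (F.tmat (nabla M h) k q $ i $ j *\<^sub>R \<sigma> \<alpha> q))) j p" for j
    by (rule F.tw_dirac_cong[OF p smooth_frame_coord[OF T \<alpha>]]) (rule c)
  have "F.tw_dirac (frame_coord (twisted_dirac M (Phi M \<sigma> h)) \<alpha>) j p = Phi M \<sigma> (lichnerowicz h) \<alpha> p (frame M \<alpha> j p)" for j
  proof -
    have "Phi M \<sigma> (lichnerowicz h) \<alpha> p (frame M \<alpha> j p) =
        (\<Sum>i\<in>UNIV. lichnerowicz h p (frame M \<alpha> i p) (frame M \<alpha> j p) *\<^sub>R \<gamma> i (\<sigma> \<alpha> p))"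
      by (rule Phi_eq[OF \<alpha> p F.frame_tangent[OF p]]) (rule L)
    moreover have "F.tw_dirac (\<lambda>j q. \<Sum>k\<in>UNIV. \<gamma> k (\<Sum>i\<in>UNIV. \<gamma> i (F.tmat (nabla M h) k q $ i $ j *\<^sub>R \<sigma> \<alpha> q))) j p =
        (\<Sum>i\<in>UNIV. lichnerowicz h p (frame M \<alpha> i p) (frame M \<alpha> j p) *\<^sub>R \<gamma> i (\<sigma> \<alpha> p))"
      unfolding lichnerowicz_def
      by (rule F.tw_dirac_tw_dirac_Phi[OF spinor_smooth[OF parallel_field[OF \<sigma>] \<alpha>] _ h cot_sym2_nabla[OF h] p]) (rule par)
    ultimately show ?thesis unfolding cong by simp
  qed
  then show ?thesis
    by (intro linear_eq_on_frame[OF \<alpha> p w linear_twisted_dirac[OF \<alpha> T p]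
        tspinor_linear[OF tspinor_Phi[OF parallel_field[OF \<sigma>] smooth_bilinear_lichnerowicz] \<alpha> p]])
      (simp add: twisted_dirac_frame_vector[OF \<alpha> T p])
qed

end

end

end

theorem lemma2p4:
  fixes M :: "('m::{t2_space, second_countable_topology}, 'n::finite, 'i, 'k::finite) spin_manifold"
    and \<sigma> :: "('m, 'i, 'k) spinor"
    and h :: "'m tensor2"
    and dirac_star :: "('m, 'i, 'k) tspinor \<Rightarrow> ('m, 'i, 'k) tspinor"
    and nabla_star :: "'m tensor3 \<Rightarrow> 'm tensor2"
  assumes "compact (UNIV :: 'm set)"
    and "riemannian_manifold M"
    and "spin_structure M"
    and "parallel_spinor M \<sigma>"
    and "\<forall>\<alpha>\<in>indices M. \<forall>p\<in>patch M \<alpha>. norm (\<sigma> \<alpha> p) = 1"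
    and "twisted_dirac_adjoint M dirac_star"
    and "nabla_adjoint M nabla_star"
    and "sym2_tensor (atlas M) h"
  shows "\<forall>\<alpha>\<in>indices M. \<forall>p\<in>patch M \<alpha>. \<forall>w\<in>tangent_space (atlas M) p.
    dirac_star (twisted_dirac M (Phi M \<sigma> h)) \<alpha> p w =
    Phi M \<sigma> (\<lambda>q x y. nabla_star (nabla M h) q x y - 2 * curv_action M h q x y) \<alpha> p w"
proof (intro ballI)
  interpret spin_geometry M by unfold_locales (rule assms)+
  interpret closed_manifold M by unfold_locales (rule assms)
  note \<sigma> = \<open>parallel_spinor M \<sigma>\<close> and h = \<open>sym2_tensor (atlas M) h\<close>
  fix \<alpha> p w assume \<alpha>: "\<alpha> \<in> indices M" and p: "p \<in> patch M \<alpha>" and w: "w \<in> TS p"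
  interpret F: orthonormal_frame M "patch M \<alpha>" "frame M \<alpha>" by (rule orthonormal_frame_patch[OF \<alpha>])
  have D: "tspinor_field M (twisted_dirac M (Phi M \<sigma> h))" by (rule tspinor_twisted_dirac_Phi[OF h \<sigma>])
  have DD: "tspinor_field M (twisted_dirac M (twisted_dirac M (Phi M \<sigma> h)))"
    by (rule tspinor_cong[OF tspinor_Phi[OF parallel_field[OF \<sigma>] smooth_bilinear_lichnerowicz[OF h]]
      twisted_dirac_twisted_dirac_Phi[OF h \<sigma>]])
  have "dirac_star (twisted_dirac M (Phi M \<sigma> h)) \<alpha> p w = Phi M \<sigma> (lichnerowicz h) \<alpha> p w"
    unfolding twisted_dirac_adjoint_eq[OF assms(1,6) D DD \<alpha> p w] by (rule twisted_dirac_twisted_dirac_Phi[OF h \<sigma> \<alpha> p w])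
  also have "\<dots> = Phi M \<sigma> (\<lambda>q x y. nabla_star (nabla M h) q x y - 2 * curv_action M h q x y) \<alpha> p w"
    unfolding Phi_def lichnerowicz_def
      nabla_adjoint_eq[OF assms(7) cot_sym2_nabla[OF h] F.frame_tangent[OF p] F.frame_tangent[OF p]] ..
  finally show "dirac_star (twisted_dirac M (Phi M \<sigma> h)) \<alpha> p w =
    Phi M \<sigma> (\<lambda>q x y. nabla_star (nabla M h) q x y - 2 * curv_action M h q x y) \<alpha> p w" .
qed

end
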